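(* Let $\Omega\subset\mathbb{R}^2$ be a Serrin ring domain or a periodic Serrin band, whose associated solution $u$ of $\Delta u+2=0$ is not a paraboloid $a-\frac12\|\mathbf{x}-v_0\|^2$ ($a\in\mathbb{R}$, $v_0\in\mathbb{R}^2$), and let $g$ be its developing map. Then $$\eta:=\frac{g''}{2g'}$$ is an algebro-geometric potential of the mKdV hierarchy with real coefficients; that is, there exist an integer $\mathfrak{m}\ge0$ and constants $a_0,c_0,\dots,c_{\mathfrak{m}-1}\in\mathbb{R}$ such that $$Q_{\mathfrak{m}}[\eta]=a_0+\sum_{j=0}^{\mathfrak{m}-1}c_jQ_j[\eta].$$
   Context: Serrin ring domain: a smooth bounded doubly connected domain $\Omega\subset\mathbb{R}^2$, with boundary components $\partial_1\Omega,\partial_2\Omega$, for which there are constants $a_j,b_j\in\mathbb{R}$ and a solution $u$ of $\Delta u+2=0$ in $\Omega$ with $u=a_j$, $\partial u/\partial\nu=b_j$ on $\partial_j\Omega$, $j=1,2$ ($\nu$ the exterior unit normal). Serrin band: a smooth unbounded domain $\Omega\subset\mathbb{R}^2$ with two boundary components for which there are constants $a,b\in\mathbb{R}$ and a solution $u$ of $\Delta u+2=0$ in $\Omega$ with $u=a$, $\partial u/\partial\nu=b$ on $\partial\Omega$; it is periodic if it is invariant by a non-zero translation. Developing map, with $\mathbb{R}^2\equiv\mathbb{C}$, $z=x+iy$. For a ring domain: a holomorphic bijection $g:\mathcal{U}\to\overline\Omega$ from a vertical quotient band $\mathcal{U}=([s_1,s_2]\times\mathbb{R},\sim)$, $(x,y)\sim(x,y+T)$,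 for some $s_1<s_2$, $T>0$, sending each curve $\{x=s_j\}$ to a component of $\partial\Omega$. For a periodic band: a holomorphic bijection $g:[s_1,s_2]\times\mathbb{R}\to\overline\Omega$ sending each line $\{x=s_j\}$ to a component of $\partial\Omega$, such that $g'$ is $T$-periodic in $y$ for some $T>0$. mKdV operators: for a holomorphic function $\eta(z)$, $Q_n[\eta]$ is determined recursively by $Q_{-1}[\eta]=0$, $Q_0[\eta]=\eta$ and $$Q_{n+1}'-\frac{\eta'}{\eta}Q_{n+1}=Q_n'''-\frac{\eta'}{\eta}Q_n''-4\eta^2Q_n',\qquad Q_j'=\frac{d}{dz}(Q_j[\eta]),$$ where the free additive term $k_{n+1}\eta$ ($k_{n+1}$ constant) in the solution is always chosen to be zero; thus $Q_n[\eta]$ is a polynomial in $\eta,\dots,\eta^{(2n)}$, homogeneous of weight $2n+1$ when $\eta^{(k)}$ has weight $k+1$. E.g. $Q_1[\eta]=\eta''-2\eta^3$, $Q_2[\eta]=\eta^{(4)}-10\eta''\eta^2-10\eta(\eta')^2+6\eta^5$. For $\mathfrak{m}=0$ the displayed relation means $\eta\equiv a_0$. *)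

theory Defs
  imports "HOL-Complex_Analysis.Complex_Analysis" "HOL-Library.Poly_Mapping"
begin

text \<open>The plane is identified with the type \<^typ>\<open>complex\<close>; its real inner product is \<open>\<bullet>\<close> and
  its orthonormal basis \<^term>\<open>Basis :: complex set\<close> consists of \<open>1\<close> and \<open>\<i>\<close>.\<close>

section \<open>Smooth functions and smooth domains\<close>

definition partial_derivative ::
    "('a::euclidean_space \<Rightarrow> 'b::real_normed_vector) \<Rightarrow> 'a \<Rightarrow> 'a \<Rightarrow> 'b" where
  "partial_derivative f e = (\<lambda>x. frechet_derivative f (at x) e)"

primrec C_diff_on ::
    "nat \<Rightarrow> ('a::euclidean_space \<Rightarrow> 'b::real_normed_vector) \<Rightarrow> 'a set \<Rightarrow> bool" where
  "C_diff_on 0 f U \<longleftrightarrow> continuous_on U f"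
| "C_diff_on (Suc k) f U \<longleftrightarrow>
     (\<forall>x\<in>U. f differentiable (at x)) \<and> (\<forall>e\<in>Basis. C_diff_on k (partial_derivative f e) U)"

definition smooth_on ::
    "('a::euclidean_space \<Rightarrow> 'b::real_normed_vector) \<Rightarrow> 'a set \<Rightarrow> bool" where
  "smooth_on f U \<longleftrightarrow> (\<forall>k. C_diff_on k f U)"

definition laplacian :: "(complex \<Rightarrow> real) \<Rightarrow> complex \<Rightarrow> real" where
  "laplacian u z = (\<Sum>e\<in>Basis. partial_derivative (partial_derivative u e) e z)"

definition local_defining_function ::
    "complex set \<Rightarrow> complex \<Rightarrow> complex set \<Rightarrow> (complex \<Rightarrow> real) \<Rightarrow> bool" where
  "local_defining_function \<Omega> p U \<phi> \<longleftrightarrow>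
     open U \<and> p \<in> U \<and> smooth_on \<phi> U \<and>
     (\<forall>z\<in>U. \<exists>h. frechet_derivative \<phi> (at z) h \<noteq> 0) \<and>
     \<Omega> \<inter> U = {z\<in>U. \<phi> z < 0}"

definition smooth_domain :: "complex set \<Rightarrow> bool" where
  "smooth_domain \<Omega> \<longleftrightarrow> open \<Omega> \<and> connected \<Omega> \<and> \<Omega> \<noteq> {} \<and>
     (\<forall>p\<in>frontier \<Omega>. \<exists>U \<phi>. local_defining_function \<Omega> p U \<phi>)"

text \<open>The gradient of a local defining function points out of \<open>\<Omega>\<close>; the exterior unit normal is
  its normalisation.\<close>

definition exterior_unit_normal :: "complex set \<Rightarrow> complex \<Rightarrow> complex \<Rightarrow> bool" where
  "exterior_unit_normal \<Omega> p \<nu> \<longleftrightarrow> norm \<nu> = 1 \<and>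
     (\<exists>U \<phi> c. local_defining_function \<Omega> p U \<phi> \<and> c > 0 \<and>
        (\<forall>h. frechet_derivative \<phi> (at p) h = c * (\<nu> \<bullet> h)))"

definition has_normal_derivative ::
    "complex set \<Rightarrow> (complex \<Rightarrow> real) \<Rightarrow> complex \<Rightarrow> real \<Rightarrow> bool" where
  "has_normal_derivative \<Omega> u p b \<longleftrightarrow>
     (\<exists>\<nu> D. exterior_unit_normal \<Omega> p \<nu> \<and>
        (u has_derivative D) (at p within closure \<Omega>) \<and> D \<nu> = b)"

section \<open>Serrin domains\<close>

text \<open>Solutions are classical: twice continuously differentiable in \<open>\<Omega>\<close>, continuously
  differentiable up to the boundary.\<close>

definition torsion_solution :: "complex set \<Rightarrow> (complex \<Rightarrow> real) \<Rightarrow> bool" where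
  "torsion_solution \<Omega> u \<longleftrightarrow>
     C_diff_on 2 u \<Omega> \<and>
     (\<exists>G. continuous_on (closure \<Omega>) G \<and>
        (\<forall>z\<in>closure \<Omega>. (u has_derivative (\<lambda>h. G z \<bullet> h)) (at z within closure \<Omega>))) \<and>
     (\<forall>z\<in>\<Omega>. laplacian u z + 2 = 0)"

definition overdetermined_on ::
    "complex set \<Rightarrow> (complex \<Rightarrow> real) \<Rightarrow> complex set \<Rightarrow> real \<Rightarrow> real \<Rightarrow> bool" where
  "overdetermined_on \<Omega> u C a b \<longleftrightarrow>
     (\<forall>p\<in>C. u p = a \<and> has_normal_derivative \<Omega> u p b)"

text \<open>For a bounded set, the components of the complement in the plane correspond to those of the
  complement in the Riemann sphere.\<close>

definition doubly_connected :: "complex set \<Rightarrow> bool" where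
  "doubly_connected \<Omega> \<longleftrightarrow> card (components (- \<Omega>)) = 2"

text \<open>\<open>serrin_ring_domain \<Omega> u\<close> says that \<open>\<Omega>\<close> is a Serrin ring domain with associated solution \<open>u\<close>;
  similarly for bands.\<close>

definition serrin_ring_domain :: "complex set \<Rightarrow> (complex \<Rightarrow> real) \<Rightarrow> bool" where
  "serrin_ring_domain \<Omega> u \<longleftrightarrow>
     smooth_domain \<Omega> \<and> bounded \<Omega> \<and> doubly_connected \<Omega> \<and> torsion_solution \<Omega> u \<and>
     (\<exists>C\<^sub>1 C\<^sub>2 a\<^sub>1 a\<^sub>2 b\<^sub>1 b\<^sub>2. C\<^sub>1 \<noteq> C\<^sub>2 \<and> components (frontier \<Omega>) = {C\<^sub>1, C\<^sub>2} \<and>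
        overdetermined_on \<Omega> u C\<^sub>1 a\<^sub>1 b\<^sub>1 \<and> overdetermined_on \<Omega> u C\<^sub>2 a\<^sub>2 b\<^sub>2)"

definition serrin_band :: "complex set \<Rightarrow> (complex \<Rightarrow> real) \<Rightarrow> bool" where
  "serrin_band \<Omega> u \<longleftrightarrow>
     smooth_domain \<Omega> \<and> \<not> bounded \<Omega> \<and> card (components (frontier \<Omega>)) = 2 \<and>
     torsion_solution \<Omega> u \<and> (\<exists>a b. overdetermined_on \<Omega> u (frontier \<Omega>) a b)"

definition periodic_serrin_band :: "complex set \<Rightarrow> (complex \<Rightarrow> real) \<Rightarrow> bool" where
  "periodic_serrin_band \<Omega> u \<longleftrightarrow>
     serrin_band \<Omega> u \<and> (\<exists>v. v \<noteq> 0 \<and> (\<lambda>z. z + v) ` \<Omega> = \<Omega>)"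

definition paraboloid_on :: "complex set \<Rightarrow> (complex \<Rightarrow> real) \<Rightarrow> bool" where
  "paraboloid_on \<Omega> u \<longleftrightarrow> (\<exists>a v\<^sub>0. \<forall>z\<in>\<Omega>. u z = a - (norm (z - v\<^sub>0))\<^sup>2 / 2)"

section \<open>Developing maps\<close>

definition closed_band :: "real \<Rightarrow> real \<Rightarrow> complex set" where
  "closed_band s\<^sub>1 s\<^sub>2 = {z. s\<^sub>1 \<le> Re z \<and> Re z \<le> s\<^sub>2}"

definition open_band :: "real \<Rightarrow> real \<Rightarrow> complex set" where
  "open_band s\<^sub>1 s\<^sub>2 = {z. s\<^sub>1 < Re z \<and> Re z < s\<^sub>2}"

text \<open>A map on the quotient band is a map \<open>g\<close> on the band that is constant on the classes of
  \<open>z \<sim> z + \<i>T\<close>; injectivity on the quotient says that \<open>g\<close> separates distinct classes.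
  At points of the two boundary lines, holomorphy means complex differentiability within the closed
  band. Since \<^const>\<open>deriv\<close> is two-sided, it is used on the open band only.\<close>

definition ring_developing_map ::
    "complex set \<Rightarrow> real \<Rightarrow> real \<Rightarrow> real \<Rightarrow> (complex \<Rightarrow> complex) \<Rightarrow> bool" where
  "ring_developing_map \<Omega> s\<^sub>1 s\<^sub>2 T g \<longleftrightarrow>
     s\<^sub>1 < s\<^sub>2 \<and> T > 0 \<and>
     g holomorphic_on closed_band s\<^sub>1 s\<^sub>2 \<and>
     g ` closed_band s\<^sub>1 s\<^sub>2 = closure \<Omega> \<and>
     (\<forall>z\<in>closed_band s\<^sub>1 s\<^sub>2. \<forall>w\<in>closed_band s\<^sub>1 s\<^sub>2.
        g z = g w \<longleftrightarrow> (\<exists>n::int. w = z + of_int n * (\<i> * of_real T))) \<and>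
     (\<forall>s\<in>{s\<^sub>1, s\<^sub>2}. g ` {z. Re z = s} \<in> components (frontier \<Omega>))"

definition band_developing_map ::
    "complex set \<Rightarrow> real \<Rightarrow> real \<Rightarrow> real \<Rightarrow> (complex \<Rightarrow> complex) \<Rightarrow> bool" where
  "band_developing_map \<Omega> s\<^sub>1 s\<^sub>2 T g \<longleftrightarrow>
     s\<^sub>1 < s\<^sub>2 \<and> T > 0 \<and>
     g holomorphic_on closed_band s\<^sub>1 s\<^sub>2 \<and>
     bij_betw g (closed_band s\<^sub>1 s\<^sub>2) (closure \<Omega>) \<and>
     (\<forall>s\<in>{s\<^sub>1, s\<^sub>2}. g ` {z. Re z = s} \<in> components (frontier \<Omega>)) \<and>
     (\<forall>z\<in>open_band s\<^sub>1 s\<^sub>2. deriv g (z + \<i> * of_real T) = deriv g z)"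

section \<open>The mKdV hierarchy\<close>

text \<open>A differential polynomial is a polynomial in the indeterminates \<open>\<eta>, \<eta>', \<eta>'', \<dots>\<close>; a monomial
  \<open>m\<close> is the map sending \<open>k\<close> to the exponent of the \<open>k\<close>-th derivative \<open>\<eta>\<^sup>(\<^sup>k\<^sup>)\<close> in it.\<close>

type_synonym diff_poly = "(nat \<Rightarrow>\<^sub>0 nat) \<Rightarrow>\<^sub>0 complex"

definition DVar :: "nat \<Rightarrow> diff_poly" where
  "DVar k = Poly_Mapping.single (Poly_Mapping.single k 1) 1"

text \<open>The derivation with \<open>\<eta>\<^sup>(\<^sup>k\<^sup>) \<mapsto> \<eta>\<^sup>(\<^sup>k\<^sup>+\<^sup>1\<^sup>)\<close>: in each monomial, one factor \<open>\<eta>\<^sup>(\<^sup>k\<^sup>)\<close> at a time is replaced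
  by \<open>\<eta>\<^sup>(\<^sup>k\<^sup>+\<^sup>1\<^sup>)\<close>, weighted by the exponent.\<close>

definition DP :: "diff_poly \<Rightarrow> diff_poly" where
  "DP p = (\<Sum>m\<in>Poly_Mapping.keys p. \<Sum>k\<in>Poly_Mapping.keys m.
     Poly_Mapping.single
       (m - Poly_Mapping.single k 1 + Poly_Mapping.single (Suc k) 1)
       (of_nat (Poly_Mapping.lookup m k) * Poly_Mapping.lookup p m))"

definition dp_eval :: "diff_poly \<Rightarrow> (complex \<Rightarrow> complex) \<Rightarrow> complex \<Rightarrow> complex" where
  "dp_eval p \<eta> z = (\<Sum>m\<in>Poly_Mapping.keys p. Poly_Mapping.lookup p m *
     (\<Prod>k\<in>Poly_Mapping.keys m. ((deriv ^^ k) \<eta> z) ^ Poly_Mapping.lookup m k))"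

text \<open>The recursion \<open>Q\<^sub>n\<^sub>+\<^sub>1' - (\<eta>'/\<eta>) Q\<^sub>n\<^sub>+\<^sub>1 = Q\<^sub>n''' - (\<eta>'/\<eta>) Q\<^sub>n'' - 4 \<eta>\<^sup>2 Q\<^sub>n'\<close>, multiplied by \<open>\<eta>\<close>, determines
  \<open>Q\<^sub>n\<^sub>+\<^sub>1\<close> up to a constant multiple of \<open>\<eta>\<close>. The last conjunct sets this free term to zero.\<close>

primrec mkdv_poly :: "nat \<Rightarrow> diff_poly" where
  "mkdv_poly 0 = DVar 0"
| "mkdv_poly (Suc n) = (THE q.
     DVar 0 * DP q - DVar 1 * q
       = DVar 0 * DP (DP (DP (mkdv_poly n))) - DVar 1 * DP (DP (mkdv_poly n))
         - 4 * DVar 0 ^ 3 * DP (mkdv_poly n) \<and>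
     Poly_Mapping.lookup q (Poly_Mapping.single 0 1) = 0)"

definition mkdv_Q :: "nat \<Rightarrow> (complex \<Rightarrow> complex) \<Rightarrow> complex \<Rightarrow> complex" where
  "mkdv_Q n \<eta> z = dp_eval (mkdv_poly n) \<eta> z"

definition real_algebro_geometric_mkdv :: "(complex \<Rightarrow> complex) \<Rightarrow> complex set \<Rightarrow> bool" where
  "real_algebro_geometric_mkdv \<eta> U \<longleftrightarrow>
     (\<exists>(m::nat) (a\<^sub>0::real) (c::nat \<Rightarrow> real). \<forall>z\<in>U.
        mkdv_Q m \<eta> z = of_real a\<^sub>0 + (\<Sum>j<m. of_real (c j) * mkdv_Q j \<eta> z))"

end

(* Differentiating the overdetermined condition along the two boundary lines shows that the
   holomorphic function f = (u_x - i u_y + cnj z) / 2 satisfies f' g' = P with P real, and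
   that the boundary data extend g across the lines. On each line either Im eta = 0 or eta obeys
   a Robin condition, and the mKdV recursion transports this condition to all the Q_n. Hence the
   functions Im Q_n are Dirichlet or Steklov data on a compact cylinder; such data with enough zero
   averages on a fine grid vanish, by a Rellich identity and a Poincare inequality. A nontrivial real linear
   combination of the Q_n is therefore a real constant. *)
theory Submission
  imports Defs "HOL-Computational_Algebra.Formal_Power_Series" "HOL-Real_Asymp.Real_Asymp"
begin

unbundle no vec_syntax



text \<open>The obstacle is regularity: on the boundary lines g is only complex differentiable
  within the closed band, and u is only C^1 up to the boundary, so the overdetermined condition
  cannot be differentiated there as it stands. Finite differences take the place of derivatives.
  Discs of one radius tangent to the boundary from both sides make the normal part of a boundary
  chord quadratically small, and maximum principles carry estimates on difference quotients into the
  band before the step tends to 0. Second derivatives on the lines appear only after g has been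
  extended. That u is no paraboloid means that f is not constant, hence P is not 0. With the bound
  on f' this keeps g' away from 0 up to the lines, so eta is holomorphic near the closed band. The
  Robin coefficient of a line is the same for all Q_n, so linear combinations inherit the condition.
  The mesh that forces rigidity depends on this coefficient, on T and on the width only. What is
  imposed is vanishing of the imaginary part at the N grid points of each line: these are 2N
  conditions, and 2N + 1 functions Q_n always meet them nontrivially.\<close>

section \<open>Differential polynomials, their derivation and their evaluation\<close>

abbreviation cst :: "complex \<Rightarrow> diff_poly" where
  "cst c \<equiv> Poly_Mapping.single 0 c"

text \<open>The share of a single monomial in \<open>DP\<close>, with the coefficient as an
  argument: it is additive in that argument, which is what makes \<open>DP\<close> additive although
  the set \<open>keys p\<close> is not.\<close>

definition DPM :: "(nat \<Rightarrow>\<^sub>0 nat) \<Rightarrow> complex \<Rightarrow> diff_poly" where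
  "DPM m a = (\<Sum>k\<in>Poly_Mapping.keys m. Poly_Mapping.single
       (m - Poly_Mapping.single k 1 + Poly_Mapping.single (Suc k) 1)
       (of_nat (Poly_Mapping.lookup m k) * a))"

lemma DPM_superset:
  assumes "finite K" "Poly_Mapping.keys m \<subseteq> K"
  shows "DPM m a = (\<Sum>k\<in>K. Poly_Mapping.single
       (m - Poly_Mapping.single k 1 + Poly_Mapping.single (Suc k) 1)
       (of_nat (Poly_Mapping.lookup m k) * a))"
  unfolding DPM_def
  by (rule sum.mono_neutral_left) (use assms in \<open>auto simp: in_keys_iff\<close>)

lemma DPM_zero [simp]: "DPM m 0 = 0"
  by (simp add: DPM_def)

lemma DPM_add: "DPM m (a + b) = DPM m a + DPM m b"
  by (simp add: DPM_def distrib_left single_add sum.distrib)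

text \<open>Cancellation can shrink \<open>keys (p + q)\<close>, so additivity is proved over one
  index set that is large enough for all polynomials involved.\<close>

lemma DP_superset:
  assumes "finite M" "Poly_Mapping.keys p \<subseteq> M"
  shows "DP p = (\<Sum>m\<in>M. DPM m (Poly_Mapping.lookup p m))"
  unfolding DP_def DPM_def[symmetric]
  by (rule sum.mono_neutral_left) (use assms in \<open>auto simp: in_keys_iff\<close>)

lemma DP_single [simp]: "DP (Poly_Mapping.single m a) = DPM m a"
  by (subst DP_superset[of "{m}"]) (auto simp: lookup_single)

lemma DP_add: "DP (p + q) = DP p + DP q"
proof -
  let ?M = "Poly_Mapping.keys p \<union> Poly_Mapping.keys q"
  have "DP (p + q) = (\<Sum>m\<in>?M. DPM m (Poly_Mapping.lookup (p + q) m))"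
    by (rule DP_superset) (auto simp: in_keys_iff lookup_add)
  also have "\<dots> = (\<Sum>m\<in>?M. DPM m (Poly_Mapping.lookup p m)) + (\<Sum>m\<in>?M. DPM m (Poly_Mapping.lookup q m))"
    by (simp add: lookup_add DPM_add sum.distrib)
  also have "\<dots> = DP p + DP q"
    by (subst (1 2) DP_superset[symmetric]) auto
  finally show ?thesis .
qed

lemma DP_zero [simp]: "DP 0 = 0"
  by (simp add: DP_def)

lemma DP_sum: "DP (sum f A) = (\<Sum>i\<in>A. DP (f i))"
  by (induction A rule: infinite_finite_induct) (auto simp: DP_add)

lemma DP_uminus: "DP (- p) = - DP p"
  using DP_add[of p "- p"] by (simp add: eq_neg_iff_add_eq_0 add.commute)

lemma DP_diff: "DP (p - q) = DP p - DP q"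
  using DP_add[of p "- q"] by (simp add: DP_uminus)

lemma DPM_plus:
  "DPM (m + n) (a * b) = DPM m a * Poly_Mapping.single n b + Poly_Mapping.single m a * DPM n b"
proof -
  let ?K = "Poly_Mapping.keys m \<union> Poly_Mapping.keys n"
  let ?e = "\<lambda>k. Poly_Mapping.single k (1::nat)"
  \<comment> \<open>Subtraction of exponents is truncated, so the index k has to occur in m. Where
    it does not, the factor \<open>of_nat (Poly_Mapping.lookup m k)\<close> is zero and nothing is
    to be shown.\<close>
  have shift: "m + n - ?e k + ?e (Suc k) = (m - ?e k + ?e (Suc k)) + n"
    if "Poly_Mapping.lookup m k \<noteq> 0" for m n :: "nat \<Rightarrow>\<^sub>0 nat" and k
    by (rule poly_mapping_eqI) (use that in \<open>auto simp: lookup_add lookup_minus lookup_single when_def\<close>)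
  have 1: "Poly_Mapping.single (m + n - ?e k + ?e (Suc k)) (of_nat (Poly_Mapping.lookup m k) * (a * b))
      = Poly_Mapping.single (m - ?e k + ?e (Suc k)) (of_nat (Poly_Mapping.lookup m k) * a) * Poly_Mapping.single n b" for k
    by (cases "Poly_Mapping.lookup m k = 0") (simp_all add: mult_single shift mult.assoc del: One_nat_def)
  have 2: "Poly_Mapping.single (m + n - ?e k + ?e (Suc k)) (of_nat (Poly_Mapping.lookup n k) * (a * b))
      = Poly_Mapping.single m a * Poly_Mapping.single (n - ?e k + ?e (Suc k)) (of_nat (Poly_Mapping.lookup n k) * b)" for k
    using shift[of n k m]
    by (cases "Poly_Mapping.lookup n k = 0") (simp_all add: mult_single ac_simps del: One_nat_def)
  have "DPM (m + n) (a * b) = (\<Sum>k\<in>?K. Poly_Mapping.single (m + n - ?e k + ?e (Suc k))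
       (of_nat (Poly_Mapping.lookup (m + n) k) * (a * b)))"
    by (rule DPM_superset) (auto simp: in_keys_iff lookup_add)
  also have "\<dots> = (\<Sum>k\<in>?K. Poly_Mapping.single (m + n - ?e k + ?e (Suc k))
       (of_nat (Poly_Mapping.lookup m k) * (a * b))) + (\<Sum>k\<in>?K. Poly_Mapping.single (m + n - ?e k + ?e (Suc k))
       (of_nat (Poly_Mapping.lookup n k) * (a * b)))"
    by (simp add: lookup_add distrib_right single_add sum.distrib)
  also have "\<dots> = DPM m a * Poly_Mapping.single n b + Poly_Mapping.single m a * DPM n b"
    unfolding 1 2 sum_distrib_right[symmetric] sum_distrib_left[symmetric]
    by (subst (1 2) DPM_superset[symmetric]) auto
  finally show ?thesis .
qed

lemma poly_mapping_eq_sum_single: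
  "p = (\<Sum>m\<in>Poly_Mapping.keys p. Poly_Mapping.single m (Poly_Mapping.lookup p m))"
  by (rule poly_mapping_eqI) (auto simp: lookup_sum lookup_single when_def in_keys_iff)

lemma poly_mapping_additive_induct:
  fixes P :: "('a \<Rightarrow>\<^sub>0 'b::comm_monoid_add) \<Rightarrow> bool"
  assumes "P 0" "\<And>m a. P (Poly_Mapping.single m a)" "\<And>p q. P p \<Longrightarrow> P q \<Longrightarrow> P (p + q)"
  shows "P p"
proof -
  have "P (\<Sum>m\<in>A. Poly_Mapping.single m (Poly_Mapping.lookup p m))" if "finite A" for A
    using that by induction (auto intro: assms)
  from this[of "Poly_Mapping.keys p"] show ?thesis
    using poly_mapping_eq_sum_single[of p] by simp
qed

lemma DP_mult: "DP (p * q) = DP p * q + p * DP q"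
proof (induction p rule: poly_mapping_additive_induct)
  case (2 m a)
  show ?case
    by (induction q rule: poly_mapping_additive_induct)
       (simp_all add: mult_single DPM_plus DP_add algebra_simps)
qed (simp_all add: DP_add algebra_simps)

lemma DP_cst [simp]: "DP (cst c) = 0"
  by (simp add: DPM_def)

lemma DP_one [simp]: "DP 1 = 0"
  using DP_cst[of 1] by (simp del: DP_single)

lemma DP_numeral [simp]: "DP (numeral n) = 0"
  using DP_cst[of "numeral n"] by (simp del: DP_single)

lemma DP_DVar [simp]: "DP (DVar k) = DVar (Suc k)"
  by (simp add: DVar_def DPM_def)

text \<open>Presents differential polynomials as the algebra generated by the constants and the
  variables, so that a claim such as the chain rule is checked on generators, sums and products
  instead of on monomials.\<close>

lemma diff_poly_induct [case_names const DVar add mult]: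
  assumes "\<And>c. P (cst c)" "\<And>k. P (DVar k)"
    "\<And>p q. P p \<Longrightarrow> P q \<Longrightarrow> P (p + q)" "\<And>p q. P p \<Longrightarrow> P q \<Longrightarrow> P (p * q)"
  shows "P p"
proof (induction p rule: poly_mapping_additive_induct)
  case (2 m a)
  have pow: "P (Poly_Mapping.single (Poly_Mapping.single k n) 1)" for k n
  proof (induction n)
    case 0
    show ?case using assms(1)[of 1] by simp
  next
    case (Suc n)
    have "Poly_Mapping.single (Poly_Mapping.single k (Suc n)) 1
        = DVar k * Poly_Mapping.single (Poly_Mapping.single k n) 1"
      by (simp add: DVar_def mult_single single_add[symmetric])
    then show ?case using Suc assms(2,4) by simp
  qed
  have "P (Poly_Mapping.single (\<Sum>k\<in>A. Poly_Mapping.single k (Poly_Mapping.lookup m k)) 1)"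
    if "finite A" for A
    using that
  proof induction
    case empty
    show ?case using assms(1)[of 1] by simp
  next
    case (insert k A)
    have "Poly_Mapping.single (\<Sum>k\<in>insert k A. Poly_Mapping.single k (Poly_Mapping.lookup m k)) (1::complex)
      = Poly_Mapping.single (Poly_Mapping.single k (Poly_Mapping.lookup m k)) 1
        * Poly_Mapping.single (\<Sum>k\<in>A. Poly_Mapping.single k (Poly_Mapping.lookup m k)) 1"
      using insert by (simp add: mult_single)
    then show ?case using insert pow assms(4) by simp
  qed
  from this[of "Poly_Mapping.keys m"] have "P (Poly_Mapping.single m 1)"
    using poly_mapping_eq_sum_single[of m] by simp
  then have "P (cst a * Poly_Mapping.single m 1)"
    using assms(1,4) by blast
  then show ?case by (simp add: mult_single)
qed (use assms(1)[of 0] assms(3) in auto)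

lemma dp_eval_superset:
  assumes "finite M" "Poly_Mapping.keys p \<subseteq> M"
  shows "dp_eval p \<eta> z = (\<Sum>m\<in>M. Poly_Mapping.lookup p m *
     (\<Prod>k\<in>Poly_Mapping.keys m. ((deriv ^^ k) \<eta> z) ^ Poly_Mapping.lookup m k))"
  unfolding dp_eval_def
  by (rule sum.mono_neutral_left) (use assms in \<open>auto simp: in_keys_iff\<close>)

lemma dp_eval_single:
  assumes "finite K" "Poly_Mapping.keys m \<subseteq> K"
  shows "dp_eval (Poly_Mapping.single m a) \<eta> z
    = a * (\<Prod>k\<in>K. ((deriv ^^ k) \<eta> z) ^ Poly_Mapping.lookup m k)"
proof -
  have "dp_eval (Poly_Mapping.single m a) \<eta> z
    = a * (\<Prod>k\<in>Poly_Mapping.keys m. ((deriv ^^ k) \<eta> z) ^ Poly_Mapping.lookup m k)"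
    by (subst dp_eval_superset[of "{m}"]) (auto simp: lookup_single)
  also have "(\<Prod>k\<in>Poly_Mapping.keys m. ((deriv ^^ k) \<eta> z) ^ Poly_Mapping.lookup m k)
      = (\<Prod>k\<in>K. ((deriv ^^ k) \<eta> z) ^ Poly_Mapping.lookup m k)"
    by (rule prod.mono_neutral_left) (use assms in \<open>auto simp: in_keys_iff\<close>)
  finally show ?thesis .
qed

lemma dp_eval_add: "dp_eval (p + q) \<eta> z = dp_eval p \<eta> z + dp_eval q \<eta> z"
proof -
  let ?M = "Poly_Mapping.keys p \<union> Poly_Mapping.keys q"
  let ?f = "\<lambda>m. \<Prod>k\<in>Poly_Mapping.keys m. ((deriv ^^ k) \<eta> z) ^ Poly_Mapping.lookup m k"
  have "dp_eval (p + q) \<eta> z = (\<Sum>m\<in>?M. Poly_Mapping.lookup (p + q) m * ?f m)"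
    by (rule dp_eval_superset) (auto simp: in_keys_iff lookup_add)
  also have "\<dots> = (\<Sum>m\<in>?M. Poly_Mapping.lookup p m * ?f m) + (\<Sum>m\<in>?M. Poly_Mapping.lookup q m * ?f m)"
    by (simp add: lookup_add distrib_right sum.distrib)
  also have "\<dots> = dp_eval p \<eta> z + dp_eval q \<eta> z"
    by (subst (1 2) dp_eval_superset[symmetric]) auto
  finally show ?thesis .
qed

lemma dp_eval_cst [simp]: "dp_eval (cst c) \<eta> z = c"
  by (subst dp_eval_single[of "{}"]) auto

lemma dp_eval_zero [simp]: "dp_eval 0 \<eta> z = 0"
  by (simp add: dp_eval_def)

lemma dp_eval_numeral [simp]: "dp_eval (numeral n) \<eta> z = numeral n"
  using dp_eval_cst[of "numeral n"] by (simp del: dp_eval_cst)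

lemma dp_eval_DVar [simp]: "dp_eval (DVar k) \<eta> z = (deriv ^^ k) \<eta> z"
  unfolding DVar_def by (subst dp_eval_single[of "{k}"]) auto

lemma dp_eval_sum: "dp_eval (sum f A) \<eta> z = (\<Sum>i\<in>A. dp_eval (f i) \<eta> z)"
  by (induction A rule: infinite_finite_induct) (auto simp: dp_eval_add)

lemma dp_eval_mult: "dp_eval (p * q) \<eta> z = dp_eval p \<eta> z * dp_eval q \<eta> z"
proof (induction p rule: poly_mapping_additive_induct)
  case (2 m a)
  show ?case
  proof (induction q rule: poly_mapping_additive_induct)
    case (2 n b)
    let ?K = "Poly_Mapping.keys m \<union> Poly_Mapping.keys n"
    show ?case
      unfolding mult_single
      by (subst (1 2 3) dp_eval_single[of ?K])
         (auto simp: in_keys_iff lookup_add power_add prod.distrib mult_ac)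
  qed (simp_all add: dp_eval_add algebra_simps)
qed (simp_all add: dp_eval_add algebra_simps)

lemma dp_eval_uminus: "dp_eval (- p) \<eta> z = - dp_eval p \<eta> z"
  using dp_eval_add[of p "- p"] by (simp add: eq_neg_iff_add_eq_0 add.commute)

lemma dp_eval_diff: "dp_eval (p - q) \<eta> z = dp_eval p \<eta> z - dp_eval q \<eta> z"
  using dp_eval_add[of p "- q"] by (simp add: dp_eval_uminus)

text \<open>Evaluation is multiplicative, so both sides obey the product rule and only the
  generators need checking. This is the bridge from identities of differential polynomials to
  identities of holomorphic functions.\<close>

lemma has_field_derivative_dp_eval:
  assumes "\<eta> holomorphic_on U" "open U" "z \<in> U"
  shows "(dp_eval p \<eta> has_field_derivative dp_eval (DP p) \<eta> z) (at z)"
proof (induction p rule: diff_poly_induct)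
  case (const c)
  have "dp_eval (cst c) \<eta> = (\<lambda>_. c)" by auto
  then show ?case by (simp only: DP_cst dp_eval_zero DERIV_const)
next
  case (DVar k)
  have "(deriv ^^ k) \<eta> field_differentiable at z"
    using assms holomorphic_higher_deriv holomorphic_on_imp_differentiable_at by blast
  moreover have "dp_eval (DVar k) \<eta> = (deriv ^^ k) \<eta>" by auto
  ultimately show ?case by (simp add: DERIV_deriv_iff_field_differentiable)
next
  case (add p q)
  have "dp_eval (p + q) \<eta> = (\<lambda>z. dp_eval p \<eta> z + dp_eval q \<eta> z)"
    by (auto simp: dp_eval_add)
  then show ?case using add by (auto simp: DP_add dp_eval_add intro!: derivative_intros)
next
  case (mult p q)
  have "dp_eval (p * q) \<eta> = (\<lambda>z. dp_eval p \<eta> z * dp_eval q \<eta> z)"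
    by (auto simp: dp_eval_mult)
  then show ?case
    using DERIV_mult[OF mult] by (simp add: DP_mult dp_eval_add dp_eval_mult algebra_simps)
qed

section \<open>The hierarchy by an algebraic recursion, and uniqueness in the differential
  one\<close>

text \<open>\<open>mkdv_S n\<close> is twice the local primitive of \<open>\<eta> Q\<^sub>n'\<close>. Its algebraic recursion comes from the
  first integral \<open>4 R\<^sup>2 - Q'\<^sup>2 + Q\<^sup>2 / \<mu>\<close> of the generating functions of the hierarchy.\<close>

function mkdv_R :: "nat \<Rightarrow> diff_poly" and mkdv_S :: "nat \<Rightarrow> diff_poly" where
  "mkdv_R 0 = DVar 0"
| "mkdv_R (Suc n) = DP (DP (mkdv_R n)) - 2 * DVar 0 * mkdv_S n"
| "mkdv_S n = (\<Sum>i\<le>n. mkdv_R i * mkdv_R (n - i)) +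
     (\<Sum>i<n. mkdv_S i * mkdv_S (n - Suc i) - DP (mkdv_R i) * DP (mkdv_R (n - Suc i)))"
  by pat_completeness auto
termination
  \<comment> \<open>\<open>mkdv_S n\<close> calls \<open>mkdv_R n\<close>, and
    \<open>mkdv_R (Suc n)\<close> calls \<open>mkdv_S n\<close>; the weights 2n and 2n + 1
    interleave the two functions.\<close>
  by (relation "Wellfounded.measure (case_sum (\<lambda>n. 2 * n) (\<lambda>n. 2 * n + 1))") auto

declare mkdv_S.simps [simp del]

lemma mkdv_S_0: "mkdv_S 0 = DVar 0 * DVar 0"
  by (subst mkdv_S.simps) simp

definition fps_DP :: "diff_poly fps \<Rightarrow> diff_poly fps" where
  "fps_DP f = Abs_fps (\<lambda>n. DP (f $ n))"

lemma fps_DP_nth [simp]: "fps_DP f $ n = DP (f $ n)"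
  by (simp add: fps_DP_def)

lemma fps_DP_add: "fps_DP (f + g) = fps_DP f + fps_DP g"
  by (simp add: fps_eq_iff DP_add)

lemma fps_DP_diff: "fps_DP (f - g) = fps_DP f - fps_DP g"
  by (simp add: fps_eq_iff DP_diff)

lemma fps_DP_mult: "fps_DP (f * g) = fps_DP f * g + f * fps_DP g"
  by (simp add: fps_eq_iff fps_mult_nth DP_sum DP_mult sum.distrib)

lemma fps_DP_X [simp]: "fps_DP fps_X = 0"
  by (simp add: fps_eq_iff)

lemma fps_DP_const: "fps_DP (fps_const c) = fps_const (DP c)"
  by (simp add: fps_eq_iff)

text \<open>The defect d = S' - 2 \<eta> Q' of the generating functions satisfies d = 2 X S d:
  eliminate Q Q' and Q'' between the derivative of the equation for S and the equation for Q
  multiplied by Q'. The factor X then kills d coefficient by coefficient.\<close>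

lemma DP_mkdv_S: "DP (mkdv_S n) = 2 * DVar 0 * DP (mkdv_R n)"
proof -
  define Q where "Q = Abs_fps mkdv_R"
  define S where "S = Abs_fps mkdv_S"
  define e where "e = fps_const (DVar 0)"
  define d where "d = fps_DP S - (e + e) * fps_DP Q"
  let ?D = fps_DP and ?X = "fps_X :: diff_poly fps"
  have e_S: "((e + e) * f) $ k = 2 * DVar 0 * f $ k" for f k
    by (simp only: e_def distrib_right fps_add_nth fps_mult_left_const_nth mult_2)
  have Q: "Q = e + ?X * (?D (?D Q) - (e + e) * S)"
  proof (rule fps_ext)
    fix n show "Q $ n = (e + ?X * (?D (?D Q) - (e + e) * S)) $ n"
    proof (cases n)
      case 0
      then show ?thesis by (simp add: Q_def e_def)
    next
      case (Suc k)
      have "e $ Suc k = 0" by (simp add: e_def)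
      then show ?thesis
        unfolding Suc fps_add_nth fps_X_mult_nth fps_sub_nth fps_DP_nth e_S
        by (simp add: Q_def S_def)
    qed
  qed
  have S: "S = Q * Q + ?X * (S * S - ?D Q * ?D Q)"
  proof (rule fps_ext)
    fix n show "S $ n = (Q * Q + ?X * (S * S - ?D Q * ?D Q)) $ n"
    proof (cases n)
      case 0
      then show ?thesis by (simp add: Q_def S_def mkdv_S_0)
    next
      case (Suc k)
      have "S $ n = (\<Sum>i\<le>n. mkdv_R i * mkdv_R (n - i)) +
          (\<Sum>i\<le>k. mkdv_S i * mkdv_S (k - i) - DP (mkdv_R i) * DP (mkdv_R (k - i)))"
        unfolding S_def fps_nth_Abs_fps
        by (subst mkdv_S.simps) (simp add: Suc lessThan_Suc_atMost del: sum.lessThan_Suc sum.atMost_Suc)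
      also have "\<dots> = (Q * Q + ?X * (S * S - ?D Q * ?D Q)) $ n"
        unfolding Suc fps_add_nth fps_X_mult_nth fps_sub_nth
          fps_mult_nth[of Q Q] fps_mult_nth[of S S] fps_mult_nth[of "?D Q" "?D Q"]
        by (simp add: Q_def S_def sum_subtractf atMost_atLeast0 del: sum.atMost_Suc)
      finally show ?thesis .
    qed
  qed
  have "?D S = 2 * Q * ?D Q + ?X * (2 * S * ?D S - 2 * ?D Q * ?D (?D Q))"
    by (subst S, simp only: fps_DP_add fps_DP_mult fps_DP_diff fps_DP_X) (simp add: algebra_simps)
  moreover have "Q * ?D Q = e * ?D Q + ?X * (?D (?D Q) * ?D Q - (e + e) * S * ?D Q)"
    by (subst (1) Q) (simp add: algebra_simps)
  moreover have "s - (e + e) * q = x * (2 * S * (s - (e + e) * q))"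
    if "s = 2 * Q * q + x * (2 * S * s - 2 * q * r)" "Q * q = e * q + x * (r * q - (e + e) * S * q)"
    for s q x r :: "diff_poly fps"
    using that by algebra
  ultimately have "?D S - (e + e) * ?D Q = ?X * (2 * S * (?D S - (e + e) * ?D Q))"
    by blast
  then have d_eq: "d = ?X * (2 * S * d)" unfolding d_def .
  have "d $ n = 0"
  proof (induction n rule: less_induct)
    case (less n)
    have "(2 * S * d) $ k = 0" if "k < n" for k
      unfolding fps_mult_nth[of "2 * S" d] using less that by (intro sum.neutral) auto
    then show ?case
      by (subst d_eq) (cases n, auto)
  qed
  then show ?thesis
    unfolding d_def fps_sub_nth fps_DP_nth e_S by (simp add: S_def Q_def)
qed

lemma lookup_DVar_mult:
  "Poly_Mapping.lookup (DVar k * q) m = (if Poly_Mapping.lookup m k = 0 then 0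
     else Poly_Mapping.lookup q (m - Poly_Mapping.single k 1))"
proof (induction q rule: poly_mapping_additive_induct)
  case (2 n a)
  have "Poly_Mapping.single k 1 + n = m \<longleftrightarrow>
      Poly_Mapping.lookup m k \<noteq> 0 \<and> n = m - Poly_Mapping.single k 1"
    by (auto simp: poly_mapping_eq_iff fun_eq_iff lookup_add lookup_minus lookup_single when_def)
  then show ?case
    by (auto simp: DVar_def mult_single lookup_single when_def simp del: One_nat_def)
qed (simp_all add: distrib_left lookup_add)

text \<open>As the index \<open>Suc k\<close> is absent from p, it enters \<open>DP p\<close> only
  by differentiating a factor of index k. The monomial in question therefore has m as its single
  source, and no contributions can cancel.\<close>

lemma lookup_DP_top:
  assumes top: "\<And>m'. m' \<in> Poly_Mapping.keys p \<Longrightarrow> Poly_Mapping.lookup m' (Suc k) = 0"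
    and m: "m \<in> Poly_Mapping.keys p" "Poly_Mapping.lookup m k \<noteq> 0"
  shows "Poly_Mapping.lookup (DP p) (m - Poly_Mapping.single k 1 + Poly_Mapping.single (Suc k) 1)
    = of_nat (Poly_Mapping.lookup m k) * Poly_Mapping.lookup p m"
proof -
  let ?e = "\<lambda>k. Poly_Mapping.single k (1::nat)"
  let ?M = "m - ?e k + ?e (Suc k)"
  have eq: "m' - ?e j + ?e (Suc j) = ?M \<longleftrightarrow> j = k \<and> m' = m"
    if m': "m' \<in> Poly_Mapping.keys p" "j \<in> Poly_Mapping.keys m'" for m' j
  proof
    assume a: "m' - ?e j + ?e (Suc j) = ?M"
    have "Poly_Mapping.lookup (m' - ?e j + ?e (Suc j)) (Suc k) = Poly_Mapping.lookup ?M (Suc k)"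
      using a by simp
    then have "j = k"
      using top[OF m'(1)] top[OF m(1)] by (auto simp: lookup_add lookup_minus lookup_single when_def split: if_splits)
    have "Poly_Mapping.lookup m' i = Poly_Mapping.lookup m i" for i
    proof -
      have "Poly_Mapping.lookup (m' - ?e k + ?e (Suc k)) i = Poly_Mapping.lookup ?M i"
        using a \<open>j = k\<close> by simp
      then show ?thesis
        using m'(2) m(2) \<open>j = k\<close>
        by (auto simp: lookup_add lookup_minus lookup_single when_def in_keys_iff split: if_splits)
    qed
    then show "j = k \<and> m' = m" using \<open>j = k\<close> by (simp add: poly_mapping_eqI)
  qed auto
  have "Poly_Mapping.lookup (DP p) ?M = (\<Sum>m'\<in>Poly_Mapping.keys p. \<Sum>j\<in>Poly_Mapping.keys m'.
      if j = k \<and> m' = m then of_nat (Poly_Mapping.lookup m' j) * Poly_Mapping.lookup p m' else 0)"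
    unfolding DP_def lookup_sum lookup_single
    by (intro sum.cong refl) (simp add: when_def eq del: One_nat_def)
  also have "\<dots> = (\<Sum>m'\<in>Poly_Mapping.keys p. if m' = m then of_nat (Poly_Mapping.lookup m k) * Poly_Mapping.lookup p m else 0)"
  proof (rule sum.cong[OF refl])
    fix m' assume "m' \<in> Poly_Mapping.keys p"
    have "(\<Sum>j\<in>Poly_Mapping.keys m'. if j = k \<and> m' = m then of_nat (Poly_Mapping.lookup m' j) * Poly_Mapping.lookup p m' else 0)
      = (\<Sum>j\<in>Poly_Mapping.keys m'. if j = k then (if m' = m then of_nat (Poly_Mapping.lookup m k) * Poly_Mapping.lookup p m else 0) else 0)"
      by (intro sum.cong) auto
    then show "(\<Sum>j\<in>Poly_Mapping.keys m'. if j = k \<and> m' = m then of_nat (Poly_Mapping.lookup m' j) * Poly_Mapping.lookup p m' else 0)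
      = (if m' = m then of_nat (Poly_Mapping.lookup m k) * Poly_Mapping.lookup p m else 0)"
      using m(2) by (auto simp: in_keys_iff)
  qed
  finally show ?thesis using m by simp
qed

text \<open>If \<open>k \<ge> 1\<close> is the top index of a solution \<open>p\<close> of \<open>\<eta> p' = \<eta>' p\<close>, only \<open>\<eta> p'\<close> contains \<open>\<eta>\<^sup>(\<^sup>k\<^sup>+\<^sup>1\<^sup>)\<close>.\<close>

lemma log_derivative_unique:
  assumes eq: "DVar 0 * DP p = DVar 1 * p"
    and z: "Poly_Mapping.lookup p (Poly_Mapping.single 0 1) = 0"
  shows "p = 0"
proof (rule ccontr)
  assume "p \<noteq> 0"
  let ?e = "\<lambda>k. Poly_Mapping.single k (1::nat)"
  let ?I = "\<Union>m\<in>Poly_Mapping.keys p. Poly_Mapping.keys m"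
  have fin: "finite ?I" by simp
  obtain m\<^sub>0 where m\<^sub>0: "m\<^sub>0 \<in> Poly_Mapping.keys p"
    using \<open>p \<noteq> 0\<close> by (meson ex_in_conv keys_eq_empty)
  have coeff: "Poly_Mapping.lookup (DVar 0 * DP p) M = Poly_Mapping.lookup (DVar 1 * p) M" for M
    using eq by simp
  show False
  proof (cases "?I \<subseteq> {0}")
    \<comment> \<open>Here p is a polynomial in \<eta> alone. Comparing coefficients of
      \<open>\<eta>^n * \<eta>'\<close> gives n = 1 for the monomial at hand, and the monomial
      \<eta> itself is excluded by the normalisation.\<close>
    case True
    let ?n = "Poly_Mapping.lookup m\<^sub>0 0"
    have zero: "Poly_Mapping.lookup m i = 0" if "m \<in> Poly_Mapping.keys p" "i \<noteq> 0" for m i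
    proof (rule ccontr)
      assume "Poly_Mapping.lookup m i \<noteq> 0"
      then have "i \<in> ?I" using that by (auto simp: in_keys_iff)
      then show False using True that by auto
    qed
    have M: "m\<^sub>0 + ?e 1 - ?e 1 = m\<^sub>0" by simp
    have R: "Poly_Mapping.lookup (DVar 1 * p) (m\<^sub>0 + ?e 1) = Poly_Mapping.lookup p m\<^sub>0"
      unfolding lookup_DVar_mult by (simp add: lookup_add)
    have nz: "Poly_Mapping.lookup p m\<^sub>0 \<noteq> 0" using m\<^sub>0 by (simp add: in_keys_iff)
    have L: "Poly_Mapping.lookup (DVar 0 * DP p) (m\<^sub>0 + ?e 1) = of_nat ?n * Poly_Mapping.lookup p m\<^sub>0"
    proof (cases "?n = 0")
      case True
      then show ?thesis unfolding lookup_DVar_mult by (simp add: lookup_add lookup_single)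
    next
      case False
      have "m\<^sub>0 + ?e 1 - ?e 0 = m\<^sub>0 - ?e 0 + ?e (Suc 0)"
        using False by (intro poly_mapping_eqI) (auto simp: lookup_add lookup_minus lookup_single when_def)
      then show ?thesis
        using False lookup_DP_top[of p 0 m\<^sub>0] zero m\<^sub>0 unfolding lookup_DVar_mult
        by (simp add: lookup_add lookup_single)
    qed
    have "?n = 1" using coeff[of "m\<^sub>0 + ?e 1"] L R nz by simp
    then have "m\<^sub>0 = ?e 0"
      using zero[OF m\<^sub>0] by (intro poly_mapping_eqI) (auto simp: lookup_single when_def)
    then show False using nz z by simp
  next
    case False
    define k where "k = Max ?I"
    have "?I \<noteq> {}" using False by fast
    then have "k \<in> ?I" using fin unfolding k_def by (rule Max_in[rotated])
    then obtain m where m: "m \<in> Poly_Mapping.keys p" "Poly_Mapping.lookup m k \<noteq> 0"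
      by (auto simp: in_keys_iff)
    have "k \<noteq> 0"
    proof
      assume "k = 0"
      have "x \<le> k" if "x \<in> ?I" for x
        unfolding k_def using fin that by (rule Max_ge)
      then have "?I \<subseteq> {0}" using \<open>k = 0\<close> by blast
      then show False using False by simp
    qed
    have top: "Poly_Mapping.lookup m' (Suc k) = 0" if "m' \<in> Poly_Mapping.keys p" for m'
    proof (rule ccontr)
      assume "Poly_Mapping.lookup m' (Suc k) \<noteq> 0"
      then have "Suc k \<in> ?I" using that by (auto simp: in_keys_iff)
      then have "Suc k \<le> k" unfolding k_def using fin Max_ge by blast
      then show False by simp
    qed
    let ?M = "m - ?e k + ?e (Suc k)"
    have "Poly_Mapping.lookup (DVar 0 * DP p) (?M + ?e 0) = of_nat (Poly_Mapping.lookup m k) * Poly_Mapping.lookup p m"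
      using lookup_DP_top[OF top m] unfolding lookup_DVar_mult by (simp add: lookup_add)
    moreover have "Poly_Mapping.lookup p (?M + ?e 0 - ?e 1) = 0"
    proof (rule ccontr)
      assume "Poly_Mapping.lookup p (?M + ?e 0 - ?e 1) \<noteq> 0"
      then have "Poly_Mapping.lookup (?M + ?e 0 - ?e 1) (Suc k) = 0"
        using top by (auto simp: in_keys_iff)
      then show False using \<open>k \<noteq> 0\<close> by (auto simp: lookup_add lookup_minus lookup_single when_def)
    qed
    then have "Poly_Mapping.lookup (DVar 1 * p) (?M + ?e 0) = 0"
      by (simp only: lookup_DVar_mult split: if_split) blast
    ultimately have "of_nat (Poly_Mapping.lookup m k) * Poly_Mapping.lookup p m = 0"
      using coeff[of "?M + ?e 0"] by simp
    then show False using m by (simp add: in_keys_iff)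
  qed
qed

lemma lookup_zero_mult:
  "Poly_Mapping.lookup (p * q) 0 = Poly_Mapping.lookup p 0 * Poly_Mapping.lookup (q :: diff_poly) 0"
proof (induction p rule: poly_mapping_additive_induct)
  case (2 m a)
  show ?case
  proof (induction q rule: poly_mapping_additive_induct)
    case (2 n b)
    have "m + n = 0 \<longleftrightarrow> m = 0 \<and> n = 0"
      by (auto simp: poly_mapping_eq_iff fun_eq_iff lookup_add)
    then show ?case by (auto simp: mult_single lookup_single when_def)
  qed (simp_all add: lookup_add distrib_left)
qed (simp_all add: lookup_add distrib_right)

text \<open>Each monomial produced by the derivation carries a factor of positive index.\<close>

lemma lookup_DP_eq_0:
  assumes "\<And>k. Poly_Mapping.lookup M (Suc k) = 0"
  shows "Poly_Mapping.lookup (DP p) M = 0"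
proof -
  have "m - Poly_Mapping.single k 1 + Poly_Mapping.single (Suc k) 1 \<noteq> M" for m k
  proof
    assume "m - Poly_Mapping.single k 1 + Poly_Mapping.single (Suc k) 1 = M"
    then have "Poly_Mapping.lookup M (Suc k) = Poly_Mapping.lookup (m - Poly_Mapping.single k 1) (Suc k) + 1"
      by (auto simp: lookup_add)
    then show False using assms by simp
  qed
  then show ?thesis unfolding DP_def by (simp add: lookup_sum lookup_single when_def)
qed

text \<open>What matters is \<open>mkdv_S n\<close>: without a constant term there, the product of
  \<eta> and \<open>mkdv_S n\<close> contains no linear monomial \<eta>, and this is the
  normalisation demanded in \<open>mkdv_poly\<close>.\<close>

lemma lookup_zero_mkdv:
  "Poly_Mapping.lookup (mkdv_R n) 0 = 0" "Poly_Mapping.lookup (mkdv_S n) 0 = 0"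
proof -
  have DP0: "Poly_Mapping.lookup (DP p) 0 = 0" for p by (rule lookup_DP_eq_0) simp
  show R: "Poly_Mapping.lookup (mkdv_R n) 0 = 0" for n
  proof (cases n)
    case 0
    have "Poly_Mapping.single 0 (Suc 0) \<noteq> (0 :: nat \<Rightarrow>\<^sub>0 nat)"
      by (auto simp: poly_mapping_eq_iff fun_eq_iff lookup_single when_def)
    then show ?thesis using 0 by (simp add: DVar_def lookup_single when_def)
  next
    case (Suc k)
    have "Poly_Mapping.single 0 (Suc 0) \<noteq> (0 :: nat \<Rightarrow>\<^sub>0 nat)"
      by (auto simp: poly_mapping_eq_iff fun_eq_iff lookup_single when_def)
    then show ?thesis using Suc by (simp add: lookup_minus DP0 lookup_zero_mult DVar_def lookup_single when_def)
  qed
  show "Poly_Mapping.lookup (mkdv_S n) 0 = 0"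
  proof (induction n rule: less_induct)
    case (less n)
    show ?case
      by (subst mkdv_S.simps)
         (auto simp: lookup_add lookup_sum lookup_minus lookup_zero_mult R DP0 less intro!: sum.neutral)
  qed
qed

text \<open>The definite description is resolved here. When \<open>mkdv_R (Suc n)\<close> is
  inserted into the differential recursion, \<open>DP_mkdv_S\<close> removes the derivative of
  \<open>mkdv_S n\<close> and the remaining terms with \<open>mkdv_S n\<close> cancel. A second
  solution would differ by a solution of \<open>\<eta> * q' = \<eta>' * q\<close> without linear
  term, hence by zero.\<close>

lemma mkdv_poly_eq: "mkdv_poly n = mkdv_R n"
proof (induction n)
  case (Suc n)
  let ?P = "\<lambda>q. DVar 0 * DP q - DVar 1 * q
       = DVar 0 * DP (DP (DP (mkdv_R n))) - DVar 1 * DP (DP (mkdv_R n))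
         - 4 * DVar 0 ^ 3 * DP (mkdv_R n) \<and>
     Poly_Mapping.lookup q (Poly_Mapping.single 0 1) = 0"
  have D2: "DP (2 * DVar 0 * mkdv_S n) = 2 * DVar 1 * mkdv_S n + 4 * DVar 0 ^ 2 * DP (mkdv_R n)"
    by (simp add: DP_mult DP_mkdv_S power2_eq_square)
  have sol: "?P (mkdv_R (Suc n))"
  proof
    show "DVar 0 * DP (mkdv_R (Suc n)) - DVar 1 * mkdv_R (Suc n)
       = DVar 0 * DP (DP (DP (mkdv_R n))) - DVar 1 * DP (DP (mkdv_R n))
         - 4 * DVar 0 ^ 3 * DP (mkdv_R n)"
      unfolding mkdv_R.simps DP_diff D2 by (simp add: algebra_simps power2_eq_square power3_eq_cube)
    have "Poly_Mapping.lookup (DP (DP (mkdv_R n))) (Poly_Mapping.single 0 1) = 0"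
      by (rule lookup_DP_eq_0) (simp add: lookup_single)
    moreover have "Poly_Mapping.lookup (DVar 0 * (2 * mkdv_S n)) (Poly_Mapping.single 0 1) = 0"
      unfolding lookup_DVar_mult by (simp add: lookup_zero_mult lookup_zero_mkdv)
    ultimately show "Poly_Mapping.lookup (mkdv_R (Suc n)) (Poly_Mapping.single 0 1) = 0"
      by (simp add: lookup_minus mult.assoc mult.left_commute)
  qed
  have "q = mkdv_R (Suc n)" if "?P q" for q
  proof -
    have "q - mkdv_R (Suc n) = 0"
    proof (rule log_derivative_unique)
      show "DVar 0 * DP (q - mkdv_R (Suc n)) = DVar 1 * (q - mkdv_R (Suc n))"
      proof -
        have "a * (x - x') = b * (y - y')" if "a * x - b * y = z" "a * x' - b * y' = z"
          for a b x y x' y' z :: diff_poly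
        proof -
          have "a * (x - x') - b * (y - y') = (a * x - b * y) - (a * x' - b * y')"
            by (simp add: right_diff_distrib)
          then show ?thesis using that by simp
        qed
        then show ?thesis using that sol unfolding DP_diff by blast
      qed
      show "Poly_Mapping.lookup (q - mkdv_R (Suc n)) (Poly_Mapping.single 0 1) = 0"
        using that sol by (simp add: lookup_minus)
    qed
    then show ?thesis by simp
  qed
  then have "(THE q. ?P q) = mkdv_R (Suc n)"
    using sol by (rule the_equality[rotated])
  then show ?case using Suc by (simp only: mkdv_poly.simps)
qed simp

section \<open>Bands, the maximum principle on them, and a discrete Gronwall inequality\<close>

lemma open_open_band: "open (open_band s\<^sub>1 s\<^sub>2)"
  unfolding open_band_def by (intro open_Collect_conj open_halfspace_Re_gt open_halfspace_Re_lt)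

lemma convex_open_band: "convex (open_band s\<^sub>1 s\<^sub>2)"
  unfolding open_band_def Collect_conj_eq
  by (intro convex_Int convex_halfspace_Re_gt convex_halfspace_Re_lt)

lemma deriv_shift:
  fixes f :: "complex \<Rightarrow> complex"
  assumes "open W" "z \<in> W" and shift: "\<And>w. w \<in> W \<Longrightarrow> f (w + c) = f w + d"
    and "f field_differentiable at (z + c)"
  shows "deriv f (z + c) = deriv f z"
proof -
  have 1: "(f has_field_derivative deriv f (z + c)) (at (z + c))"
    using assms by (simp add: DERIV_deriv_iff_field_differentiable)
  have 2: "((\<lambda>z. z + c) has_field_derivative 1) (at z)"
    by (auto intro!: derivative_eq_intros)
  have "((\<lambda>z. f (z + c) - d) has_field_derivative deriv f (z + c)) (at z)"
    using DERIV_diff[OF DERIV_chain2[OF 1 2] DERIV_const[of d]] by simp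
  then have "(f has_field_derivative deriv f (z + c)) (at z)"
    by (rule has_field_derivative_transform_within_open[OF _ assms(1,2)]) (simp add: shift)
  then show ?thesis by (simp add: DERIV_imp_deriv)
qed

lemma has_derivative_along_line:
  assumes "f holomorphic_on U" "open U" "Complex s y \<in> U"
  shows "((\<lambda>y. Re (f (Complex s y))) has_real_derivative - Im (deriv f (Complex s y))) (at y)"
    and "((\<lambda>y. Im (f (Complex s y))) has_real_derivative Re (deriv f (Complex s y))) (at y)"
proof -
  have 1: "((\<lambda>y. Complex s y) has_vector_derivative \<i>) (at y)"
    unfolding Complex_eq by (auto intro!: derivative_eq_intros)
  have "(f has_field_derivative deriv f (Complex s y)) (at (Complex s y))"
    using assms holomorphic_derivI by blast
  from field_vector_diff_chain_at[OF 1 this]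
  have d: "((\<lambda>y. f (Complex s y)) has_vector_derivative \<i> * deriv f (Complex s y)) (at y)"
    by (simp add: o_def)
  show "((\<lambda>y. Re (f (Complex s y))) has_real_derivative - Im (deriv f (Complex s y))) (at y)"
    "((\<lambda>y. Im (f (Complex s y))) has_real_derivative Re (deriv f (Complex s y))) (at y)"
    using bounded_linear.has_vector_derivative[OF bounded_linear_Re d]
      bounded_linear.has_vector_derivative[OF bounded_linear_Im d]
    by (simp_all add: has_real_derivative_iff_has_vector_derivative o_def)
qed

lemma has_derivative_across_line:
  assumes "f holomorphic_on U" "open U" "Complex x y \<in> U"
  shows "((\<lambda>x. Re (f (Complex x y))) has_real_derivative Re (deriv f (Complex x y))) (at x)"
    and "((\<lambda>x. Im (f (Complex x y))) has_real_derivative Im (deriv f (Complex x y))) (at x)"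
proof -
  have 1: "((\<lambda>x. Complex x y) has_vector_derivative 1) (at x)"
    unfolding Complex_eq by (auto intro!: derivative_eq_intros)
  have "(f has_field_derivative deriv f (Complex x y)) (at (Complex x y))"
    using assms holomorphic_derivI by blast
  from field_vector_diff_chain_at[OF 1 this]
  have d: "((\<lambda>x. f (Complex x y)) has_vector_derivative deriv f (Complex x y)) (at x)"
    by (simp add: o_def)
  show "((\<lambda>x. Re (f (Complex x y))) has_real_derivative Re (deriv f (Complex x y))) (at x)"
    "((\<lambda>x. Im (f (Complex x y))) has_real_derivative Im (deriv f (Complex x y))) (at x)"
    using bounded_linear.has_vector_derivative[OF bounded_linear_Re d]
      bounded_linear.has_vector_derivative[OF bounded_linear_Im d]
    by (simp_all add: has_real_derivative_iff_has_vector_derivative o_def)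
qed

lemma closed_closed_band: "closed (closed_band s\<^sub>1 s\<^sub>2)"
  unfolding closed_band_def by (intro closed_Collect_conj closed_halfspace_Re_ge closed_halfspace_Re_le)

lemma open_band_subset_closed_band: "open_band s\<^sub>1 s\<^sub>2 \<subseteq> closed_band s\<^sub>1 s\<^sub>2"
  by (auto simp: open_band_def closed_band_def)

lemma closure_open_band:
  assumes "s\<^sub>1 < s\<^sub>2"
  shows "closure (open_band s\<^sub>1 s\<^sub>2) = closed_band s\<^sub>1 s\<^sub>2"
proof
  show "closure (open_band s\<^sub>1 s\<^sub>2) \<subseteq> closed_band s\<^sub>1 s\<^sub>2"
    by (rule closure_minimal[OF open_band_subset_closed_band closed_closed_band])
  show "closed_band s\<^sub>1 s\<^sub>2 \<subseteq> closure (open_band s\<^sub>1 s\<^sub>2)"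
  proof
    fix z assume z: "z \<in> closed_band s\<^sub>1 s\<^sub>2"
    define w where "w = Complex ((s\<^sub>1 + s\<^sub>2) / 2) (Im z)"
    have w: "w \<in> open_band s\<^sub>1 s\<^sub>2" using assms by (auto simp: w_def open_band_def)
    have mem: "z + of_real (1 / (real n + 1)) * (w - z) \<in> open_band s\<^sub>1 s\<^sub>2" for n
    proof -
      define t where "t = 1 / (real n + 1)"
      have t: "0 < t" "t \<le> 1" by (auto simp: t_def)
      have "Re (z + of_real t * (w - z)) = (1 - t) * Re z + t * Re w" by (simp add: algebra_simps)
      moreover have "(1 - t) * s\<^sub>1 \<le> (1 - t) * Re z" "(1 - t) * Re z \<le> (1 - t) * s\<^sub>2"
        using z t by (auto simp: closed_band_def intro!: mult_left_mono)
      moreover have "t * s\<^sub>1 < t * Re w" "t * Re w < t * s\<^sub>2"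
        using w t by (auto simp: open_band_def intro!: mult_strict_left_mono)
      ultimately show ?thesis unfolding t_def[symmetric] by (auto simp: open_band_def algebra_simps)
    qed
    have "(\<lambda>n. 1 / (real n + 1)) \<longlonglongrightarrow> 0"
      using LIMSEQ_inverse_real_of_nat by (simp add: inverse_eq_divide add.commute)
    then have "(\<lambda>n. z + of_real (1 / (real n + 1)) * (w - z)) \<longlonglongrightarrow> z + of_real 0 * (w - z)"
      by (intro tendsto_intros)
    then show "z \<in> closure (open_band s\<^sub>1 s\<^sub>2)"
      unfolding closure_sequential using mem by (intro exI[of _ "\<lambda>n. z + of_real (1 / (real n + 1)) * (w - z)"]) simp
  qed
qed

text \<open>The Gaussian factor \<open>exp (\<epsilon> z\<^sup>2)\<close> decays in the direction of the band.\<close>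

lemma Phragmen_Lindelof_band:
  assumes V: "open V" and VR: "\<And>z. z \<in> V \<Longrightarrow> \<bar>Re z\<bar> \<le> R"
    and hol: "f holomorphic_on V" and cont: "continuous_on (closure V) f"
    and bd: "bounded (f ` closure V)" and B: "0 < B"
    and fr: "\<And>z. z \<in> frontier V \<Longrightarrow> norm (f z) \<le> B" and z\<^sub>0: "z\<^sub>0 \<in> V"
  shows "norm (f z\<^sub>0) \<le> B"
proof -
  have R: "\<bar>Re z\<bar> \<le> R" if "z \<in> closure V" for z
  proof -
    have "closed {z. \<bar>Re z\<bar> \<le> R}" by (intro closed_Collect_le continuous_intros)
    then have "closure V \<subseteq> {z. \<bar>Re z\<bar> \<le> R}" using VR by (intro closure_minimal) auto
    then show ?thesis using that by auto
  qed
  obtain K where K: "0 < K" "\<And>z. z \<in> closure V \<Longrightarrow> norm (f z) \<le> K"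
    using bd unfolding bounded_pos by auto
  have nexp: "norm (exp (of_real \<epsilon> * z\<^sup>2)) = exp (\<epsilon> * ((Re z)\<^sup>2 - (Im z)\<^sup>2))" for \<epsilon> :: real and z
    by (simp add: power2_eq_square algebra_simps)
  have main: "norm (f z\<^sub>0) * exp (\<epsilon> * ((Re z\<^sub>0)\<^sup>2 - (Im z\<^sub>0)\<^sup>2)) \<le> B * exp (\<epsilon> * R\<^sup>2)" if \<epsilon>: "\<epsilon> > 0" for \<epsilon> :: real
  proof -
    define F where "F z = f z * exp (of_real \<epsilon> * z\<^sup>2)" for z
    have nF: "norm (F z) = norm (f z) * exp (\<epsilon> * ((Re z)\<^sup>2 - (Im z)\<^sup>2))" for z
      by (simp only: F_def norm_mult nexp)
    \<comment> \<open>On the circle of radius \<rho> one has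
      \<open>(Re z)^2 - (Im z)^2 \<le> 2 * R^2 - \<rho>^2\<close>. The summand with the logarithm,
      together with \<open>R^2\<close>, brings the crude bound K times the Gaussian factor below
      \<open>B * exp (\<epsilon> * R^2)\<close>; the summand \<open>norm z\<^sub>0\<close> keeps
      \<open>z\<^sub>0\<close> inside.\<close>
    define \<rho> where "\<rho> = norm z\<^sub>0 + \<bar>R\<bar> + 1 + \<bar>ln (K / B)\<bar> / \<epsilon> + R\<^sup>2"
    have "0 \<le> \<bar>ln (K / B)\<bar> / \<epsilon>" "0 \<le> R\<^sup>2" "0 \<le> norm z\<^sub>0" using \<epsilon> by auto
    then have \<rho>: "norm z\<^sub>0 < \<rho>" "1 \<le> \<rho>" "\<bar>ln (K / B)\<bar> / \<epsilon> + R\<^sup>2 \<le> \<rho>"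
      unfolding \<rho>_def by linarith+
    have "\<rho> * 1 \<le> \<rho> * \<rho>" using \<rho> by (intro mult_left_mono) auto
    then have "\<bar>ln (K / B)\<bar> / \<epsilon> + R\<^sup>2 \<le> \<rho>\<^sup>2" using \<rho>(3) by (simp add: power2_eq_square)
    then have "\<epsilon> * (\<bar>ln (K / B)\<bar> / \<epsilon> + R\<^sup>2) \<le> \<epsilon> * \<rho>\<^sup>2" using \<epsilon> by (intro mult_left_mono) auto
    then have "\<bar>ln (K / B)\<bar> + \<epsilon> * R\<^sup>2 \<le> \<epsilon> * \<rho>\<^sup>2" using \<epsilon> by (simp add: distrib_left)
    then have "ln (K / B) + \<epsilon> * (2 * R\<^sup>2 - \<rho>\<^sup>2) \<le> \<epsilon> * R\<^sup>2" by (simp add: algebra_simps)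
    then have "exp (ln (K / B) + \<epsilon> * (2 * R\<^sup>2 - \<rho>\<^sup>2)) \<le> exp (\<epsilon> * R\<^sup>2)" by (simp only: exp_le_cancel_iff)
    then have "K / B * exp (\<epsilon> * (2 * R\<^sup>2 - \<rho>\<^sup>2)) \<le> exp (\<epsilon> * R\<^sup>2)"
      using K(1) B by (simp only: exp_add) simp
    then have "B * (K / B * exp (\<epsilon> * (2 * R\<^sup>2 - \<rho>\<^sup>2))) \<le> B * exp (\<epsilon> * R\<^sup>2)"
      using B by (intro mult_left_mono) auto
    then have far: "K * exp (\<epsilon> * (2 * R\<^sup>2 - \<rho>\<^sup>2)) \<le> B * exp (\<epsilon> * R\<^sup>2)"
      using B by (simp only: mult.assoc[symmetric]) simp
    have sq: "(Re z)\<^sup>2 \<le> R\<^sup>2" if "z \<in> closure V" for z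
      using R[OF that] by (metis abs_ge_zero order_trans power2_abs power_mono)
    let ?S = "V \<inter> ball 0 \<rho>"
    have cl: "closure ?S \<subseteq> closure V" by (rule closure_mono) auto
    have "norm (F z\<^sub>0) \<le> B * exp (\<epsilon> * R\<^sup>2)"
    proof (rule maximum_modulus_frontier[of F ?S])
      show "F holomorphic_on interior ?S"
        unfolding F_def using V by (auto simp: interior_open open_Int intro!: holomorphic_intros holomorphic_on_subset[OF hol])
      show "continuous_on (closure ?S) F"
        unfolding F_def by (intro continuous_intros continuous_on_subset[OF cont cl])
      show "bounded ?S" by (simp add: bounded_Int)
      show "z\<^sub>0 \<in> ?S" using z\<^sub>0 \<rho> by simp
      fix z assume z: "z \<in> frontier ?S"
      then have zc: "z \<in> closure V" using cl by (auto simp: frontier_def)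
      show "norm (F z) \<le> B * exp (\<epsilon> * R\<^sup>2)"
      proof (cases "z \<in> frontier V")
        case True
        have "(Re z)\<^sup>2 - (Im z)\<^sup>2 \<le> R\<^sup>2" using sq[OF zc] by (smt (verit) zero_le_power2)
        then have "exp (\<epsilon> * ((Re z)\<^sup>2 - (Im z)\<^sup>2)) \<le> exp (\<epsilon> * R\<^sup>2)" using \<epsilon> by simp
        then show ?thesis unfolding nF using fr[OF True] B by (intro mult_mono) auto
      next
        case False
        then have "z \<in> frontier (ball 0 \<rho>)" using z by (auto simp: frontier_Int)
        then have nz: "norm z = \<rho>" using \<rho> by simp
        have "(Re z)\<^sup>2 + (Im z)\<^sup>2 = \<rho>\<^sup>2" using nz by (metis cmod_power2)
        then have "(Re z)\<^sup>2 - (Im z)\<^sup>2 \<le> 2 * R\<^sup>2 - \<rho>\<^sup>2" using sq[OF zc] by simp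
        then have "exp (\<epsilon> * ((Re z)\<^sup>2 - (Im z)\<^sup>2)) \<le> exp (\<epsilon> * (2 * R\<^sup>2 - \<rho>\<^sup>2))" using \<epsilon> by simp
        then have "norm (F z) \<le> K * exp (\<epsilon> * (2 * R\<^sup>2 - \<rho>\<^sup>2))"
          unfolding nF using K(2)[OF zc] K(1) by (intro mult_mono) auto
        then show ?thesis using far by simp
      qed
    qed
    then show ?thesis unfolding nF .
  qed
  have "((\<lambda>\<epsilon>. B * exp (\<epsilon> * R\<^sup>2)) \<longlongrightarrow> B * exp (0 * R\<^sup>2)) (at_right 0)"
    by (intro tendsto_intros)
  moreover have "((\<lambda>\<epsilon>. norm (f z\<^sub>0) * exp (\<epsilon> * ((Re z\<^sub>0)\<^sup>2 - (Im z\<^sub>0)\<^sup>2)))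
      \<longlongrightarrow> norm (f z\<^sub>0) * exp (0 * ((Re z\<^sub>0)\<^sup>2 - (Im z\<^sub>0)\<^sup>2))) (at_right 0)"
    by (intro tendsto_intros)
  moreover have "eventually (\<lambda>\<epsilon>. norm (f z\<^sub>0) * exp (\<epsilon> * ((Re z\<^sub>0)\<^sup>2 - (Im z\<^sub>0)\<^sup>2)) \<le> B * exp (\<epsilon> * R\<^sup>2)) (at_right 0)"
    using main by (auto simp: eventually_at_right_field intro: exI[of _ 1])
  ultimately have "norm (f z\<^sub>0) * exp (0 * ((Re z\<^sub>0)\<^sup>2 - (Im z\<^sub>0)\<^sup>2)) \<le> B * exp (0 * R\<^sup>2)"
    by (rule tendsto_le[OF trivial_limit_at_right_real])
  then show ?thesis by simp
qed

lemma norm_le_on_band: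
  assumes s: "s\<^sub>1 < s\<^sub>2" and hol: "f holomorphic_on open_band s\<^sub>1 s\<^sub>2"
    and cont: "continuous_on (closed_band s\<^sub>1 s\<^sub>2) f" and bd: "bounded (f ` closed_band s\<^sub>1 s\<^sub>2)"
    and B: "0 < B" and lines: "\<And>z. Re z = s\<^sub>1 \<or> Re z = s\<^sub>2 \<Longrightarrow> norm (f z) \<le> B"
    and z: "z \<in> closed_band s\<^sub>1 s\<^sub>2"
  shows "norm (f z) \<le> B"
proof (cases "z \<in> open_band s\<^sub>1 s\<^sub>2")
  case True
  show ?thesis
  proof (rule Phragmen_Lindelof_band[OF open_open_band _ hol _ _ B _ True])
    show "\<bar>Re z\<bar> \<le> \<bar>s\<^sub>1\<bar> + \<bar>s\<^sub>2\<bar>" if "z \<in> open_band s\<^sub>1 s\<^sub>2" for z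
      using that by (auto simp: open_band_def)
    show "norm (f z) \<le> B" if "z \<in> frontier (open_band s\<^sub>1 s\<^sub>2)" for z
    proof (rule lines)
      have "z \<in> closed_band s\<^sub>1 s\<^sub>2" "z \<notin> open_band s\<^sub>1 s\<^sub>2"
        using that s by (auto simp: frontier_def closure_open_band interior_open[OF open_open_band])
      then show "Re z = s\<^sub>1 \<or> Re z = s\<^sub>2" by (auto simp: open_band_def closed_band_def)
    qed
  qed (use cont bd s in \<open>simp_all add: closure_open_band\<close>)
next
  case False
  then show ?thesis using z by (intro lines) (auto simp: open_band_def closed_band_def)
qed

text \<open>No derivative of w is assumed. Over n equal steps the linear term produces growth
  bounded by an exponential, while the quadratic errors sum to order 1/n, which vanishes in the
  limit.\<close>

lemma discrete_Gronwall:
  fixes w :: "real \<Rightarrow> 'a::real_normed_vector"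
  assumes S: "convex S" "y\<^sub>0 \<in> S" "y \<in> S" and 0: "w y\<^sub>0 = 0" and M: "0 \<le> M"
    and step: "\<And>a b. a \<in> S \<Longrightarrow> b \<in> S \<Longrightarrow> norm (w b - w a) \<le> M * norm (w a) * \<bar>b - a\<bar> + M * \<bar>b - a\<bar>\<^sup>2"
  shows "w y = 0"
proof -
  define l where "l = \<bar>y - y\<^sub>0\<bar>"
  have est: "norm (w y) \<le> l / n * (exp (M * l) - 1)" if n: "n > 0" for n :: nat
  proof -
    define \<delta> where "\<delta> = l / n"
    have \<delta>: "0 \<le> \<delta>" "real n * \<delta> = l" using n by (auto simp: \<delta>_def l_def)
    define p where "p k = y\<^sub>0 + real k / n * (y - y\<^sub>0)" for k :: nat
    have pS: "p k \<in> S" if "k \<le> n" for k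
    proof -
      have "p k = (1 - real k / n) *\<^sub>R y\<^sub>0 + (real k / n) *\<^sub>R y" by (simp add: p_def left_diff_distrib right_diff_distrib)
      also have "\<dots> \<in> S" using that n by (intro convexD[OF S(1) S(2) S(3)]) auto
      finally show ?thesis .
    qed
    have inc: "\<bar>p (Suc k) - p k\<bar> = \<delta>" for k
    proof -
      have "p (Suc k) - p k = (y - y\<^sub>0) / n" by (simp add: p_def add_divide_distrib distrib_right)
      then show ?thesis by (simp add: \<delta>_def l_def abs_divide)
    qed
    \<comment> \<open>The right-hand side is the exact solution of the recursion
      \<open>a (k + 1) = (1 + M * \<delta>) * a k + M * \<delta>^2\<close> with
      \<open>a 0 = 0\<close>.\<close>
    have "norm (w (p k)) \<le> \<delta> * ((1 + M * \<delta>) ^ k - 1)" if "k \<le> n" for k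
      using that
    proof (induction k)
      case 0
      then show ?case using assms(4) by (simp add: p_def)
    next
      case (Suc k)
      have "norm (w (p (Suc k))) \<le> norm (w (p k)) + norm (w (p (Suc k)) - w (p k))"
        by (rule norm_triangle_sub)
      also have "\<dots> \<le> norm (w (p k)) + (M * norm (w (p k)) * \<delta> + M * \<delta>\<^sup>2)"
        using step[of "p k" "p (Suc k)"] pS Suc.prems inc by simp
      also have "\<dots> = (1 + M * \<delta>) * norm (w (p k)) + M * \<delta>\<^sup>2" by (simp add: algebra_simps)
      also have "\<dots> \<le> (1 + M * \<delta>) * (\<delta> * ((1 + M * \<delta>) ^ k - 1)) + M * \<delta>\<^sup>2"
        using Suc M \<delta> by (intro add_right_mono mult_left_mono) auto
      also have "\<dots> = \<delta> * ((1 + M * \<delta>) ^ Suc k - 1)" by (simp add: algebra_simps power2_eq_square)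
      finally show ?case .
    qed
    from this[of n] have 1: "norm (w (p n)) \<le> \<delta> * ((1 + M * \<delta>) ^ n - 1)" by simp
    have "(1 + M * \<delta>) ^ n \<le> exp (M * \<delta>) ^ n"
      using M \<delta> by (intro power_mono) auto
    also have "\<dots> = exp (M * l)" using \<delta> by (simp add: exp_of_nat_mult[symmetric] mult.left_commute)
    finally have "\<delta> * ((1 + M * \<delta>) ^ n - 1) \<le> \<delta> * (exp (M * l) - 1)"
      using \<delta> by (intro mult_left_mono) auto
    moreover have "p n = y" using n by (simp add: p_def)
    ultimately show ?thesis using 1 by (simp add: \<delta>_def)
  qed
  have "(\<lambda>n. l / real n) \<longlonglongrightarrow> 0" by (rule lim_const_over_n)
  then have "(\<lambda>n. l / real n * (exp (M * l) - 1)) \<longlonglongrightarrow> 0 * (exp (M * l) - 1)"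
    by (intro tendsto_intros)
  then have "norm (w y) \<le> 0"
    by (intro LIMSEQ_le_const[of "\<lambda>n. l / real n * (exp (M * l) - 1)" 0]) (auto intro!: exI[of _ 1] est[simplified])
  then show ?thesis by simp
qed

section \<open>Transport of the two boundary conditions through the hierarchy\<close>

context
  fixes U :: "complex set" and \<eta> :: "complex \<Rightarrow> complex" and s :: real
  assumes hol: "\<eta> holomorphic_on U" and op: "open U" and line: "\<And>y. Complex s y \<in> U"
begin

private abbreviation E :: "diff_poly \<Rightarrow> real \<Rightarrow> complex" where
  "E p y \<equiv> dp_eval p \<eta> (Complex s y)"

private lemma dp_hol: "dp_eval p \<eta> holomorphic_on U"
  using has_field_derivative_dp_eval[OF hol op] holomorphic_on_open[OF op] by blast

private lemma dp_deriv: "z \<in> U \<Longrightarrow> deriv (dp_eval p \<eta>) z = dp_eval (DP p) \<eta> z"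
  by (rule DERIV_imp_deriv) (rule has_field_derivative_dp_eval[OF hol op])

private lemma dRe: "((\<lambda>y. Re (E p y)) has_real_derivative - Im (E (DP p) y)) (at y)"
  and dIm: "((\<lambda>y. Im (E p y)) has_real_derivative Re (E (DP p) y)) (at y)"
  using has_derivative_along_line[OF dp_hol op line, of p y] by (simp_all add: dp_deriv line)

private lemma E_R_Suc: "E (mkdv_R (Suc n)) y = E (DP (DP (mkdv_R n))) y - 2 * \<eta> (Complex s y) * E (mkdv_S n) y"
  by (simp add: dp_eval_diff dp_eval_mult)

private lemma E_DP_R_Suc: "E (DP (mkdv_R (Suc n))) y = E (DP (DP (DP (mkdv_R n)))) y
    - 2 * deriv \<eta> (Complex s y) * E (mkdv_S n) y - 4 * (\<eta> (Complex s y))\<^sup>2 * E (DP (mkdv_R n)) y"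
  by (simp add: DP_diff DP_mult dp_eval_diff dp_eval_mult dp_eval_add DP_mkdv_S power2_eq_square)

private lemma E_S: "E (mkdv_S n) y = (\<Sum>i\<le>n. E (mkdv_R i) y * E (mkdv_R (n - i)) y) +
     (\<Sum>i<n. E (mkdv_S i) y * E (mkdv_S (n - Suc i)) y - E (DP (mkdv_R i)) y * E (DP (mkdv_R (n - Suc i))) y)"
  by (subst mkdv_S.simps) (simp add: dp_eval_add dp_eval_sum dp_eval_mult dp_eval_diff)

text \<open>Along a vertical line d/dy is \<i> d/dz, so the derivatives of a function that is real
  on the line are alternately imaginary and real. The recursion for \<open>mkdv_S n\<close> involves
  first derivatives only in pairs, whose products are real again.\<close>

lemma Im_mkdv_Dirichlet:
  assumes "\<And>y. Im (\<eta> (Complex s y)) = 0"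
  shows "Im (dp_eval (mkdv_R n) \<eta> (Complex s y)) = 0"
proof -
  have step: "Re (E (DP p) y) = 0" if "\<And>y. Im (E p y) = 0" for p y
    using DERIV_unique[OF dIm[of p y], of 0] that by simp
  have step': "Im (E (DP p) y) = 0" if "\<And>y. Re (E p y) = 0" for p y
    using DERIV_unique[OF dRe[of p y], of 0] that by simp
  have "(\<forall>i\<le>n. \<forall>y. Im (E (mkdv_R i) y) = 0) \<and> (\<forall>i<n. \<forall>y. Im (E (mkdv_S i) y) = 0)"
  proof (induction n)
    case 0
    then show ?case using assms by simp
  next
    case (Suc n)
    have R: "Im (E (mkdv_R i) y) = 0" if "i \<le> n" for i y using Suc that by auto
    have S: "Im (E (mkdv_S i) y) = 0" if "i < n" for i y using Suc that by auto
    have DR: "Re (E (DP (mkdv_R i)) y) = 0" if "i \<le> n" for i y using step R that by blast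
    have Sn: "Im (E (mkdv_S n) y) = 0" for y
      unfolding E_S[of n] by (simp add: R S DR)
    have "Im (E (DP (DP (mkdv_R n))) y) = 0" for y by (rule step') (rule DR, simp)
    then have "Im (E (mkdv_R (Suc n)) y) = 0" for y
      unfolding E_R_Suc using assms Sn by simp
    then show ?case using R S Sn by (auto simp: less_Suc_eq le_Suc_eq)
  qed
  then show ?thesis by simp
qed

text \<open>The imaginary part of \<open>mkdv_S n\<close> is only determined up to a constant by its derivative;
  the algebraic recursion fixes it.\<close>

lemma Im_mkdv_Robin:
  fixes c :: "real \<Rightarrow> real"
  assumes c': "\<And>y. (c has_real_derivative - 4 * Re (\<eta> (Complex s y)) * Im (\<eta> (Complex s y))) (at y)"
    and \<eta>': "\<And>y. Im (deriv \<eta> (Complex s y)) = c y * Im (\<eta> (Complex s y))"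
  shows "Im (dp_eval (DP (mkdv_R n)) \<eta> (Complex s y)) = c y * Im (dp_eval (mkdv_R n) \<eta> (Complex s y))"
proof -
  define a where "a y = Re (\<eta> (Complex s y))" for y
  define b where "b y = Im (\<eta> (Complex s y))" for y
  define e where "e y = Re (deriv \<eta> (Complex s y))" for y
  have a': "(a has_real_derivative - (c y * b y)) (at y)" for y
    using has_derivative_along_line(1)[OF hol op line] by (simp add: a_def[abs_def] b_def \<eta>')
  have b': "(b has_real_derivative e y) (at y)" for y
    using has_derivative_along_line(2)[OF hol op line] by (simp add: b_def[abs_def] e_def)
  have c'': "(c has_real_derivative - 4 * a y * b y) (at y)" for y
    using c' by (simp add: a_def b_def)
  let ?R = "\<lambda>i. E (mkdv_R i)" and ?S = "\<lambda>i. E (mkdv_S i)" and ?D = "\<lambda>i. E (DP (mkdv_R i))"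
    and ?DD = "\<lambda>i. E (DP (DP (mkdv_R i)))" and ?DDD = "\<lambda>i. E (DP (DP (DP (mkdv_R i))))"
  \<comment> \<open>The Robin condition is not inductive by itself. The companion identity for
    \<open>mkdv_S\<close> runs one index behind: each step first extends it to n and then uses it
    for the condition at n + 1.\<close>
  have "(\<forall>i\<le>n. \<forall>y. Im (?D i y) = c y * Im (?R i y)) \<and> (\<forall>i<n. \<forall>y. Im (?S i y) = 2 * a y * Im (?R i y))"
  proof (induction n)
    case 0
    show ?case by (simp add: \<eta>')
  next
    case (Suc n)
    have D: "Im (?D i y) = c y * Im (?R i y)" if "i \<le> n" for i y using Suc that by auto
    have S: "Im (?S i y) = 2 * a y * Im (?R i y)" if "i < n" for i y using Suc that by auto
    \<comment> \<open>The tangential derivative of the Robin condition; this is where the prescribed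
      derivative of c enters.\<close>
    have ReDD: "Re (?DD i y) = - 4 * a y * b y * Im (?R i y) + c y * Re (?D i y)" if "i \<le> n" for i y
    proof (rule DERIV_unique[OF dIm])
      have "(\<lambda>y. Im (?D i y)) = (\<lambda>y. c y * Im (?R i y))" using D that by auto
      then show "((\<lambda>y. Im (?D i y)) has_real_derivative
          - 4 * a y * b y * Im (?R i y) + c y * Re (?D i y)) (at y)"
        using DERIV_mult[OF c'' dIm[of "mkdv_R i"]] by (simp add: algebra_simps)
    qed
    \<comment> \<open>The terms \<open>4 * a * b * Im (?R i)\<close> coming from
      \<open>?DD i\<close> and from \<open>2 * \<eta> * ?S i\<close> cancel. Real parts at index i +
      1 are thereby expressed by data at index i, as the convolution in \<open>mkdv_S n\<close>
      requires after a shift.\<close>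
    have ReR: "Re (?R (Suc i) y) = c y * Re (?D i y) - 2 * a y * Re (?S i y)" if "i < n" for i y
      unfolding E_R_Suc using that by (simp add: ReDD S a_def b_def algebra_simps)
    have Sn: "Im (?S n y) = 2 * a y * Im (?R n y)" for y
    proof -
      have rev: "(\<Sum>i<k. f (k - Suc i) * g i) = (\<Sum>i<k. f i * g (k - Suc i) :: real)" for f g k
        by (subst sum.nat_diff_reindex[symmetric]) (auto intro!: sum.cong)
      \<comment> \<open>Splitting off the term i = 0 and applying \<open>ReR\<close> to the rest
        turns the first convolution into \<open>2 * a * Im (?R n)\<close> plus terms that are
        exactly opposite to the contributions of the other two convolutions.\<close>
      have 1: "(\<Sum>i\<le>n. Im (?R i y * ?R (n - i) y)) = 2 * (\<Sum>i<Suc n. Re (?R i y) * Im (?R (Suc n - Suc i) y))"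
        using rev[of "\<lambda>i. Re (?R i y)" "Suc n" "\<lambda>i. Im (?R i y)"]
        by (simp add: sum.distrib lessThan_Suc_atMost mult.commute del: sum.lessThan_Suc sum.atMost_Suc)
      have "(\<Sum>i<Suc n. Re (?R i y) * Im (?R (Suc n - Suc i) y))
          = a y * Im (?R n y) + (\<Sum>i<n. Re (?R (Suc i) y) * Im (?R (n - Suc i) y))"
        by (subst sum.lessThan_Suc_shift) (simp add: a_def)
      also have "(\<Sum>i<n. Re (?R (Suc i) y) * Im (?R (n - Suc i) y))
          = (\<Sum>i<n. c y * (Re (?D i y) * Im (?R (n - Suc i) y)) - 2 * a y * (Re (?S i y) * Im (?R (n - Suc i) y)))"
        by (intro sum.cong) (auto simp: ReR algebra_simps simp del: mkdv_R.simps)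
      also have "\<dots> = c y * (\<Sum>i<n. Re (?D i y) * Im (?R (n - Suc i) y)) - 2 * a y * (\<Sum>i<n. Re (?S i y) * Im (?R (n - Suc i) y))"
        by (simp add: sum_subtractf sum_distrib_left)
      finally have 2: "(\<Sum>i<Suc n. Re (?R i y) * Im (?R (Suc n - Suc i) y)) = a y * Im (?R n y)
         + c y * (\<Sum>i<n. Re (?D i y) * Im (?R (n - Suc i) y)) - 2 * a y * (\<Sum>i<n. Re (?S i y) * Im (?R (n - Suc i) y))"
        by simp
      have 3: "(\<Sum>i<n. Im (?S i y * ?S (n - Suc i) y)) = 4 * a y * (\<Sum>i<n. Re (?S i y) * Im (?R (n - Suc i) y))"
      proof -
        have "(\<Sum>i<n. Im (?S i y * ?S (n - Suc i) y)) = (\<Sum>i<n. 2 * a y * (Re (?S i y) * Im (?R (n - Suc i) y))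
            + 2 * a y * (Re (?S (n - Suc i) y) * Im (?R i y)))"
          by (intro sum.cong) (auto simp: S algebra_simps)
        also have "\<dots> = 2 * a y * (\<Sum>i<n. Re (?S i y) * Im (?R (n - Suc i) y)) + 2 * a y * (\<Sum>i<n. Re (?S (n - Suc i) y) * Im (?R i y))"
          by (simp add: sum.distrib sum_distrib_left)
        finally show ?thesis using rev[of "\<lambda>i. Re (?S i y)" n "\<lambda>i. Im (?R i y)"] by simp
      qed
      have 4: "(\<Sum>i<n. Im (?D i y * ?D (n - Suc i) y)) = 2 * c y * (\<Sum>i<n. Re (?D i y) * Im (?R (n - Suc i) y))"
      proof -
        have "(\<Sum>i<n. Im (?D i y * ?D (n - Suc i) y)) = (\<Sum>i<n. c y * (Re (?D i y) * Im (?R (n - Suc i) y))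
            + c y * (Re (?D (n - Suc i) y) * Im (?R i y)))"
          by (intro sum.cong) (auto simp: D algebra_simps)
        also have "\<dots> = c y * (\<Sum>i<n. Re (?D i y) * Im (?R (n - Suc i) y)) + c y * (\<Sum>i<n. Re (?D (n - Suc i) y) * Im (?R i y))"
          by (simp add: sum.distrib sum_distrib_left)
        finally show ?thesis using rev[of "\<lambda>i. Re (?D i y)" n "\<lambda>i. Im (?R i y)"] by simp
      qed
      have "Im (?S n y) = (\<Sum>i\<le>n. Im (?R i y * ?R (n - i) y)) + ((\<Sum>i<n. Im (?S i y * ?S (n - Suc i) y))
           - (\<Sum>i<n. Im (?D i y * ?D (n - Suc i) y)))"
        by (subst E_S) (simp only: plus_complex.sel minus_complex.sel Im_sum sum_subtractf)
      then show ?thesis unfolding 1 2 3 4 by simp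
    qed
    have Dn: "Im (?D (Suc n) y) = c y * Im (?R (Suc n) y)" for y
    proof -
      have "- Im (?DDD n y) = - 4 * (a y * e y - c y * (b y)\<^sup>2) * Im (?R n y) - 8 * a y * b y * Re (?D n y) - c y * Im (?DD n y)"
      proof (rule DERIV_unique[OF dRe])
        have *: "(\<lambda>y. Re (?DD n y)) = (\<lambda>y. - 4 * (a y * b y) * Im (?R n y) + c y * Re (?D n y))"
          using ReDD by (auto simp: mult.assoc)
        show "((\<lambda>y. Re (?DD n y)) has_real_derivative
            - 4 * (a y * e y - c y * (b y)\<^sup>2) * Im (?R n y) - 8 * a y * b y * Re (?D n y) - c y * Im (?DD n y)) (at y)"
          unfolding *
          by (rule derivative_eq_intros a' b' c'' dIm dRe refl)+ (simp add: algebra_simps power2_eq_square)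
      qed
      then have 1: "Im (?DDD n y) = 4 * (a y * e y - c y * (b y)\<^sup>2) * Im (?R n y) + 8 * a y * b y * Re (?D n y) + c y * Im (?DD n y)"
        by (simp add: algebra_simps)
      have 2: "Im (2 * deriv \<eta> (Complex s y) * ?S n y) = 4 * a y * e y * Im (?R n y) + 2 * c y * b y * Re (?S n y)"
        by (simp add: Sn \<eta>' e_def a_def b_def algebra_simps)
      have 3: "Im (4 * (\<eta> (Complex s y))\<^sup>2 * ?D n y) = 4 * ((a y)\<^sup>2 - (b y)\<^sup>2) * c y * Im (?R n y) + 8 * a y * b y * Re (?D n y)"
        using D[of n y] by (simp add: a_def b_def power2_eq_square algebra_simps)
      have 4: "Im (2 * \<eta> (Complex s y) * ?S n y) = 4 * (a y)\<^sup>2 * Im (?R n y) + 2 * b y * Re (?S n y)"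
        by (simp add: Sn a_def b_def power2_eq_square algebra_simps)
      show ?thesis
        unfolding E_R_Suc E_DP_R_Suc minus_complex.sel 1 2 3 4 by (simp add: algebra_simps power2_eq_square)
    qed
    show ?case
      using D S Sn Dn by (auto simp: less_Suc_eq le_Suc_eq simp del: mkdv_R.simps)
  qed
  then show ?thesis by simp
qed

end

section \<open>Rigidity of the boundary data and the linear relation\<close>

text \<open>Cauchy-Schwarz, in the form that f' has non-negative variance on [a, y], bounds
  \<open>(f y)^2\<close> by the length times the energy; integrating once more yields the square of
  the length.\<close>

lemma Poincare_interval:
  fixes f f' :: "real \<Rightarrow> real"
  assumes "a \<le> b" and zero: "f a = 0"
    and d: "\<And>y. y \<in> {a..b} \<Longrightarrow> (f has_real_derivative f' y) (at y)"
    and cont: "continuous_on {a..b} f'"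
  shows "integral {a..b} (\<lambda>y. (f y)\<^sup>2) \<le> (b - a)\<^sup>2 * integral {a..b} (\<lambda>y. (f' y)\<^sup>2)"
proof -
  let ?I = "integral {a..b} (\<lambda>y. (f' y)\<^sup>2)"
  have c2: "continuous_on {a..b} (\<lambda>y. (f' y)\<^sup>2)" by (intro continuous_intros cont)
  have I: "?I \<ge> 0"
    by (rule integral_nonneg) (use c2 in \<open>auto intro: integrable_continuous_real\<close>)
  have pt: "(f y)\<^sup>2 \<le> (b - a) * ?I" if y: "y \<in> {a..b}" for y
  proof (cases "y = a")
    case True
    then show ?thesis using zero I \<open>a \<le> b\<close> by simp
  next
    case False
    then have ya: "a < y" using y by simp
    have sub: "{a..y} \<subseteq> {a..b}" using y by auto
    have ftc: "(f' has_integral f y) {a..y}"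
    proof -
      have "(f' has_integral (f y - f a)) {a..y}"
        by (rule fundamental_theorem_of_calculus)
           (use ya sub d in \<open>auto simp: has_real_derivative_iff_has_vector_derivative[symmetric] intro!: DERIV_subset[OF d]\<close>)
      then show ?thesis using zero by simp
    qed
    have int2: "(\<lambda>y. (f' y)\<^sup>2) integrable_on {a..y}"
      by (rule integrable_continuous_real) (rule continuous_on_subset[OF c2 sub])
    define m where "m = f y / (y - a)"
    have "0 \<le> integral {a..y} (\<lambda>t. (f' t - m)\<^sup>2)"
      by (rule integral_nonneg) (use continuous_on_subset[OF cont sub] in \<open>auto intro!: integrable_continuous_real continuous_intros\<close>)
    also have "((\<lambda>t. (f' t)\<^sup>2 - 2 * m * f' t + m\<^sup>2) has_integral
        integral {a..y} (\<lambda>t. (f' t)\<^sup>2) - 2 * m * f y + m\<^sup>2 * (y - a)) {a..y}"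
      using has_integral_add[OF has_integral_diff[OF integrable_integral[OF int2] has_integral_mult_right[OF ftc, of "2 * m"]]
          has_integral_const_real[of "m\<^sup>2" a y]] ya by (simp add: mult.commute)
    then have "integral {a..y} (\<lambda>t. (f' t - m)\<^sup>2) = integral {a..y} (\<lambda>t. (f' t)\<^sup>2) - 2 * m * f y + m\<^sup>2 * (y - a)"
      by (intro integral_unique) (simp add: power2_diff algebra_simps)
    finally have "0 \<le> integral {a..y} (\<lambda>t. (f' t)\<^sup>2) - (f y)\<^sup>2 / (y - a)"
      using ya by (simp add: m_def power2_eq_square)
    then have "(f y)\<^sup>2 \<le> (y - a) * integral {a..y} (\<lambda>t. (f' t)\<^sup>2)"
      using ya by (simp add: field_simps)
    also have "\<dots> \<le> (b - a) * ?I"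
    proof (rule mult_mono)
      show "integral {a..y} (\<lambda>t. (f' t)\<^sup>2) \<le> ?I"
        by (rule integral_subset_le) (use sub int2 c2 in \<open>auto intro: integrable_continuous_real\<close>)
      show "0 \<le> integral {a..y} (\<lambda>t. (f' t)\<^sup>2)"
        by (rule integral_nonneg) (use int2 in auto)
    qed (use y ya in auto)
    finally show ?thesis .
  qed
  have "continuous_on {a..b} f"
    using d by (meson DERIV_isCont continuous_at_imp_continuous_on)
  then have "integral {a..b} (\<lambda>y. (f y)\<^sup>2) \<le> integral {a..b} (\<lambda>y. (b - a) * ?I)"
    by (intro integral_le) (use pt in \<open>auto intro!: integrable_continuous_real continuous_intros\<close>)
  also have "\<dots> = (b - a)\<^sup>2 * ?I"
    using \<open>a \<le> b\<close> by (simp add: power2_eq_square)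
  finally show ?thesis .
qed

text \<open>Each cell has its own zero, at its left end, so the constant is the square of the mesh
  width. Refining the grid makes it as small as desired, which a single zero per period would not
  do.\<close>

lemma Poincare_grid:
  fixes f f' :: "real \<Rightarrow> real"
  assumes "0 \<le> \<delta>"
    and zero: "\<And>k. k < N \<Longrightarrow> f (real k * \<delta>) = 0"
    and d: "\<And>y. (f has_real_derivative f' y) (at y)"
    and cont: "continuous_on UNIV f'"
  shows "integral {0..real N * \<delta>} (\<lambda>y. (f y)\<^sup>2) \<le> \<delta>\<^sup>2 * integral {0..real N * \<delta>} (\<lambda>y. (f' y)\<^sup>2)"
  using zero
proof (induction N)
  case (Suc N)
  have cf: "continuous_on UNIV f"
    using d by (meson DERIV_isCont continuous_at_imp_continuous_on)
  have int: "(\<lambda>y. (g y)\<^sup>2) integrable_on {p..q}" if "continuous_on UNIV g" for g :: "real \<Rightarrow> real" and p q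
    by (intro integrable_continuous_real continuous_intros continuous_on_subset[OF that]) auto
  have le: "0 \<le> real N * \<delta>" "real N * \<delta> \<le> real (Suc N) * \<delta>"
    using \<open>0 \<le> \<delta>\<close> by (auto intro: mult_right_mono)
  have split: "integral {0..real (Suc N) * \<delta>} (\<lambda>y. (g y)\<^sup>2) = integral {0..real N * \<delta>} (\<lambda>y. (g y)\<^sup>2)
      + integral {real N * \<delta>..real (Suc N) * \<delta>} (\<lambda>y. (g y)\<^sup>2)" if "continuous_on UNIV g" for g :: "real \<Rightarrow> real"
    using Henstock_Kurzweil_Integration.integral_combine[OF le int[OF that]] by simp
  have "integral {real N * \<delta>..real (Suc N) * \<delta>} (\<lambda>y. (f y)\<^sup>2)
      \<le> (real (Suc N) * \<delta> - real N * \<delta>)\<^sup>2 * integral {real N * \<delta>..real (Suc N) * \<delta>} (\<lambda>y. (f' y)\<^sup>2)"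
    by (rule Poincare_interval) (use le d Suc.prems continuous_on_subset[OF cont] in auto)
  moreover have "real (Suc N) * \<delta> - real N * \<delta> = \<delta>" by (simp add: algebra_simps)
  ultimately show ?case
    unfolding split[OF cf] split[OF cont] using Suc by (simp add: distrib_left)
qed simp

text \<open>Gaussian elimination. If some \<open>f i p\<close> is nonzero, i is the pivot: it
  reduces the other columns, the induction hypothesis handles the remaining conditions, and the
  coefficient of i is the one that condition p dictates.\<close>

lemma homogeneous_system_nontrivial:
  fixes f :: "'j \<Rightarrow> 'p \<Rightarrow> real"
  assumes "finite P" "finite J" "card P < card J"
  shows "\<exists>c. (\<exists>j\<in>J. c j \<noteq> 0) \<and> (\<forall>p\<in>P. (\<Sum>j\<in>J. c j * f j p) = 0)"
  using assms
proof (induction P arbitrary: J f rule: finite_induct)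
  case empty
  then have "J \<noteq> {}" by auto
  then show ?case by (intro exI[of _ "\<lambda>_. 1"]) auto
next
  case (insert p P)
  show ?case
  proof (cases "\<forall>j\<in>J. f j p = 0")
    case True
    have "card P < card J" using insert by simp
    from insert.IH[OF insert.prems(1) this, of f] True show ?thesis by auto
  next
    case False
    then obtain i where i: "i \<in> J" "f i p \<noteq> 0" by auto
    let ?J = "J - {i}"
    have "card P < card ?J" using insert i by simp
    moreover have "finite ?J" using insert by simp
    ultimately obtain c where c: "\<exists>j\<in>?J. c j \<noteq> 0"
      "\<And>q. q \<in> P \<Longrightarrow> (\<Sum>j\<in>?J. c j * (f j q - f j p / f i p * f i q)) = 0"
      using insert.IH[of ?J "\<lambda>j q. f j q - f j p / f i p * f i q"] by blast
    define c' where "c' = c(i := - (\<Sum>j\<in>?J. c j * (f j p / f i p)))"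
    have "(\<Sum>j\<in>J. c' j * f j q) = (\<Sum>j\<in>?J. c j * (f j q - f j p / f i p * f i q))" for q
    proof -
      have "(\<Sum>j\<in>J. c' j * f j q) = c' i * f i q + (\<Sum>j\<in>?J. c' j * f j q)"
        using insert.prems i by (subst sum.remove[of J i]) auto
      also have "(\<Sum>j\<in>?J. c' j * f j q) = (\<Sum>j\<in>?J. c j * f j q)"
        by (intro sum.cong) (auto simp: c'_def)
      finally show ?thesis
        by (simp add: c'_def right_diff_distrib sum_subtractf sum_distrib_right mult.assoc)
    qed
    moreover have "(\<Sum>j\<in>?J. c j * (f j p - f j p / f i p * f i p)) = 0"
      using i by simp
    moreover have "\<exists>j\<in>J. c' j \<noteq> 0" using c(1) by (auto simp: c'_def)
    ultimately show ?thesis using c(2) by (intro exI[of _ c']) auto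
  qed
qed

lemma leibniz_strip:
  fixes f fx :: "real \<Rightarrow> real \<Rightarrow> real"
  assumes d: "\<And>x y. x \<in> {s\<^sub>1..s\<^sub>2} \<Longrightarrow> ((\<lambda>x. f x y) has_real_derivative fx x y) (at x)"
    and c: "\<And>x. x \<in> {s\<^sub>1..s\<^sub>2} \<Longrightarrow> continuous_on {0..T} (f x)"
    and c': "continuous_on ({s\<^sub>1..s\<^sub>2} \<times> {0..T}) (\<lambda>(x, y). fx x y)"
    and x: "x \<in> {s\<^sub>1..s\<^sub>2}"
  shows "((\<lambda>x. integral {0..T} (f x)) has_real_derivative integral {0..T} (fx x)) (at x within {s\<^sub>1..s\<^sub>2})"
proof -
  have "((\<lambda>x. integral (cbox 0 T) (f x)) has_real_derivative integral (cbox 0 T) (fx x)) (at x within {s\<^sub>1..s\<^sub>2})"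
    by (rule leibniz_rule_field_derivative)
       (use d c c' x in \<open>auto intro!: DERIV_subset[OF d] integrable_continuous_real\<close>)
  then show ?thesis by simp
qed

lemma continuous_on_strip:
  fixes F :: "complex \<Rightarrow> complex"
  assumes "continuous_on U F" "closed_band s\<^sub>1 s\<^sub>2 \<subseteq> U"
  shows "continuous_on ({s\<^sub>1..s\<^sub>2} \<times> S) (\<lambda>z. F (Complex (fst z) (snd z)))"
proof (rule continuous_on_compose2[OF assms(1)])
  show "continuous_on ({s\<^sub>1..s\<^sub>2} \<times> S) (\<lambda>z. Complex (fst z) (snd z))"
    unfolding Complex_eq by (intro continuous_intros)
  show "(\<lambda>z. Complex (fst z) (snd z)) ` ({s\<^sub>1..s\<^sub>2} \<times> S) \<subseteq> U"
    using assms(2) by (auto simp: closed_band_def)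
qed

lemma continuous_on_vertical:
  fixes F :: "complex \<Rightarrow> complex"
  assumes "continuous_on U F" "closed_band s\<^sub>1 s\<^sub>2 \<subseteq> U" "x \<in> {s\<^sub>1..s\<^sub>2}"
  shows "continuous_on S (\<lambda>y. F (Complex x y))"
proof (rule continuous_on_compose2[OF assms(1)])
  show "continuous_on S (Complex x)"
    unfolding Complex_eq by (intro continuous_intros)
  show "Complex x ` S \<subseteq> U"
    using assms(2,3) by (auto simp: closed_band_def)
qed

text \<open>With \<open>\<phi> = Im H\<close> the flux \<open>E x = \<integral> \<phi> \<phi>\<^sub>x dy\<close> satisfies \<open>E' = \<integral> \<bar>\<nabla>\<phi>\<bar>\<^sup>2 dy\<close>, while the Rellich integral
  \<open>\<kappa> = \<integral> (\<phi>\<^sub>y\<^sup>2 - \<phi>\<^sub>x\<^sup>2) dy\<close> does not depend on \<open>x\<close>. On the boundary, the Poincare inequality on the grid and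
  the Robin condition bound \<open>E\<close> by a small multiple of \<open>\<kappa>\<close>, but \<open>E\<close> grows at least by \<open>\<kappa> (s\<^sub>2 - s\<^sub>1)\<close>.\<close>

lemma steklov_rigidity:
  assumes s: "s\<^sub>1 < s\<^sub>2" and T: "0 < T" and op: "open U" and sub: "closed_band s\<^sub>1 s\<^sub>2 \<subseteq> U"
    and hol: "H holomorphic_on U"
    and per: "\<And>z. z \<in> open_band s\<^sub>1 s\<^sub>2 \<Longrightarrow> H (z + \<i> * of_real T) = H z"
    and M: "0 < M" and N: "0 < (N::nat)"
    and N1: "2 * (T / N)\<^sup>2 * M\<^sup>2 \<le> 1" and N2: "4 * M * (T / N)\<^sup>2 < s\<^sub>2 - s\<^sub>1"
    and bc: "\<And>s. s \<in> {s\<^sub>1, s\<^sub>2} \<Longrightarrow> (\<forall>y. Im (H (Complex s y)) = 0) \<or>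
        (\<forall>y\<in>{0..T}. \<bar>Im (deriv H (Complex s y))\<bar> \<le> M * \<bar>Im (H (Complex s y))\<bar>)"
    and grid: "\<And>s k. s \<in> {s\<^sub>1, s\<^sub>2} \<Longrightarrow> k < N \<Longrightarrow> Im (H (Complex s (real k * (T / N)))) = 0"
  shows "\<exists>a::real. \<forall>z\<in>open_band s\<^sub>1 s\<^sub>2. H z = of_real a"
proof -
  define \<delta> where "\<delta> = T / N"
  define h where "h x y = Im (H (Complex x y))" for x y
  define p where "p x y = Re (deriv H (Complex x y))" for x y
  define q where "q x y = Im (deriv H (Complex x y))" for x y
  define r where "r x y = Re (deriv (deriv H) (Complex x y))" for x y
  define t where "t x y = Im (deriv (deriv H) (Complex x y))" for x y
  have hol': "deriv H holomorphic_on U" "deriv (deriv H) holomorphic_on U"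
    using hol op by (auto intro: holomorphic_deriv)
  have inU: "Complex x y \<in> U" if "x \<in> {s\<^sub>1..s\<^sub>2}" for x y
    using sub that by (auto simp: closed_band_def)
  have hy: "(h x has_real_derivative p x y) (at y)"
    and py: "(p x has_real_derivative - t x y) (at y)"
    and qy: "(q x has_real_derivative r x y) (at y)"
    and hx: "((\<lambda>x. h x y) has_real_derivative q x y) (at x)"
    and px: "((\<lambda>x. p x y) has_real_derivative r x y) (at x)"
    and qx: "((\<lambda>x. q x y) has_real_derivative t x y) (at x)" if "x \<in> {s\<^sub>1..s\<^sub>2}" for x y
    using has_derivative_along_line[OF hol op inU[OF that]] has_derivative_along_line[OF hol'(1) op inU[OF that]]
      has_derivative_across_line[OF hol op inU[OF that]] has_derivative_across_line[OF hol'(1) op inU[OF that]]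
    unfolding h_def p_def q_def r_def t_def by auto
  note conts = hol[THEN holomorphic_on_imp_continuous_on] hol'[THEN holomorphic_on_imp_continuous_on]
  have cy: "continuous_on S (h x)" "continuous_on S (p x)" "continuous_on S (q x)" "continuous_on S (r x)" "continuous_on S (t x)"
    if "x \<in> {s\<^sub>1..s\<^sub>2}" for x S
    unfolding h_def p_def q_def r_def t_def
    by (intro continuous_intros continuous_on_vertical[OF _ sub that] conts)+
  have cxy: "continuous_on ({s\<^sub>1..s\<^sub>2} \<times> S) (\<lambda>z. h (fst z) (snd z))" "continuous_on ({s\<^sub>1..s\<^sub>2} \<times> S) (\<lambda>z. p (fst z) (snd z))"
    "continuous_on ({s\<^sub>1..s\<^sub>2} \<times> S) (\<lambda>z. q (fst z) (snd z))" "continuous_on ({s\<^sub>1..s\<^sub>2} \<times> S) (\<lambda>z. r (fst z) (snd z))"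
    "continuous_on ({s\<^sub>1..s\<^sub>2} \<times> S) (\<lambda>z. t (fst z) (snd z))" for S
    unfolding h_def p_def q_def r_def t_def
    by (intro continuous_intros continuous_on_strip[OF _ sub] conts)+
  have perD: "deriv H (z + \<i> * of_real T) = deriv H z" if z: "z \<in> open_band s\<^sub>1 s\<^sub>2" for z
  proof -
    have "z + \<i> * of_real T \<in> U" "z \<in> U"
      using z sub by (auto simp: open_band_def closed_band_def)
    then show ?thesis
      using holomorphic_on_imp_differentiable_at[OF hol op] per
      by (intro deriv_shift[OF open_open_band z, of _ _ 0]) (auto simp: open_band_def closed_band_def)
  qed
  \<comment> \<open>Periodicity is given on the open band only, so the integral identities hold for
    interior x; continuity of \<open>K\<close> and \<open>E\<close> on the closed interval carries
    their consequences to the two lines.\<close>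
  have perx: "h x T = h x 0" "p x T = p x 0" "q x T = q x 0" if "x \<in> {s\<^sub>1<..<s\<^sub>2}" for x
  proof -
    have "Complex x 0 + \<i> * of_real T = Complex x T" by (simp add: complex_eq_iff)
    then have "H (Complex x T) = H (Complex x 0)" "deriv H (Complex x T) = deriv H (Complex x 0)"
      using per[of "Complex x 0"] perD[of "Complex x 0"] that by (auto simp: open_band_def closed_band_def)
    then show "h x T = h x 0" "p x T = p x 0" "q x T = q x 0" by (simp_all add: h_def p_def q_def)
  qed
  define A where "A x = integral {0..T} (\<lambda>y. (h x y)\<^sup>2)" for x
  define B where "B x = integral {0..T} (\<lambda>y. (p x y)\<^sup>2)" for x
  define C where "C x = integral {0..T} (\<lambda>y. (q x y)\<^sup>2)" for x
  define E where "E x = integral {0..T} (\<lambda>y. h x y * q x y)" for x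
  define K where "K x = integral {0..T} (\<lambda>y. (p x y)\<^sup>2 - (q x y)\<^sup>2)" for x
  have nonneg: "0 \<le> A x" "0 \<le> B x" "0 \<le> C x" if "x \<in> {s\<^sub>1..s\<^sub>2}" for x
    unfolding A_def B_def C_def
    by (rule integral_nonneg; (rule integrable_continuous_real | simp); intro continuous_intros cy[OF that])+
  have KBC: "K x = B x - C x" if "x \<in> {s\<^sub>1..s\<^sub>2}" for x
    unfolding K_def B_def C_def
    by (intro integral_diff integrable_continuous_real continuous_intros cy[OF that])
  have dK: "(K has_real_derivative integral {0..T} (\<lambda>y. 2 * p x y * r x y - 2 * q x y * t x y)) (at x within {s\<^sub>1..s\<^sub>2})"
    if "x \<in> {s\<^sub>1..s\<^sub>2}" for x
    unfolding K_def
    by (rule leibniz_strip)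
       (use that in \<open>auto intro!: derivative_eq_intros px qx continuous_intros cy cxy simp: case_prod_beta\<close>)
  have dE: "(E has_real_derivative integral {0..T} (\<lambda>y. q x y * q x y + t x y * h x y)) (at x within {s\<^sub>1..s\<^sub>2})"
    if "x \<in> {s\<^sub>1..s\<^sub>2}" for x
    unfolding E_def
    by (rule leibniz_strip)
       (use that in \<open>auto intro!: derivative_eq_intros hx qx continuous_intros cy cxy simp: case_prod_beta\<close>)
  \<comment> \<open>\<open>K x\<close> is the real part of the integral of
    \<open>(deriv H)^2\<close> over a period, and the integrand here is the y-derivative of the
    imaginary part \<open>2 * p * q\<close> of \<open>(deriv H)^2\<close>.\<close>
  have K0: "integral {0..T} (\<lambda>y. 2 * p x y * r x y - 2 * q x y * t x y) = 0" if x: "x \<in> {s\<^sub>1<..<s\<^sub>2}" for x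
  proof -
    have x': "x \<in> {s\<^sub>1..s\<^sub>2}" using x by auto
    have "((\<lambda>y. 2 * p x y * r x y - 2 * q x y * t x y) has_integral 2 * p x T * q x T - 2 * p x 0 * q x 0) {0..T}"
    proof (rule fundamental_theorem_of_calculus)
      fix y
      have "((\<lambda>y. 2 * p x y * q x y) has_real_derivative 2 * p x y * r x y - 2 * q x y * t x y) (at y)"
        by (rule derivative_eq_intros py[OF x'] qy[OF x'] refl)+ (simp add: algebra_simps)
      then show "((\<lambda>y. 2 * p x y * q x y) has_vector_derivative 2 * p x y * r x y - 2 * q x y * t x y) (at y within {0..T})"
        by (simp add: has_real_derivative_iff_has_vector_derivative has_vector_derivative_at_within)
    qed (use T in simp)
    then show ?thesis using perx[OF x] by (simp add: integral_unique)
  qed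
  have E': "integral {0..T} (\<lambda>y. q x y * q x y + t x y * h x y) = B x + C x" if x: "x \<in> {s\<^sub>1<..<s\<^sub>2}" for x
  proof -
    have x': "x \<in> {s\<^sub>1..s\<^sub>2}" using x by auto
    have "((\<lambda>y. p x y * p x y - t x y * h x y) has_integral h x T * p x T - h x 0 * p x 0) {0..T}"
    proof (rule fundamental_theorem_of_calculus)
      fix y
      have "((\<lambda>y. h x y * p x y) has_real_derivative p x y * p x y - t x y * h x y) (at y)"
        by (rule derivative_eq_intros py[OF x'] hy[OF x'] refl)+ (simp add: algebra_simps)
      then show "((\<lambda>y. h x y * p x y) has_vector_derivative p x y * p x y - t x y * h x y) (at y within {0..T})"
        by (simp add: has_real_derivative_iff_has_vector_derivative has_vector_derivative_at_within)
    qed (use T in simp)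
    then have 0: "((\<lambda>y. p x y * p x y - t x y * h x y) has_integral 0) {0..T}"
      using perx[OF x] by simp
    have i: "((\<lambda>y. (p x y)\<^sup>2) has_integral B x) {0..T}" "((\<lambda>y. (q x y)\<^sup>2) has_integral C x) {0..T}"
      unfolding B_def C_def
      by (intro integrable_integral integrable_continuous_real continuous_intros cy[OF x'])+
    from has_integral_diff[OF has_integral_add[OF i] 0] show ?thesis
      by (intro integral_unique) (simp add: power2_eq_square algebra_simps)
  qed
  have atx: "at x within {s\<^sub>1..s\<^sub>2} = at x" if "x \<in> {s\<^sub>1<..<s\<^sub>2}" for x
    using that by (intro at_within_interior) auto
  have cK: "continuous_on {s\<^sub>1..s\<^sub>2} K" and cE: "continuous_on {s\<^sub>1..s\<^sub>2} E"
    using dK dE by (meson DERIV_continuous continuous_on_eq_continuous_within)+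
  have dE': "(E has_real_derivative B x + C x) (at x)" if "x \<in> {s\<^sub>1<..<s\<^sub>2}" for x
    using dE[of x] that E'[OF that] atx[OF that] by simp
  define \<kappa> where "\<kappa> = K s\<^sub>1"
  have K\<kappa>: "K x = \<kappa>" if "x \<in> {s\<^sub>1..s\<^sub>2}" for x
    unfolding \<kappa>_def
  proof (rule DERIV_isconst2[OF s cK])
    fix x assume x: "s\<^sub>1 < x" "x < s\<^sub>2"
    then show "(K has_real_derivative 0) (at x)"
      using dK[of x] K0[of x] atx[of x] by simp
  qed (use that in auto)
  have N\<delta>: "real N * \<delta> = T" using N by (simp add: \<delta>_def)
  \<comment> \<open>The sign of \<kappa> is not known yet; \<open>max \<kappa> 0\<close> gives one
    bound for both signs and for both kinds of boundary condition.\<close>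
  have Epos: "\<bar>E s\<bar> \<le> M * (2 * \<delta>\<^sup>2 * max \<kappa> 0)" if s': "s \<in> {s\<^sub>1, s\<^sub>2}" for s
  proof -
    have s'': "s \<in> {s\<^sub>1..s\<^sub>2}" using s' s by auto
    have AB: "A s \<le> \<delta>\<^sup>2 * B s"
      using Poincare_grid[of \<delta> N "h s" "p s"] N\<delta> T N hy[OF s''] cy(2)[OF s''] grid[OF s']
      unfolding A_def B_def h_def[of s] by (simp add: \<delta>_def)
    show ?thesis
      using bc[OF s']
    proof
      assume "\<forall>y. Im (H (Complex s y)) = 0"
      then have "E s = 0" by (simp add: E_def h_def)
      then show ?thesis using M by simp
    next
      assume R: "\<forall>y\<in>{0..T}. \<bar>Im (deriv H (Complex s y))\<bar> \<le> M * \<bar>Im (H (Complex s y))\<bar>"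
      have qh: "\<bar>q s y\<bar> \<le> M * \<bar>h s y\<bar>" if "y \<in> {0..T}" for y
        using R that by (simp add: q_def h_def)
      have "C s \<le> integral {0..T} (\<lambda>y. M\<^sup>2 * (h s y)\<^sup>2)"
        unfolding C_def
      proof (intro integral_le integrable_continuous_real continuous_intros cy[OF s''])
        fix y assume "y \<in> {0..T}"
        from power_mono[OF qh[OF this], of 2] show "(q s y)\<^sup>2 \<le> M\<^sup>2 * (h s y)\<^sup>2"
          by (simp add: power_mult_distrib)
      qed
      then have CA: "C s \<le> M\<^sup>2 * A s" by (simp add: A_def)
      have "A s \<le> \<delta>\<^sup>2 * (\<kappa> + C s)"
        using AB KBC[OF s''] K\<kappa>[OF s''] by simp
      also have "\<dots> \<le> \<delta>\<^sup>2 * (\<kappa> + M\<^sup>2 * A s)"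
        by (intro mult_left_mono add_left_mono CA) simp
      also have "\<dots> = \<delta>\<^sup>2 * \<kappa> + (\<delta>\<^sup>2 * M\<^sup>2) * A s" by (simp add: algebra_simps)
      \<comment> \<open>By \<open>N1\<close> the mesh is so fine that the term with
        \<open>A s\<close> can be absorbed on the left.\<close>
      also have "\<dots> \<le> \<delta>\<^sup>2 * \<kappa> + (1 / 2) * A s"
        using N1 nonneg(1)[OF s''] by (intro add_left_mono mult_right_mono) (auto simp: \<delta>_def)
      finally have "A s \<le> 2 * \<delta>\<^sup>2 * \<kappa>" by simp
      also have "\<dots> \<le> 2 * \<delta>\<^sup>2 * max \<kappa> 0" by (intro mult_left_mono) auto
      finally have A: "A s \<le> 2 * \<delta>\<^sup>2 * max \<kappa> 0" .
      have "norm (integral {0..T} (\<lambda>y. h s y * q s y)) \<le> integral {0..T} (\<lambda>y. M * (h s y)\<^sup>2)"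
      proof (intro integral_norm_bound_integral integrable_continuous_real continuous_intros cy[OF s''])
        fix y assume "y \<in> {0..T}"
        from mult_left_mono[OF qh[OF this], of "\<bar>h s y\<bar>"]
        show "norm (h s y * q s y) \<le> M * (h s y)\<^sup>2"
          by (simp add: abs_mult power2_eq_square algebra_simps flip: abs_mult)
      qed
      then have "\<bar>E s\<bar> \<le> M * A s" by (simp add: E_def A_def)
      also have "\<dots> \<le> M * (2 * \<delta>\<^sup>2 * max \<kappa> 0)" using A M by (intro mult_left_mono) auto
      finally show ?thesis .
    qed
  qed
  obtain \<xi> where \<xi>: "s\<^sub>1 < \<xi>" "\<xi> < s\<^sub>2" "E s\<^sub>2 - E s\<^sub>1 = (s\<^sub>2 - s\<^sub>1) * (B \<xi> + C \<xi>)"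
    using MVT[OF s cE] dE' by (metis DERIV_unique greaterThanLessThan_iff real_differentiable_def)
  \<comment> \<open>The two integrals are non-negative and differ by \<kappa>, so their sum
    dominates it. By \<open>N2\<close> this growth exceeds the upper bound for the flux unless
    \<open>max \<kappa> 0\<close> is zero.\<close>
  have "max \<kappa> 0 \<le> B \<xi> + C \<xi>"
    using KBC[of \<xi>] K\<kappa>[of \<xi>] nonneg[of \<xi>] \<xi> by auto
  then have "(s\<^sub>2 - s\<^sub>1) * max \<kappa> 0 \<le> E s\<^sub>2 - E s\<^sub>1"
    unfolding \<xi>(3) using s by (intro mult_left_mono) auto
  also have "\<dots> \<le> 4 * M * \<delta>\<^sup>2 * max \<kappa> 0" using Epos[of s\<^sub>1] Epos[of s\<^sub>2] by (simp add: abs_le_iff)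
  finally have "max \<kappa> 0 * (s\<^sub>2 - s\<^sub>1 - 4 * M * \<delta>\<^sup>2) \<le> 0" by (simp add: algebra_simps)
  then have \<kappa>0: "max \<kappa> 0 = 0"
    using N2 by (simp add: \<delta>_def mult_le_0_iff)
  have E0: "E s\<^sub>1 = 0" "E s\<^sub>2 = 0" using Epos[of s\<^sub>1] Epos[of s\<^sub>2] \<kappa>0 by auto
  have BC0: "B x + C x = 0" if x: "x \<in> {s\<^sub>1<..<s\<^sub>2}" for x
  proof -
    have mono: "E a \<le> E b" if "s\<^sub>1 \<le> a" "a \<le> b" "b \<le> s\<^sub>2" for a b
    proof (rule DERIV_nonneg_imp_increasing_open[OF \<open>a \<le> b\<close>])
      fix y assume "a < y" "y < b"
      then have "y \<in> {s\<^sub>1<..<s\<^sub>2}" using that by auto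
      then show "\<exists>D. (E has_real_derivative D) (at y) \<and> 0 \<le> D"
        using dE'[of y] nonneg[of y] by (intro exI[of _ "B y + C y"]) auto
    qed (use that in \<open>auto intro: continuous_on_subset[OF cE]\<close>)
    have Ez: "E y = 0" if "y \<in> {s\<^sub>1<..<s\<^sub>2}" for y
      using mono[of s\<^sub>1 y] mono[of y s\<^sub>2] E0 that by auto
    have "((\<lambda>_. 0) has_real_derivative B x + C x) (at x)"
      by (rule DERIV_cong_ev[THEN iffD1, OF refl _ refl dE'[OF x]])
         (use eventually_nhds_in_open[of "{s\<^sub>1<..<s\<^sub>2}" x] x Ez in \<open>auto elim!: eventually_mono\<close>)
    then show ?thesis using DERIV_unique DERIV_const by blast
  qed
  have pq0: "p x y = 0 \<and> q x y = 0" if x: "x \<in> {s\<^sub>1<..<s\<^sub>2}" and y: "y \<in> {0..T}" for x y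
  proof -
    have x': "x \<in> {s\<^sub>1..s\<^sub>2}" using x by auto
    have "B x = 0" "C x = 0" using BC0[OF x] nonneg[OF x'] by auto
    moreover have "continuous_on {0..T} (\<lambda>y. (p x y)\<^sup>2)" "continuous_on {0..T} (\<lambda>y. (q x y)\<^sup>2)"
      by (intro continuous_intros cy[OF x'])+
    ultimately have "(p x y)\<^sup>2 = 0 \<and> (q x y)\<^sup>2 = 0"
      using integral_eq_0_iff[of 0 T "\<lambda>y. (p x y)\<^sup>2"] integral_eq_0_iff[of 0 T "\<lambda>y. (q x y)\<^sup>2"] T y
      unfolding B_def C_def by auto
    then show ?thesis by simp
  qed
  \<comment> \<open>The integrals see one period only; the identity theorem carries
    \<open>deriv H = 0\<close> from an open rectangle to the whole band.\<close>
  define W where "W = open_band s\<^sub>1 s\<^sub>2"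
  define V where "V = W \<inter> {z. 0 < Im z \<and> Im z < T}"
  have W: "open W" "convex W" "connected W" "W \<subseteq> U"
    using open_open_band convex_open_band sub
    by (auto simp: W_def open_band_def closed_band_def convex_connected)
  have V: "open V"
    unfolding V_def Collect_conj_eq
    by (intro open_Int W open_halfspace_Im_gt open_halfspace_Im_lt)
  define z\<^sub>0 where "z\<^sub>0 = Complex ((s\<^sub>1 + s\<^sub>2) / 2) (T / 2)"
  have z\<^sub>0: "z\<^sub>0 \<in> V" "z\<^sub>0 \<in> W" using s T by (auto simp: V_def W_def z\<^sub>0_def open_band_def)
  have D0: "deriv H z = 0" if "z \<in> W" for z
  proof (rule analytic_continuation_open[of V W "deriv H" "\<lambda>_. 0"])
    show "deriv H z = 0" if "z \<in> V" for z
    proof -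
      have "Re z \<in> {s\<^sub>1<..<s\<^sub>2}" "Im z \<in> {0..T}" using that by (auto simp: V_def W_def open_band_def)
      from pq0[OF this] show ?thesis by (simp add: p_def q_def complex_eq_iff)
    qed
  qed (use V W z\<^sub>0 that hol' in \<open>auto simp: V_def intro: holomorphic_on_subset\<close>)
  have const: "H z = H z\<^sub>0" if "z \<in> W" for z
    using has_field_derivative_zero_constant[OF W(2), of H]
    using D0 hol op W(4) z\<^sub>0 that
    by (metis (no_types, lifting) has_field_derivative_at_within holomorphic_derivI subsetD)
  define a where "a = H z\<^sub>0"
  \<comment> \<open>The constant value is real because, by continuity, it is also the value at the
    grid point of index 0 on the left line, where the imaginary part vanishes.\<close>
  have "isCont H (Complex s\<^sub>1 0)"
    using s by (intro field_differentiable_imp_continuous_at holomorphic_on_imp_differentiable_at[OF hol op] inU) simp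
  moreover have "(\<lambda>n. Complex (s\<^sub>1 + (s\<^sub>2 - s\<^sub>1) / (real n + 2)) 0) \<longlonglongrightarrow> Complex s\<^sub>1 0"
  proof -
    have "(\<lambda>n. s\<^sub>1 + (s\<^sub>2 - s\<^sub>1) / (real n + 2)) \<longlonglongrightarrow> s\<^sub>1" by real_asymp
    then show ?thesis by (intro tendsto_Complex tendsto_const)
  qed
  ultimately have "(\<lambda>n. H (Complex (s\<^sub>1 + (s\<^sub>2 - s\<^sub>1) / (real n + 2)) 0)) \<longlonglongrightarrow> H (Complex s\<^sub>1 0)"
    by (rule isCont_tendsto_compose)
  moreover have "H (Complex (s\<^sub>1 + (s\<^sub>2 - s\<^sub>1) / (real n + 2)) 0) = a" for n
  proof -
    have "(s\<^sub>2 - s\<^sub>1) / (real n + 2) > 0" "(s\<^sub>2 - s\<^sub>1) / (real n + 2) < s\<^sub>2 - s\<^sub>1"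
      using s divide_strict_left_mono[of 1 "real n + 2" "s\<^sub>2 - s\<^sub>1"] by auto
    then show ?thesis using const unfolding a_def by (auto simp: W_def open_band_def)
  qed
  ultimately have "H (Complex s\<^sub>1 0) = a" by (simp add: LIMSEQ_const_iff)
  then have "Im a = 0" using grid[of s\<^sub>1 0] N by simp
  then have "a = of_real (Re a)" by (simp add: complex_eq_iff)
  then show ?thesis using const by (auto simp: a_def W_def)
qed

text \<open>Linear algebra supplies a combination of the first \<open>card P + 1\<close> functions
  whose imaginary part vanishes at all grid points, and as a single c serves every n it satisfies
  the boundary condition of \<open>steklov_rigidity\<close>. Solving for the last function with a
  nonzero coefficient gives the relation.\<close>

lemma real_algebro_geometric_mkdvI:
  assumes s: "s\<^sub>1 < s\<^sub>2" and T: "0 < T" and op: "open U" and sub: "closed_band s\<^sub>1 s\<^sub>2 \<subseteq> U"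
    and hol: "\<eta> holomorphic_on U"
    and per: "\<And>z. z \<in> open_band s\<^sub>1 s\<^sub>2 \<Longrightarrow> \<eta> (z + \<i> * of_real T) = \<eta> z"
    and bc: "\<And>s. s \<in> {s\<^sub>1, s\<^sub>2} \<Longrightarrow> (\<forall>y. Im (\<eta> (Complex s y)) = 0) \<or>
        (\<exists>c. \<forall>y. (c has_real_derivative - 4 * Re (\<eta> (Complex s y)) * Im (\<eta> (Complex s y))) (at y) \<and>
             Im (deriv \<eta> (Complex s y)) = c y * Im (\<eta> (Complex s y)))"
  shows "real_algebro_geometric_mkdv \<eta> (open_band s\<^sub>1 s\<^sub>2)"
proof -
  define Q where "Q n = dp_eval (mkdv_R n) \<eta>" for n
  have inU: "Complex s y \<in> U" if "s \<in> {s\<^sub>1, s\<^sub>2}" for s y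
    using that sub s by (auto simp: closed_band_def)
  have dQ: "(Q n has_field_derivative dp_eval (DP (mkdv_R n)) \<eta> z) (at z)" if "z \<in> U" for n z
    unfolding Q_def by (rule has_field_derivative_dp_eval[OF hol op that])
  have hd: "(deriv ^^ k) \<eta> field_differentiable at z" if "z \<in> U" for k z
    using hol op that holomorphic_higher_deriv holomorphic_on_imp_differentiable_at by blast
  have perk: "(deriv ^^ k) \<eta> (z + \<i> * of_real T) = (deriv ^^ k) \<eta> z" if "z \<in> open_band s\<^sub>1 s\<^sub>2" for k z
    using that
  proof (induction k arbitrary: z)
    case (Suc k)
    have "z + \<i> * of_real T \<in> U" using sub Suc.prems by (auto simp: open_band_def closed_band_def)
    then show ?case
      using deriv_shift[OF open_open_band Suc.prems, of "(deriv ^^ k) \<eta>" "\<i> * of_real T" 0] Suc.IH hd by simp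
  qed (use per in simp)
  have perQ: "Q n (z + \<i> * of_real T) = Q n z" if "z \<in> open_band s\<^sub>1 s\<^sub>2" for n z
    unfolding Q_def dp_eval_def using perk[OF that] by simp
  have "\<exists>M>0. (\<forall>n y. Im (Q n (Complex s y)) = 0) \<or>
        (\<exists>c. (\<forall>y\<in>{0..T}. \<bar>c y\<bar> \<le> M) \<and> (\<forall>n y. Im (deriv (Q n) (Complex s y)) = c y * Im (Q n (Complex s y))))"
    if s': "s \<in> {s\<^sub>1, s\<^sub>2}" for s
    using bc[OF s']
  proof
    assume "\<forall>y. Im (\<eta> (Complex s y)) = 0"
    then show ?thesis
      using Im_mkdv_Dirichlet[OF hol op inU[OF s']] by (intro exI[of _ 1]) (auto simp: Q_def)
  next
    assume "\<exists>c. \<forall>y. (c has_real_derivative - 4 * Re (\<eta> (Complex s y)) * Im (\<eta> (Complex s y))) (at y) \<and>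
             Im (deriv \<eta> (Complex s y)) = c y * Im (\<eta> (Complex s y))"
    then obtain c where c: "\<And>y. (c has_real_derivative - 4 * Re (\<eta> (Complex s y)) * Im (\<eta> (Complex s y))) (at y)"
      "\<And>y. Im (deriv \<eta> (Complex s y)) = c y * Im (\<eta> (Complex s y))" by blast
    have "continuous_on {0..T} c"
      using c(1) by (meson DERIV_isCont continuous_at_imp_continuous_on)
    then have "bounded (c ` {0..T})" by (intro compact_imp_bounded compact_continuous_image) auto
    then obtain M where M: "0 < M" "\<And>y. y \<in> {0..T} \<Longrightarrow> \<bar>c y\<bar> \<le> M"
      unfolding bounded_pos by auto
    have "Im (deriv (Q n) (Complex s y)) = c y * Im (Q n (Complex s y))" for n y
      using Im_mkdv_Robin[OF hol op inU[OF s'] c] DERIV_imp_deriv[OF dQ[OF inU[OF s']]] by (simp add: Q_def)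
    then show ?thesis using M by blast
  qed
  then obtain M where M: "\<And>s. s \<in> {s\<^sub>1, s\<^sub>2} \<Longrightarrow> M s > 0 \<and> ((\<forall>n y. Im (Q n (Complex s y)) = 0) \<or>
        (\<exists>c. (\<forall>y\<in>{0..T}. \<bar>c y\<bar> \<le> M s) \<and> (\<forall>n y. Im (deriv (Q n) (Complex s y)) = c y * Im (Q n (Complex s y)))))"
    by metis
  define B where "B = M s\<^sub>1 + M s\<^sub>2"
  have B: "B > 0" "\<And>s. s \<in> {s\<^sub>1, s\<^sub>2} \<Longrightarrow> M s \<le> B"
    using M[of s\<^sub>1] M[of s\<^sub>2] by (auto simp: B_def)
  have "eventually (\<lambda>N::nat. N > 0 \<and> 2 * (T / N)\<^sup>2 * B\<^sup>2 \<le> 1 \<and> 4 * B * (T / N)\<^sup>2 < s\<^sub>2 - s\<^sub>1) sequentially"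
  proof (intro eventually_conj)
    have t: "(\<lambda>N::nat. T / N) \<longlonglongrightarrow> 0" by (rule lim_const_over_n)
    have "(\<lambda>N::nat. 2 * (T / N)\<^sup>2 * B\<^sup>2) \<longlonglongrightarrow> 2 * 0\<^sup>2 * B\<^sup>2" by (intro tendsto_intros t)
    then have "(\<lambda>N::nat. 2 * (T / N)\<^sup>2 * B\<^sup>2) \<longlonglongrightarrow> 0" by simp
    then show "eventually (\<lambda>N::nat. 2 * (T / N)\<^sup>2 * B\<^sup>2 \<le> 1) sequentially"
      by (rule eventually_mono[OF order_tendstoD(2)[of _ 0 _ 1]]) auto
    have "(\<lambda>N::nat. 4 * B * (T / N)\<^sup>2) \<longlonglongrightarrow> 4 * B * 0\<^sup>2" by (intro tendsto_intros t)
    then have "(\<lambda>N::nat. 4 * B * (T / N)\<^sup>2) \<longlonglongrightarrow> 0" by simp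
    then show "eventually (\<lambda>N::nat. 4 * B * (T / N)\<^sup>2 < s\<^sub>2 - s\<^sub>1) sequentially"
      using s by (intro order_tendstoD) auto
  qed (simp add: eventually_gt_at_top)
  then obtain N :: nat where N: "N > 0" "2 * (T / N)\<^sup>2 * B\<^sup>2 \<le> 1" "4 * B * (T / N)\<^sup>2 < s\<^sub>2 - s\<^sub>1"
    by (auto dest!: eventually_happens)
  define P where "P = {s\<^sub>1, s\<^sub>2} \<times> {..<N}"
  have finP: "finite P" by (simp add: P_def)
  obtain c where c: "\<exists>j<Suc (card P). c j \<noteq> 0"
    "\<And>p. p \<in> P \<Longrightarrow> (\<Sum>j<Suc (card P). c j * Im (Q j (Complex (fst p) (real (snd p) * (T / N))))) = 0"
    using homogeneous_system_nontrivial[OF finP, of "{..<Suc (card P)}"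
       "\<lambda>j p. Im (Q j (Complex (fst p) (real (snd p) * (T / N))))"] by (auto simp: Bex_def)
  define H where "H z = (\<Sum>j<Suc (card P). of_real (c j) * Q j z)" for z
  have dH: "(H has_field_derivative (\<Sum>j<Suc (card P). of_real (c j) * deriv (Q j) z)) (at z)" if "z \<in> U" for z
    unfolding H_def using dQ[OF that] DERIV_imp_deriv[OF dQ[OF that]]
    by (auto intro!: derivative_eq_intros sum.cong simp del: sum.lessThan_Suc)
  have ImH: "Im (H z) = (\<Sum>j<Suc (card P). c j * Im (Q j z))" for z
    by (simp add: H_def)
  have "\<exists>a::real. \<forall>z\<in>open_band s\<^sub>1 s\<^sub>2. H z = of_real a"
  proof (rule steklov_rigidity[OF s T op sub _ _ B(1) N])
    show "H holomorphic_on U" using dH holomorphic_on_open[OF op] by blast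
    show "H (z + \<i> * of_real T) = H z" if "z \<in> open_band s\<^sub>1 s\<^sub>2" for z
      unfolding H_def using perQ[OF that] by simp
    show "Im (H (Complex s (real k * (T / real N)))) = 0" if "s \<in> {s\<^sub>1, s\<^sub>2}" "k < N" for s k
      using c(2)[of "(s, k)"] that unfolding ImH P_def by simp
    fix s assume s': "s \<in> {s\<^sub>1, s\<^sub>2}"
    from M[OF s'] consider "\<And>n y. Im (Q n (Complex s y)) = 0" |
      d where "\<And>y. y \<in> {0..T} \<Longrightarrow> \<bar>d y\<bar> \<le> M s" "\<And>n y. Im (deriv (Q n) (Complex s y)) = d y * Im (Q n (Complex s y))"
      by blast
    then show "(\<forall>y. Im (H (Complex s y)) = 0) \<or>
        (\<forall>y\<in>{0..T}. \<bar>Im (deriv H (Complex s y))\<bar> \<le> B * \<bar>Im (H (Complex s y))\<bar>)"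
    proof cases
      case 1
      then show ?thesis unfolding ImH by simp
    next
      case 2
      have "\<bar>Im (deriv H (Complex s y))\<bar> \<le> B * \<bar>Im (H (Complex s y))\<bar>" if "y \<in> {0..T}" for y
      proof -
        have "Im (deriv H (Complex s y)) = d y * Im (H (Complex s y))"
          unfolding DERIV_imp_deriv[OF dH[OF inU[OF s']]] ImH
          by (simp add: 2(2) sum_distrib_left algebra_simps)
        moreover have "\<bar>d y\<bar> \<le> B" using 2(1)[OF that] B(2)[OF s'] by simp
        ultimately show ?thesis by (simp add: abs_mult mult_right_mono)
      qed
      then show ?thesis by blast
    qed
  qed
  then obtain a where a: "\<And>z. z \<in> open_band s\<^sub>1 s\<^sub>2 \<Longrightarrow> H z = of_real a" by blast
  \<comment> \<open>If the only nonzero coefficient is \<open>c 0\<close>, then m = 0 and the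
    relation states that \<eta> is constant.\<close>
  define m where "m = Max {j. j < Suc (card P) \<and> c j \<noteq> 0}"
  have fin: "finite {j. j < Suc (card P) \<and> c j \<noteq> 0}" by simp
  have m: "m < Suc (card P)" "c m \<noteq> 0"
    using Max_in[OF fin] c(1) unfolding m_def by auto
  have top: "c j = 0" if "m < j" "j < Suc (card P)" for j
    using Max_ge[OF fin, of j] that unfolding m_def by fastforce
  have Hm: "H z = (\<Sum>j<m. of_real (c j) * Q j z) + of_real (c m) * Q m z" for z
  proof -
    have "H z = (\<Sum>j<Suc m. of_real (c j) * Q j z)"
      unfolding H_def by (rule sum.mono_neutral_right) (use m top in auto)
    then show ?thesis by simp
  qed
  show ?thesis
    unfolding real_algebro_geometric_mkdv_def mkdv_Q_def mkdv_poly_eq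
  proof (intro exI ballI)
    fix z assume "z \<in> open_band s\<^sub>1 s\<^sub>2"
    from a[OF this] have "of_real (c m) * Q m z = of_real a - (\<Sum>j<m. of_real (c j) * Q j z)"
      unfolding Hm by (simp add: algebra_simps)
    then have "Q m z = (of_real a - (\<Sum>j<m. of_real (c j) * Q j z)) / of_real (c m)"
      using m by (simp add: field_simps)
    also have "\<dots> = of_real (a / c m) + (\<Sum>j<m. of_real (- c j / c m) * Q j z)"
      by (simp add: diff_divide_distrib sum_divide_distrib sum_negf)
    finally show "dp_eval (mkdv_R m) \<eta> z = of_real (a / c m) + (\<Sum>j<m. of_real (- c j / c m) * dp_eval (mkdv_R j) \<eta> z)"
      unfolding Q_def .
  qed
qed

section \<open>Linear systems and reflection at a boundary point\<close>

text \<open>The base point q may lie on the boundary, where the primitive exists only by uniform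
  continuity. The Lipschitz estimate is stated for every bound B of h at once, so that one chosen
  primitive serves whatever bound an iteration later provides.\<close>

lemma Lipschitz_primitive:
  assumes A: "open A" "convex A" and q: "q \<in> closure A" and hol: "h holomorphic_on A"
    and bd: "bounded (h ` A)"
  shows "\<exists>H. (\<forall>z\<in>A. (H has_field_derivative h z) (at z)) \<and> H q = 0 \<and>
    (\<forall>B. (\<forall>z\<in>A. norm (h z) \<le> B) \<longrightarrow> (\<forall>z\<in>closure A. \<forall>w\<in>closure A. norm (H z - H w) \<le> B * norm (z - w)))"
proof -
  obtain G where G: "\<And>z. z \<in> A \<Longrightarrow> (G has_field_derivative h z) (at z within A)"
    using holomorphic_convex_primitive'[OF A(2,1) hol] by blast
  have lip: "B-lipschitz_on A G" if "\<And>z. z \<in> A \<Longrightarrow> norm (h z) \<le> B" "0 \<le> B" for B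
    by (rule lipschitz_onI) (use field_differentiable_bound[OF A(2) G that(1)] that(2) in \<open>auto simp: dist_norm\<close>)
  obtain B\<^sub>0 where B\<^sub>0: "0 < B\<^sub>0" "\<And>z. z \<in> A \<Longrightarrow> norm (h z) \<le> B\<^sub>0"
    using bd unfolding bounded_pos by auto
  have uc: "uniformly_continuous_on A G"
    using lip[OF B\<^sub>0(2)] B\<^sub>0(1) lipschitz_on_uniformly_continuous by (metis less_imp_le)
  obtain G' where G': "uniformly_continuous_on (closure A) G'" "\<And>z. z \<in> A \<Longrightarrow> G z = G' z"
    using uniformly_continuous_on_extension_on_closure[OF uc] by metis
  define H where "H z = G' z - G' q" for z
  have cont: "continuous_on (closure A) G'" by (rule uniformly_continuous_imp_continuous[OF G'(1)])
  have "norm (H z - H w) \<le> B * norm (z - w)"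
    if B: "\<forall>z\<in>A. norm (h z) \<le> B" and zw: "z \<in> closure A" "w \<in> closure A" for B z w
  proof -
    have "A \<noteq> {}" using q by auto
    then have B0: "0 \<le> B" using B norm_ge_zero order_trans by blast
    have "B-lipschitz_on A G'"
      using lip[of B] B B0 G'(2) by (auto simp: lipschitz_on_def)
    then have "B-lipschitz_on (closure A) G'"
      by (rule lipschitz_on_closure[OF _ cont])
    then show ?thesis using zw by (auto simp: lipschitz_on_def dist_norm H_def)
  qed
  moreover have "(H has_field_derivative h z) (at z)" if z: "z \<in> A" for z
  proof -
    have "(G has_field_derivative h z) (at z)"
      using G[OF z] unfolding at_within_open[OF z A(1)] .
    then have "(G' has_field_derivative h z) (at z)"
      by (rule has_field_derivative_transform_within_open[OF _ A(1) z]) (simp add: G'(2))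
    from DERIV_diff[OF this DERIV_const[of "G' q"]] show ?thesis by (simp add: H_def[abs_def])
  qed
  ultimately show ?thesis by (intro exI[of _ H]) (auto simp: H_def)
qed

lemma norm_le_on_closure:
  fixes f :: "'a::metric_space \<Rightarrow> 'b::real_normed_vector"
  assumes "continuous_on (closure S) f" "x \<in> closure S" "\<And>y. y \<in> S \<Longrightarrow> norm (f y) \<le> B"
  shows "norm (f x) \<le> B"
  using continuous_on_closure_norm_le[of S f B x] assms by blast

text \<open>Picard iteration from the point q, which may be a boundary point. The smallness
  hypothesis halves the bound on the iterates at each step, so the series converges geometrically
  and its Lipschitz estimates reach the closure; derivatives are claimed in the interior
  only.\<close>

lemma linear_system_exists:
  fixes u v :: "complex \<Rightarrow> complex"
  assumes A: "open A" "convex A" and q: "q \<in> closure A"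
    and u: "u holomorphic_on A" "\<And>z. z \<in> A \<Longrightarrow> norm (u z) \<le> M"
    and v: "v holomorphic_on A" "\<And>z. z \<in> A \<Longrightarrow> norm (v z) \<le> M"
    and small: "\<And>z w. z \<in> A \<Longrightarrow> w \<in> A \<Longrightarrow> M * norm (z - w) \<le> 1 / 2" and M: "0 < M"
  shows "\<exists>\<xi> \<kappa> L. \<xi> q = 1 \<and> \<kappa> q = k \<and> 0 \<le> L \<and>
    (\<forall>z\<in>A. (\<xi> has_field_derivative \<kappa> z * u z) (at z)) \<and> (\<forall>z\<in>A. (\<kappa> has_field_derivative \<xi> z * v z) (at z)) \<and>
    (\<forall>z\<in>closure A. \<forall>w\<in>closure A. norm (\<xi> z - \<xi> w) \<le> L * norm (z - w) \<and> norm (\<kappa> z - \<kappa> w) \<le> L * norm (z - w))"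
proof -
  define P where "P h H \<longleftrightarrow> (\<forall>z\<in>A. (H has_field_derivative h z) (at z)) \<and> H q = 0 \<and>
    (\<forall>B. (\<forall>z\<in>A. norm (h z) \<le> B) \<longrightarrow> (\<forall>z\<in>closure A. \<forall>w\<in>closure A. norm (H z - H w) \<le> B * norm (z - w)))"
    for h H :: "complex \<Rightarrow> complex"
  \<comment> \<open>Fixing one primitive for each integrand turns the iteration into a primitive
    recursion on pairs of functions.\<close>
  define I where "I h = (SOME H. P h H)" for h
  have I: "P h (I h)" if "h holomorphic_on A" "bounded (h ` A)" for h
  proof -
    have "\<exists>H. P h H" unfolding P_def by (rule Lipschitz_primitive[OF A q that])
    then show ?thesis unfolding I_def by (rule someI_ex)
  qed
  define s where "s = rec_nat (\<lambda>_::complex. 1 :: complex, \<lambda>_::complex. k)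
    (\<lambda>_ p. (I (\<lambda>z. snd p z * u z), I (\<lambda>z. fst p z * v z)))"
  define x where "x n = fst (s n)" for n
  define y where "y n = snd (s n)" for n
  have x0: "x 0 = (\<lambda>_. 1)" and y0: "y 0 = (\<lambda>_. k)" by (simp_all add: x_def y_def s_def)
  have xS: "x (Suc n) = I (\<lambda>z. y n z * u z)" and yS: "y (Suc n) = I (\<lambda>z. x n z * v z)" for n
    by (simp_all add: x_def y_def s_def)
  define m where "m = max 1 (norm k)"
  have m: "1 \<le> m" "norm k \<le> m" by (auto simp: m_def)
  have small': "M * norm (z - w) \<le> 1 / 2" if "z \<in> closure A" "w \<in> closure A" for z w
  proof -
    have "norm (M * norm (fst p - snd p)) \<le> 1 / 2" if "p \<in> closure (A \<times> A)" for p
      by (rule norm_le_on_closure[OF _ that]) (use small M in \<open>auto intro!: continuous_intros\<close>)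
    from this[of "(z, w)"] show ?thesis using that M by (auto simp: closure_Times)
  qed
  have step: "P (\<lambda>z. f z * w z) (I (\<lambda>z. f z * w z)) \<and>
      (\<forall>z\<in>closure A. norm (I (\<lambda>z. f z * w z) z) \<le> m * (1 / 2) ^ Suc n) \<and>
      (\<forall>z\<in>closure A. \<forall>z'\<in>closure A. norm (I (\<lambda>z. f z * w z) z - I (\<lambda>z. f z * w z) z') \<le> m * M * (1 / 2) ^ n * norm (z - z'))"
    if f: "f holomorphic_on A" "\<And>z. z \<in> closure A \<Longrightarrow> norm (f z) \<le> m * (1 / 2) ^ n"
    and w: "w holomorphic_on A" "\<And>z. z \<in> A \<Longrightarrow> norm (w z) \<le> M" for f w n
  proof -
    have b: "norm (f z * w z) \<le> m * M * (1 / 2) ^ n" if "z \<in> A" for z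
    proof -
      have "norm (f z * w z) \<le> (m * (1 / 2) ^ n) * M"
        unfolding norm_mult using that f(2) w(2) closure_subset m by (intro mult_mono) auto
      then show ?thesis by (simp add: mult_ac)
    qed
    have "bounded ((\<lambda>z. f z * w z) ` A)" unfolding bounded_iff using b by blast
    then have P: "P (\<lambda>z. f z * w z) (I (\<lambda>z. f z * w z))"
      by (intro I holomorphic_on_mult f w)
    then have lip: "norm (I (\<lambda>z. f z * w z) z - I (\<lambda>z. f z * w z) z') \<le> m * M * (1 / 2) ^ n * norm (z - z')"
      if "z \<in> closure A" "z' \<in> closure A" for z z'
      using that b unfolding P_def by blast
    have "norm (I (\<lambda>z. f z * w z) z) \<le> m * (1 / 2) ^ Suc n" if z: "z \<in> closure A" for z
    proof -
      have "norm (I (\<lambda>z. f z * w z) z) \<le> m * M * (1 / 2) ^ n * norm (z - q)"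
        using lip[OF z q] P by (simp add: P_def)
      also have "\<dots> = m * (1 / 2) ^ n * (M * norm (z - q))" by simp
      also have "\<dots> \<le> m * (1 / 2) ^ n * (1 / 2)"
        using small'[OF z q] m by (intro mult_left_mono) auto
      finally show ?thesis by simp
    qed
    then show ?thesis using P lip by blast
  qed
  have Phol: "H holomorphic_on A" if "P h H" for h H
    using that holomorphic_on_open[OF A(1)] unfolding P_def by blast
  have xy: "x n holomorphic_on A \<and> y n holomorphic_on A \<and>
     (\<forall>z\<in>closure A. norm (x n z) \<le> m * (1 / 2) ^ n) \<and> (\<forall>z\<in>closure A. norm (y n z) \<le> m * (1 / 2) ^ n)" for n
  proof (induction n)
    case 0
    then show ?case using m by (simp add: x0 y0)
  next
    case (Suc n)
    then show ?case
      unfolding xS yS using step[of "y n" n u] step[of "x n" n v] u v Phol by blast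
  qed
  have PxS: "P (\<lambda>z. y n z * u z) (x (Suc n))"
    and lipx: "\<And>z w. z \<in> closure A \<Longrightarrow> w \<in> closure A \<Longrightarrow> norm (x (Suc n) z - x (Suc n) w) \<le> m * M * (1 / 2) ^ n * norm (z - w)" for n
    using step[of "y n" n u] xy[of n] u unfolding xS by blast+
  have PyS: "P (\<lambda>z. x n z * v z) (y (Suc n))"
    and lipy: "\<And>z w. z \<in> closure A \<Longrightarrow> w \<in> closure A \<Longrightarrow> norm (y (Suc n) z - y (Suc n) w) \<le> m * M * (1 / 2) ^ n * norm (z - w)" for n
    using step[of "x n" n v] xy[of n] v unfolding yS by blast+
  have geo: "summable (\<lambda>n. m * (1 / 2 :: real) ^ n)" by (intro summable_mult summable_geometric) simp
  define X where "X z = suminf (\<lambda>n. x n z)" for z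
  define Y where "Y z = suminf (\<lambda>n. y n z)" for z
  have sx: "summable (\<lambda>n. x n z)" and sy: "summable (\<lambda>n. y n z)" if "z \<in> closure A" for z
    using that xy by (auto intro!: summable_comparison_test'[OF geo, of 0])
  have derivX: "(X has_field_derivative Y z * u z) (at z)" if z: "z \<in> A" for z
  proof -
    define x' where "x' n z = (case n of 0 \<Rightarrow> 0 | Suc j \<Rightarrow> y j z * u z)" for n z
    have d: "(x n has_field_derivative x' n z) (at z)" if "z \<in> A" for n z
      using PxS that by (cases n) (auto simp: x'_def x0 P_def)
    have ev: "\<forall>\<^sub>F n in sequentially. \<forall>z\<in>A. norm (x n z) \<le> m * (1 / 2) ^ n"
      using xy closure_subset by (intro always_eventually) blast
    obtain g g' where "\<forall>z\<in>A. (\<lambda>n. x n z) sums g z \<and> (\<lambda>n. x' n z) sums g' z \<and> (g has_field_derivative g' z) (at z)"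
      by (rule series_and_derivative_comparison[OF A(1) geo d ev])
    then have g: "(\<lambda>n. x n z) sums g z" "(\<lambda>n. x' n z) sums g' z" "(g has_field_derivative g' z) (at z)" if "z \<in> A" for z
      using that by auto
    have "(\<lambda>n. x' (Suc n) z) sums (Y z * u z)"
      using sums_mult2[OF summable_sums[OF sy], of z "u z"] z closure_subset by (auto simp: x'_def Y_def)
    then have "(\<lambda>n. x' n z) sums (Y z * u z)"
      by (subst (asm) sums_Suc_iff) (simp add: x'_def)
    then have "g' z = Y z * u z" using g(2)[OF z] by (rule sums_unique2[rotated])
    then have "(g has_field_derivative Y z * u z) (at z)" using g(3)[OF z] by simp
    then show ?thesis
      by (rule has_field_derivative_transform_within_open[OF _ A(1) z]) (use g(1) in \<open>auto simp: X_def sums_iff\<close>)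
  qed
  have derivY: "(Y has_field_derivative X z * v z) (at z)" if z: "z \<in> A" for z
  proof -
    define x' where "x' n z = (case n of 0 \<Rightarrow> 0 | Suc j \<Rightarrow> x j z * v z)" for n z
    have d: "(y n has_field_derivative x' n z) (at z)" if "z \<in> A" for n z
      using PyS that by (cases n) (auto simp: x'_def y0 P_def)
    have ev: "\<forall>\<^sub>F n in sequentially. \<forall>z\<in>A. norm (y n z) \<le> m * (1 / 2) ^ n"
      using xy closure_subset by (intro always_eventually) blast
    obtain g g' where "\<forall>z\<in>A. (\<lambda>n. y n z) sums g z \<and> (\<lambda>n. x' n z) sums g' z \<and> (g has_field_derivative g' z) (at z)"
      by (rule series_and_derivative_comparison[OF A(1) geo d ev])
    then have g: "(\<lambda>n. y n z) sums g z" "(\<lambda>n. x' n z) sums g' z" "(g has_field_derivative g' z) (at z)" if "z \<in> A" for z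
      using that by auto
    have "(\<lambda>n. x' (Suc n) z) sums (X z * v z)"
      using sums_mult2[OF summable_sums[OF sx], of z "v z"] z closure_subset by (auto simp: x'_def X_def)
    then have "(\<lambda>n. x' n z) sums (X z * v z)"
      by (subst (asm) sums_Suc_iff) (simp add: x'_def)
    then have "g' z = X z * v z" using g(2)[OF z] by (rule sums_unique2[rotated])
    then have "(g has_field_derivative X z * v z) (at z)" using g(3)[OF z] by simp
    then show ?thesis
      by (rule has_field_derivative_transform_within_open[OF _ A(1) z]) (use g(1) in \<open>auto simp: Y_def sums_iff\<close>)
  qed
  \<comment> \<open>The increments have Lipschitz constants \<open>m * M / 2 ^ n\<close>, which add
    up to \<open>2 * m * M\<close>; the constant initial terms contribute nothing.\<close>
  define L where "L = 2 * m * M"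
  have lipsum: "norm (suminf (\<lambda>n. w n z) - suminf (\<lambda>n. w n z')) \<le> L * norm (z - z')"
    if w: "\<And>n. norm (w (Suc n) z - w (Suc n) z') \<le> m * M * (1 / 2) ^ n * norm (z - z')" "w 0 z = w 0 z'"
     "summable (\<lambda>n. w n z)" "summable (\<lambda>n. w n z')" for w :: "nat \<Rightarrow> complex \<Rightarrow> complex" and z z'
  proof -
    have "suminf (\<lambda>n. w n z) - suminf (\<lambda>n. w n z') = suminf (\<lambda>n. w n z - w n z')"
      by (rule suminf_diff[OF w(3,4)])
    also have "\<dots> = suminf (\<lambda>n. w (Suc n) z - w (Suc n) z')"
      using suminf_split_head[OF summable_diff[OF w(3,4)]] w(2) by simp
    finally have e: "suminf (\<lambda>n. w n z) - suminf (\<lambda>n. w n z') = suminf (\<lambda>n. w (Suc n) z - w (Suc n) z')" .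
    have g: "(\<lambda>n. m * M * (1 / 2) ^ n * norm (z - z')) sums (m * M * 2 * norm (z - z'))"
      using sums_mult2[OF sums_mult[OF geometric_sums[of "1 / 2 :: real"], of "m * M"], of "norm (z - z')"] by simp
    show ?thesis
      unfolding e using norm_suminf_le[OF w(1) sums_summable[OF g]] sums_unique[OF g] by (simp add: L_def)
  qed
  have "X q = 1"
  proof -
    have "x n q = (if n = 0 then 1 else 0)" for n using PxS by (cases n) (auto simp: x0 P_def)
    then show ?thesis unfolding X_def by (subst suminf_finite[of "{0}"]) auto
  qed
  moreover have "Y q = k"
  proof -
    have "y n q = (if n = 0 then k else 0)" for n using PyS by (cases n) (auto simp: y0 P_def)
    then show ?thesis unfolding Y_def by (subst suminf_finite[of "{0}"]) auto
  qed
  moreover have "norm (X z - X w) \<le> L * norm (z - w)" "norm (Y z - Y w) \<le> L * norm (z - w)"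
    if "z \<in> closure A" "w \<in> closure A" for z w
    unfolding X_def Y_def using that lipx lipy sx sy by (auto intro!: lipsum simp: x0 y0)
  moreover have "0 \<le> L" using m M by (simp add: L_def)
  ultimately show ?thesis using derivX derivY by blast
qed

text \<open>Increments of \<xi> are compared with increments of g instead of z, so the estimate
  makes sense between boundary points, where no derivative is available. On A the mean value
  inequality applies to \<open>\<xi> - \<kappa> w * g\<close>, whose derivative is of order
  \<open>norm (z - w)\<close>; continuity in both variables gives the closure.\<close>

lemma first_order_on_closure:
  fixes \<xi> \<kappa> g u :: "complex \<Rightarrow> complex"
  assumes A: "open A" "convex A" and L: "0 \<le> L" "0 \<le> M"
    and \<xi>: "\<And>z. z \<in> A \<Longrightarrow> (\<xi> has_field_derivative \<kappa> z * u z) (at z)"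
    and g: "\<And>z. z \<in> A \<Longrightarrow> (g has_field_derivative u z) (at z)" "continuous_on (closure A) g"
    and u: "\<And>z. z \<in> A \<Longrightarrow> norm (u z) \<le> M"
    and lip: "\<And>z w. z \<in> closure A \<Longrightarrow> w \<in> closure A \<Longrightarrow> norm (\<xi> z - \<xi> w) \<le> L * norm (z - w)"
      "\<And>z w. z \<in> closure A \<Longrightarrow> w \<in> closure A \<Longrightarrow> norm (\<kappa> z - \<kappa> w) \<le> L * norm (z - w)"
    and zw: "z \<in> closure A" "w \<in> closure A"
  shows "norm (\<xi> z - \<xi> w - \<kappa> w * (g z - g w)) \<le> L * M * (norm (z - w))\<^sup>2"
proof -
  have inner: "norm (\<xi> z - \<xi> w - \<kappa> w * (g z - g w)) \<le> L * M * (norm (z - w))\<^sup>2" if z: "z \<in> A" and w: "w \<in> A" for z w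
  proof -
    have seg: "closed_segment w z \<subseteq> A" using A(2) z w by (simp add: closed_segment_subset)
    have "norm ((\<xi> z - \<kappa> w * g z) - (\<xi> w - \<kappa> w * g w)) \<le> L * norm (z - w) * M * norm (z - w)"
    proof (rule field_differentiable_bound[of "closed_segment w z"])
      fix p assume p: "p \<in> closed_segment w z"
      then have pA: "p \<in> A" using seg by auto
      show "((\<lambda>z. \<xi> z - \<kappa> w * g z) has_field_derivative (\<kappa> p - \<kappa> w) * u p) (at p within closed_segment w z)"
        by (rule has_field_derivative_at_within)
           (rule derivative_eq_intros \<xi>[OF pA] g(1)[OF pA] refl | simp add: algebra_simps)+
      have "norm (\<kappa> p - \<kappa> w) \<le> L * norm (p - w)" using lip(2)[of p w] pA w closure_subset by blast
      also have "\<dots> \<le> L * norm (z - w)"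
        using segment_bound(1)[OF p] L by (intro mult_left_mono) auto
      finally show "norm ((\<kappa> p - \<kappa> w) * u p) \<le> L * norm (z - w) * M"
        unfolding norm_mult using u[OF pA] L by (intro mult_mono) auto
    qed auto
    moreover have "(\<xi> z - \<kappa> w * g z) - (\<xi> w - \<kappa> w * g w) = \<xi> z - \<xi> w - \<kappa> w * (g z - g w)"
      by (simp add: algebra_simps)
    ultimately show ?thesis by (simp add: power2_eq_square mult_ac)
  qed
  have cont: "continuous_on (closure A) f"
    if "\<And>z w :: complex. z \<in> closure A \<Longrightarrow> w \<in> closure A \<Longrightarrow> norm (f z - f w) \<le> L * norm (z - w)" for f :: "complex \<Rightarrow> complex"
    by (rule lipschitz_on_continuous_on[of L]) (use that L in \<open>auto simp: lipschitz_on_def dist_norm\<close>)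
  note c = cont[of \<xi>, OF lip(1)] cont[of \<kappa>, OF lip(2)] g(2)
  let ?F = "\<lambda>p. norm (\<xi> (fst p) - \<xi> (snd p) - \<kappa> (snd p) * (g (fst p) - g (snd p))) - L * M * (norm (fst p - snd p))\<^sup>2"
  have "?F (z, w) \<le> 0"
  proof (rule continuous_le_on_closure[of "A \<times> A"])
    show "continuous_on (closure (A \<times> A)) ?F"
      unfolding closure_Times
      by (intro continuous_intros continuous_on_compose2[OF c(1)] continuous_on_compose2[OF c(2)] continuous_on_compose2[OF c(3)]) auto
  qed (use zw inner in \<open>auto simp: closure_Times\<close>)
  then show ?thesis by simp
qed

lemma holomorphic_on_reflect:
  assumes "G holomorphic_on A" "open A"
  shows "(\<lambda>z. cnj (G (2 * of_real s - cnj z))) holomorphic_on ((\<lambda>z. 2 * of_real s - cnj z) -` A)"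
proof -
  have o: "open ((\<lambda>z. 2 * of_real s - cnj z) -` A)"
    by (intro continuous_open_vimage[OF assms(2)] continuous_intros)
  have "((\<lambda>z. cnj (G (2 * of_real s - cnj z))) has_field_derivative - cnj (deriv G (2 * of_real s - cnj z))) (at z)"
    if z: "2 * of_real s - cnj z \<in> A" for z
  proof -
    have 1: "(G has_field_derivative deriv G (2 * of_real s - cnj z)) (at (2 * of_real s - cnj z))"
      using assms z holomorphic_derivI by blast
    have 2: "((\<lambda>w. 2 * of_real s - w) has_field_derivative - 1) (at (cnj z))"
      by (auto intro!: derivative_eq_intros)
    have "((\<lambda>w. G (2 * of_real s - w)) has_field_derivative - deriv G (2 * of_real s - cnj z)) (at (cnj z))"
      using DERIV_chain2[OF 1 2] by simp
    from has_field_derivative_cnj_cnj[OF this] show ?thesis by (simp add: o_def)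
  qed
  then show ?thesis using holomorphic_on_open[OF o] by blast
qed

text \<open>Schwarz reflection with a second function: the branch beyond the line is the reflected
  conjugate of G, and it fits continuously because G has the boundary values \<open>cnj g\<close>.
  Extending g is thus reduced to finding a holomorphic G with these boundary values.\<close>

lemma reflection_extension:
  fixes g G :: "complex \<Rightarrow> complex"
  assumes s: "Re q = s" and r: "0 < r"
    and g: "g holomorphic_on (ball q r \<inter> {z. Re z < s})" "continuous_on (ball q r \<inter> {z. Re z \<le> s}) g"
    and G: "G holomorphic_on (ball q r \<inter> {z. Re z < s})" "continuous_on (ball q r \<inter> {z. Re z \<le> s}) G"
    and line: "\<And>z. z \<in> ball q r \<Longrightarrow> Re z = s \<Longrightarrow> G z = cnj (g z)"
  shows "\<exists>h. h holomorphic_on ball q r \<and> (\<forall>z\<in>ball q r. Re z \<le> s \<longrightarrow> h z = g z)"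
proof -
  let ?R = "\<lambda>z. 2 * of_real s - cnj z"
  have refl: "?R z \<in> ball q r \<longleftrightarrow> z \<in> ball q r" for z
  proof -
    have "?R q = q" using s by (simp add: complex_eq_iff)
    then have "dist q (?R z) = dist (?R q) (?R z)" by simp
    also have "\<dots> = norm (cnj (z - q))" by (simp add: dist_norm)
    also have "\<dots> = dist q z" by (simp only: complex_mod_cnj dist_norm norm_minus_commute)
    finally show ?thesis by simp
  qed
  define h where "h z = (if Re z \<le> s then g z else cnj (G (?R z)))" for z
  have inner1: "1 \<bullet> z = Re z" for z :: complex by (simp add: inner_complex_def)
  have "h holomorphic_on ball q r"
  proof (rule holomorphic_on_paste_across_line[of _ 1 _ s])
    show "h holomorphic_on ball q r \<inter> {z. 1 \<bullet> z < s}"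
      unfolding inner1 using g(1) by (rule holomorphic_transform) (auto simp: h_def)
    have "(\<lambda>z. cnj (G (?R z))) holomorphic_on (?R -` (ball q r \<inter> {z. Re z < s}))"
      by (rule holomorphic_on_reflect[OF G(1)]) (intro open_Int open_ball open_halfspace_Re_lt)
    then have "(\<lambda>z. cnj (G (?R z))) holomorphic_on ball q r \<inter> {z. s < 1 \<bullet> z}"
      unfolding inner1 by (rule holomorphic_on_subset) (use refl in auto)
    then show "h holomorphic_on ball q r \<inter> {z. s < 1 \<bullet> z}"
      by (rule holomorphic_transform) (auto simp: h_def)
    show "continuous_on (ball q r) h"
    proof -
      have eq: "ball q r = (ball q r \<inter> {z. Re z \<le> s}) \<union> (ball q r \<inter> {z. s \<le> Re z})" by auto
      have "continuous_on ((ball q r \<inter> {z. Re z \<le> s}) \<union> (ball q r \<inter> {z. s \<le> Re z}))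
          (\<lambda>z. if Re z \<le> s then g z else cnj (G (?R z)))"
      proof (rule continuous_on_cases_local)
        show "closedin (top_of_set (ball q r \<inter> {z. Re z \<le> s} \<union> ball q r \<inter> {z. s \<le> Re z})) (ball q r \<inter> {z. Re z \<le> s})"
          unfolding eq[symmetric] by (intro closedin_closed_Int closed_halfspace_Re_le)
        show "closedin (top_of_set (ball q r \<inter> {z. Re z \<le> s} \<union> ball q r \<inter> {z. s \<le> Re z})) (ball q r \<inter> {z. s \<le> Re z})"
          unfolding eq[symmetric] by (intro closedin_closed_Int closed_halfspace_Re_ge)
        show "continuous_on (ball q r \<inter> {z. s \<le> Re z}) (\<lambda>z. cnj (G (?R z)))"
          by (intro continuous_intros continuous_on_compose2[OF G(2)]) (use refl in auto)
        fix z assume z: "z \<in> ball q r \<inter> {z. Re z \<le> s} \<and> \<not> Re z \<le> s \<or> z \<in> ball q r \<inter> {z. s \<le> Re z} \<and> Re z \<le> s"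
        then have "Re z = s" "z \<in> ball q r" by auto
        moreover have "?R z = z" using \<open>Re z = s\<close> by (simp add: complex_eq_iff)
        ultimately show "g z = cnj (G (?R z))" using line by simp
      qed (rule g(2))
      then show ?thesis unfolding eq[symmetric] h_def .
    qed
  qed auto
  then show ?thesis by (intro exI[of _ h]) (auto simp: h_def)
qed

text \<open>On the boundary line \<open>2 f = b N + cnj g\<close> with \<open>N\<close> the conjugate unit normal. The linear system
  \<open>\<xi>' = \<kappa> g'\<close>, \<open>\<kappa>' = - (2/b\<^sup>2) \<xi> f'\<close> linearises the Riccati equation that governs \<open>N\<close> along the line, so
  \<open>b\<^sup>2 \<kappa> / \<xi>\<close> is a holomorphic function with boundary values \<open>- b N\<close>.\<close>

lemma Riccati_extension:
  fixes g f N :: "complex \<Rightarrow> complex" and b C K :: real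
  defines "A \<equiv> \<lambda>q r s. ball q r \<inter> {z. Re z < s}"
  assumes s: "Re q = s" and r: "0 < r" and b: "b \<noteq> 0" and C: "0 < C" and K: "0 \<le> K"
    and g: "\<And>z. z \<in> A q r s \<Longrightarrow> (g has_field_derivative g' z) (at z)" "continuous_on (closure (A q r s)) g"
    and f: "\<And>z. z \<in> A q r s \<Longrightarrow> (f has_field_derivative f' z) (at z)" "continuous_on (closure (A q r s)) f"
    and g'f': "g' holomorphic_on A q r s" "f' holomorphic_on A q r s"
      "\<And>z. z \<in> A q r s \<Longrightarrow> norm (g' z) \<le> C" "\<And>z. z \<in> A q r s \<Longrightarrow> norm (f' z) \<le> C"
    and lip: "\<And>z w. z \<in> closure (A q r s) \<Longrightarrow> w \<in> closure (A q r s) \<Longrightarrow> norm (g z - g w) \<le> C * norm (z - w)"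
      "\<And>z w. z \<in> closure (A q r s) \<Longrightarrow> w \<in> closure (A q r s) \<Longrightarrow> norm (f z - f w) \<le> C * norm (z - w)"
    and line: "\<And>z. z \<in> ball q r \<Longrightarrow> Re z = s \<Longrightarrow> norm (N z) = 1 \<and> 2 * f z = of_real b * N z + cnj (g z)"
    and chord: "\<And>z w. z \<in> ball q r \<Longrightarrow> w \<in> ball q r \<Longrightarrow> Re z = s \<Longrightarrow> Re w = s \<Longrightarrow>
        norm (cnj (g z - g w) + (N w)\<^sup>2 * (g z - g w)) \<le> K * (norm (z - w))\<^sup>2"
    and small: "C * (1 + 2 / b\<^sup>2) * (2 * r) \<le> 1 / 2"
  shows "\<exists>r'>0. \<exists>h. h holomorphic_on ball q r' \<and> (\<forall>z\<in>ball q r'. Re z \<le> s \<longrightarrow> h z = g z)"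
proof -
  let ?A = "A q r s"
  have A: "open ?A" "convex ?A"
    unfolding A_def by (auto intro!: open_Int open_halfspace_Re_lt convex_Int convex_halfspace_Re_lt)
  have clA: "z \<in> closure ?A" if z: "z \<in> ball q r" "Re z \<le> s" for z
  proof (cases "Re z < s")
    case True
    then show ?thesis using z closure_subset[of ?A] by (auto simp: A_def)
  next
    case False
    show ?thesis
      unfolding closure_approachable
    proof (intro allI impI)
      fix e :: real assume e: "e > 0"
      define t where "t = min (e / 2) ((r - dist q z) / 2)"
      have t: "0 < t" "t < e" "t < r - dist q z" using e z by (auto simp: t_def min_def)
      have "dist (z - of_real t) z < e" using t by (simp add: dist_norm)
      moreover have "dist q (z - of_real t) \<le> dist q z + t"
        using dist_triangle[of q "z - of_real t" z] t by (simp add: dist_norm)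
      ultimately show "\<exists>y\<in>?A. dist y z < e"
        using t z by (intro bexI[of _ "z - of_real t"]) (auto simp: A_def)
    qed
  qed
  have q: "q \<in> closure ?A" using clA[of q] s r by simp
  define v where "v z = - of_real (2 / b\<^sup>2) * f' z" for z
  define M where "M = C * (1 + 2 / b\<^sup>2)"
  have M: "0 < M" "C \<le> M" "2 / b\<^sup>2 * C \<le> M" 
  proof -
    have "0 < C * (2 / b\<^sup>2)" using C b by simp
    then show "0 < M" "C \<le> M" "2 / b\<^sup>2 * C \<le> M" using C unfolding M_def distrib_left by (simp_all add: mult.commute)
  qed
  have nv: "norm (v z) \<le> M" if "z \<in> ?A" for z
  proof -
    have "norm (v z) = 2 / b\<^sup>2 * norm (f' z)" by (simp add: v_def norm_mult norm_divide norm_power)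
    also have "\<dots> \<le> 2 / b\<^sup>2 * C" using g'f'(4)[OF that] by (intro mult_left_mono) auto
    finally show ?thesis using M by simp
  qed
  have ng: "norm (g' z) \<le> M" if "z \<in> ?A" for z using g'f'(3)[OF that] M by simp
  have small': "M * norm (z - w) \<le> 1 / 2" if "z \<in> ?A" "w \<in> ?A" for z w
  proof -
    have "norm (z - w) \<le> 2 * r"
      using dist_triangle3[of z w q] that by (auto simp: A_def dist_norm norm_minus_commute)
    then have "M * norm (z - w) \<le> M * (2 * r)" using M by (intro mult_left_mono) auto
    also have "\<dots> \<le> 1 / 2" using small unfolding M_def .
    finally show ?thesis .
  qed
  have hv: "v holomorphic_on ?A" unfolding v_def by (intro holomorphic_intros g'f')
  \<comment> \<open>The initial values are those for which \<open>\<kappa> = - N * \<xi> / b\<close>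
    holds at q.\<close>
  obtain \<xi> \<kappa> L where \<xi>q: "\<xi> q = 1" and \<kappa>q: "\<kappa> q = - N q / of_real b" and L: "0 \<le> L"
    and d\<xi>: "\<And>z. z \<in> ?A \<Longrightarrow> (\<xi> has_field_derivative \<kappa> z * g' z) (at z)"
    and d\<kappa>: "\<And>z. z \<in> ?A \<Longrightarrow> (\<kappa> has_field_derivative \<xi> z * v z) (at z)"
    and lips: "\<And>z w. z \<in> closure ?A \<Longrightarrow> w \<in> closure ?A \<Longrightarrow> norm (\<xi> z - \<xi> w) \<le> L * norm (z - w)"
      "\<And>z w. z \<in> closure ?A \<Longrightarrow> w \<in> closure ?A \<Longrightarrow> norm (\<kappa> z - \<kappa> w) \<le> L * norm (z - w)"
    using linear_system_exists[OF A q g'f'(1) ng hv nv small' M(1), where k = "- N q / of_real b"] by auto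
  have M0: "0 \<le> M" using M by simp
  have fo\<xi>: "norm (\<xi> z - \<xi> w - \<kappa> w * (g z - g w)) \<le> L * M * (norm (z - w))\<^sup>2"
    if "z \<in> closure ?A" "w \<in> closure ?A" for z w
    by (rule first_order_on_closure[OF A L M0 d\<xi> g ng lips that])
  have fo\<kappa>: "norm (\<kappa> z - \<kappa> w + of_real (2 / b\<^sup>2) * \<xi> w * (f z - f w)) \<le> L * M * (norm (z - w))\<^sup>2"
    if "z \<in> closure ?A" "w \<in> closure ?A" for z w
  proof -
    have df: "((\<lambda>z. - of_real (2 / b\<^sup>2) * f z) has_field_derivative v z) (at z)" if "z \<in> ?A" for z
      unfolding v_def by (rule DERIV_cmult[OF f(1)[OF that]])
    have cf: "continuous_on (closure ?A) (\<lambda>z. - of_real (2 / b\<^sup>2) * f z)" by (intro continuous_intros f(2))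
    have "norm (\<kappa> z - \<kappa> w - \<xi> w * (- of_real (2 / b\<^sup>2) * f z - - of_real (2 / b\<^sup>2) * f w)) \<le> L * M * (norm (z - w))\<^sup>2"
      by (rule first_order_on_closure[OF A L M0 d\<kappa> df cf nv lips(2,1) that])
    moreover have "\<kappa> z - \<kappa> w - \<xi> w * (- of_real (2 / b\<^sup>2) * f z - - of_real (2 / b\<^sup>2) * f w)
        = \<kappa> z - \<kappa> w + of_real (2 / b\<^sup>2) * \<xi> w * (f z - f w)"
    proof -
      have "a - c - x * (- k * p - - k * p') = a - c + k * x * (p - p')" for a c x k p p' :: complex
        by (simp add: algebra_simps)
      then show ?thesis .
    qed
    ultimately show ?thesis by (simp only:)
  qed
  define S where "S = {y. \<bar>y - Im q\<bar> < r}"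
  have S: "convex S"
  proof -
    have "S = ball (Im q) r" by (auto simp: S_def dist_real_def)
    then show ?thesis by simp
  qed
  have inS: "Complex s y \<in> ball q r" if "y \<in> S" for y
    using that s by (simp add: S_def dist_norm cmod_def abs_minus_commute)
  \<comment> \<open>Its vanishing says \<open>b^2 * \<kappa> / \<xi> = - b * N\<close>. As N is not
    known to be differentiable, this defect is controlled through its increments and
    \<open>discrete_Gronwall\<close> instead of a differential equation.\<close>
  define \<omega> where "\<omega> y = \<kappa> (Complex s y) + N (Complex s y) / of_real b * \<xi> (Complex s y)" for y
  define X where "X = 1 + L * r"
  define Y where "Y = 1 / \<bar>b\<bar> + L * r"
  define LN where "LN = 3 * C / \<bar>b\<bar>"
  define M' where "M' = C / \<bar>b\<bar> + (LN * Y * C / \<bar>b\<bar> + X * K / b\<^sup>2 + L * M + L * M / \<bar>b\<bar>)"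
  have nn: "0 \<le> X" "0 \<le> Y" "0 \<le> LN" "0 \<le> LN * Y * C / \<bar>b\<bar> + X * K / b\<^sup>2 + L * M + L * M / \<bar>b\<bar>"
    using L r C K M by (auto simp: X_def Y_def LN_def)
  have step: "norm (\<omega> y' - \<omega> y) \<le> M' * norm (\<omega> y) * \<bar>y' - y\<bar> + M' * \<bar>y' - y\<bar>\<^sup>2" if y: "y \<in> S" "y' \<in> S" for y y'
  proof -
    let ?z = "Complex s y'" and ?w = "Complex s y"
    define l where "l = \<bar>y' - y\<bar>"
    have l: "norm (?z - ?w) = l" "0 \<le> l" by (auto simp: l_def cmod_def)
    have in1: "?z \<in> ball q r" "?w \<in> ball q r" using inS y by auto
    have cl: "?z \<in> closure ?A" "?w \<in> closure ?A" using clA in1 by auto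
    define Dg Df DN where "Dg = g ?z - g ?w" and "Df = f ?z - f ?w" and "DN = N ?z - N ?w"
    define e1 where "e1 = \<kappa> ?z - \<kappa> ?w + of_real (2 / b\<^sup>2) * \<xi> ?w * Df"
    define e2 where "e2 = \<xi> ?z - \<xi> ?w - \<kappa> ?w * Dg"
    define e3 where "e3 = cnj Dg + (N ?w)\<^sup>2 * Dg"
    have e1: "norm e1 \<le> L * M * l\<^sup>2" using fo\<kappa>[OF cl] l by (simp add: e1_def Df_def)
    have e2: "norm e2 \<le> L * M * l\<^sup>2" using fo\<xi>[OF cl] l by (simp add: e2_def Dg_def)
    have e3: "norm e3 \<le> K * l\<^sup>2" using chord[OF in1] l by (simp add: e3_def Dg_def)
    have Dg: "norm Dg \<le> C * l" using lip(1)[OF cl] l by (simp add: Dg_def)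
    have Df: "norm Df \<le> C * l" using lip(2)[OF cl] l by (simp add: Df_def)
    have lz: "norm (N ?z) = 1" "2 * f ?z = of_real b * N ?z + cnj (g ?z)"
      and lw: "norm (N ?w) = 1" "2 * f ?w = of_real b * N ?w + cnj (g ?w)"
      using line in1 by auto
    have fN: "2 * Df = of_real b * DN + cnj Dg"
      using lz(2) lw(2) by (simp add: Df_def DN_def Dg_def algebra_simps)
    have "norm (of_real b * DN) = norm (2 * Df - cnj Dg)" using fN by simp
    also have "\<dots> \<le> norm (2 * Df) + norm (cnj Dg)" by (rule norm_triangle_ineq4)
    also have "\<dots> \<le> 3 * C * l" using Df Dg by (simp add: norm_mult)
    finally have DN: "norm DN \<le> LN * l"
      using b by (simp add: norm_mult LN_def field_simps)
    have qr: "norm (?w - q) \<le> r" using in1 by (simp add: dist_norm norm_minus_commute)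
    have "norm (\<xi> ?w - \<xi> q) \<le> L * r"
      using lips(1)[OF cl(2) q] mult_left_mono[OF qr L] by simp
    then have X: "norm (\<xi> ?w) \<le> X" using norm_triangle_sub[of "\<xi> ?w" "\<xi> q"] \<xi>q by (simp add: X_def)
    have "norm (\<kappa> ?w - \<kappa> q) \<le> L * r"
      using lips(2)[OF cl(2) q] mult_left_mono[OF qr L] by simp
    moreover have "norm (\<kappa> q) = 1 / \<bar>b\<bar>" using line[of q] s r by (simp add: \<kappa>q norm_divide)
    ultimately have Y: "norm (\<kappa> ?w) \<le> Y" using norm_triangle_sub[of "\<kappa> ?w" "\<kappa> q"] by (simp add: Y_def)
    have bne: "complex_of_real b \<noteq> 0" using b by simp
    \<comment> \<open>A discrete Riccati equation: one term is linear in \<omega>, the others are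
      quadratic in the step. \<open>e1\<close> and \<open>e2\<close> are Taylor errors of the linear
      system; \<open>e3\<close> measures how far the chord of g is from the tangent
      direction.\<close>
    have "\<omega> y' - \<omega> y = N ?w / of_real b * \<omega> y * Dg + (DN * \<kappa> ?w * Dg / of_real b - \<xi> ?w * e3 / (of_real b)\<^sup>2 + e1 + N ?z * e2 / of_real b)"
    proof -
      have k: "\<kappa> ?z = \<kappa> ?w + e1 - of_real (2 / b\<^sup>2) * \<xi> ?w * Df" by (simp add: e1_def)
      have x: "\<xi> ?z = \<xi> ?w + e2 + \<kappa> ?w * Dg" by (simp add: e2_def)
      have D: "of_real (2 / b\<^sup>2) * \<xi> ?w * Df = \<xi> ?w * (of_real b * DN + cnj Dg) / (of_real b)\<^sup>2"
        unfolding fN[symmetric] by (simp add: field_simps)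
      have c: "cnj Dg = e3 - (N ?w)\<^sup>2 * Dg" by (simp add: e3_def)
      have nz: "N ?z = N ?w + DN" by (simp add: DN_def)
      show ?thesis
        unfolding \<omega>_def k x D c nz using bne by (simp add: field_simps power2_eq_square)
    qed
    also have "norm \<dots> \<le> norm (N ?w / of_real b * \<omega> y * Dg) + (norm (DN * \<kappa> ?w * Dg / of_real b)
        + norm (\<xi> ?w * e3 / (of_real b)\<^sup>2) + norm e1 + norm (N ?z * e2 / of_real b))"
      by (intro order_trans[OF norm_triangle_ineq] add_mono order_refl order_trans[OF norm_triangle_ineq4])
    also have "norm (N ?w / of_real b * \<omega> y * Dg) \<le> C / \<bar>b\<bar> * norm (\<omega> y) * l"
    proof -
      have "norm (N ?w / of_real b * \<omega> y * Dg) = norm (\<omega> y) / \<bar>b\<bar> * norm Dg"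
        by (simp add: norm_mult norm_divide lw)
      also have "\<dots> \<le> norm (\<omega> y) / \<bar>b\<bar> * (C * l)" using Dg by (intro mult_left_mono) auto
      finally show ?thesis by (simp add: mult_ac)
    qed
    also have "norm (DN * \<kappa> ?w * Dg / of_real b) \<le> LN * Y * C / \<bar>b\<bar> * l\<^sup>2"
    proof -
      have "norm (DN * \<kappa> ?w * Dg) \<le> (LN * l) * Y * (C * l)"
        unfolding norm_mult using DN Y Dg nn l C by (intro mult_mono) auto
      then have "norm (DN * \<kappa> ?w * Dg) / \<bar>b\<bar> \<le> (LN * l) * Y * (C * l) / \<bar>b\<bar>" by (intro divide_right_mono) auto
      then show ?thesis by (simp add: norm_divide power2_eq_square mult_ac)
    qed
    also have "norm (\<xi> ?w * e3 / (of_real b)\<^sup>2) \<le> X * K / b\<^sup>2 * l\<^sup>2"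
    proof -
      have "norm (\<xi> ?w * e3) \<le> X * (K * l\<^sup>2)"
        unfolding norm_mult using X e3 nn by (intro mult_mono) auto
      then have "norm (\<xi> ?w * e3) / b\<^sup>2 \<le> X * (K * l\<^sup>2) / b\<^sup>2" by (intro divide_right_mono) auto
      then show ?thesis by (simp add: norm_divide norm_power mult_ac)
    qed
    also note e1
    also have "norm (N ?z * e2 / of_real b) \<le> L * M / \<bar>b\<bar> * l\<^sup>2"
      using divide_right_mono[OF e2, of "\<bar>b\<bar>"] by (simp add: norm_divide norm_mult lz)
    finally have "norm (\<omega> y' - \<omega> y) \<le> C / \<bar>b\<bar> * norm (\<omega> y) * l
       + (LN * Y * C / \<bar>b\<bar> + X * K / b\<^sup>2 + L * M + L * M / \<bar>b\<bar>) * l\<^sup>2"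
      by (simp add: algebra_simps)
    also have "\<dots> \<le> M' * norm (\<omega> y) * l + M' * l\<^sup>2"
    proof (rule add_mono)
      have "C / \<bar>b\<bar> \<le> M'" using nn(4) unfolding M'_def by simp
      then show "C / \<bar>b\<bar> * norm (\<omega> y) * l \<le> M' * norm (\<omega> y) * l"
        using l by (intro mult_right_mono) auto
      have "LN * Y * C / \<bar>b\<bar> + X * K / b\<^sup>2 + L * M + L * M / \<bar>b\<bar> \<le> M'" using C unfolding M'_def by simp
      then show "(LN * Y * C / \<bar>b\<bar> + X * K / b\<^sup>2 + L * M + L * M / \<bar>b\<bar>) * l\<^sup>2 \<le> M' * l\<^sup>2"
        by (intro mult_right_mono) auto
    qed
    finally show ?thesis by (simp add: l_def)
  qed
  have qc: "Complex s (Im q) = q" using s by (simp add: complex_eq_iff)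
  have \<omega>0: "\<omega> y = 0" if "y \<in> S" for y
  proof (rule discrete_Gronwall[OF S _ that _ _ step])
    show "Im q \<in> S" using r by (simp add: S_def)
    show "\<omega> (Im q) = 0" using b by (simp add: \<omega>_def qc \<xi>q \<kappa>q)
    show "0 \<le> M'" using nn C by (simp add: M'_def)
  qed
  \<comment> \<open>\<open>\<xi>\<close> equals 1 at q and has Lipschitz constant L, so it has no
    zero within this radius.\<close>
  define r' where "r' = min r (1 / (2 * L + 2))"
  have r': "0 < r'" "r' \<le> r" "L * r' < 1"
  proof -
    show "0 < r'" "r' \<le> r" using r L by (auto simp: r'_def)
    have "L * r' \<le> L * (1 / (2 * L + 2))" using L by (intro mult_left_mono) (auto simp: r'_def)
    also have "\<dots> < 1" using L by (simp add: divide_less_eq)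
    finally show "L * r' < 1" .
  qed
  have \<xi>nz: "\<xi> z \<noteq> 0" if "z \<in> ball q r'" "Re z \<le> s" for z
  proof
    assume 0: "\<xi> z = 0"
    have z: "z \<in> closure ?A" using clA that r' by auto
    have "1 \<le> L * norm (z - q)" using lips(1)[OF z q] 0 \<xi>q by simp
    also have "\<dots> \<le> L * r'" using that L by (intro mult_left_mono) (auto simp: dist_norm norm_minus_commute)
    finally show False using r' by simp
  qed
  have sub: "ball q r' \<inter> {z. Re z < s} \<subseteq> ?A" "ball q r' \<inter> {z. Re z \<le> s} \<subseteq> closure ?A"
    using r' clA by (auto simp: A_def)
  have contL: "continuous_on (closure ?A) F" if "\<And>z w. z \<in> closure ?A \<Longrightarrow> w \<in> closure ?A \<Longrightarrow> norm (F z - F w) \<le> L * norm (z - w)" for F :: "complex \<Rightarrow> complex"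
    by (rule lipschitz_on_continuous_on[of L]) (use that L in \<open>auto simp: lipschitz_on_def dist_norm\<close>)
  have hol: "F holomorphic_on ball q r' \<inter> {z. Re z < s}" if "\<And>z. z \<in> ?A \<Longrightarrow> (F has_field_derivative F' z) (at z)" for F F' :: "complex \<Rightarrow> complex"
    by (rule holomorphic_on_subset[OF _ sub(1)]) (use that holomorphic_on_open[OF A(1)] in blast)
  have "\<exists>h. h holomorphic_on ball q r' \<and> (\<forall>z\<in>ball q r'. Re z \<le> s \<longrightarrow> h z = g z)"
  \<comment> \<open>On the line the quotient is \<open>- b * N\<close>, so the second function takes
    the values \<open>2 * f - b * N\<close>, that is \<open>cnj g\<close>.\<close>
  proof (rule reflection_extension[OF s r'(1), of g "\<lambda>z. 2 * f z + (of_real b)\<^sup>2 * \<kappa> z / \<xi> z"])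
    show "g holomorphic_on ball q r' \<inter> {z. Re z < s}" by (rule hol[OF g(1)])
    show "continuous_on (ball q r' \<inter> {z. Re z \<le> s}) g" by (rule continuous_on_subset[OF g(2) sub(2)])
    show "(\<lambda>z. 2 * f z + (of_real b)\<^sup>2 * \<kappa> z / \<xi> z) holomorphic_on ball q r' \<inter> {z. Re z < s}"
      by (intro holomorphic_intros hol[OF f(1)] hol[OF d\<kappa>] hol[OF d\<xi>]) (use \<xi>nz in auto)
    show "continuous_on (ball q r' \<inter> {z. Re z \<le> s}) (\<lambda>z. 2 * f z + (of_real b)\<^sup>2 * \<kappa> z / \<xi> z)"
      by (intro continuous_intros continuous_on_subset[OF f(2) sub(2)] continuous_on_subset[OF contL sub(2)] lips) (use \<xi>nz in auto)
    fix z assume z: "z \<in> ball q r'" "Re z = s"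
    define y where "y = Im z"
    have zc: "z = Complex s y" using z by (simp add: y_def complex_eq_iff)
    have "\<bar>Im (q - z)\<bar> \<le> norm (q - z)" by (rule abs_Im_le_cmod)
    also have "norm (q - z) < r" using z r' by (simp add: dist_norm)
    finally have "y \<in> S" by (simp add: S_def y_def abs_minus_commute)
    from \<omega>0[OF this] have "\<kappa> z = - (N z / of_real b * \<xi> z)" by (simp add: \<omega>_def zc eq_neg_iff_add_eq_0)
    moreover have "2 * f z = of_real b * N z + cnj (g z)" using line[of z] z r' by auto
    ultimately show "2 * f z + (of_real b)\<^sup>2 * \<kappa> z / \<xi> z = cnj (g z)"
      using \<xi>nz[of z] z b by (simp add: power2_eq_square)
  qed
  then show ?thesis using r' by blast
qed

section \<open>Boundary estimates from tangent discs on a band\<close>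

lemma real_valued_holomorphic_const:
  assumes "open W" "connected W" "h holomorphic_on W" and Im: "\<And>z. z \<in> W \<Longrightarrow> Im (h z) = 0"
  shows "\<exists>P::real. \<forall>z\<in>W. h z = of_real P"
proof -
  have "deriv h z = 0" if z: "z \<in> W" for z
  proof -
    have zc: "Complex (Re z) (Im z) = z" by simp
    have line: "\<forall>\<^sub>F y in nhds (Im z). Complex (Re z) y \<in> W"
    proof -
      have "isCont (\<lambda>y. Complex (Re z) y) (Im z)" unfolding Complex_eq by (intro continuous_intros)
      then show ?thesis using z \<open>open W\<close> by (simp add: continuous_at_open eventually_nhds)
    qed
    have across: "\<forall>\<^sub>F x in nhds (Re z). Complex x (Im z) \<in> W"
    proof -
      have "isCont (\<lambda>x. Complex x (Im z)) (Re z)" unfolding Complex_eq by (intro continuous_intros)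
      then show ?thesis using z \<open>open W\<close> by (simp add: continuous_at_open eventually_nhds)
    qed
    have "((\<lambda>y. 0) has_real_derivative Re (deriv h z)) (at (Im z))"
      using has_derivative_along_line(2)[OF assms(3,1), of "Re z" "Im z"] z
      by (subst DERIV_cong_ev[OF refl _ refl, symmetric]) (use line in \<open>auto elim!: eventually_mono simp: Im\<close>)
    then have 1: "Re (deriv h z) = 0" using DERIV_unique DERIV_const by blast
    have "((\<lambda>x. 0) has_real_derivative Im (deriv h z)) (at (Re z))"
      using has_derivative_across_line(2)[OF assms(3,1), of "Re z" "Im z"] z
      by (subst DERIV_cong_ev[OF refl _ refl, symmetric]) (use across in \<open>auto elim!: eventually_mono simp: Im\<close>)
    then have 2: "Im (deriv h z) = 0" using DERIV_unique DERIV_const by blast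
    show ?thesis using 1 2 by (simp add: complex_eq_iff)
  qed
  then have "(h has_field_derivative 0) (at z)" if "z \<in> W" for z
    using holomorphic_derivI[OF assms(3,1) that, of UNIV] that by simp
  then obtain c where c: "\<And>z. z \<in> W \<Longrightarrow> h z = c"
    using DERIV_zero_connected_constant[OF assms(2,1) finite.emptyI holomorphic_on_imp_continuous_on[OF assms(3)]] by auto
  show ?thesis
  proof (cases "W = {}")
    case False
    then obtain w where "w \<in> W" by auto
    then have "c = of_real (Re c)" using Im[of w] c[of w] by (simp add: complex_eq_iff)
    then show ?thesis using c by metis
  qed auto
qed

lemma one_sided_derivative_nonneg:
  fixes h :: "real \<Rightarrow> real"
  assumes "(h has_real_derivative d) (at 0 within {0..l})" "0 < l" "h 0 = 0"
    and "0 < t\<^sub>0" "\<And>t. 0 < t \<Longrightarrow> t < t\<^sub>0 \<Longrightarrow> 0 \<le> h t"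
  shows "0 \<le> d"
proof (rule ccontr)
  assume "\<not> 0 \<le> d"
  then obtain e where e: "e > 0" "\<And>t. 0 < t \<Longrightarrow> t \<in> {0..l} \<Longrightarrow> t < e \<Longrightarrow> h t < h 0"
    using has_real_derivative_neg_dec_right[OF assms(1)] by auto
  define t where "t = min l (min (e / 2) (t\<^sub>0 / 2))"
  have "0 < t" "t \<in> {0..l}" "t < e" "t < t\<^sub>0" using assms e by (auto simp: t_def min_def)
  then show False using e(2)[of t] assms(5)[of t] assms(3) by simp
qed

lemma has_real_derivative_norm_squared:
  fixes \<gamma> :: "real \<Rightarrow> complex"
  assumes "(\<gamma> has_vector_derivative v) (at 0 within S)"
  shows "((\<lambda>t. (norm (\<gamma> t - e))\<^sup>2) has_real_derivative 2 * ((\<gamma> 0 - e) \<bullet> v)) (at 0 within S)"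
proof -
  have "((\<lambda>t. \<gamma> t - e) has_derivative (\<lambda>h. h *\<^sub>R v)) (at 0 within S)"
    using assms unfolding has_vector_derivative_def by (auto intro!: derivative_eq_intros)
  from has_derivative_inner[OF this this] show ?thesis
    unfolding power2_norm_eq_inner has_field_derivative_def
    by (rule has_derivative_eq_rhs) (auto simp: fun_eq_iff inner_commute algebra_simps)
qed

text \<open>Expand the square. For d a chord from the point of tangency, staying outside the disc
  amounts to a quadratic bound on the normal component; this is the form in which the curvature
  bound of the boundary is used.\<close>

lemma norm_sub_of_real_mult_ge_iff:
  fixes d \<nu> :: complex
  assumes "norm \<nu> = 1" "0 < r"
  shows "r \<le> norm (d - of_real r * \<nu>) \<longleftrightarrow> 2 * r * (\<nu> \<bullet> d) \<le> (norm d)\<^sup>2"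
proof -
  have "r \<le> norm (d - of_real r * \<nu>) \<longleftrightarrow> r\<^sup>2 \<le> (norm (d - of_real r * \<nu>))\<^sup>2"
    using assms by (simp add: power2_le_iff_abs_le)
  also have "(norm (d - of_real r * \<nu>))\<^sup>2 = (norm d)\<^sup>2 - 2 * r * (\<nu> \<bullet> d) + r\<^sup>2 * (norm \<nu>)\<^sup>2"
    unfolding power2_norm_eq_inner scaleR_conv_of_real[symmetric]
    by (simp add: inner_diff inner_commute algebra_simps power2_eq_square)
  finally show ?thesis using assms by simp
qed

lemma Re_cnj_mult: "Re (cnj a * b) = a \<bullet> b"
  by (simp add: inner_complex_def)

lemma quasi_periodic_shift:
  fixes F :: "complex \<Rightarrow> complex"
  assumes F: "\<And>z. z \<in> closed_band s\<^sub>1 s\<^sub>2 \<Longrightarrow> F (z + \<i> * of_real T) = F z + \<sigma>" and z: "z \<in> closed_band s\<^sub>1 s\<^sub>2"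
  shows "F (z + \<i> * of_real (of_int n * T)) = F z + of_int n * \<sigma>"
proof (induction n rule: int_induct[where k = 0])
  case base
  show ?case by simp
next
  case (step1 i)
  define w where "w = z + \<i> * of_real (of_int i * T)"
  have "w \<in> closed_band s\<^sub>1 s\<^sub>2" using z by (simp add: w_def closed_band_def)
  moreover have e: "z + \<i> * of_real (of_int (i + 1) * T) = w + \<i> * of_real T"
    by (simp add: w_def algebra_simps)
  moreover have "F w = F z + of_int i * \<sigma>" using step1 by (simp only: w_def)
  ultimately show ?case unfolding e using F[of w] by (simp add: distrib_right)
next
  case (step2 i)
  define w where "w = z + \<i> * of_real (of_int (i - 1) * T)"
  have "w \<in> closed_band s\<^sub>1 s\<^sub>2" using z by (simp add: w_def closed_band_def)
  moreover have "z + \<i> * of_real (of_int i * T) = w + \<i> * of_real T"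
    by (simp add: w_def algebra_simps)
  ultimately have "F z + of_int i * \<sigma> = F w + \<sigma>" using F[of w] step2 by (simp only:)
  then show ?case unfolding w_def[symmetric] by (simp add: algebra_simps)
qed

lemma reduce_to_period:
  fixes T :: real
  assumes T: "0 < T"
  obtains n :: int where "0 \<le> Im z - of_int n * T" "Im z - of_int n * T \<le> T"
proof
  define n where "n = \<lfloor>Im z / T\<rfloor>"
  have "of_int n \<le> Im z / T" "Im z / T < of_int n + 1" by (simp_all add: n_def)
  then show "0 \<le> Im z - of_int n * T" "Im z - of_int n * T \<le> T"
    using T by (auto simp: field_simps)
qed

text \<open>Regularity of the boundary is encoded by tangent discs of one radius r on either side,
  which requires no parametrisation. The additive periods \<tau> and \<tau>' admit a domain that is
  only translation invariant. The equations \<open>left\<close> and \<open>right\<close> are the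
  overdetermined conditions in terms of f, with a constant for each line.\<close>

locale strip =
  fixes s\<^sub>1 s\<^sub>2 T :: real and g f \<nu> :: "complex \<Rightarrow> complex" and \<tau> \<tau>' :: complex and b\<^sub>1 b\<^sub>2 r :: real
  assumes s: "s\<^sub>1 < s\<^sub>2" and T: "0 < T"
    and g_diff: "\<And>z. z \<in> closed_band s\<^sub>1 s\<^sub>2 \<Longrightarrow> g field_differentiable (at z within closed_band s\<^sub>1 s\<^sub>2)"
    and f_cont: "continuous_on (closed_band s\<^sub>1 s\<^sub>2) f" and f_hol: "f holomorphic_on open_band s\<^sub>1 s\<^sub>2"
    and g_per: "\<And>z. z \<in> closed_band s\<^sub>1 s\<^sub>2 \<Longrightarrow> g (z + \<i> * of_real T) = g z + \<tau>"
    and f_per: "\<And>z. z \<in> closed_band s\<^sub>1 s\<^sub>2 \<Longrightarrow> f (z + \<i> * of_real T) = f z + \<tau>'"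
    and dg: "\<And>z. z \<in> open_band s\<^sub>1 s\<^sub>2 \<Longrightarrow> deriv g z \<noteq> 0"
    and r: "0 < r"
    and \<nu>: "\<And>z. Re z \<in> {s\<^sub>1, s\<^sub>2} \<Longrightarrow> norm (\<nu> z) = 1"
    and inner_disc: "\<And>z. Re z \<in> {s\<^sub>1, s\<^sub>2} \<Longrightarrow> ball (g z - of_real r * \<nu> z) r \<subseteq> g ` open_band s\<^sub>1 s\<^sub>2"
    and outer_disc: "\<And>z. Re z \<in> {s\<^sub>1, s\<^sub>2} \<Longrightarrow> ball (g z + of_real r * \<nu> z) r \<inter> g ` closed_band s\<^sub>1 s\<^sub>2 = {}"
    and bdry: "\<And>z. Re z \<in> {s\<^sub>1, s\<^sub>2} \<Longrightarrow> g z \<notin> g ` open_band s\<^sub>1 s\<^sub>2"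
    and left: "\<And>z. Re z = s\<^sub>1 \<Longrightarrow> 2 * f z = of_real b\<^sub>1 * cnj (\<nu> z) + cnj (g z)"
    and right: "\<And>z. Re z = s\<^sub>2 \<Longrightarrow> 2 * f z = of_real b\<^sub>2 * cnj (\<nu> z) + cnj (g z)"
    and nonconst: "\<exists>z\<in>open_band s\<^sub>1 s\<^sub>2. deriv f z \<noteq> 0"
begin

abbreviation "C \<equiv> closed_band s\<^sub>1 s\<^sub>2"
abbreviation "B \<equiv> open_band s\<^sub>1 s\<^sub>2"

lemma g_cont: "continuous_on C g"
  using g_diff field_differentiable_imp_continuous_at continuous_on_eq_continuous_within by blast

lemma g_hol: "g holomorphic_on B"
  unfolding holomorphic_on_def
  using g_diff open_band_subset_closed_band field_differentiable_within_subset by blast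

lemma B_sub_C: "B \<subseteq> C" by (rule open_band_subset_closed_band)

lemma line_in_C: "Re z \<in> {s\<^sub>1, s\<^sub>2} \<Longrightarrow> z \<in> C"
  using s by (auto simp: closed_band_def)

lemma shift_in_C: "z + \<i> * of_real y \<in> C \<longleftrightarrow> z \<in> C"
  by (simp add: closed_band_def)

lemma shift_in_B: "z + \<i> * of_real y \<in> B \<longleftrightarrow> z \<in> B"
  by (simp add: open_band_def)

definition "period_box = cbox (Complex s\<^sub>1 0) (Complex s\<^sub>2 T)"

lemma period_box: "z \<in> period_box \<longleftrightarrow> z \<in> C \<and> 0 \<le> Im z \<and> Im z \<le> T"
  by (auto simp: period_box_def in_cbox_complex_iff closed_band_def)

text \<open>The additive period cancels in the difference, so its values on one compact period box
  are all its values. This supplies the boundedness that the maximum principle on an unbounded band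
  requires.\<close>

lemma quasi_periodic_difference_bounded:
  fixes F :: "complex \<Rightarrow> complex"
  assumes F: "\<And>z. z \<in> C \<Longrightarrow> F (z + \<i> * of_real T) = F z + \<sigma>" and cont: "continuous_on C F"
  shows "bounded ((\<lambda>z. F (z + \<i> * of_real h) - F z) ` C)"
proof -
  let ?D = "\<lambda>z. F (z + \<i> * of_real h) - F z"
  have "continuous_on period_box ?D"
    by (intro continuous_intros continuous_on_compose2[OF cont]) (auto simp: period_box shift_in_C)
  moreover have "compact period_box" by (simp add: period_box_def)
  ultimately have "compact (?D ` period_box)" by (rule compact_continuous_image)
  moreover have "?D ` C \<subseteq> ?D ` period_box"
  proof
    fix w assume "w \<in> ?D ` C"
    then obtain z where z: "z \<in> C" "w = ?D z" by auto
    obtain n where n: "0 \<le> Im z - of_int n * T" "Im z - of_int n * T \<le> T" by (rule reduce_to_period[OF T])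
    define z' where "z' = z + \<i> * of_real (of_int (- n) * T)"
    have "z' \<in> C" unfolding z'_def shift_in_C by (rule z(1))
    then have z': "z' \<in> period_box" using n by (simp add: period_box z'_def)
    have "F z' = F z + of_int (- n) * \<sigma>"
      unfolding z'_def by (rule quasi_periodic_shift[where F = F and \<sigma> = \<sigma>, OF F z(1)])
    moreover have "F (z' + \<i> * of_real h) = F (z + \<i> * of_real h) + of_int (- n) * \<sigma>"
    proof -
      have "z' + \<i> * of_real h = z + \<i> * of_real h + \<i> * of_real (of_int (- n) * T)" by (simp add: z'_def)
      then show ?thesis using quasi_periodic_shift[where F = F and \<sigma> = \<sigma> and z = "z + \<i> * of_real h" and n = "- n", OF F] z by (simp only: shift_in_C)
    qed
    ultimately have "w = ?D z'" using z by simp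
    then show "w \<in> ?D ` period_box" using z' by blast
  qed
  ultimately show ?thesis by (meson bounded_subset compact_imp_bounded)
qed

text \<open>Vertical increments are holomorphic in z, so their bound on the two lines passes to the
  band by the maximum principle, and only then does h tend to 0. No boundary value of
  \<open>deriv F\<close> is involved.\<close>

lemma derivative_bound_from_lines:
  fixes F :: "complex \<Rightarrow> complex"
  assumes F: "\<And>z. z \<in> C \<Longrightarrow> F (z + \<i> * of_real T) = F z + \<sigma>" and cont: "continuous_on C F"
    and hol: "F holomorphic_on B" and K: "0 < K"
    and lines: "\<And>z h. Re z \<in> {s\<^sub>1, s\<^sub>2} \<Longrightarrow> 0 < h \<Longrightarrow> norm (F (z + \<i> * of_real h) - F z) \<le> K * h"
  shows "\<And>z. z \<in> B \<Longrightarrow> norm (deriv F z) \<le> K"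
    and "\<And>z w. z \<in> C \<Longrightarrow> w \<in> C \<Longrightarrow> norm (F z - F w) \<le> K * norm (z - w)"
proof -
  have D: "norm (F (z + \<i> * of_real h) - F z) \<le> K * h" if h: "0 < h" and z: "z \<in> C" for z h
  proof (rule norm_le_on_band[OF s _ _ quasi_periodic_difference_bounded[where F = F and \<sigma> = \<sigma>, OF F cont] _ _ z])
    have "(\<lambda>z. F (z + \<i> * of_real h)) holomorphic_on B"
      by (rule holomorphic_on_compose_gen[OF _ hol, unfolded o_def]) (auto intro!: holomorphic_intros simp: shift_in_B)
    then show "(\<lambda>z. F (z + \<i> * of_real h) - F z) holomorphic_on B" by (intro holomorphic_intros hol)
    show "continuous_on C (\<lambda>z. F (z + \<i> * of_real h) - F z)"
      by (intro continuous_intros continuous_on_compose2[OF cont] cont) (auto simp: shift_in_C)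
  qed (use h K lines in auto)
  show bound: "norm (deriv F z) \<le> K" if z: "z \<in> B" for z
  proof -
    have "(F has_field_derivative deriv F z) (at z)"
      using hol open_open_band z holomorphic_derivI by blast
    then have "((\<lambda>w. (F (z + w) - F z) / w) \<longlongrightarrow> deriv F z) (at 0)" by (simp add: DERIV_def)
    moreover have "filterlim (\<lambda>h. \<i> * of_real h) (at 0) (at_right (0::real))"
      unfolding filterlim_at by (auto intro!: tendsto_eq_intros simp: eventually_at_right_field intro: exI[of _ 1])
    ultimately have "((\<lambda>h. (F (z + \<i> * of_real h) - F z) / (\<i> * of_real h)) \<longlongrightarrow> deriv F z) (at_right 0)"
      by (rule filterlim_compose)
    then have "((\<lambda>h. norm ((F (z + \<i> * of_real h) - F z) / (\<i> * of_real h))) \<longlongrightarrow> norm (deriv F z)) (at_right 0)"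
      by (rule tendsto_norm)
    moreover have "\<forall>\<^sub>F h in at_right 0. norm ((F (z + \<i> * of_real h) - F z) / (\<i> * of_real h)) \<le> K"
      using D z B_sub_C by (auto simp: eventually_at_right_field norm_divide norm_mult divide_le_eq intro!: exI[of _ 1])
    ultimately show ?thesis by (rule tendsto_upperbound) simp
  qed
  show "norm (F z - F w) \<le> K * norm (z - w)" if zw: "z \<in> C" "w \<in> C" for z w
  proof -
    have "K-lipschitz_on B F"
    proof (rule lipschitz_onI)
      show "dist (F x) (F y) \<le> K * dist x y" if "x \<in> B" "y \<in> B" for x y
        unfolding dist_norm
        by (rule field_differentiable_bound[OF convex_open_band _ bound that])
           (use hol open_open_band in \<open>auto intro: holomorphic_derivI\<close>)
    qed (use K in simp)
    then have "K-lipschitz_on (closure B) F"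
      by (rule lipschitz_on_closure) (simp add: closure_open_band[OF s] cont)
    then show ?thesis using zw by (auto simp: lipschitz_on_def dist_norm closure_open_band[OF s])
  qed
qed

text \<open>Negation of z exchanges the two lines while the domain and its normals stay the same, so
  whatever is proved for the right line transfers to the left one. The shift by T is reversed, hence
  the signs of the periods.\<close>

lemma reflected: "strip (- s\<^sub>2) (- s\<^sub>1) T (\<lambda>z. g (- z)) (\<lambda>z. f (- z)) (\<lambda>z. \<nu> (- z)) (- \<tau>) (- \<tau>') b\<^sub>2 b\<^sub>1 r"
proof -
  have neg: "- z \<in> C \<longleftrightarrow> z \<in> closed_band (- s\<^sub>2) (- s\<^sub>1)" "- z \<in> B \<longleftrightarrow> z \<in> open_band (- s\<^sub>2) (- s\<^sub>1)" for z
    by (auto simp: closed_band_def open_band_def)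
  have imC: "uminus ` closed_band (- s\<^sub>2) (- s\<^sub>1) = C" and imO: "uminus ` open_band (- s\<^sub>2) (- s\<^sub>1) = B"
  proof -
    show "uminus ` closed_band (- s\<^sub>2) (- s\<^sub>1) = C"
    proof (intro set_eqI iffI)
      fix z assume "z \<in> C"
      then show "z \<in> uminus ` closed_band (- s\<^sub>2) (- s\<^sub>1)"
        by (intro image_eqI[of _ _ "- z"]) (auto simp: closed_band_def)
    qed (auto simp: closed_band_def)
    show "uminus ` open_band (- s\<^sub>2) (- s\<^sub>1) = B"
    proof (intro set_eqI iffI)
      fix z assume "z \<in> B"
      then show "z \<in> uminus ` open_band (- s\<^sub>2) (- s\<^sub>1)"
        by (intro image_eqI[of _ _ "- z"]) (auto simp: open_band_def)
    qed (auto simp: open_band_def)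
  qed
  have gC: "(\<lambda>z. g (- z)) ` closed_band (- s\<^sub>2) (- s\<^sub>1) = g ` C" and gO: "(\<lambda>z. g (- z)) ` open_band (- s\<^sub>2) (- s\<^sub>1) = g ` B"
    unfolding imC[symmetric] imO[symmetric] by (simp_all add: image_image)
  have Dneg: "deriv (\<lambda>z. F (- z)) z = - deriv F (- z)" if "F holomorphic_on B" "z \<in> open_band (- s\<^sub>2) (- s\<^sub>1)" for F z
  proof (rule DERIV_imp_deriv)
    have "(F has_field_derivative deriv F (- z)) (at (- z))"
      using that neg open_open_band holomorphic_derivI by blast
    moreover have "(uminus has_field_derivative -1) (at z)" by (auto intro!: derivative_eq_intros)
    ultimately show "((\<lambda>z. F (- z)) has_field_derivative - deriv F (- z)) (at z)"
      using DERIV_chain2 by fastforce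
  qed
  have per: "F (- (z + \<i> * of_real T)) = F (- z) + - \<sigma>"
    if "\<And>z. z \<in> C \<Longrightarrow> F (z + \<i> * of_real T) = F z + \<sigma>" "z \<in> closed_band (- s\<^sub>2) (- s\<^sub>1)" for F :: "complex \<Rightarrow> complex" and z \<sigma>
    using quasi_periodic_shift[where F = F and \<sigma> = \<sigma> and z = "- z" and n = "-1", OF that(1)] that(2) neg by simp
  have lines: "Re (- z) \<in> {s\<^sub>1, s\<^sub>2}" if "Re z \<in> {- s\<^sub>2, - s\<^sub>1}" for z using that by auto
  show ?thesis
  proof
    show "(\<lambda>z. g (- z)) field_differentiable (at z within closed_band (- s\<^sub>2) (- s\<^sub>1))"
      if "z \<in> closed_band (- s\<^sub>2) (- s\<^sub>1)" for z
    proof -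
      have "(g \<circ> uminus) field_differentiable (at z within closed_band (- s\<^sub>2) (- s\<^sub>1))"
        by (rule field_differentiable_compose_within[of uminus _ _ g])
           (use that neg g_diff imC in \<open>auto intro: field_differentiable_minus field_differentiable_ident\<close>)
      then show ?thesis by (simp add: o_def)
    qed
    show "continuous_on (closed_band (- s\<^sub>2) (- s\<^sub>1)) (\<lambda>z. f (- z))"
      by (rule continuous_on_compose2[OF f_cont]) (auto intro!: continuous_intros simp: imC)
    show "(\<lambda>z. f (- z)) holomorphic_on open_band (- s\<^sub>2) (- s\<^sub>1)"
      by (rule holomorphic_on_compose_gen[OF _ f_hol, unfolded o_def]) (auto intro!: holomorphic_intros simp: neg)
    show "deriv (\<lambda>z. g (- z)) z \<noteq> 0" if "z \<in> open_band (- s\<^sub>2) (- s\<^sub>1)" for z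
      using Dneg[OF g_hol that] dg neg(2) that by simp
    show "\<exists>z\<in>open_band (- s\<^sub>2) (- s\<^sub>1). deriv (\<lambda>z. f (- z)) z \<noteq> 0"
    proof -
      obtain z where "z \<in> B" "deriv f z \<noteq> 0" using nonconst by blast
      then show ?thesis using Dneg[OF f_hol, of "- z"] neg(2)[of "- z"] by (intro bexI[of _ "- z"]) auto
    qed
  qed (use s T r gC gO \<nu>[OF lines] inner_disc[OF lines] outer_disc[OF lines] bdry[OF lines] left right per[of g \<tau>, OF g_per] per[of f \<tau>', OF f_per] in auto)
qed

end

context strip
begin

text \<open>Uniform continuity on a compact period box, moved along the band by the additive
  period.\<close>

lemma right_uniform:
  "\<exists>d>0. \<forall>z\<in>C. s\<^sub>2 - Re z < d \<longrightarrow> norm (g z - g (Complex s\<^sub>2 (Im z))) < r / 2"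
proof -
  have "compact period_box" by (simp add: period_box_def)
  moreover have "continuous_on period_box g"
    by (rule continuous_on_subset[OF g_cont]) (auto simp: period_box)
  ultimately have "uniformly_continuous_on period_box g" by (rule compact_uniformly_continuous[rotated])
  then obtain d where d: "d > 0" "\<And>z w. z \<in> period_box \<Longrightarrow> w \<in> period_box \<Longrightarrow> dist z w < d \<Longrightarrow> dist (g z) (g w) < r / 2"
    using r unfolding uniformly_continuous_on_def by (meson half_gt_zero)
  have "norm (g z - g (Complex s\<^sub>2 (Im z))) < r / 2" if z: "z \<in> C" "s\<^sub>2 - Re z < d" for z
  proof -
    obtain n where n: "0 \<le> Im z - of_int n * T" "Im z - of_int n * T \<le> T" by (rule reduce_to_period[OF T])
    define w where "w = Complex s\<^sub>2 (Im z)"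
    have w: "w \<in> C" using s by (simp add: w_def closed_band_def)
    define z' w' where "z' = z + \<i> * of_real (of_int (- n) * T)" and "w' = w + \<i> * of_real (of_int (- n) * T)"
    have "z' \<in> C" "w' \<in> C" unfolding z'_def w'_def shift_in_C by (rule z w)+
    then have "z' \<in> period_box" "w' \<in> period_box" using n by (simp_all add: period_box z'_def w'_def w_def)
    moreover have "dist z' w' < d"
    proof -
      have "z' - w' = of_real (Re z - s\<^sub>2)" by (simp add: z'_def w'_def w_def complex_eq_iff)
      then have "dist z' w' = \<bar>Re z - s\<^sub>2\<bar>" by (simp only: dist_norm norm_of_real)
      then show ?thesis using z by (auto simp: closed_band_def)
    qed
    ultimately have "dist (g z') (g w') < r / 2" by (rule d)
    moreover have "g z' = g z + of_int (- n) * \<tau>" "g w' = g w + of_int (- n) * \<tau>"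
      unfolding z'_def w'_def using quasi_periodic_shift[where F = g and \<sigma> = \<tau>, OF g_per] z(1) w by blast+
    ultimately show ?thesis by (simp add: dist_norm w_def)
  qed
  then show ?thesis using d(1) by blast
qed

text \<open>Hopf's boundary point lemma: \<open>exp (n z) / (g z - e)\<close> obeys the maximum principle where
  \<open>\<bar>g z - e\<bar> > r/2\<close>, with \<open>e\<close> the centre of the interior disc at \<open>g q\<close>.\<close>

lemma right_barrier:
  "\<exists>n>0. \<forall>q z. Re q = s\<^sub>2 \<longrightarrow> z \<in> B \<longrightarrow> r / 2 < norm (g z - (g q - of_real r * \<nu> q)) \<longrightarrow>
     r * exp (n * (Re z - s\<^sub>2)) \<le> norm (g z - (g q - of_real r * \<nu> q))"
proof -
  obtain d where d: "d > 0" "\<And>z. z \<in> C \<Longrightarrow> s\<^sub>2 - Re z < d \<Longrightarrow> norm (g z - g (Complex s\<^sub>2 (Im z))) < r / 2"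
    using right_uniform by blast
  \<comment> \<open>By the choice of d, inside the band the value r/2 of the distance to e is
    attained only at distance at least d from the line; there
    \<open>exp (n * (Re z - s\<^sub>2))\<close> is at most 1/2 and makes up for the smaller
    denominator.\<close>
  define n where "n = ln 2 / d"
  have n: "n > 0" "exp (n * d) = 2" using d by (simp_all add: n_def)
  have "r * exp (n * (Re z\<^sub>0 - s\<^sub>2)) \<le> norm (g z\<^sub>0 - e)"
    if q: "Re q = s\<^sub>2" and e: "e = g q - of_real r * \<nu> q" and z\<^sub>0: "z\<^sub>0 \<in> B" "r / 2 < norm (g z\<^sub>0 - e)" for q e z\<^sub>0
  proof -
    have far: "r \<le> norm (g z - e)" if "Re z \<in> {s\<^sub>1, s\<^sub>2}" for z
    proof (rule ccontr)
      assume "\<not> r \<le> norm (g z - e)"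
      then have "g z \<in> ball e r" by (simp add: dist_norm norm_minus_commute)
      then show False using inner_disc[of q] bdry[OF that] q e by auto
    qed
    define V where "V = B \<inter> g -` (- cball e (r / 2))"
    have V: "open V" unfolding V_def
      by (rule continuous_open_preimage[OF continuous_on_subset[OF g_cont B_sub_C] open_open_band]) (simp add: open_Compl)
    have "closed (C \<inter> g -` (- ball e (r / 2)))"
      by (rule continuous_closed_preimage[OF g_cont closed_closed_band]) (simp add: closed_Compl)
    moreover have "V \<subseteq> C \<inter> g -` (- ball e (r / 2))" using B_sub_C by (auto simp: V_def)
    ultimately have "closure V \<subseteq> C \<inter> g -` (- ball e (r / 2))" by (rule closure_minimal[rotated])
    then have clV: "z \<in> C" "r / 2 \<le> norm (g z - e)" if "z \<in> closure V" for z
      using that by (auto simp: dist_norm norm_minus_commute)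
    let ?F = "\<lambda>z. exp (of_real n * z) / (g z - e)"
    have Fn: "norm (?F z) = exp (n * Re z) / norm (g z - e)" for z by (simp add: norm_divide)
    have nz: "g z - e \<noteq> 0" if "z \<in> closure V" for z using clV(2)[OF that] r by auto
    have "norm (?F z\<^sub>0) \<le> exp (n * s\<^sub>2) / r"
    proof (rule Phragmen_Lindelof_band[where f = ?F, OF V])
      show "\<bar>Re z\<bar> \<le> \<bar>s\<^sub>1\<bar> + \<bar>s\<^sub>2\<bar>" if "z \<in> V" for z using that by (auto simp: V_def open_band_def)
      show "?F holomorphic_on V"
      proof (intro holomorphic_on_divide)
        have "V \<subseteq> B" by (auto simp: V_def)
        then show "(\<lambda>z. g z - e) holomorphic_on V" by (intro holomorphic_intros holomorphic_on_subset[OF g_hol])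
        show "g z - e \<noteq> 0" if "z \<in> V" for z
          using nz[of z] closure_subset[of V] that by blast
      qed (intro holomorphic_intros)
      show "continuous_on (closure V) ?F"
      proof (intro continuous_on_divide)
        have "closure V \<subseteq> C" using clV by blast
        then show "continuous_on (closure V) (\<lambda>z. g z - e)" by (intro continuous_intros continuous_on_subset[OF g_cont])
        show "\<forall>z\<in>closure V. g z - e \<noteq> 0" using nz by blast
      qed (intro continuous_intros)
      have "norm (?F z) \<le> exp (n * s\<^sub>2) / (r / 2)" if "z \<in> closure V" for z
        unfolding Fn using clV[OF that] r n by (intro frac_le) (auto simp: closed_band_def)
      then show "bounded (?F ` closure V)" unfolding bounded_iff by blast
      show "0 < exp (n * s\<^sub>2) / r" using r by simp
      show "z\<^sub>0 \<in> V" using z\<^sub>0 by (auto simp: V_def dist_norm norm_minus_commute)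
      fix z assume z: "z \<in> frontier V"
      then have zc: "z \<in> closure V" "z \<notin> V" using V by (auto simp: frontier_def interior_open)
      note zC = clV[OF zc(1)]
      show "norm (?F z) \<le> exp (n * s\<^sub>2) / r"
      proof (cases "z \<in> B")
        case False
        then have "Re z \<in> {s\<^sub>1, s\<^sub>2}" using zC(1) by (auto simp: open_band_def closed_band_def)
        from far[OF this] show ?thesis
          unfolding Fn using r zC(1) n by (intro frac_le) (auto simp: closed_band_def)
      next
        case True
        then have eq: "norm (g z - e) = r / 2"
          using zc zC by (auto simp: V_def dist_norm norm_minus_commute)
        have "r \<le> norm (g (Complex s\<^sub>2 (Im z)) - e)" by (rule far) simp
        also have "\<dots> \<le> norm (g z - e) + norm (g z - g (Complex s\<^sub>2 (Im z)))"
          using norm_triangle_ineq4[of "g z - e" "g z - g (Complex s\<^sub>2 (Im z))"] by simp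
        finally have "\<not> s\<^sub>2 - Re z < d" using d(2)[OF zC(1)] eq by auto
        then have "n * Re z \<le> n * (s\<^sub>2 - d)" using n by (intro mult_left_mono) auto
        then have "exp (n * Re z) \<le> exp (n * (s\<^sub>2 - d))" by simp
        also have "\<dots> = exp (n * s\<^sub>2) / 2" using n(2) by (simp add: right_diff_distrib exp_diff)
        finally have "exp (n * Re z) \<le> exp (n * s\<^sub>2) / 2" .
        then have "exp (n * Re z) / (r / 2) \<le> exp (n * s\<^sub>2) / 2 / (r / 2)" using r by (intro divide_right_mono) auto
        then show ?thesis unfolding Fn eq by simp
      qed
    qed
    then have "exp (n * Re z\<^sub>0) / norm (g z\<^sub>0 - e) \<le> exp (n * s\<^sub>2) / r" unfolding Fn .
    moreover have "norm (g z\<^sub>0 - e) > 0" using z\<^sub>0 r by linarith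
    ultimately have "r * exp (n * Re z\<^sub>0) \<le> exp (n * s\<^sub>2) * norm (g z\<^sub>0 - e)"
      using r by (simp add: field_simps)
    then have "r * exp (n * Re z\<^sub>0) / exp (n * s\<^sub>2) \<le> norm (g z\<^sub>0 - e)" by (simp add: field_simps)
    then show ?thesis by (simp add: right_diff_distrib exp_diff)
  qed
  then show ?thesis using n by blast
qed

text \<open>Three comparisons at \<open>g q\<close>: the outer disc along the inward path gives
  \<open>0 \<le> \<nu> q \<bullet> D\<close>, the inner disc in both directions of the line gives
  \<open>\<nu> q \<bullet> (\<i> * D) = 0\<close>, and the barrier gives the upper bound. So D is a
  non-negative multiple of the normal; that it is not zero comes only later, from the nonvanishing
  of P.\<close>

lemma right_derivative:
  "\<exists>K>0. \<forall>q D. Re q = s\<^sub>2 \<longrightarrow> (g has_field_derivative D) (at q within C) \<longrightarrow>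
     cnj (\<nu> q) * D = of_real (norm D) \<and> norm D \<le> K"
proof -
  obtain n where n: "n > 0" "\<And>q z. Re q = s\<^sub>2 \<Longrightarrow> z \<in> B \<Longrightarrow> r / 2 < norm (g z - (g q - of_real r * \<nu> q)) \<Longrightarrow>
     r * exp (n * (Re z - s\<^sub>2)) \<le> norm (g z - (g q - of_real r * \<nu> q))"
    using right_barrier by blast
  have "cnj (\<nu> q) * D = of_real (norm D) \<and> norm D \<le> n * r"
    if q: "Re q = s\<^sub>2" and D: "(g has_field_derivative D) (at q within C)" for q D
  proof -
    define l where "l = s\<^sub>2 - s\<^sub>1"
    have l: "0 < l" using s by (simp add: l_def)
    have qs: "Re q \<in> {s\<^sub>1, s\<^sub>2}" using q by simp
    have n\<nu>: "norm (\<nu> q) = 1" by (rule \<nu>[OF qs])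
    define e where "e = g q - of_real r * \<nu> q"
    define e' where "e' = g q + of_real r * \<nu> q"
    have path: "((\<lambda>t. g (q + of_real t * w)) has_vector_derivative w * D) (at 0 within {0..l})"
      if "\<And>t. t \<in> {0..l} \<Longrightarrow> q + of_real t * w \<in> C" for w
    proof -
      have 1: "((\<lambda>t. q + of_real t * w) has_vector_derivative w) (at 0 within {0..l})"
        by (auto intro!: derivative_eq_intros)
      have "(g has_field_derivative D) (at (q + of_real 0 * w) within (\<lambda>t. q + of_real t * w) ` {0..l})"
        using D that by (auto intro: has_field_derivative_subset)
      from field_vector_diff_chain_within[OF 1 this] show ?thesis by (simp add: o_def)
    qed
    have inC: "q + of_real t * (-1) \<in> C" "q + of_real t * \<i> \<in> C" "q + of_real t * (- \<i>) \<in> C" if "t \<in> {0..l}" for t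
      using that q s by (auto simp: closed_band_def l_def)
    have e0: "g (q + of_real 0 * w) - e = of_real r * \<nu> q" "g (q + of_real 0 * w) - e' = - (of_real r * \<nu> q)" for w
      by (simp_all add: e_def e'_def)
    have nr: "(norm (of_real r * \<nu> q))\<^sup>2 = r\<^sup>2" using r n\<nu> by (simp add: norm_mult)
    have outer: "r \<le> norm (g z - e')" if "z \<in> C" for z
    proof (rule ccontr)
      assume "\<not> r \<le> norm (g z - e')"
      then have "g z \<in> ball e' r" by (simp add: dist_norm norm_minus_commute)
      then show False using outer_disc[OF qs] that by (auto simp: e'_def)
    qed
    have inner: "r \<le> norm (g z - e)" if "Re z \<in> {s\<^sub>1, s\<^sub>2}" for z
    proof (rule ccontr)
      assume "\<not> r \<le> norm (g z - e)"
      then have "g z \<in> ball e r" by (simp add: dist_norm norm_minus_commute)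
      then show False using inner_disc[OF qs] bdry[OF that] by (auto simp: e_def)
    qed
    have sq: "r\<^sup>2 \<le> x\<^sup>2" if "r \<le> x" for x using that r by (intro power_mono) auto
    have a: "0 \<le> \<nu> q \<bullet> D"
    proof -
      have d: "((\<lambda>t. (norm (g (q + of_real t * (-1)) - e'))\<^sup>2 - r\<^sup>2) has_real_derivative
          2 * ((g (q + of_real 0 * (-1)) - e') \<bullet> (-1 * D)) - 0) (at 0 within {0..l})"
        by (intro DERIV_diff has_real_derivative_norm_squared path inC DERIV_const)
      have "0 \<le> 2 * ((g (q + of_real 0 * (-1)) - e') \<bullet> (-1 * D)) - 0"
      proof (rule one_sided_derivative_nonneg[OF d l _ l])
        show "(norm (g (q + of_real 0 * (-1)) - e'))\<^sup>2 - r\<^sup>2 = 0" unfolding e0 using nr by simp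
        show "0 \<le> (norm (g (q + of_real t * (-1)) - e'))\<^sup>2 - r\<^sup>2" if "0 < t" "t < l" for t
          using sq[OF outer[OF inC(1)[of t]]] that by simp
      qed
      then have "0 \<le> 2 * (r * (\<nu> q \<bullet> D))"
        unfolding e0 by (simp add: scaleR_conv_of_real[symmetric])
      then show ?thesis using r by (simp add: zero_le_mult_iff)
    qed
    have bb: "0 \<le> \<nu> q \<bullet> (w * D)" if w: "w = \<i> \<or> w = - \<i>" for w
    proof -
      have inCw: "q + of_real t * w \<in> C" if "t \<in> {0..l}" for t using inC[OF that] w by auto
      have d: "((\<lambda>t. (norm (g (q + of_real t * w) - e))\<^sup>2 - r\<^sup>2) has_real_derivative
          2 * ((g (q + of_real 0 * w) - e) \<bullet> (w * D)) - 0) (at 0 within {0..l})"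
        by (intro DERIV_diff has_real_derivative_norm_squared path inCw DERIV_const)
      have "0 \<le> 2 * ((g (q + of_real 0 * w) - e) \<bullet> (w * D)) - 0"
      proof (rule one_sided_derivative_nonneg[OF d l _ l])
        show "(norm (g (q + of_real 0 * w) - e))\<^sup>2 - r\<^sup>2 = 0" unfolding e0 using nr by simp
        show "0 \<le> (norm (g (q + of_real t * w) - e))\<^sup>2 - r\<^sup>2" if "0 < t" "t < l" for t
          using sq[OF inner[of "q + of_real t * w"]] q w by auto
      qed
      then have "0 \<le> 2 * (r * (\<nu> q \<bullet> (w * D)))"
        unfolding e0 by (simp add: scaleR_conv_of_real[symmetric])
      then show ?thesis using r by (simp add: zero_le_mult_iff)
    qed
    \<comment> \<open>The squared distance to e and \<open>r^2 * exp (- 2 * n * t)\<close> agree at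
      t = 0, and shortly afterwards the former is not smaller; comparing the derivatives at 0 bounds
      the normal component by \<open>n * r\<close>.\<close>
    have c: "\<nu> q \<bullet> D \<le> n * r"
    proof -
      have "continuous (at q within C) g"
        using g_cont line_in_C[OF qs] by (simp add: continuous_on_eq_continuous_within)
      then obtain t\<^sub>0 where t\<^sub>0: "t\<^sub>0 > 0" "\<And>z. z \<in> C \<Longrightarrow> dist z q < t\<^sub>0 \<Longrightarrow> dist (g z) (g q) < r / 2"
        using r unfolding continuous_within_eps_delta by (meson half_gt_zero)
      have "((\<lambda>t. r\<^sup>2 * exp (- 2 * n * t)) has_real_derivative r\<^sup>2 * (exp (- 2 * n * 0) * (- 2 * n))) (at 0 within {0..l})"
        by (auto intro!: derivative_eq_intros)
      then have d: "((\<lambda>t. (norm (g (q + of_real t * (-1)) - e))\<^sup>2 - r\<^sup>2 * exp (- 2 * n * t)) has_real_derivative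
          2 * ((g (q + of_real 0 * (-1)) - e) \<bullet> (-1 * D)) - r\<^sup>2 * (exp (- 2 * n * 0) * (- 2 * n))) (at 0 within {0..l})"
        by (intro DERIV_diff has_real_derivative_norm_squared path inC)
      have "0 \<le> 2 * ((g (q + of_real 0 * (-1)) - e) \<bullet> (-1 * D)) - r\<^sup>2 * (exp (- 2 * n * 0) * (- 2 * n))"
      proof (rule one_sided_derivative_nonneg[OF d l])
        show "(norm (g (q + of_real 0 * (-1)) - e))\<^sup>2 - r\<^sup>2 * exp (- 2 * n * 0) = 0" unfolding e0 using nr by simp
        show "0 < min t\<^sub>0 l" using t\<^sub>0 l by simp
        fix t assume t: "0 < t" "t < min t\<^sub>0 l"
        let ?z = "q + of_real t * (-1)"
        have zB: "?z \<in> B" using t q by (auto simp: open_band_def l_def)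
        have "dist (g ?z) (g q) < r / 2" using t\<^sub>0(2)[of ?z] zB B_sub_C t by (auto simp: dist_norm)
        moreover have "norm (g q - e) = r" using n\<nu> r by (simp add: e_def norm_mult)
        ultimately have "r / 2 < norm (g ?z - e)"
          using norm_triangle_ineq4[of "g ?z - e" "g ?z - g q"] by (simp add: dist_norm)
        from n(2)[OF q zB this[unfolded e_def]] have "r * exp (- n * t) \<le> norm (g ?z - e)"
          using q by (simp add: e_def)
        then have "(r * exp (- n * t))\<^sup>2 \<le> (norm (g ?z - e))\<^sup>2" using r by (intro power_mono) auto
        moreover have "(r * exp (- n * t))\<^sup>2 = r\<^sup>2 * exp (- 2 * n * t)"
          by (simp add: power_mult_distrib exp_double[symmetric] flip: exp_of_nat_mult)
        ultimately show "0 \<le> (norm (g ?z - e))\<^sup>2 - r\<^sup>2 * exp (- 2 * n * t)" by simp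
      qed
      then have "0 \<le> 2 * (- (r * (\<nu> q \<bullet> D))) + r\<^sup>2 * (2 * n)"
        unfolding e0 by (simp add: scaleR_conv_of_real[symmetric])
      then have "0 \<le> (2 * r) * (n * r - \<nu> q \<bullet> D)" by (simp add: algebra_simps power2_eq_square)
      then show ?thesis using r by (simp add: zero_le_mult_iff)
    qed
    have "\<nu> q \<bullet> (\<i> * D) = 0" using bb[of \<i>] bb[of "- \<i>"] by simp
    then have "Im (cnj (\<nu> q) * D) = 0" by (simp add: inner_complex_def algebra_simps)
    then have eq: "cnj (\<nu> q) * D = of_real (\<nu> q \<bullet> D)" by (simp add: complex_eq_iff Re_cnj_mult[symmetric])
    have "norm D = norm (cnj (\<nu> q) * D)" using n\<nu> by (simp add: norm_mult)
    also have "\<dots> = \<nu> q \<bullet> D" unfolding eq using a by simp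
    finally show ?thesis using eq c by simp
  qed
  moreover have "0 < n * r" using n r by simp
  ultimately show ?thesis by blast
qed

lemma right_Lipschitz:
  "\<exists>K>0. \<forall>z w. Re z = s\<^sub>2 \<longrightarrow> Re w = s\<^sub>2 \<longrightarrow> norm (g z - g w) \<le> K * norm (z - w)"
proof -
  obtain K where K: "K > 0" "\<And>q D. Re q = s\<^sub>2 \<Longrightarrow> (g has_field_derivative D) (at q within C) \<Longrightarrow> norm D \<le> K"
    using right_derivative by blast
  have "\<exists>D. (g has_field_derivative D) (at z within C)" if "Re z = s\<^sub>2" for z
    using g_diff[OF line_in_C[of z]] that unfolding field_differentiable_def by simp
  then obtain g' where g': "\<And>z. Re z = s\<^sub>2 \<Longrightarrow> (g has_field_derivative g' z) (at z within C)" by metis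
  have "norm (g z - g w) \<le> K * norm (z - w)" if "Re z = s\<^sub>2" "Re w = s\<^sub>2" for z w
  proof (rule field_differentiable_bound[of "{z. Re z = s\<^sub>2}" g g'])
    show "convex {z. Re z = s\<^sub>2}" using convex_hyperplane[of "1 :: complex" s\<^sub>2] by (simp add: inner_complex_def)
    show "(g has_field_derivative g' p) (at p within {z. Re z = s\<^sub>2})" if "p \<in> {z. Re z = s\<^sub>2}" for p
      by (rule has_field_derivative_subset[OF g']) (use that line_in_C in auto)
  qed (use that K g' in auto)
  then show ?thesis using K(1) by blast
qed

end

section \<open>Chord estimates and the constant product of the derivatives of f and g\<close>

text \<open>The difference of two unit vectors is orthogonal to their sum, so the imaginary part
  sees only the component of d along \<open>\<nu> + \<nu>'\<close>. For a boundary chord d that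
  component is quadratically small; the third hypothesis keeps the sum from degenerating.\<close>

lemma Im_cnj_chord:
  fixes \<nu> \<nu>' d :: complex
  assumes "norm \<nu> = 1" "norm \<nu>' = 1" "norm (\<nu>' - \<nu>) \<le> 1"
  shows "\<bar>Im (cnj (\<nu>' - \<nu>) * d)\<bar> \<le> norm (\<nu>' - \<nu>) * \<bar>(\<nu> + \<nu>') \<bullet> d\<bar>"
proof -
  define m where "m = \<nu> + \<nu>'"
  define \<Delta> where "\<Delta> = \<nu>' - \<nu>"
  have n1: "\<nu> \<bullet> \<nu> = 1" "\<nu>' \<bullet> \<nu>' = 1" using assms by (simp_all add: dot_square_norm)
  have "m \<bullet> m + \<Delta> \<bullet> \<Delta> = 4"
    using n1 by (simp add: m_def \<Delta>_def inner_add inner_diff inner_commute)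
  moreover have "\<Delta> \<bullet> \<Delta> \<le> 1" using assms(3) by (simp add: \<Delta>_def dot_square_norm power_le_one)
  ultimately have m1: "1 \<le> (norm m)\<^sup>2" by (simp add: dot_square_norm)
  have m1': "1 \<le> norm m"
    by (rule power2_le_imp_le) (use m1 in simp_all)
  define \<alpha> where "\<alpha> = cnj m * d"
  define \<beta> where "\<beta> = cnj \<Delta> * m"
  have "Re \<beta> = 0"
    unfolding \<beta>_def Re_cnj_mult m_def \<Delta>_def inner_add inner_diff using n1 by (simp only: inner_commute)
  have "of_real ((norm m)\<^sup>2) * (cnj \<Delta> * d) = \<beta> * \<alpha>"
    unfolding complex_norm_square \<alpha>_def \<beta>_def by (simp only: mult_ac)
  moreover have "Im (of_real t * x) = t * Im x" for t x by simp
  ultimately have "(norm m)\<^sup>2 * Im (cnj \<Delta> * d) = Im (\<beta> * \<alpha>)" by metis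
  also have "\<dots> = Im \<beta> * Re \<alpha>" using \<open>Re \<beta> = 0\<close> by simp
  finally have "(norm m)\<^sup>2 * \<bar>Im (cnj \<Delta> * d)\<bar> = \<bar>Im \<beta>\<bar> * \<bar>Re \<alpha>\<bar>"
    by (metis abs_mult abs_power2)
  also have "\<dots> \<le> (norm \<Delta> * norm m) * \<bar>m \<bullet> d\<bar>"
    using abs_Im_le_cmod[of \<beta>] by (intro mult_mono) (auto simp: \<beta>_def norm_mult \<alpha>_def Re_cnj_mult simp del: times_complex.sel)
  finally have "norm m * (norm m * \<bar>Im (cnj \<Delta> * d)\<bar>) \<le> norm m * (norm \<Delta> * \<bar>m \<bullet> d\<bar>)"
    by (simp add: power2_eq_square mult_ac)
  moreover have "0 < norm m" using m1' by linarith
  ultimately have "norm m * \<bar>Im (cnj \<Delta> * d)\<bar> \<le> norm \<Delta> * \<bar>m \<bullet> d\<bar>"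
    by (simp only: mult_le_cancel_left_pos)
  moreover have "1 * \<bar>Im (cnj \<Delta> * d)\<bar> \<le> norm m * \<bar>Im (cnj \<Delta> * d)\<bar>" using m1' by (intro mult_right_mono) auto
  ultimately show ?thesis unfolding m_def \<Delta>_def by linarith
qed

context strip
begin

lemma lines_Lipschitz:
  "\<exists>K>0. \<forall>z w. Re z \<in> {s\<^sub>1, s\<^sub>2} \<longrightarrow> Re w = Re z \<longrightarrow> norm (g z - g w) \<le> K * norm (z - w)"
proof -
  obtain K\<^sub>2 where K\<^sub>2: "K\<^sub>2 > 0" "\<And>z w. Re z = s\<^sub>2 \<Longrightarrow> Re w = s\<^sub>2 \<Longrightarrow> norm (g z - g w) \<le> K\<^sub>2 * norm (z - w)"
    using right_Lipschitz by blast
  obtain K\<^sub>1 where K\<^sub>1: "K\<^sub>1 > 0" "\<And>z w. Re z = - s\<^sub>1 \<Longrightarrow> Re w = - s\<^sub>1 \<Longrightarrow> norm (g (- z) - g (- w)) \<le> K\<^sub>1 * norm (z - w)"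
    using strip.right_Lipschitz[OF reflected] by blast
  have "norm (g z - g w) \<le> (K\<^sub>1 + K\<^sub>2) * norm (z - w)" if "Re z \<in> {s\<^sub>1, s\<^sub>2}" "Re w = Re z" for z w
  proof -
    have "norm (g z - g w) \<le> K\<^sub>1 * norm (z - w) \<or> norm (g z - g w) \<le> K\<^sub>2 * norm (z - w)"
      using that K\<^sub>2(2)[of z w] K\<^sub>1(2)[of "- z" "- w"] by (auto simp: norm_minus_commute)
    moreover have "0 \<le> K\<^sub>1 * norm (z - w)" "0 \<le> K\<^sub>2 * norm (z - w)" using K\<^sub>1 K\<^sub>2 by auto
    ultimately show ?thesis by (auto simp: distrib_right)
  qed
  moreover have "0 < K\<^sub>1 + K\<^sub>2" using K\<^sub>1 K\<^sub>2 by simp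
  ultimately show ?thesis by blast
qed

lemma g_bounds:
  "\<exists>K>0. (\<forall>z\<in>B. norm (deriv g z) \<le> K) \<and> (\<forall>z\<in>C. \<forall>w\<in>C. norm (g z - g w) \<le> K * norm (z - w))"
proof -
  from lines_Lipschitz obtain K where
    K: "K > 0" "\<forall>z w. Re z \<in> {s\<^sub>1, s\<^sub>2} \<longrightarrow> Re w = Re z \<longrightarrow> norm (g z - g w) \<le> K * norm (z - w)"
    by (elim exE conjE)
  have "norm (g (z + \<i> * of_real h) - g z) \<le> K * h" if "Re z \<in> {s\<^sub>1, s\<^sub>2}" "0 < h" for z h
  proof -
    have "Re (z + \<i> * of_real h) \<in> {s\<^sub>1, s\<^sub>2}" "Re z = Re (z + \<i> * of_real h)" using that by simp_all
    then have "norm (g (z + \<i> * of_real h) - g z) \<le> K * norm (z + \<i> * of_real h - z)" using K(2) by blast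
    also have "norm (z + \<i> * of_real h - z) = h" using that by (simp add: norm_mult)
    finally show ?thesis .
  qed
  note * = derivative_bound_from_lines[where F = g and \<sigma> = \<tau> and K = K, OF g_per g_cont g_hol K(1) this]
  show ?thesis
    by (intro exI[of _ K] conjI ballI K(1) *)
qed

definition "b z = (if Re z = s\<^sub>1 then b\<^sub>1 else b\<^sub>2)"

lemma on_lines: "Re z \<in> {s\<^sub>1, s\<^sub>2} \<Longrightarrow> 2 * f z = of_real (b z) * cnj (\<nu> z) + cnj (g z)"
  using left right s by (auto simp: b_def)

text \<open>A boundary point lies in neither of the two discs tangent at another boundary point. The
  points may lie on different lines.\<close>

lemma normal_chord:
  assumes "Re z \<in> {s\<^sub>1, s\<^sub>2}" "Re w \<in> {s\<^sub>1, s\<^sub>2}"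
  shows "2 * r * \<bar>\<nu> w \<bullet> (g z - g w)\<bar> \<le> (norm (g z - g w))\<^sup>2"
proof -
  let ?d = "g z - g w"
  have "g z \<notin> ball (g w + of_real r * \<nu> w) r"
    using outer_disc[OF assms(2)] line_in_C[OF assms(1)] by auto
  then have "r \<le> norm (?d - of_real r * \<nu> w)" by (simp add: dist_norm norm_minus_commute algebra_simps)
  then have 1: "2 * r * (\<nu> w \<bullet> ?d) \<le> (norm ?d)\<^sup>2"
    using norm_sub_of_real_mult_ge_iff[OF \<nu>[OF assms(2)] r] by simp
  have "g z \<notin> ball (g w - of_real r * \<nu> w) r"
    using inner_disc[OF assms(2)] bdry[OF assms(1)] by auto
  then have "r \<le> norm (?d - of_real r * (- \<nu> w))" by (simp add: dist_norm norm_minus_commute algebra_simps)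
  then have 2: "2 * r * (- \<nu> w \<bullet> ?d) \<le> (norm ?d)\<^sup>2"
    using norm_sub_of_real_mult_ge_iff[of "- \<nu> w"] \<nu>[OF assms(2)] r by simp
  show ?thesis using 1 2 r by (simp add: abs_if)
qed

text \<open>The outer disc at one point and the inner disc at the other are disjoint, so their
  centres are at least 2r apart; expanding the square of that distance bounds
  \<open>norm (\<nu> z - \<nu> w)\<close> through \<open>normal_chord\<close>.\<close>

lemma normal_Lipschitz:
  assumes z: "Re z \<in> {s\<^sub>1, s\<^sub>2}" and w: "Re w \<in> {s\<^sub>1, s\<^sub>2}"
  shows "r * norm (\<nu> z - \<nu> w) \<le> 2 * norm (g z - g w)"
proof -
  define d where "d = g z - g w"
  define c\<^sub>1 where "c\<^sub>1 = g z + of_real r * \<nu> z"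
  define c\<^sub>2 where "c\<^sub>2 = g w - of_real r * \<nu> w"
  have "2 * r \<le> norm (c\<^sub>1 - c\<^sub>2)"
  proof (rule ccontr)
    assume a: "\<not> 2 * r \<le> norm (c\<^sub>1 - c\<^sub>2)"
    define p where "p = (c\<^sub>1 + c\<^sub>2) / 2"
    have "c\<^sub>1 - p = (c\<^sub>1 - c\<^sub>2) / 2" "c\<^sub>2 - p = - ((c\<^sub>1 - c\<^sub>2) / 2)" by (simp_all add: p_def field_simps)
    then have "norm (c\<^sub>1 - p) = norm (c\<^sub>1 - c\<^sub>2) / 2" "norm (c\<^sub>2 - p) = norm (c\<^sub>1 - c\<^sub>2) / 2"
      by (simp_all only: norm_minus_cancel norm_divide norm_numeral)
    then have "norm (c\<^sub>1 - p) < r" "norm (c\<^sub>2 - p) < r" using a by simp_all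
    then have "p \<in> ball c\<^sub>1 r" "p \<in> ball c\<^sub>2 r" by (simp_all add: dist_norm)
    then show False using outer_disc[OF z] inner_disc[OF w] B_sub_C unfolding c\<^sub>1_def c\<^sub>2_def by blast
  qed
  then have "(2 * r)\<^sup>2 \<le> (norm (c\<^sub>1 - c\<^sub>2))\<^sup>2" using r by (intro power_mono) auto
  also have "c\<^sub>1 - c\<^sub>2 = d + r *\<^sub>R (\<nu> z + \<nu> w)" by (simp add: c\<^sub>1_def c\<^sub>2_def d_def scaleR_conv_of_real algebra_simps)
  also have "(norm (d + r *\<^sub>R (\<nu> z + \<nu> w)))\<^sup>2 = (norm d)\<^sup>2 + 2 * r * (\<nu> w \<bullet> d) + 2 * r * (\<nu> z \<bullet> d) + r\<^sup>2 * ((\<nu> z + \<nu> w) \<bullet> (\<nu> z + \<nu> w))"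
    unfolding power2_norm_eq_inner by (simp add: inner_add inner_commute algebra_simps power2_eq_square)
  also have "(\<nu> z + \<nu> w) \<bullet> (\<nu> z + \<nu> w) = 4 - (norm (\<nu> z - \<nu> w))\<^sup>2"
  proof -
    have "\<nu> z \<bullet> \<nu> z = 1" "\<nu> w \<bullet> \<nu> w = 1" using \<nu>[OF z] \<nu>[OF w] by (simp_all add: dot_square_norm)
    then show ?thesis
      unfolding power2_norm_eq_inner inner_add inner_diff inner_commute[of "\<nu> w" "\<nu> z"] by simp
  qed
  finally have "r\<^sup>2 * (norm (\<nu> z - \<nu> w))\<^sup>2 \<le> (norm d)\<^sup>2 + 2 * r * (\<nu> w \<bullet> d) + 2 * r * (\<nu> z \<bullet> d)"
    by (simp add: algebra_simps power_mult_distrib)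
  moreover have "2 * r * (\<nu> w \<bullet> d) \<le> (norm d)\<^sup>2"
  proof -
    have "2 * r * (\<nu> w \<bullet> d) \<le> 2 * r * \<bar>\<nu> w \<bullet> d\<bar>" using r by (intro mult_left_mono) auto
    then show ?thesis using normal_chord[OF z w] by (simp add: d_def)
  qed
  moreover have "2 * r * (\<nu> z \<bullet> d) \<le> (norm d)\<^sup>2"
  proof -
    have "2 * r * (\<nu> z \<bullet> d) \<le> 2 * r * \<bar>\<nu> z \<bullet> (g w - g z)\<bar>"
      using r by (intro mult_left_mono) (auto simp: d_def inner_diff)
    then show ?thesis using normal_chord[OF w z] by (simp add: d_def norm_minus_commute)
  qed
  moreover have "0 \<le> (norm d)\<^sup>2" by simp
  ultimately have "r\<^sup>2 * (norm (\<nu> z - \<nu> w))\<^sup>2 \<le> 4 * (norm d)\<^sup>2" by linarith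
  then have "(r * norm (\<nu> z - \<nu> w))\<^sup>2 \<le> (2 * norm d)\<^sup>2" by (simp add: power_mult_distrib)
  then show ?thesis unfolding d_def by (rule power2_le_imp_le) simp
qed

text \<open>The boundary equation expresses \<open>2 * f\<close> by the normal and
  \<open>cnj g\<close>, both Lipschitz along the lines; the bound then passes inward as it does for
  g.\<close>

lemma f_bounds:
  "\<exists>K>0. (\<forall>z\<in>B. norm (deriv f z) \<le> K) \<and> (\<forall>z\<in>C. \<forall>w\<in>C. norm (f z - f w) \<le> K * norm (z - w))"
proof -
  obtain K where K: "K > 0" "\<And>z w. z \<in> C \<Longrightarrow> w \<in> C \<Longrightarrow> norm (g z - g w) \<le> K * norm (z - w)"
    using g_bounds by blast
  define M where "M = (\<bar>b\<^sub>1\<bar> + \<bar>b\<^sub>2\<bar>) * (2 / r) * K + K"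
  have "0 \<le> (\<bar>b\<^sub>1\<bar> + \<bar>b\<^sub>2\<bar>) * (2 / r) * K" using K r by simp
  then have M: "0 < M" unfolding M_def using K by linarith
  have "norm (f (z + \<i> * of_real h) - f z) \<le> M * h" if z: "Re z \<in> {s\<^sub>1, s\<^sub>2}" and h: "0 < h" for z h
  proof -
    let ?w = "z + \<i> * of_real h"
    have w: "Re ?w \<in> {s\<^sub>1, s\<^sub>2}" using z by simp
    have dg: "norm (g ?w - g z) \<le> K * h"
      using K(2)[OF line_in_C[OF w] line_in_C[OF z]] h by (simp add: norm_mult)
    have "r * norm (\<nu> ?w - \<nu> z) \<le> 2 * (K * h)" using normal_Lipschitz[OF w z] dg by simp
    then have "norm (\<nu> ?w - \<nu> z) \<le> 2 / r * K * h" using r by (simp add: field_simps)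
    have "2 * (f ?w - f z) = of_real (b z) * cnj (\<nu> ?w - \<nu> z) + cnj (g ?w - g z)"
      using on_lines[OF w] on_lines[OF z] by (simp add: b_def algebra_simps)
    then have "2 * norm (f ?w - f z) = norm (of_real (b z) * cnj (\<nu> ?w - \<nu> z) + cnj (g ?w - g z))"
      by (metis norm_mult norm_numeral)
    also have "\<dots> \<le> \<bar>b z\<bar> * norm (\<nu> ?w - \<nu> z) + norm (g ?w - g z)"
      by (rule order_trans[OF norm_triangle_ineq]) (simp only: norm_mult norm_of_real complex_mod_cnj order_refl)
    also have "\<dots> \<le> (\<bar>b\<^sub>1\<bar> + \<bar>b\<^sub>2\<bar>) * (2 / r * K * h) + K * h"
      using \<open>norm (\<nu> ?w - \<nu> z) \<le> 2 / r * K * h\<close> dg by (intro add_mono mult_mono) (auto simp: b_def)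
    also have "\<dots> = M * h" by (simp add: M_def algebra_simps)
    finally have "2 * norm (f ?w - f z) \<le> M * h" .
    moreover have "0 \<le> norm (f ?w - f z)" by simp
    ultimately show ?thesis by linarith
  qed
  note * = derivative_bound_from_lines[where F = f and \<sigma> = \<tau>' and K = M, OF f_per f_cont f_hol M this]
  show ?thesis
    by (intro exI[of _ M] conjI ballI M *)
qed

lemma difference_quotient_tendsto:
  assumes F: "F holomorphic_on B" and z: "z \<in> B"
  shows "((\<lambda>h. (F (z + \<i> * of_real h) - F z) / of_real h) \<longlongrightarrow> \<i> * deriv F z) (at_right 0)"
proof -
  have "(F has_field_derivative deriv F z) (at z)"
    using F open_open_band z holomorphic_derivI by blast
  then have "((\<lambda>w. (F (z + w) - F z) / w) \<longlongrightarrow> deriv F z) (at 0)" by (simp add: DERIV_def)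
  moreover have "filterlim (\<lambda>h. \<i> * of_real h) (at 0) (at_right (0::real))"
    unfolding filterlim_at by (auto intro!: tendsto_eq_intros simp: eventually_at_right_field intro: exI[of _ 1])
  ultimately have "((\<lambda>h. (F (z + \<i> * of_real h) - F z) / (\<i> * of_real h)) \<longlongrightarrow> deriv F z) (at_right 0)"
    by (rule filterlim_compose)
  then have "((\<lambda>h. \<i> * ((F (z + \<i> * of_real h) - F z) / (\<i> * of_real h))) \<longlongrightarrow> \<i> * deriv F z) (at_right 0)"
    by (intro tendsto_intros)
  then show ?thesis by simp
qed

text \<open>On the lines the imaginary part of the product of the differences of \<open>f\<close> and \<open>g\<close> is of third order.\<close>

lemma Hopf_differential_const:
  "\<exists>P::real. P \<noteq> 0 \<and> (\<forall>z\<in>B. deriv f z * deriv g z = of_real P)"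
proof -
  obtain K where K: "K > 0" "\<And>z w. z \<in> C \<Longrightarrow> w \<in> C \<Longrightarrow> norm (g z - g w) \<le> K * norm (z - w)"
    using g_bounds by blast
  define M where "M = (\<bar>b\<^sub>1\<bar> + \<bar>b\<^sub>2\<bar>) * (K ^ 3 / r\<^sup>2) + 1"
  have M: "0 < M" using K r by (auto simp: M_def intro!: add_nonneg_pos)
  \<comment> \<open>For steps below \<open>h\<^sub>0\<close> a chord has length at most r/2 and the
    normals at its ends differ by at most 1, as \<open>Im_cnj_chord\<close> requires.\<close>
  define h\<^sub>0 where "h\<^sub>0 = r / (2 * K)"
  have h\<^sub>0: "0 < h\<^sub>0" using K r by (simp add: h\<^sub>0_def)
  define Q where "Q h z = (f (z + \<i> * of_real h) - f z) * (g (z + \<i> * of_real h) - g z) / of_real (h\<^sup>2)" for h z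
  have lineQ: "\<bar>Im (Q h z)\<bar> \<le> M * h" if z: "Re z \<in> {s\<^sub>1, s\<^sub>2}" and h: "0 < h" "h < h\<^sub>0" for z h
  proof -
    let ?w = "z + \<i> * of_real h"
    have w: "Re ?w \<in> {s\<^sub>1, s\<^sub>2}" using z by simp
    define d where "d = g ?w - g z"
    have d: "norm d \<le> K * h"
      using K(2)[OF line_in_C[OF w] line_in_C[OF z]] h by (simp add: norm_mult d_def)
    have "K * h \<le> r / 2" using h K by (simp add: h\<^sub>0_def field_simps)
    then have d1: "norm d \<le> r / 2" using d by simp
    have \<Delta>: "r * norm (\<nu> ?w - \<nu> z) \<le> 2 * norm d" using normal_Lipschitz[OF w z] by (simp add: d_def)
    then have "r * norm (\<nu> ?w - \<nu> z) \<le> r * 1" using d1 by simp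
    then have \<Delta>1: "norm (\<nu> ?w - \<nu> z) \<le> 1" using r by (simp only: mult_le_cancel_left_pos)
    have "2 * (f ?w - f z) = of_real (b z) * cnj (\<nu> ?w - \<nu> z) + cnj d"
      using on_lines[OF w] on_lines[OF z] by (simp add: b_def d_def algebra_simps)
    \<comment> \<open>The term \<open>cnj d * d\<close> is real, so only the variation of the normal
      contributes to the imaginary part.\<close>
    then have "2 * ((f ?w - f z) * d) = of_real (b z) * (cnj (\<nu> ?w - \<nu> z) * d) + cnj d * d"
      by (simp only: mult.assoc[symmetric] distrib_right)
    also have "cnj d * d = of_real ((norm d)\<^sup>2)" unfolding complex_norm_square by (rule mult.commute)
    finally have "2 * ((f ?w - f z) * d) = of_real (b z) * (cnj (\<nu> ?w - \<nu> z) * d) + of_real ((norm d)\<^sup>2)" .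
    then have "Im (2 * ((f ?w - f z) * d)) = Im (of_real (b z) * (cnj (\<nu> ?w - \<nu> z) * d) + of_real ((norm d)\<^sup>2))"
      by (rule arg_cong)
    moreover have "Im (2 * x) = 2 * Im x" "Im (of_real t * x + of_real u) = t * Im x" for x t u by simp_all
    ultimately have im: "2 * Im ((f ?w - f z) * d) = b z * Im (cnj (\<nu> ?w - \<nu> z) * d)" by metis
    have "r * \<bar>(\<nu> z + \<nu> ?w) \<bullet> d\<bar> \<le> r * (\<bar>\<nu> z \<bullet> d\<bar> + \<bar>\<nu> ?w \<bullet> d\<bar>)"
      using r by (intro mult_left_mono) (auto simp: inner_add)
    also have "\<dots> \<le> (norm d)\<^sup>2"
    proof -
      have "\<bar>\<nu> ?w \<bullet> (g z - g ?w)\<bar> = \<bar>\<nu> ?w \<bullet> d\<bar>" by (simp add: d_def inner_diff abs_minus_commute)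
      then show ?thesis
        using normal_chord[OF w z] normal_chord[OF z w] by (simp add: d_def norm_minus_commute distrib_left)
    qed
    finally have m: "r * \<bar>(\<nu> z + \<nu> ?w) \<bullet> d\<bar> \<le> (norm d)\<^sup>2" .
    have "r\<^sup>2 * \<bar>Im (cnj (\<nu> ?w - \<nu> z) * d)\<bar> \<le> r\<^sup>2 * (norm (\<nu> ?w - \<nu> z) * \<bar>(\<nu> z + \<nu> ?w) \<bullet> d\<bar>)"
      by (intro mult_left_mono Im_cnj_chord \<nu> z w \<Delta>1) simp
    also have "\<dots> = (r * norm (\<nu> ?w - \<nu> z)) * (r * \<bar>(\<nu> z + \<nu> ?w) \<bullet> d\<bar>)" by (simp add: power2_eq_square)
    also have "\<dots> \<le> (2 * norm d) * (norm d)\<^sup>2" using r by (intro mult_mono[OF \<Delta> m]) auto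
    also have "\<dots> = 2 * norm d ^ 3" by (simp add: power2_eq_square power3_eq_cube)
    also have "\<dots> \<le> 2 * (K * h) ^ 3" using d by (intro mult_left_mono power_mono) auto
    finally have I: "\<bar>Im (cnj (\<nu> ?w - \<nu> z) * d)\<bar> \<le> 2 * (K * h) ^ 3 / r\<^sup>2"
      using r by (simp add: pos_le_divide_eq mult.commute)
    have "2 * \<bar>Im ((f ?w - f z) * d)\<bar> = \<bar>b z\<bar> * \<bar>Im (cnj (\<nu> ?w - \<nu> z) * d)\<bar>"
      using im by (metis abs_mult abs_numeral)
    also have "\<dots> \<le> (\<bar>b\<^sub>1\<bar> + \<bar>b\<^sub>2\<bar>) * (2 * (K * h) ^ 3 / r\<^sup>2)"
      by (rule mult_mono[OF _ I]) (auto simp: b_def)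
    also have "\<dots> = 2 * ((\<bar>b\<^sub>1\<bar> + \<bar>b\<^sub>2\<bar>) * (K ^ 3 / r\<^sup>2) * h ^ 3)"
      by (simp add: power_mult_distrib)
    finally have "\<bar>Im ((f ?w - f z) * d)\<bar> \<le> (\<bar>b\<^sub>1\<bar> + \<bar>b\<^sub>2\<bar>) * (K ^ 3 / r\<^sup>2) * h ^ 3"
      by linarith
    also have "\<dots> \<le> M * h ^ 3" using h by (intro mult_right_mono) (auto simp: M_def)
    finally have "\<bar>Im ((f ?w - f z) * d)\<bar> / h\<^sup>2 \<le> M * h ^ 3 / h\<^sup>2" using h by (intro divide_right_mono) auto
    also have "M * h ^ 3 / h\<^sup>2 = M * h" using h by (simp add: power2_eq_square power3_eq_cube)
    finally show ?thesis by (simp add: Q_def d_def abs_divide flip: of_real_power)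
  qed
  have allQ: "\<bar>Im (Q h z)\<bar> \<le> M * h" if h: "0 < h" "h < h\<^sub>0" and z: "z \<in> C" for h z
  proof -
    have Qhol: "Q h holomorphic_on B"
    proof -
      have shift: "(\<lambda>z. F (z + \<i> * of_real h)) holomorphic_on B" if "F holomorphic_on B" for F
        by (rule holomorphic_on_compose_gen[OF _ that, unfolded o_def]) (auto intro!: holomorphic_intros simp: shift_in_B)
      then show ?thesis unfolding Q_def using h by (intro holomorphic_intros shift[OF f_hol] shift[OF g_hol] f_hol g_hol) auto
    qed
    have Qcont: "continuous_on C (Q h)"
      unfolding Q_def using h
      by (intro continuous_intros continuous_on_compose2[OF f_cont] continuous_on_compose2[OF g_cont] f_cont g_cont)
         (auto simp: shift_in_C)
    obtain K\<^sub>f where K\<^sub>f: "\<And>z. z \<in> C \<Longrightarrow> norm (f (z + \<i> * of_real h) - f z) \<le> K\<^sub>f"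
      using quasi_periodic_difference_bounded[where F = f and \<sigma> = \<tau>' and h = h, OF f_per f_cont] unfolding bounded_iff by auto
    obtain K\<^sub>g where K\<^sub>g: "\<And>z. z \<in> C \<Longrightarrow> norm (g (z + \<i> * of_real h) - g z) \<le> K\<^sub>g"
      using quasi_periodic_difference_bounded[where F = g and \<sigma> = \<tau> and h = h, OF g_per g_cont] unfolding bounded_iff by auto
    have Qbd: "norm (Q h z) \<le> K\<^sub>f * K\<^sub>g / h\<^sup>2" if "z \<in> C" for z
      unfolding Q_def norm_divide norm_mult using K\<^sub>f[OF that] K\<^sub>g[OF that] h order_trans[OF norm_ge_zero K\<^sub>f[OF that]]
      by (auto intro!: divide_right_mono mult_mono simp: norm_power)
    \<comment> \<open>The maximum principle controls moduli. For c equal to \<iota> = \<i> or to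
      \<open>- \<i>\<close>, the modulus of \<open>exp (c * Q h z)\<close> is the exponential of
      minus or plus the imaginary part of \<open>Q h z\<close>.\<close>
    have main: "Re (c * Q h z) \<le> M * h" if c: "norm c = 1" "\<And>x. \<bar>Re (c * x)\<bar> = \<bar>Im x\<bar>" for c
    proof -
      have "norm (exp (c * Q h z)) \<le> exp (M * h)"
      proof (rule norm_le_on_band[where f = "\<lambda>z. exp (c * Q h z)", OF s _ _ _ _ _ z])
        show "(\<lambda>z. exp (c * Q h z)) holomorphic_on B" by (intro holomorphic_intros Qhol)
        show "continuous_on C (\<lambda>z. exp (c * Q h z))" by (intro continuous_intros Qcont)
        have "norm (exp (c * Q h z)) \<le> exp (K\<^sub>f * K\<^sub>g / h\<^sup>2)" if "z \<in> C" for z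
        proof -
          have "Re (c * Q h z) \<le> norm (c * Q h z)" by (rule complex_Re_le_cmod)
          also have "\<dots> \<le> K\<^sub>f * K\<^sub>g / h\<^sup>2" using Qbd[OF that] c by (simp add: norm_mult)
          finally show ?thesis by simp
        qed
        then show "bounded ((\<lambda>z. exp (c * Q h z)) ` C)" unfolding bounded_iff by blast
        show "norm (exp (c * Q h w)) \<le> exp (M * h)" if "Re w = s\<^sub>1 \<or> Re w = s\<^sub>2" for w
        proof -
          have "Re (c * Q h w) \<le> \<bar>Im (Q h w)\<bar>" using c(2)[of "Q h w"] by linarith
          then show ?thesis using lineQ[of w h] that h by simp
        qed
      qed simp
      then show ?thesis by simp
    qed
    from main[of "\<i>"] main[of "- \<i>"] show ?thesis by auto
  qed
  have "Im (deriv f z * deriv g z) = 0" if z: "z \<in> B" for z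
  proof -
    have "((\<lambda>h. ((f (z + \<i> * of_real h) - f z) / of_real h) * ((g (z + \<i> * of_real h) - g z) / of_real h))
        \<longlongrightarrow> (\<i> * deriv f z) * (\<i> * deriv g z)) (at_right 0)"
      by (intro tendsto_mult difference_quotient_tendsto f_hol g_hol z)
    moreover have "(\<i> * deriv f z) * (\<i> * deriv g z) = - (deriv f z * deriv g z)"
      by (simp add: algebra_simps)
    ultimately have "((\<lambda>h. Q h z) \<longlongrightarrow> - (deriv f z * deriv g z)) (at_right 0)"
      by (simp only: Q_def power2_eq_square of_real_mult times_divide_times_eq)
    then have "((\<lambda>h. \<bar>Im (Q h z)\<bar>) \<longlongrightarrow> \<bar>Im (- (deriv f z * deriv g z))\<bar>) (at_right 0)"
      by (intro tendsto_intros)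
    moreover have "((\<lambda>h. M * h) \<longlongrightarrow> M * 0) (at_right 0)" by (intro tendsto_intros)
    moreover have "\<forall>\<^sub>F h in at_right 0. \<bar>Im (Q h z)\<bar> \<le> M * h"
      using allQ z B_sub_C h\<^sub>0 by (auto simp: eventually_at_right_field)
    ultimately have "\<bar>Im (- (deriv f z * deriv g z))\<bar> \<le> M * 0"
      by (intro tendsto_le[OF trivial_limit_at_right_real])
    then show ?thesis by simp
  qed
  moreover have "(\<lambda>z. deriv f z * deriv g z) holomorphic_on B"
    by (intro holomorphic_intros holomorphic_deriv f_hol g_hol open_open_band)
  ultimately obtain P :: real where P: "\<And>z. z \<in> B \<Longrightarrow> deriv f z * deriv g z = of_real P"
    using real_valued_holomorphic_const[OF open_open_band convex_connected[OF convex_open_band]] by blast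
  moreover have "P \<noteq> 0"
  proof -
    obtain z where "z \<in> B" "deriv f z \<noteq> 0" using nonconst by blast
    then show ?thesis using P[of z] dg[of z] by auto
  qed
  ultimately show ?thesis by blast
qed

end

section \<open>Holomorphic extension of g across the lines\<close>

context strip
begin

text \<open>For \<open>b\<^sub>2 = 0\<close> the function \<open>2 * f\<close> already has the
  boundary values \<open>cnj g\<close>, and plain reflection suffices. Otherwise the normal enters,
  and \<open>Riccati_extension\<close> replaces it by holomorphic data.\<close>

lemma right_extension:
  assumes q: "Re q = s\<^sub>2"
  shows "\<exists>\<rho>>0. \<exists>h. h holomorphic_on ball q \<rho> \<and> (\<forall>z\<in>ball q \<rho>. Re z \<le> s\<^sub>2 \<longrightarrow> h z = g z)"
proof -
  obtain K\<^sub>1 where K\<^sub>1: "K\<^sub>1 > 0" "\<And>z. z \<in> B \<Longrightarrow> norm (deriv g z) \<le> K\<^sub>1"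
    "\<And>z w. z \<in> C \<Longrightarrow> w \<in> C \<Longrightarrow> norm (g z - g w) \<le> K\<^sub>1 * norm (z - w)"
    using g_bounds by auto
  obtain K\<^sub>2 where K\<^sub>2: "K\<^sub>2 > 0" "\<And>z. z \<in> B \<Longrightarrow> norm (deriv f z) \<le> K\<^sub>2"
    "\<And>z w. z \<in> C \<Longrightarrow> w \<in> C \<Longrightarrow> norm (f z - f w) \<le> K\<^sub>2 * norm (z - w)"
    using f_bounds by auto
  define K where "K = K\<^sub>1 + K\<^sub>2"
  have K: "0 < K" "K\<^sub>1 \<le> K" "K\<^sub>2 \<le> K" using K\<^sub>1 K\<^sub>2 by (auto simp: K_def)
  define k where "k = K * (1 + 2 / b\<^sub>2\<^sup>2)"
  have k: "0 < k" unfolding k_def using K by (intro mult_pos_pos add_pos_nonneg) auto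
  \<comment> \<open>The first bound keeps the half disc inside the band; the second provides the
    smallness for the Picard iteration behind \<open>Riccati_extension\<close>.\<close>
  define \<rho> where "\<rho> = min ((s\<^sub>2 - s\<^sub>1) / 2) (1 / (4 * k))"
  have \<rho>: "0 < \<rho>" "\<rho> \<le> (s\<^sub>2 - s\<^sub>1) / 2" 
    unfolding \<rho>_def using s k by (simp, intro min.cobounded1)
  have "k * (2 * \<rho>) \<le> k * (2 * (1 / (4 * k)))" using k by (intro mult_left_mono) (auto simp: \<rho>_def)
  also have "\<dots> = 1 / 2" using k by simp
  finally have small: "K * (1 + 2 / b\<^sub>2\<^sup>2) * (2 * \<rho>) \<le> 1 / 2" unfolding k_def .
  have re: "s\<^sub>1 < Re z" if "z \<in> ball q \<rho>" for z
  proof -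
    have "\<bar>Re (q - z)\<bar> < \<rho>" using that abs_Re_le_cmod[of "q - z"] by (simp add: dist_norm)
    then show ?thesis using q \<rho>(2) s by (auto simp: abs_less_iff field_simps)
  qed
  let ?A = "ball q \<rho> \<inter> {z. Re z < s\<^sub>2}"
  have AB: "?A \<subseteq> B" using re by (auto simp: open_band_def)
  have clA: "closure ?A \<subseteq> C" using AB B_sub_C by (intro closure_minimal closed_closed_band) auto
  have bC: "ball q \<rho> \<inter> {z. Re z \<le> s\<^sub>2} \<subseteq> C" using re by (force simp: closed_band_def)
  have lineC: "Re z \<in> {s\<^sub>1, s\<^sub>2}" if "Re z = s\<^sub>2" for z using that by simp
  show ?thesis
  proof (cases "b\<^sub>2 = 0")
    case True
    have "\<exists>h. h holomorphic_on ball q \<rho> \<and> (\<forall>z\<in>ball q \<rho>. Re z \<le> s\<^sub>2 \<longrightarrow> h z = g z)"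
    proof (rule reflection_extension[OF q \<rho>(1), where G = "\<lambda>z. 2 * f z"])
      show "2 * f z = cnj (g z)" if "Re z = s\<^sub>2" for z using right[OF that] True by simp
    qed (intro holomorphic_intros continuous_intros holomorphic_on_subset[OF g_hol AB] holomorphic_on_subset[OF f_hol AB]
        continuous_on_subset[OF g_cont bC] continuous_on_subset[OF f_cont bC])+
    then show ?thesis using \<rho>(1) by blast
  next
    case False
    \<comment> \<open>Multiplication by the unit number \<open>\<nu> w\<close> turns the expression
      into the real number \<open>2 * (\<nu> w \<bullet> d)\<close>, to which
      \<open>normal_chord\<close> applies.\<close>
    have chord: "norm (cnj (g z - g w) + (cnj (\<nu> w))\<^sup>2 * (g z - g w)) \<le> K\<^sup>2 / r * (norm (z - w))\<^sup>2"
      if z: "Re z = s\<^sub>2" and w: "Re w = s\<^sub>2" for z w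
    proof -
      define d where "d = g z - g w"
      have n1: "\<nu> w * cnj (\<nu> w) = 1" using \<nu>[OF lineC[OF w]] by (simp add: complex_norm_square[symmetric])
      have "\<nu> w * (cnj d + (cnj (\<nu> w))\<^sup>2 * d) = \<nu> w * cnj d + (\<nu> w * cnj (\<nu> w)) * (cnj (\<nu> w) * d)"
        by (simp add: algebra_simps power2_eq_square)
      also have "\<dots> = of_real (2 * (\<nu> w \<bullet> d))"
        unfolding n1 by (simp add: complex_eq_iff inner_complex_def algebra_simps)
      finally have "norm (\<nu> w * (cnj d + (cnj (\<nu> w))\<^sup>2 * d)) = norm (complex_of_real (2 * (\<nu> w \<bullet> d)))" by simp
      then have "norm (cnj d + (cnj (\<nu> w))\<^sup>2 * d) = 2 * \<bar>\<nu> w \<bullet> d\<bar>"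
        unfolding norm_mult norm_of_real using \<nu>[OF lineC[OF w]] by (simp add: abs_mult)
      also have "\<dots> \<le> (norm d)\<^sup>2 / r"
        using normal_chord[OF lineC[OF z] lineC[OF w]] r by (simp add: d_def pos_le_divide_eq mult_ac)
      also have "\<dots> \<le> (K * norm (z - w))\<^sup>2 / r"
      proof (intro divide_right_mono power_mono)
        have "norm d \<le> K\<^sub>1 * norm (z - w)" unfolding d_def by (intro K\<^sub>1 line_in_C lineC z w)
        also have "\<dots> \<le> K * norm (z - w)" using K by (intro mult_right_mono) auto
        finally show "norm d \<le> K * norm (z - w)" .
      qed (use r in auto)
      finally show ?thesis by (simp add: d_def power_mult_distrib)
    qed
    have bK: "x \<le> K * t" if "x \<le> K\<^sub>1 * t \<or> x \<le> K\<^sub>2 * t" "0 \<le> t" for x t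
      using that mult_right_mono[OF K(2), of t] mult_right_mono[OF K(3), of t] by auto
    show ?thesis
    proof (rule Riccati_extension[OF q \<rho>(1) False K(1), where g = g and f = f and N = "\<lambda>z. cnj (\<nu> z)" and K = "K\<^sup>2 / r"
          and g' = "deriv g" and f' = "deriv f"])
      show "0 \<le> K\<^sup>2 / r" using r by simp
      show "(g has_field_derivative deriv g z) (at z)" "(f has_field_derivative deriv f z) (at z)"
        "norm (deriv g z) \<le> K" "norm (deriv f z) \<le> K" if "z \<in> ?A" for z
        using that AB holomorphic_derivI[OF g_hol open_open_band] holomorphic_derivI[OF f_hol open_open_band]
          K\<^sub>1(2)[of z] K\<^sub>2(2)[of z] K by auto
      show "continuous_on (closure ?A) g" "continuous_on (closure ?A) f"
        by (rule continuous_on_subset[OF g_cont clA] continuous_on_subset[OF f_cont clA])+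
      show "deriv g holomorphic_on ?A" "deriv f holomorphic_on ?A"
        by (rule holomorphic_on_subset[OF holomorphic_deriv[OF g_hol open_open_band] AB]
            holomorphic_on_subset[OF holomorphic_deriv[OF f_hol open_open_band] AB])+
      show "norm (g z - g w) \<le> K * norm (z - w)" "norm (f z - f w) \<le> K * norm (z - w)"
        if "z \<in> closure ?A" "w \<in> closure ?A" for z w
        using that clA K\<^sub>1(3)[of z w] K\<^sub>2(3)[of z w] by (auto intro!: bK)
      show "norm (cnj (\<nu> z)) = 1 \<and> 2 * f z = of_real b\<^sub>2 * cnj (\<nu> z) + cnj (g z)" if "Re z = s\<^sub>2" for z
        using \<nu>[OF lineC[OF that]] right[OF that] by simp
    qed (use chord small in auto)
  qed
qed

lemma left_extension:
  assumes q: "Re q = s\<^sub>1"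
  shows "\<exists>\<rho>>0. \<exists>h. h holomorphic_on ball q \<rho> \<and> (\<forall>z\<in>ball q \<rho>. s\<^sub>1 \<le> Re z \<longrightarrow> h z = g z)"
proof -
  have "Re (- q) = - s\<^sub>1" using q by simp
  from strip.right_extension[OF reflected this]
  obtain \<rho> h where h: "\<rho> > 0" "h holomorphic_on ball (- q) \<rho>"
    "\<And>z. z \<in> ball (- q) \<rho> \<Longrightarrow> Re z \<le> - s\<^sub>1 \<Longrightarrow> h z = g (- z)" by auto
  have neg: "- z \<in> ball (- q) \<rho> \<longleftrightarrow> z \<in> ball q \<rho>" for z by (simp add: dist_norm norm_minus_commute)
  have "(\<lambda>z. h (- z)) holomorphic_on ball q \<rho>"
    by (rule holomorphic_on_compose_gen[OF _ h(2), unfolded o_def]) (use neg in \<open>auto intro!: holomorphic_intros\<close>)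
  moreover have "h (- z) = g z" if "z \<in> ball q \<rho>" "s\<^sub>1 \<le> Re z" for z
    using h(3)[of "- z"] neg that by simp
  ultimately show ?thesis using h(1) by blast
qed

text \<open>Outside the closed band the glued function takes the value of an arbitrarily chosen
  local extension, so these must agree. Radii of at most half the width force two discs that share a
  point outside the band to be centred on the same line. The mirror image of the point then lies in
  both discs and in the open band, and the identity theorem applies on their convex
  intersection.\<close>

lemma holomorphic_extension:
  "\<exists>U G. open U \<and> C \<subseteq> U \<and> G holomorphic_on U \<and> (\<forall>z\<in>C. G z = g z)"
proof -
  define L where "L = {q. Re q \<in> {s\<^sub>1, s\<^sub>2}}"
  have "\<exists>\<rho> h. 0 < \<rho> \<and> \<rho> \<le> (s\<^sub>2 - s\<^sub>1) / 2 \<and> h holomorphic_on ball q \<rho> \<and> (\<forall>z\<in>ball q \<rho>. z \<in> C \<longrightarrow> h z = g z)"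
    if q: "q \<in> L" for q
  proof -
    have "\<exists>\<rho>>0. \<exists>h. h holomorphic_on ball q \<rho> \<and> (\<forall>z\<in>ball q \<rho>. z \<in> C \<longrightarrow> h z = g z)"
    proof (cases "Re q = s\<^sub>2")
      case True
      from right_extension[OF this] show ?thesis by (auto simp: closed_band_def)
    next
      case False
      then have "Re q = s\<^sub>1" using q by (simp add: L_def)
      from left_extension[OF this] show ?thesis by (auto simp: closed_band_def)
    qed
    then obtain \<rho> h where h: "0 < \<rho>" "h holomorphic_on ball q \<rho>" "\<forall>z\<in>ball q \<rho>. z \<in> C \<longrightarrow> h z = g z" by auto
    define \<rho>' where "\<rho>' = min \<rho> ((s\<^sub>2 - s\<^sub>1) / 2)"
    have "0 < \<rho>'" "\<rho>' \<le> (s\<^sub>2 - s\<^sub>1) / 2" "\<rho>' \<le> \<rho>"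
      unfolding \<rho>'_def using h s by (simp, intro min.cobounded2, intro min.cobounded1)
    moreover from this have "h holomorphic_on ball q \<rho>'" by (intro holomorphic_on_subset[OF h(2)]) auto
    ultimately show ?thesis using h(3) by (intro exI[of _ \<rho>'] exI[of _ h]) auto
  qed
  then obtain \<rho> h where h: "\<And>q. q \<in> L \<Longrightarrow> 0 < \<rho> q" "\<And>q. q \<in> L \<Longrightarrow> \<rho> q \<le> (s\<^sub>2 - s\<^sub>1) / 2"
    "\<And>q. q \<in> L \<Longrightarrow> h q holomorphic_on ball q (\<rho> q)" "\<And>q z. q \<in> L \<Longrightarrow> z \<in> ball q (\<rho> q) \<Longrightarrow> z \<in> C \<Longrightarrow> h q z = g z"
    by metis
  define G where "G z = (if z \<in> C then g z else h (SOME q. q \<in> L \<and> z \<in> ball q (\<rho> q)) z)" for z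
  define U where "U = B \<union> (\<Union>q\<in>L. ball q (\<rho> q))"
  have re: "\<bar>Re q - Re z\<bar> < (s\<^sub>2 - s\<^sub>1) / 2" if "q \<in> L" "z \<in> ball q (\<rho> q)" for q z
    using that h(2)[OF that(1)] abs_Re_le_cmod[of "q - z"] by (simp add: dist_norm)
  have agree: "h q z = h q' z"
    if z: "z \<notin> C" "q \<in> L" "z \<in> ball q (\<rho> q)" "q' \<in> L" "z \<in> ball q' (\<rho> q')" for z q q'
  proof -
    define s where "s = Re q"
    have same: "Re q' = s" and side: "s = s\<^sub>2 \<and> s < Re z \<or> s = s\<^sub>1 \<and> Re z < s"
      using re[OF z(2,3)] re[OF z(4,5)] z(1,2,4) strip_axioms[unfolded strip_def]
      by (auto simp: s_def L_def closed_band_def abs_less_iff field_simps)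
    define z' where "z' = 2 * of_real s - cnj z"
    have refl: "z' \<in> ball p t" if "Re p = s" "z \<in> ball p t" for p t
    proof -
      have "2 * of_real s - cnj p = p" using that by (simp add: complex_eq_iff)
      then have "p - z' = cnj (z - p)" by (simp add: z'_def complex_eq_iff)
      then have "norm (p - z') = norm (z - p)" by (simp only: complex_mod_cnj)
      then show ?thesis using that by (simp add: dist_norm norm_minus_commute)
    qed
    define V where "V = ball q (\<rho> q) \<inter> ball q' (\<rho> q')"
    have V: "open V" "convex V" "z \<in> V" "z' \<in> V"
      using z refl same by (auto simp: V_def s_def convex_Int)
    have "z' \<in> B"
      using side re[OF z(2), of z'] V(4) strip_axioms[unfolded strip_def]
      by (auto simp: V_def z'_def open_band_def s_def abs_less_iff field_simps)
    show ?thesis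
    proof (rule analytic_continuation_open[of "V \<inter> B" V "h q" "h q'" z])
      show "V \<inter> B \<noteq> {}" using V(4) \<open>z' \<in> B\<close> by auto
      show "connected V" using V(2) by (rule convex_connected)
      show "h q holomorphic_on V" "h q' holomorphic_on V"
        by (rule holomorphic_on_subset[OF h(3)], rule z, force simp: V_def)+
      show "h q w = h q' w" if "w \<in> V \<inter> B" for w
        using that h(4) z B_sub_C by (auto simp: V_def)
    qed (use V open_open_band in auto)
  qed
  have Gh: "G z = h q z" if "q \<in> L" "z \<in> ball q (\<rho> q)" for q z
  proof (cases "z \<in> C")
    case True
    then show ?thesis using h(4) that by (simp add: G_def)
  next
    case False
    define q' where "q' = (SOME q. q \<in> L \<and> z \<in> ball q (\<rho> q))"
    have "q' \<in> L \<and> z \<in> ball q' (\<rho> q')" unfolding q'_def by (rule someI[of _ q]) (use that in auto)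
    then show ?thesis using agree[OF False that, of q'] False by (simp add: G_def q'_def)
  qed
  have "open U" unfolding U_def using open_open_band by auto
  moreover have "C \<subseteq> U"
  proof
    fix z assume "z \<in> C"
    then have "z \<in> B \<or> z \<in> L" by (auto simp: L_def closed_band_def open_band_def)
    moreover have "z \<in> ball z (\<rho> z)" if "z \<in> L" using h(1)[OF that] by simp
    ultimately show "z \<in> U" unfolding U_def by blast
  qed
  moreover have "G holomorphic_on U"
    unfolding holomorphic_on_open[OF \<open>open U\<close>]
  proof
    fix z assume "z \<in> U"
    then consider "z \<in> B" | q where "q \<in> L" "z \<in> ball q (\<rho> q)" by (auto simp: U_def)
    then show "\<exists>f'. (G has_field_derivative f') (at z)"
    proof cases
      case 1
      have "(g has_field_derivative deriv g z) (at z)" by (rule holomorphic_derivI[OF g_hol open_open_band 1])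
      then have "(G has_field_derivative deriv g z) (at z)"
        by (rule has_field_derivative_transform_within_open[OF _ open_open_band 1]) (use B_sub_C in \<open>auto simp: G_def\<close>)
      then show ?thesis by blast
    next
      case 2
      have "(h q has_field_derivative deriv (h q) z) (at z)" by (rule holomorphic_derivI[OF h(3)[OF 2(1)] open_ball 2(2)])
      then have "(G has_field_derivative deriv (h q) z) (at z)"
        by (rule has_field_derivative_transform_within_open[OF _ open_ball 2(2)]) (simp add: Gh[OF 2(1)])
      then show ?thesis by blast
    qed
  qed
  ultimately show ?thesis by (intro exI[of _ U] exI[of _ G]) (auto simp: G_def)
qed

end

section \<open>Boundary conditions for \<eta>\<close>

lemma vector_derivative_along_line:
  assumes "(F has_field_derivative F') (at (Complex s y))"
  shows "((\<lambda>y. F (Complex s y)) has_vector_derivative \<i> * F') (at y)"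
proof -
  have 1: "((\<lambda>y. Complex s y) has_vector_derivative \<i>) (at y)"
    unfolding Complex_eq by (auto intro!: derivative_eq_intros)
  from field_vector_diff_chain_at[OF 1 assms] show ?thesis by (simp add: o_def)
qed

lemma Re_of_real_mult_ii: "Re (of_real t * (\<i> * x)) = - (t * Im x)"
  by simp

text \<open>Differentiate \<open>2 f = \<beta> \<bar>G'\<bar> / G' + cnj G\<close> along the line, with \<open>f' = P / G'\<close>.\<close>

lemma boundary_relation:
  fixes G f :: "complex \<Rightarrow> complex" and \<beta> P s :: real
  assumes G: "G holomorphic_on U" "open U" "Complex s y \<in> U" "deriv G (Complex s y) \<noteq> 0"
    and f: "(f has_field_derivative of_real P / deriv G (Complex s y)) (at (Complex s y))"
    and S: "open S" "y \<in> S"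
    and eq: "\<And>t. t \<in> S \<Longrightarrow> 2 * f (Complex s t) = of_real \<beta> * (of_real (norm (deriv G (Complex s t))) / deriv G (Complex s t)) + cnj (G (Complex s t))"
  shows "2 * \<beta> * Re (deriv (deriv G) (Complex s y) / (2 * deriv G (Complex s y)))
       = - norm (deriv G (Complex s y)) - 2 * P / norm (deriv G (Complex s y))"
proof -
  let ?q = "Complex s y"
  define D where "D t = deriv G (Complex s t)" for t
  define H where "H = deriv (deriv G) ?q"
  define a where "a = Re (H / D y)"
  define m where "m = norm (D y)"
  have D0: "D y \<noteq> 0" "0 < m" using G(4) by (simp_all add: D_def m_def)
  have dG: "((\<lambda>t. G (Complex s t)) has_vector_derivative \<i> * D y) (at y)"
    unfolding D_def by (rule vector_derivative_along_line[OF holomorphic_derivI[OF G(1-3)]])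
  have dD: "(D has_vector_derivative \<i> * H) (at y)"
    unfolding D_def[abs_def] H_def
    by (rule vector_derivative_along_line[OF holomorphic_derivI[OF holomorphic_deriv[OF G(1,2)] G(2,3)]])
  have df: "((\<lambda>t. f (Complex s t)) has_vector_derivative \<i> * (of_real P / D y)) (at y)"
    using vector_derivative_along_line[OF f] by (simp add: D_def)
  have HD: "H = (H / D y) * D y" using D0 by simp
  have dn: "((\<lambda>t. norm (D t)) has_vector_derivative - m * Im (H / D y)) (at y)"
  proof -
    have "((\<lambda>t. norm (D t)) has_derivative (\<lambda>h. (h *\<^sub>R (\<i> * H)) \<bullet> sgn (D y))) (at y)"
      using has_derivative_compose[OF dD[unfolded has_vector_derivative_def] has_derivative_norm[OF D0(1)]]
      by (simp add: o_def)
    moreover have "(\<lambda>h. (h *\<^sub>R (\<i> * H)) \<bullet> sgn (D y)) = (\<lambda>h. h *\<^sub>R (- m * Im (H / D y)))"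
    proof
      fix h
      have "(\<i> * H) \<bullet> D y = Re (cnj (D y) * (\<i> * (H / D y * D y)))"
        unfolding HD[symmetric] Re_cnj_mult by (rule inner_commute)
      also have "\<dots> = Re ((D y * cnj (D y)) * (\<i> * (H / D y)))" by (simp only: mult_ac)
      also have "\<dots> = - (m\<^sup>2 * Im (H / D y))"
        unfolding complex_norm_square[symmetric] m_def by (rule Re_of_real_mult_ii)
      finally have "(\<i> * H) \<bullet> D y = - (m\<^sup>2 * Im (H / D y))" .
      then have "(\<i> * H) \<bullet> sgn (D y) = - m * Im (H / D y)"
        using D0 by (simp add: sgn_div_norm m_def[symmetric] field_simps power2_eq_square)
      then show "(h *\<^sub>R (\<i> * H)) \<bullet> sgn (D y) = h *\<^sub>R (- m * Im (H / D y))" by simp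
    qed
    ultimately show ?thesis by (simp add: has_vector_derivative_def)
  qed
  \<comment> \<open>The conjugate unit normal up to sign. As it has modulus one, its logarithmic
    derivative along the line is imaginary, so that only the real part a of \<open>H / D y\<close>
    survives.\<close>
  define E where "E t = of_real (norm (D t)) / D t" for t
  have dE: "(E has_vector_derivative - \<i> * of_real a * E y) (at y)"
  proof -
    have inv: "((\<lambda>t. inverse (D t)) has_vector_derivative - (\<i> * H) / (D y)\<^sup>2) (at y)"
      using field_vector_diff_chain_at[OF dD DERIV_inverse[OF D0(1), unfolded numeral_2_eq_2[symmetric]]]
      by (simp add: o_def field_simps power2_eq_square)
    have nr: "((\<lambda>t. complex_of_real (norm (D t))) has_vector_derivative of_real (- m * Im (H / D y))) (at y)"
      by (rule has_vector_derivative_of_real) (rule dn[unfolded has_real_derivative_iff_has_vector_derivative[symmetric]])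
    have Eeq: "E = (\<lambda>t. of_real (norm (D t)) * inverse (D t))" by (simp add: E_def fun_eq_iff divide_inverse)
    have "(E has_vector_derivative of_real (norm (D y)) * (- (\<i> * H) / (D y)\<^sup>2) + of_real (- m * Im (H / D y)) * inverse (D y)) (at y)"
      unfolding Eeq by (rule has_vector_derivative_mult[OF nr inv])
    moreover have "of_real (norm (D y)) * (- (\<i> * H) / (D y)\<^sup>2) + of_real (- m * Im (H / D y)) * inverse (D y)
        = - \<i> * of_real a * E y"
    proof -
      define w where "w = H / D y"
      have 1: "of_real (norm (D y)) * (- (\<i> * H) / (D y)\<^sup>2) = - \<i> * w * E y"
        by (simp add: E_def w_def power2_eq_square)
      have 2: "of_real (- m * Im w) * inverse (D y) = - of_real (Im w) * E y"
        by (simp add: E_def m_def divide_inverse)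
      have 3: "- \<i> * w + - of_real (Im w) = - \<i> * of_real (Re w)"
        by (simp add: complex_eq_iff)
      show ?thesis
        unfolding a_def w_def[symmetric] 1 2 distrib_right[symmetric] 3 ..
    qed
    ultimately show ?thesis by simp
  qed
  have R: "((\<lambda>t. of_real \<beta> * E t + cnj (G (Complex s t))) has_vector_derivative
      of_real \<beta> * (- \<i> * of_real a * E y) + cnj (\<i> * D y)) (at y)"
    by (intro has_vector_derivative_add has_vector_derivative_mult_right dE has_vector_derivative_cnj dG)
  have "((\<lambda>t. 2 * f (Complex s t)) has_vector_derivative 2 * (\<i> * (of_real P / D y))) (at y)"
    by (intro has_vector_derivative_mult_right df)
  then have "((\<lambda>t. of_real \<beta> * E t + cnj (G (Complex s t))) has_vector_derivative 2 * (\<i> * (of_real P / D y))) (at y)"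
    by (rule has_vector_derivative_transform_within_open[OF _ S]) (simp add: eq E_def D_def)
  from vector_derivative_unique_at[OF R this]
  have e: "of_real \<beta> * (- \<i> * of_real a * E y) + cnj (\<i> * D y) = 2 * (\<i> * (of_real P / D y))" .
  have E1: "E y \<noteq> 0" using D0 by (simp add: E_def)
  have cD: "cnj (D y) = of_real m * E y"
    using D0 by (simp add: E_def m_def field_simps complex_norm_square[symmetric] power2_eq_square[symmetric])
  have PD: "of_real P / D y = of_real (P / m) * E y" using D0 by (simp add: E_def m_def)
  \<comment> \<open>All three terms are real multiples of \<open>\<i> * E y\<close>, since
    \<open>cnj (D y) = m * E y\<close> and \<open>P / D y = (P / m) * E y\<close>.\<close>
  have "of_real (\<beta> * a + m + 2 * P / m) * (\<i> * E y) = 0"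
    using e unfolding PD complex_cnj_mult cD by (simp add: algebra_simps) (metis add.right_inverse)
  then have "complex_of_real (\<beta> * a + m + 2 * P / m) = 0" using E1 by simp
  then have "\<beta> * a + m + 2 * P / m = 0" by (simp only: of_real_eq_0_iff)
  moreover have "2 * \<beta> * Re (H / (2 * D y)) = \<beta> * a"
  proof -
    have "H / (2 * D y) = of_real (1 / 2) * (H / D y)" by simp
    moreover have "Re (of_real t * x) = t * Re x" for t x by simp
    ultimately have "Re (H / (2 * D y)) = 1 / 2 * Re (H / D y)" by metis
    then show ?thesis by (simp add: a_def)
  qed
  ultimately have "2 * \<beta> * Re (H / (2 * D y)) = - m - 2 * P / m" by linarith
  then show ?thesis by (simp only: H_def D_def m_def)
qed

text \<open>The modulus m of \<open>deriv G\<close> satisfies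
  \<open>m' = - 2 * m * Im \<eta>\<close> along the line. For \<beta> = 0 the relation makes m
  constant, whence \<open>Im \<eta> = 0\<close>. Otherwise the tangential derivative of the relation
  is the Robin condition; differentiating its coefficient and using the relation once more gives the
  law that \<open>Im_mkdv_Robin\<close> requires of c.\<close>

lemma boundary_condition_of_relation:
  fixes G :: "complex \<Rightarrow> complex" and \<beta> P s :: real
  defines "\<eta> \<equiv> \<lambda>z. deriv (deriv G) z / (2 * deriv G z)"
  assumes G: "G holomorphic_on U" "open U" "\<And>z. z \<in> U \<Longrightarrow> deriv G z \<noteq> 0" and line: "\<And>y. Complex s y \<in> U"
    and rel: "\<And>y. 2 * \<beta> * Re (\<eta> (Complex s y)) = - norm (deriv G (Complex s y)) - 2 * P / norm (deriv G (Complex s y))"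
  shows "(\<forall>y. Im (\<eta> (Complex s y)) = 0) \<or>
        (\<exists>c. \<forall>y. (c has_real_derivative - 4 * Re (\<eta> (Complex s y)) * Im (\<eta> (Complex s y))) (at y) \<and>
             Im (deriv \<eta> (Complex s y)) = c y * Im (\<eta> (Complex s y)))"
proof -
  define m where "m y = norm (deriv G (Complex s y))" for y
  define i where "i y = Im (\<eta> (Complex s y))" for y
  have m0: "0 < m y" for y using G(3)[OF line] by (simp add: m_def)
  have hD: "deriv G holomorphic_on U" by (rule holomorphic_deriv[OF G(1,2)])
  have h\<eta>: "\<eta> holomorphic_on U"
    unfolding \<eta>_def using G(3) by (intro holomorphic_intros holomorphic_deriv[OF hD G(2)] hD) auto
  have dm: "(m has_real_derivative - 2 * m y * i y) (at y)" for y
  proof -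
    let ?D = "deriv G (Complex s y)" and ?H = "deriv (deriv G) (Complex s y)"
    have dD: "((\<lambda>t. deriv G (Complex s t)) has_vector_derivative \<i> * ?H) (at y)"
      by (rule vector_derivative_along_line[OF holomorphic_derivI[OF hD G(2) line]])
    have D0: "?D \<noteq> 0" by (rule G(3)[OF line])
    have "?H = 2 * \<eta> (Complex s y) * ?D" using D0 by (simp add: \<eta>_def)
    then have "(\<i> * ?H) \<bullet> ?D = Re (cnj ?D * (\<i> * (2 * \<eta> (Complex s y) * ?D)))"
      unfolding Re_cnj_mult by (simp add: inner_commute)
    also have "\<dots> = Re ((?D * cnj ?D) * (\<i> * (2 * \<eta> (Complex s y))))" by (simp only: mult_ac)
    also have "\<dots> = - (2 * (m y)\<^sup>2 * i y)"
      unfolding complex_norm_square[symmetric] m_def i_def Re_of_real_mult_ii by simp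
    finally have "(\<i> * ?H) \<bullet> sgn ?D = - 2 * m y * i y"
      using D0 by (simp add: sgn_div_norm m_def field_simps power2_eq_square)
    moreover have "(m has_derivative (\<lambda>h. (h *\<^sub>R (\<i> * ?H)) \<bullet> sgn ?D)) (at y)"
      using has_derivative_compose[OF dD[unfolded has_vector_derivative_def] has_derivative_norm[OF D0]]
      by (simp add: m_def[abs_def] o_def)
    moreover have "(\<lambda>h. (h *\<^sub>R (\<i> * ?H)) \<bullet> sgn ?D) = (*) ((\<i> * ?H) \<bullet> sgn ?D)"
      by (simp add: fun_eq_iff mult.commute)
    ultimately show ?thesis by (simp only: has_field_derivative_def)
  qed
  show ?thesis
  proof (cases "\<beta> = 0")
    case True
    have "m y * m y = - 2 * P" for y
    proof -
      have "m y = - (2 * P / m y)" using rel[of y] True by (simp add: m_def)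
      then have "m y * m y = - (2 * P / m y) * m y" by simp
      then show ?thesis using m0[of y] by simp
    qed
    then have "((\<lambda>y. m y * m y) has_real_derivative 0) (at y)" for y by simp
    then have zero: "- 2 * m y * i y * m y + - 2 * m y * i y * m y = 0" for y
      using DERIV_unique[OF DERIV_mult[OF dm dm]] by (metis mult.commute)
    have "i y = 0" for y using zero[of y] m0[of y] by simp
    then show ?thesis by (simp add: i_def)
  next
    case False
    \<comment> \<open>Read off from the tangential derivative of the relation,
      \<open>- 2 * \<beta> * Im \<eta>' = (2 * m - 4 * P / m) * Im \<eta>\<close>.\<close>
    define c where "c y = (- m y + 2 * P / m y) / \<beta>" for y
    have dP: "((\<lambda>y. 2 * P / m y) has_real_derivative 4 * P / m y * i y) (at y)" for y
      by (rule derivative_eq_intros dm refl | use m0[of y] in \<open>simp add: field_simps power2_eq_square\<close>)+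
    have "(c has_real_derivative - 4 * Re (\<eta> (Complex s y)) * i y) (at y)" for y
    proof -
      have "(c has_real_derivative (- (- 2 * m y * i y) + 4 * P / m y * i y) / \<beta>) (at y)"
        unfolding c_def[abs_def] by (intro DERIV_cdivide DERIV_add DERIV_minus dm dP)
      also have "(- (- 2 * m y * i y) + 4 * P / m y * i y) / \<beta> = - 2 * (- m y - 2 * P / m y) * i y / \<beta>"
        by (simp add: algebra_simps)
      also have "\<dots> = - 4 * Re (\<eta> (Complex s y)) * i y"
        unfolding m_def rel[symmetric] using False by simp
      finally show ?thesis .
    qed
    moreover have "Im (deriv \<eta> (Complex s y)) = c y * i y" for y
    proof -
      have 1: "((\<lambda>y. 2 * \<beta> * Re (\<eta> (Complex s y))) has_real_derivative 2 * \<beta> * - Im (deriv \<eta> (Complex s y))) (at y)"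
        by (intro DERIV_cmult has_derivative_along_line(1)[OF h\<eta> G(2) line])
      have "((\<lambda>y. - m y - 2 * P / m y) has_real_derivative - (- 2 * m y * i y) - 4 * P / m y * i y) (at y)"
        by (intro DERIV_diff DERIV_minus dm dP)
      then have 2: "((\<lambda>y. 2 * \<beta> * Re (\<eta> (Complex s y))) has_real_derivative - (- 2 * m y * i y) - 4 * P / m y * i y) (at y)"
        unfolding rel m_def .
      define X where "X = P / m y"
      have "4 * P / m y = 4 * X" by (simp add: X_def)
      then have "2 * \<beta> * - Im (deriv \<eta> (Complex s y)) = - (- 2 * m y * i y) - 4 * X * i y"
        using DERIV_unique[OF 1 2] by (simp only:)
      then have "\<beta> * Im (deriv \<eta> (Complex s y)) = (- m y + 2 * X) * i y"
        by (simp add: algebra_simps)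
      moreover have "\<beta> * c y = - m y + 2 * X" using False by (simp add: c_def X_def)
      ultimately have "\<beta> * Im (deriv \<eta> (Complex s y)) = \<beta> * (c y * i y)" by (simp only: mult.assoc[symmetric])
      then show ?thesis using False by (simp only: mult_cancel_left simp_thms)
    qed
    ultimately show ?thesis unfolding i_def by blast
  qed
qed

context strip
begin

lemma normal_right:
  assumes "Re q = s\<^sub>2" "(g has_field_derivative D) (at q within C)" "D \<noteq> 0"
  shows "cnj (\<nu> q) = of_real (norm D) / D"
proof -
  have "cnj (\<nu> q) * D = of_real (norm D)" using right_derivative assms by blast
  then show ?thesis using assms(3) by (simp add: eq_divide_eq)
qed

lemma normal_left:
  assumes q: "Re q = s\<^sub>1" and D: "(g has_field_derivative D) (at q within C)" "D \<noteq> 0"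
  shows "cnj (\<nu> q) = - (of_real (norm D) / D)"
proof -
  have "(uminus has_field_derivative - 1) (at (- q) within closed_band (- s\<^sub>2) (- s\<^sub>1))"
    by (auto intro!: derivative_eq_intros)
  moreover have "(g has_field_derivative D) (at (- (- q)) within uminus ` closed_band (- s\<^sub>2) (- s\<^sub>1))"
  proof -
    have "uminus ` closed_band (- s\<^sub>2) (- s\<^sub>1) \<subseteq> C" by (auto simp: closed_band_def)
    from DERIV_subset[OF D(1) this] show ?thesis by simp
  qed
  ultimately have "(g \<circ> uminus has_field_derivative D * - 1) (at (- q) within closed_band (- s\<^sub>2) (- s\<^sub>1))"
    by (rule DERIV_image_chain[rotated])
  then have "((\<lambda>z. g (- z)) has_field_derivative - D) (at (- q) within closed_band (- s\<^sub>2) (- s\<^sub>1))"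
    by (simp add: o_def)
  from strip.normal_right[OF reflected _ this] show ?thesis using q D(2) by simp
qed

text \<open>Since f' g' is a nonzero constant and f' is bounded, g' is bounded below up to the
  lines. Hence the extension can be restricted to a neighbourhood of the closed band on which its
  derivative has no zero.\<close>

theorem boundary_conditions:
  "\<exists>U G. open U \<and> C \<subseteq> U \<and> G holomorphic_on U \<and> (\<forall>z\<in>C. G z = g z) \<and> (\<forall>z\<in>U. deriv G z \<noteq> 0) \<and>
    (\<forall>s\<in>{s\<^sub>1, s\<^sub>2}. let \<eta> = (\<lambda>z. deriv (deriv G) z / (2 * deriv G z)) in (\<forall>y. Im (\<eta> (Complex s y)) = 0) \<or>
        (\<exists>c. \<forall>y. (c has_real_derivative - 4 * Re (\<eta> (Complex s y)) * Im (\<eta> (Complex s y))) (at y) \<and>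
             Im (deriv \<eta> (Complex s y)) = c y * Im (\<eta> (Complex s y))))"
proof -
  obtain U\<^sub>0 G where U\<^sub>0: "open U\<^sub>0" "C \<subseteq> U\<^sub>0" and G: "G holomorphic_on U\<^sub>0" "\<And>z. z \<in> C \<Longrightarrow> G z = g z"
    using holomorphic_extension by auto
  obtain P :: real where P: "P \<noteq> 0" "\<And>z. z \<in> B \<Longrightarrow> deriv f z * deriv g z = of_real P"
    using Hopf_differential_const by blast
  obtain K where K: "K > 0" "\<And>z. z \<in> B \<Longrightarrow> norm (deriv f z) \<le> K" using f_bounds by blast
  have hD: "deriv G holomorphic_on U\<^sub>0" by (rule holomorphic_deriv[OF G(1) U\<^sub>0(1)])
  have GB: "deriv G z = deriv g z" if "z \<in> B" for z
    by (rule complex_derivative_transform_within_open[OF holomorphic_on_subset[OF G(1)] g_hol open_open_band that])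
       (use U\<^sub>0 B_sub_C G(2) in auto)
  have lower: "\<bar>P\<bar> / K \<le> norm (deriv G z)" if "z \<in> C" for z
  proof (rule continuous_ge_on_closure[of B "\<lambda>z. norm (deriv G z)"])
    show "continuous_on (closure B) (\<lambda>z. norm (deriv G z))"
      unfolding closure_open_band[OF s]
      by (intro continuous_intros holomorphic_on_imp_continuous_on holomorphic_on_subset[OF hD U\<^sub>0(2)])
    show "z \<in> closure B" using that by (simp add: closure_open_band[OF s])
    fix w assume w: "w \<in> B"
    have "\<bar>P\<bar> = norm (deriv f w) * norm (deriv g w)" using P(2)[OF w] by (metis norm_mult norm_of_real)
    also have "\<dots> \<le> K * norm (deriv g w)" using K(2)[OF w] by (intro mult_right_mono) auto
    finally show "\<bar>P\<bar> / K \<le> norm (deriv G w)" using K(1) GB[OF w] by (simp add: divide_le_eq mult.commute)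
  qed
  define U where "U = {z \<in> U\<^sub>0. deriv G z \<noteq> 0}"
  have oU: "open U"
  proof -
    have "U = U\<^sub>0 \<inter> deriv G -` (- {0})" by (auto simp: U_def)
    then show ?thesis
      using continuous_open_preimage[OF holomorphic_on_imp_continuous_on[OF hD] U\<^sub>0(1), of "- {0}"] by (simp add: open_Compl)
  qed
  have CU: "C \<subseteq> U"
  proof
    fix z assume z: "z \<in> C"
    have "0 < \<bar>P\<bar> / K" using P K by simp
    then show "z \<in> U" using lower[OF z] z U\<^sub>0 by (auto simp: U_def)
  qed
  have GU: "G holomorphic_on U" by (rule holomorphic_on_subset[OF G(1)]) (auto simp: U_def)
  have nz: "deriv G z \<noteq> 0" if "z \<in> U" for z using that by (simp add: U_def)
  have relation: "\<exists>\<beta>. \<forall>y. 2 * \<beta> * Re (deriv (deriv G) (Complex s y) / (2 * deriv G (Complex s y)))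
       = - norm (deriv G (Complex s y)) - 2 * P / norm (deriv G (Complex s y))" if s': "s \<in> {s\<^sub>1, s\<^sub>2}" for s
  proof -
    have "\<exists>\<beta>. \<forall>z. Re z = s \<longrightarrow> 2 * f z = of_real \<beta> * (of_real (norm (deriv G z)) / deriv G z) + cnj (G z)"
    proof -
      have gD: "(g has_field_derivative deriv G z) (at z within C)" if z: "z \<in> C" for z
      proof (rule has_field_derivative_transform_within[OF has_field_derivative_at_within zero_less_one z])
        show "(G has_field_derivative deriv G z) (at z)" using holomorphic_derivI[OF GU oU] CU z by blast
      qed (simp add: G(2))
      show ?thesis
      proof (cases "s = s\<^sub>2")
        case True
        then show ?thesis
          using right normal_right[OF _ gD nz] line_in_C CU G(2) by (intro exI[of _ b\<^sub>2]) (auto simp: subset_iff)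
      next
        \<comment> \<open>On the left line the exterior normal is opposite to the direction of
          \<open>deriv G\<close>, hence the sign of the witness.\<close>
        case False
        then have "s = s\<^sub>1" using s' by simp
        then show ?thesis
          using left normal_left[OF _ gD nz] line_in_C CU G(2) by (intro exI[of _ "- b\<^sub>1"]) (auto simp: subset_iff)
      qed
    qed
    then obtain \<beta> where \<beta>: "\<And>z. Re z = s \<Longrightarrow> 2 * f z = of_real \<beta> * (of_real (norm (deriv G z)) / deriv G z) + cnj (G z)"
      by blast
    have "2 * \<beta> * Re (deriv (deriv G) (Complex s y) / (2 * deriv G (Complex s y)))
       = - norm (deriv G (Complex s y)) - 2 * P / norm (deriv G (Complex s y))" for y
    proof -
      let ?q = "Complex s y"
      have qC: "?q \<in> C" using s' line_in_C by simp
      then obtain \<rho> where \<rho>: "\<rho> > 0" "ball ?q \<rho> \<subseteq> U" using oU CU by (meson openE subsetD)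
      \<comment> \<open>f itself is not known to extend across the line. A local primitive of
        \<open>P / deriv G\<close>, which equals f up to a constant on the band side, takes its
        place.\<close>
      have "(\<lambda>z. of_real P / deriv G z) holomorphic_on ball ?q \<rho>"
        using \<rho> nz by (intro holomorphic_intros holomorphic_on_subset[OF holomorphic_deriv[OF GU oU]]) auto
      then obtain \<Phi> where \<Phi>: "\<And>z. z \<in> ball ?q \<rho> \<Longrightarrow> (\<Phi> has_field_derivative of_real P / deriv G z) (at z within ball ?q \<rho>)"
        using holomorphic_convex_primitive'[OF convex_ball open_ball] by blast
      have \<Phi>': "(\<Phi> has_field_derivative of_real P / deriv G z) (at z)" if "z \<in> ball ?q \<rho>" for z
        using \<Phi>[OF that] at_within_open[OF that open_ball] by simp
      let ?W = "ball ?q \<rho> \<inter> B"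
      have W: "open ?W" "convex ?W" by (auto simp: open_open_band intro: convex_Int convex_open_band)
      have dW: "((\<lambda>z. f z - \<Phi> z) has_field_derivative 0) (at z within ?W)" if z: "z \<in> ?W" for z
      proof -
        have zU: "z \<in> U" using z \<rho> by auto
        have "deriv f z = of_real P / deriv G z"
          using P(2)[of z] GB[of z] nz[OF zU] z by (simp add: field_simps)
        then have fd: "(f has_field_derivative of_real P / deriv G z) (at z)"
          using holomorphic_derivI[OF f_hol open_open_band, of z UNIV] z by simp
        have "((\<lambda>z. f z - \<Phi> z) has_field_derivative of_real P / deriv G z - of_real P / deriv G z) (at z)"
          by (rule DERIV_diff[OF fd \<Phi>']) (use z in blast)
        then have "((\<lambda>z. f z - \<Phi> z) has_field_derivative 0) (at z)" by (simp only: diff_self)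
        then show ?thesis by (rule has_field_derivative_at_within)
      qed
      have "\<exists>k. \<forall>z\<in>?W. f z - \<Phi> z = k" by (rule has_field_derivative_zero_constant[OF W(2) dW])
      then obtain k where k: "\<And>z. z \<in> ?W \<Longrightarrow> f z - \<Phi> z = k" by (elim exE) (simp only: Ball_def)
      have \<Phi>f: "f z = \<Phi> z + k" if z: "z \<in> ball ?q \<rho>" "z \<in> C" for z
      proof -
        have zcl: "z \<in> closure ?W"
          using z open_Int_closure_subset[OF open_ball, of ?q \<rho> B] by (auto simp: closure_open_band[OF s])
        have "norm (f z - \<Phi> z - k) \<le> 0"
        proof -
          have lim: "((\<lambda>w. norm (f w - \<Phi> w - k)) \<longlongrightarrow> norm (f z - \<Phi> z - k)) (at z within insert z ?W)"
          proof -
            have "(f \<longlongrightarrow> f z) (at z within insert z ?W)"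
            proof (rule tendsto_within_subset)
              show "(f \<longlongrightarrow> f z) (at z within C)" using f_cont z(2) unfolding continuous_on_def by blast
            qed (use z B_sub_C in blast)
            moreover have "(\<Phi> \<longlongrightarrow> \<Phi> z) (at z within insert z ?W)"
              by (rule tendsto_within_subset[OF _ subset_UNIV])
                 (use DERIV_isCont[OF \<Phi>'[OF z(1)]] in \<open>simp only: isCont_def\<close>)
            ultimately show ?thesis by (intro tendsto_intros)
          qed
          show ?thesis
          proof (cases "z \<in> ?W")
            case True
            then show ?thesis using k by simp
          next
            case False
            then have "z islimpt ?W" using zcl unfolding closure_def by blast
            then have "at z within insert z ?W \<noteq> bot"
              by (simp add: trivial_limit_within islimpt_insert)
            then show ?thesis
              by (rule tendsto_upperbound[OF lim, rotated]) (simp add: eventually_at_filter k)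
          qed
        qed
        then have "f z - \<Phi> z = k" by simp
        then show ?thesis by (simp only: diff_eq_eq add.commute)
      qed
      have dF: "((\<lambda>z. \<Phi> z + k) has_field_derivative of_real P / deriv G ?q) (at ?q)"
        using DERIV_add[OF \<Phi>' DERIV_const, of ?q k] \<rho>(1) by simp
      show ?thesis
      proof (rule boundary_relation[OF GU oU _ _ dF, where S = "{y - \<rho><..<y + \<rho>}"])
        show "?q \<in> U" "deriv G ?q \<noteq> 0" using CU qC nz by auto
        fix t assume t: "t \<in> {y - \<rho><..<y + \<rho>}"
        have "norm (?q - Complex s t) = \<bar>y - t\<bar>" by (simp add: cmod_def)
        then have "Complex s t \<in> ball ?q \<rho>" using t by (auto simp: dist_norm abs_less_iff)
        moreover have "Complex s t \<in> C" using s' line_in_C by simp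
        ultimately have "f (Complex s t) = \<Phi> (Complex s t) + k" by (rule \<Phi>f)
        with \<beta>[of "Complex s t"] show "2 * (\<Phi> (Complex s t) + k) = of_real \<beta> * (of_real (norm (deriv G (Complex s t))) / deriv G (Complex s t)) + cnj (G (Complex s t))"
          by simp
      qed (use \<rho>(1) in auto)
    qed
    then show ?thesis by blast
  qed
  show ?thesis
    unfolding Let_def
  proof (rule exI[of _ U], rule exI[of _ G], intro conjI ballI)
    fix s assume s': "s \<in> {s\<^sub>1, s\<^sub>2}"
    obtain \<beta> where \<beta>: "\<And>y. 2 * \<beta> * Re (deriv (deriv G) (Complex s y) / (2 * deriv G (Complex s y)))
       = - norm (deriv G (Complex s y)) - 2 * P / norm (deriv G (Complex s y))"
      using relation[OF s'] by blast
    have "Complex s y \<in> U" for y using s' line_in_C CU by auto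
    from boundary_condition_of_relation[OF GU oU nz this \<beta>]
    show "(\<forall>y. Im (deriv (deriv G) (Complex s y) / (2 * deriv G (Complex s y))) = 0) \<or>
        (\<exists>c. \<forall>y. (c has_real_derivative - 4 * Re (deriv (deriv G) (Complex s y) / (2 * deriv G (Complex s y)))
            * Im (deriv (deriv G) (Complex s y) / (2 * deriv G (Complex s y)))) (at y) \<and>
          Im (deriv (\<lambda>z. deriv (deriv G) z / (2 * deriv G z)) (Complex s y))
            = c y * Im (deriv (deriv G) (Complex s y) / (2 * deriv G (Complex s y))))"
      by simp
  qed (use oU CU GU G(2) nz in auto)
qed

end

section \<open>The gradient of the torsion function\<close>

definition grad :: "(complex \<Rightarrow> real) \<Rightarrow> complex \<Rightarrow> complex" where
  "grad u z = Complex (partial_derivative u 1 z) (partial_derivative u \<i> z)"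

lemma grad_has_derivative:
  assumes "u differentiable (at z)"
  shows "(u has_derivative (\<lambda>h. grad u z \<bullet> h)) (at z)"
proof -
  let ?D = "frechet_derivative u (at z)"
  have D: "(u has_derivative ?D) (at z)" using assms unfolding frechet_derivative_works .
  interpret bounded_linear ?D by (rule has_derivative_bounded_linear[OF D])
  have "?D h = grad u z \<bullet> h" for h
  proof -
    have "h = Re h *\<^sub>R 1 + Im h *\<^sub>R \<i>" by (simp add: complex_eq_iff)
    then have "?D h = Re h * ?D 1 + Im h * ?D \<i>" by (metis add scale real_scaleR_def)
    then show ?thesis by (simp add: grad_def partial_derivative_def inner_complex_def mult.commute)
  qed
  then show ?thesis using D by (metis (no_types, lifting) ext)
qed

lemma partial_eq_grad:
  assumes "(u has_derivative (\<lambda>h. G \<bullet> h)) (at z)"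
  shows "grad u z = G"
  using frechet_derivative_at[OF assms]
  by (simp add: grad_def partial_derivative_def inner_complex_def complex_eq_iff flip: frechet_derivative_at[OF assms])

lemma C_diff_on_2_iff:
  "C_diff_on 2 (u :: complex \<Rightarrow> real) U \<longleftrightarrow> (\<forall>z\<in>U. u differentiable (at z)) \<and>
     (\<forall>e\<in>{1, \<i>}. (\<forall>z\<in>U. partial_derivative u e differentiable (at z)) \<and>
        (\<forall>e'\<in>{1, \<i>}. continuous_on U (partial_derivative (partial_derivative u e) e')))"
  by (simp add: numeral_2_eq_2 Basis_complex_def)

lemma gradient_Lipschitz:
  assumes u: "C_diff_on 2 (u :: complex \<Rightarrow> real) U" and U: "open U" "p \<in> U"
  shows "\<exists>\<epsilon>>0. \<exists>K\<ge>0. cball p \<epsilon> \<subseteq> U \<and> (\<forall>z\<in>cball p \<epsilon>. \<forall>w\<in>cball p \<epsilon>. norm (grad u z - grad u w) \<le> K * norm (z - w))"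
proof -
  obtain \<epsilon> where \<epsilon>: "\<epsilon> > 0" "cball p \<epsilon> \<subseteq> U" using U open_contains_cball_eq by blast
  have "\<exists>K\<ge>0. \<forall>z\<in>cball p \<epsilon>. \<forall>w\<in>cball p \<epsilon>. \<bar>v z - v w\<bar> \<le> K * norm (z - w)"
    if e: "e \<in> {1, \<i>}" and v: "v = partial_derivative u e" for e v
  proof -
    have d: "(v has_derivative (\<lambda>h. grad v z \<bullet> h)) (at z)" if "z \<in> U" for z
      by (rule grad_has_derivative) (use u e v that in \<open>auto simp: C_diff_on_2_iff\<close>)
    have c: "continuous_on (cball p \<epsilon>) (partial_derivative v e')" if "e' \<in> {1, \<i>}" for e'
    proof -
      have "continuous_on U (partial_derivative v e')" using u e v that unfolding C_diff_on_2_iff by blast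
      then show ?thesis using \<epsilon>(2) continuous_on_subset by blast
    qed
    have "continuous_on (cball p \<epsilon>) (grad v)"
      unfolding grad_def[abs_def] Complex_eq using c by (intro continuous_intros) auto
    then have "bounded (grad v ` cball p \<epsilon>)" by (intro compact_imp_bounded compact_continuous_image) auto
    then obtain K where K: "K > 0" "\<And>z. z \<in> cball p \<epsilon> \<Longrightarrow> norm (grad v z) \<le> K" unfolding bounded_pos by auto
    have "norm (v z - v w) \<le> K * norm (z - w)" if "z \<in> cball p \<epsilon>" "w \<in> cball p \<epsilon>" for z w
    proof (rule differentiable_bound[OF convex_cball _ _ that])
      show "(v has_derivative (\<lambda>h. grad v x \<bullet> h)) (at x within cball p \<epsilon>)" if "x \<in> cball p \<epsilon>" for x
        using d that \<epsilon>(2) has_derivative_at_withinI by blast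
      show "onorm (\<lambda>h. grad v x \<bullet> h) \<le> K" if "x \<in> cball p \<epsilon>" for x
      proof (rule onorm_le)
        fix h
        have "norm (grad v x \<bullet> h) \<le> norm (grad v x) * norm h" by (simp add: Cauchy_Schwarz_ineq2)
        also have "\<dots> \<le> K * norm h" using K(2)[OF that] by (intro mult_right_mono) auto
        finally show "norm (grad v x \<bullet> h) \<le> K * norm h" .
      qed
    qed
    then show ?thesis using K(1) by (intro exI[of _ K]) auto
  qed
  from this[of 1] this[of \<i>] obtain K\<^sub>1 K\<^sub>2 where
    K: "0 \<le> K\<^sub>1" "\<And>z w. z \<in> cball p \<epsilon> \<Longrightarrow> w \<in> cball p \<epsilon> \<Longrightarrow> \<bar>partial_derivative u 1 z - partial_derivative u 1 w\<bar> \<le> K\<^sub>1 * norm (z - w)"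
    "0 \<le> K\<^sub>2" "\<And>z w. z \<in> cball p \<epsilon> \<Longrightarrow> w \<in> cball p \<epsilon> \<Longrightarrow> \<bar>partial_derivative u \<i> z - partial_derivative u \<i> w\<bar> \<le> K\<^sub>2 * norm (z - w)"
    by auto
  have "norm (grad u z - grad u w) \<le> (K\<^sub>1 + K\<^sub>2) * norm (z - w)" if "z \<in> cball p \<epsilon>" "w \<in> cball p \<epsilon>" for z w
    using cmod_le[of "grad u z - grad u w"] K(2)[OF that] K(4)[OF that] by (simp add: grad_def distrib_right)
  then show ?thesis using \<epsilon> K by (intro exI[of _ \<epsilon>] conjI exI[of _ "K\<^sub>1 + K\<^sub>2"]) auto
qed

lemma first_order_Taylor:
  fixes u :: "complex \<Rightarrow> real"
  assumes d: "\<And>z. z \<in> S \<Longrightarrow> (u has_derivative (\<lambda>h. G z \<bullet> h)) (at z)" and S: "convex S" "p \<in> S" "z \<in> S"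
    and lip: "\<And>z w. z \<in> S \<Longrightarrow> w \<in> S \<Longrightarrow> norm (G z - G w) \<le> K * norm (z - w)" and K: "0 \<le> K"
  shows "\<bar>u z - u p - G p \<bullet> (z - p)\<bar> \<le> K * (norm (z - p))\<^sup>2"
proof -
  have seg: "closed_segment p z \<subseteq> S" using S by (simp add: closed_segment_subset)
  have "norm ((u z - G p \<bullet> z) - (u p - G p \<bullet> p)) \<le> K * norm (z - p) * norm (z - p)"
  proof (rule differentiable_bound[of "closed_segment p z"])
    fix x assume x: "x \<in> closed_segment p z"
    then have xS: "x \<in> S" using seg by auto
    show "((\<lambda>x. u x - G p \<bullet> x) has_derivative (\<lambda>h. G x \<bullet> h - G p \<bullet> h)) (at x within closed_segment p z)"
      by (intro has_derivative_diff has_derivative_at_withinI[OF d[OF xS]] has_derivative_inner_right has_derivative_ident)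
    show "onorm (\<lambda>h. G x \<bullet> h - G p \<bullet> h) \<le> K * norm (z - p)"
    proof (rule onorm_le)
      fix h
      have "norm (G x \<bullet> h - G p \<bullet> h) \<le> norm (G x - G p) * norm h"
        using Cauchy_Schwarz_ineq2[of "G x - G p" h] by (simp add: inner_diff_left)
      also have "\<dots> \<le> (K * norm (z - p)) * norm h"
      proof (intro mult_right_mono)
        show "norm (G x - G p) \<le> K * norm (z - p)"
          using lip[OF xS S(2)] mult_left_mono[OF segment_bound(1)[OF x] K] by linarith
      qed auto
      finally show "norm (G x \<bullet> h - G p \<bullet> h) \<le> K * norm (z - p) * norm h" .
    qed
  qed auto
  then show ?thesis by (simp add: power2_eq_square inner_diff_right mult.assoc algebra_simps)
qed

text \<open>The mean value theorem in direction e, followed by differentiability of one first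
  partial at the single point z. As the second difference is symmetric in e and e', this leads to
  \<open>mixed_partials_eq\<close>.\<close>

lemma second_difference:
  fixes u :: "complex \<Rightarrow> real"
  assumes u: "\<And>z. z \<in> U \<Longrightarrow> u differentiable (at z)" and U: "open U" "z \<in> U"
    and A: "(partial_derivative u e has_derivative A) (at z)" and e: "norm e = 1" "norm e' = 1" and \<epsilon>: "0 < \<epsilon>"
  shows "\<exists>\<delta>>0. \<forall>h. 0 < h \<and> h < \<delta> \<longrightarrow>
    \<bar>u (z + h *\<^sub>R e + h *\<^sub>R e') - u (z + h *\<^sub>R e) - u (z + h *\<^sub>R e') + u z - h\<^sup>2 * A e'\<bar> \<le> \<epsilon> * h\<^sup>2"
proof -
  interpret bounded_linear A by (rule has_derivative_bounded_linear[OF A])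
  have "\<epsilon> / 3 > 0" using \<epsilon> by simp
  then obtain d where d: "d > 0" "\<And>y. norm (y - z) < d \<Longrightarrow>
      norm (partial_derivative u e y - partial_derivative u e z - A (y - z)) \<le> \<epsilon> / 3 * norm (y - z)"
    using A unfolding has_derivative_at_alt by metis
  obtain d' where d': "d' > 0" "ball z d' \<subseteq> U" using U openE by blast
  define \<delta> where "\<delta> = min d d' / 2"
  have \<delta>: "0 < \<delta>" "2 * \<delta> \<le> d" "2 * \<delta> \<le> d'" using d d' by (auto simp: \<delta>_def)
  have "\<bar>u (z + h *\<^sub>R e + h *\<^sub>R e') - u (z + h *\<^sub>R e) - u (z + h *\<^sub>R e') + u z - h\<^sup>2 * A e'\<bar> \<le> \<epsilon> * h\<^sup>2"
    if h: "0 < h" "h < \<delta>" for h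
  proof -
    define \<psi> where "\<psi> t = u (z + t *\<^sub>R e + h *\<^sub>R e') - u (z + t *\<^sub>R e)" for t
    define \<psi>' where "\<psi>' t = partial_derivative u e (z + t *\<^sub>R e + h *\<^sub>R e') - partial_derivative u e (z + t *\<^sub>R e)" for t
    have near: "norm (t *\<^sub>R e + h *\<^sub>R e') \<le> 2 * h" "norm (t *\<^sub>R e) \<le> h" if "0 \<le> t" "t \<le> h" for t
    proof -
      show 1: "norm (t *\<^sub>R e) \<le> h" using that e by simp
      show "norm (t *\<^sub>R e + h *\<^sub>R e') \<le> 2 * h" using norm_triangle_ineq[of "t *\<^sub>R e" "h *\<^sub>R e'"] 1 e h by simp
    qed
    have ballU: "z + w \<in> U" if "norm w < d'" for w using d'(2) that by (auto simp: dist_norm)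
    have inU: "z + t *\<^sub>R e + h *\<^sub>R e' \<in> U" "z + t *\<^sub>R e \<in> U" if "0 \<le> t" "t \<le> h" for t
      using near[OF that] h \<delta> ballU[of "t *\<^sub>R e + h *\<^sub>R e'"] ballU[of "t *\<^sub>R e"] by (auto simp: add.assoc)
    have path: "((\<lambda>t. u (z + t *\<^sub>R e + c)) has_real_derivative partial_derivative u e (z + t *\<^sub>R e + c)) (at t)"
      if "z + t *\<^sub>R e + c \<in> U" for t c
    proof -
      have D: "(u has_derivative frechet_derivative u (at (z + t *\<^sub>R e + c))) (at (z + t *\<^sub>R e + c))"
        using u[OF that] unfolding frechet_derivative_works .
      have "((\<lambda>t. z + t *\<^sub>R e + c) has_derivative (\<lambda>h. h *\<^sub>R e)) (at t)"
        by (auto intro!: derivative_eq_intros)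
      from has_derivative_compose[OF this D]
      have "((\<lambda>t. u (z + t *\<^sub>R e + c)) has_derivative (\<lambda>h. frechet_derivative u (at (z + t *\<^sub>R e + c)) (h *\<^sub>R e))) (at t)" .
      moreover have "frechet_derivative u (at (z + t *\<^sub>R e + c)) (h *\<^sub>R e) = partial_derivative u e (z + t *\<^sub>R e + c) * h" for h
        using linear_scale[OF has_derivative_linear[OF D]] by (simp add: partial_derivative_def mult.commute)
      ultimately show ?thesis by (simp add: has_field_derivative_def)
    qed
    have d\<psi>: "(\<psi> has_real_derivative \<psi>' t) (at t)" if "0 \<le> t" "t \<le> h" for t
      unfolding \<psi>_def[abs_def] \<psi>'_def using path[of t "h *\<^sub>R e'"] path[of t 0] inU[OF that] by (intro DERIV_diff) auto
    obtain \<xi> where \<xi>: "0 < \<xi>" "\<xi> < h" "\<psi> h - \<psi> 0 = (h - 0) * \<psi>' \<xi>"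
      using MVT2[of 0 h \<psi> \<psi>'] h d\<psi> by auto
    define a where "a = \<xi> *\<^sub>R e + h *\<^sub>R e'"
    define c where "c = \<xi> *\<^sub>R e"
    have na: "norm a \<le> 2 * h" "norm c \<le> h" using near[of \<xi>] \<xi> by (auto simp: a_def c_def)
    have "norm (partial_derivative u e (z + a) - partial_derivative u e z - A a) \<le> \<epsilon> / 3 * norm a"
      using d(2)[of "z + a"] na h \<delta> by simp
    also have "\<dots> \<le> \<epsilon> / 3 * (2 * h)" using na \<epsilon> by (intro mult_left_mono) auto
    finally have 1: "norm (partial_derivative u e (z + a) - partial_derivative u e z - A a) \<le> \<epsilon> / 3 * (2 * h)" .
    have "norm (partial_derivative u e (z + c) - partial_derivative u e z - A c) \<le> \<epsilon> / 3 * norm c"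
      using d(2)[of "z + c"] na h \<delta> by simp
    also have "\<dots> \<le> \<epsilon> / 3 * h" using na \<epsilon> by (intro mult_left_mono) auto
    finally have 2: "norm (partial_derivative u e (z + c) - partial_derivative u e z - A c) \<le> \<epsilon> / 3 * h" .
    have "A a - A c = h * A e'" by (simp add: a_def c_def add scale)
    moreover have "\<psi>' \<xi> = partial_derivative u e (z + a) - partial_derivative u e (z + c)"
      by (simp add: \<psi>'_def a_def c_def add.assoc)
    ultimately have "\<psi>' \<xi> - h * A e' = (partial_derivative u e (z + a) - partial_derivative u e z - A a)
        - (partial_derivative u e (z + c) - partial_derivative u e z - A c)" by simp
    then have "\<bar>\<psi>' \<xi> - h * A e'\<bar> \<le> \<epsilon> / 3 * (2 * h) + \<epsilon> / 3 * h"
      using 1 2 by (simp only: real_norm_def)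
    then have "\<bar>\<psi>' \<xi> - h * A e'\<bar> \<le> \<epsilon> * h" by simp
    then have "h * \<bar>\<psi>' \<xi> - h * A e'\<bar> \<le> h * (\<epsilon> * h)" using h by (intro mult_left_mono) auto
    moreover have "h * \<bar>\<psi>' \<xi> - h * A e'\<bar> = \<bar>\<psi> h - \<psi> 0 - h\<^sup>2 * A e'\<bar>"
    proof -
      have "\<psi> h - \<psi> 0 - h\<^sup>2 * A e' = h * (\<psi>' \<xi> - h * A e')"
        unfolding \<xi>(3) by (simp add: power2_eq_square algebra_simps)
      then show ?thesis using h by (simp only: abs_mult abs_of_pos)
    qed
    moreover have "\<psi> h - \<psi> 0 = u (z + h *\<^sub>R e + h *\<^sub>R e') - u (z + h *\<^sub>R e) - u (z + h *\<^sub>R e') + u z"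
      by (simp add: \<psi>_def)
    ultimately show ?thesis by (simp add: power2_eq_square mult_ac)
  qed
  then show ?thesis using \<delta>(1) by blast
qed

lemma mixed_partials_eq:
  fixes u :: "complex \<Rightarrow> real"
  assumes u: "C_diff_on 2 u U" and U: "open U" "z \<in> U"
  shows "partial_derivative (partial_derivative u 1) \<i> z = partial_derivative (partial_derivative u \<i>) 1 z"
proof -
  let ?a = "partial_derivative (partial_derivative u 1) \<i> z" and ?b = "partial_derivative (partial_derivative u \<i>) 1 z"
  have D: "(partial_derivative u e has_derivative frechet_derivative (partial_derivative u e) (at z)) (at z)" if "e \<in> {1, \<i>}" for e
    using u that U unfolding C_diff_on_2_iff frechet_derivative_works[symmetric] by blast
  have du: "\<And>z. z \<in> U \<Longrightarrow> u differentiable (at z)" using u unfolding C_diff_on_2_iff by blast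
  have "\<bar>?a - ?b\<bar> \<le> \<epsilon>" if \<epsilon>: "\<epsilon> > 0" for \<epsilon>
  proof -
    have \<epsilon>2: "\<epsilon> / 2 > 0" using \<epsilon> by simp
    from second_difference[OF du U D _ _ \<epsilon>2, of 1 \<i>] obtain \<delta>\<^sub>1 where \<delta>\<^sub>1: "\<delta>\<^sub>1 > 0"
      "\<And>h. 0 < h \<Longrightarrow> h < \<delta>\<^sub>1 \<Longrightarrow> \<bar>u (z + h *\<^sub>R 1 + h *\<^sub>R \<i>) - u (z + h *\<^sub>R 1) - u (z + h *\<^sub>R \<i>) + u z - h\<^sup>2 * ?a\<bar> \<le> \<epsilon> / 2 * h\<^sup>2"
      unfolding partial_derivative_def by auto
    from second_difference[OF du U D _ _ \<epsilon>2, of \<i> 1] obtain \<delta>\<^sub>2 where \<delta>\<^sub>2: "\<delta>\<^sub>2 > 0"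
      "\<And>h. 0 < h \<Longrightarrow> h < \<delta>\<^sub>2 \<Longrightarrow> \<bar>u (z + h *\<^sub>R \<i> + h *\<^sub>R 1) - u (z + h *\<^sub>R \<i>) - u (z + h *\<^sub>R 1) + u z - h\<^sup>2 * ?b\<bar> \<le> \<epsilon> / 2 * h\<^sup>2"
      unfolding partial_derivative_def by auto
    define h where "h = min \<delta>\<^sub>1 \<delta>\<^sub>2 / 2"
    have h: "0 < h" "h < \<delta>\<^sub>1" "h < \<delta>\<^sub>2" using \<delta>\<^sub>1 \<delta>\<^sub>2 by (auto simp: h_def)
    define X where "X = u (z + h *\<^sub>R 1 + h *\<^sub>R \<i>) - u (z + h *\<^sub>R 1) - u (z + h *\<^sub>R \<i>) + u z"
    have "\<bar>X - h\<^sup>2 * ?a\<bar> \<le> \<epsilon> / 2 * h\<^sup>2" using \<delta>\<^sub>1(2)[OF h(1,2)] by (simp add: X_def)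
    moreover have "\<bar>X - h\<^sup>2 * ?b\<bar> \<le> \<epsilon> / 2 * h\<^sup>2"
    proof -
      have "z + h *\<^sub>R \<i> + h *\<^sub>R 1 = z + h *\<^sub>R 1 + h *\<^sub>R \<i>" by (simp add: add_ac)
      then have "X = u (z + h *\<^sub>R \<i> + h *\<^sub>R 1) - u (z + h *\<^sub>R \<i>) - u (z + h *\<^sub>R 1) + u z"
        unfolding X_def by (simp only:)
      then show ?thesis using \<delta>\<^sub>2(2)[OF h(1,3)] by simp
    qed
    ultimately have "\<bar>h\<^sup>2 * ?a - h\<^sup>2 * ?b\<bar> \<le> \<epsilon> / 2 * h\<^sup>2 + \<epsilon> / 2 * h\<^sup>2"
      by (smt (verit, best))
    then have "\<bar>h\<^sup>2 * ?a - h\<^sup>2 * ?b\<bar> \<le> \<epsilon> * h\<^sup>2" by simp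
    then have "h\<^sup>2 * \<bar>?a - ?b\<bar> \<le> h\<^sup>2 * \<epsilon>" by (simp add: right_diff_distrib[symmetric] abs_mult mult.commute)
    then show ?thesis using h by simp
  qed
  then have "\<bar>?a - ?b\<bar> \<le> 0" using field_le_epsilon[of "\<bar>?a - ?b\<bar>" 0] by simp
  then show ?thesis by simp
qed

text \<open>The function \<open>v = u + |z|^2 / 2\<close> is harmonic, and the expression is
  \<open>v_x - i v_y\<close>. Its Cauchy-Riemann equations are harmonicity and the symmetry of the
  second derivatives.\<close>

lemma torsion_gradient_holomorphic:
  fixes u :: "complex \<Rightarrow> real"
  assumes u: "C_diff_on 2 u U" and U: "open U" and lap: "\<And>z. z \<in> U \<Longrightarrow> laplacian u z + 2 = 0"
  shows "(\<lambda>z. cnj (grad u z) + cnj z) holomorphic_on U"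
  unfolding holomorphic_on_open[OF U]
proof
  fix z assume z: "z \<in> U"
  let ?p = "partial_derivative u 1" and ?q = "partial_derivative u \<i>"
  have d: "(?p has_derivative (\<lambda>h. grad ?p z \<bullet> h)) (at z)" "(?q has_derivative (\<lambda>h. grad ?q z \<bullet> h)) (at z)"
    using u z unfolding C_diff_on_2_iff by (auto intro!: grad_has_derivative)
  define \<alpha> where "\<alpha> = Re (grad ?p z) + 1"
  define \<beta> where "\<beta> = Im (grad ?p z)"
  have \<alpha>': "Re (grad ?p z) = \<alpha> - 1" by (simp add: \<alpha>_def)
  have \<beta>: "Re (grad ?q z) = \<beta>" using mixed_partials_eq[OF u U z] by (simp add: grad_def \<beta>_def)
  have \<alpha>: "Im (grad ?q z) = - \<alpha> - 1"
    using lap[OF z] by (simp add: laplacian_def Basis_complex_def grad_def \<alpha>_def)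
  have "((\<lambda>z. of_real (?p z) - \<i> * of_real (?q z) + cnj z) has_derivative
      (\<lambda>h. of_real (grad ?p z \<bullet> h) - \<i> * of_real (grad ?q z \<bullet> h) + cnj h)) (at z)"
    by (intro has_derivative_add has_derivative_diff has_derivative_mult_right has_derivative_of_real d
        bounded_linear.has_derivative[OF bounded_linear_cnj] has_derivative_ident)
  moreover have "(\<lambda>h. of_real (grad ?p z \<bullet> h) - \<i> * of_real (grad ?q z \<bullet> h) + cnj h) = (*) (Complex \<alpha> (- \<beta>))"
  proof
    fix h
    show "of_real (grad ?p z \<bullet> h) - \<i> * of_real (grad ?q z \<bullet> h) + cnj h = Complex \<alpha> (- \<beta>) * h"
      unfolding complex_eq_iff inner_complex_def
      by (simp add: \<alpha> \<alpha>' \<beta> \<beta>_def[symmetric] left_diff_distrib)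
  qed
  moreover have "(\<lambda>z. of_real (?p z) - \<i> * of_real (?q z) + cnj z) = (\<lambda>z. cnj (grad u z) + cnj z)"
    by (simp add: fun_eq_iff grad_def complex_eq_iff)
  ultimately show "\<exists>f'. ((\<lambda>z. cnj (grad u z) + cnj z) has_field_derivative f') (at z)"
    unfolding has_field_derivative_def by metis
qed

section \<open>Tangent discs of a smooth domain\<close>

text \<open>A description of the normal without a defining function: normals obtained from different
  defining functions can be compared, and the radius records a curvature bound that is stable under
  shrinking and under translations preserving \<Omega>.\<close>

definition normal_at :: "complex set \<Rightarrow> complex \<Rightarrow> complex \<Rightarrow> real \<Rightarrow> bool" where
  "normal_at \<Omega> p \<nu> r \<longleftrightarrow> norm \<nu> = 1 \<and> ball (p - of_real r * \<nu>) r \<subseteq> \<Omega> \<and>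
     ball (p + of_real r * \<nu>) r \<inter> closure \<Omega> = {}"

lemma mem_tangent_ball:
  fixes \<nu> :: complex
  assumes "norm \<nu> = 1" "0 < r"
  shows "z \<in> ball (p + of_real r * \<nu>) r \<longleftrightarrow> (norm (z - p))\<^sup>2 < 2 * r * (\<nu> \<bullet> (z - p))"
    and "z \<in> ball (p - of_real r * \<nu>) r \<longleftrightarrow> (norm (z - p))\<^sup>2 < 2 * r * (- \<nu> \<bullet> (z - p))"
proof -
  have *: "z \<in> ball (p + of_real r * \<nu>) r \<longleftrightarrow> (norm (z - p))\<^sup>2 < 2 * r * (\<nu> \<bullet> (z - p))"
    if "norm \<nu> = 1" for \<nu>
  proof -
    have "dist (p + of_real r * \<nu>) z = norm ((z - p) - of_real r * \<nu>)"
      by (simp add: dist_norm norm_minus_commute algebra_simps)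
    then show ?thesis
      using norm_sub_of_real_mult_ge_iff[OF that assms(2), of "z - p"] by (simp add: not_le[symmetric])
  qed
  show "z \<in> ball (p + of_real r * \<nu>) r \<longleftrightarrow> (norm (z - p))\<^sup>2 < 2 * r * (\<nu> \<bullet> (z - p))"
    by (rule *) (rule assms)
  show "z \<in> ball (p - of_real r * \<nu>) r \<longleftrightarrow> (norm (z - p))\<^sup>2 < 2 * r * (- \<nu> \<bullet> (z - p))"
    using *[of "- \<nu>"] assms by simp
qed

lemma normal_at_mono:
  assumes n: "normal_at \<Omega> p \<nu> r" and r: "0 < r'" "r' \<le> r"
  shows "normal_at \<Omega> p \<nu> r'"
proof -
  have \<nu>: "norm \<nu> = 1" and r0: "0 < r" using n r by (auto simp: normal_at_def)
  have *: "a\<^sup>2 < 2 * r * x" if "a\<^sup>2 < 2 * r' * x" for a x :: real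
  proof -
    have "0 < 2 * r' * x" using that zero_le_power2[of a] by linarith
    then have "0 < x" using r(1) by (simp add: zero_less_mult_iff)
    then have "2 * r' * x \<le> 2 * r * x" using r(2) by simp
    then show ?thesis using that by linarith
  qed
  have "ball (p + of_real r' * \<nu>) r' \<subseteq> ball (p + of_real r * \<nu>) r"
    unfolding subset_eq Ball_def mem_tangent_ball(1)[OF \<nu> r(1)] mem_tangent_ball(1)[OF \<nu> r0] using * by blast
  moreover have "ball (p - of_real r' * \<nu>) r' \<subseteq> ball (p - of_real r * \<nu>) r"
    unfolding subset_eq Ball_def mem_tangent_ball(2)[OF \<nu> r(1)] mem_tangent_ball(2)[OF \<nu> r0] using * by blast
  ultimately show ?thesis using n unfolding normal_at_def by blast
qed

text \<open>For different unit vectors the point \<open>p + t * (\<nu>' - \<nu>)\<close> with small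
  t > 0 lies in the inner disc of \<nu> and in the outer disc of \<nu>', which is
  impossible.\<close>

lemma normal_at_unique:
  assumes n: "normal_at \<Omega> p \<nu> r" "0 < r" and n': "normal_at \<Omega> p \<nu>' r'" "0 < r'"
  shows "\<nu> = \<nu>'"
proof (rule ccontr)
  assume "\<nu> \<noteq> \<nu>'"
  have n1: "norm \<nu> = 1" "norm \<nu>' = 1" using n n' by (auto simp: normal_at_def)
  then have d1: "\<nu> \<bullet> \<nu> = 1" "\<nu>' \<bullet> \<nu>' = 1" by (simp_all add: dot_square_norm)
  define h where "h = \<nu>' - \<nu>"
  have h: "0 < (norm h)\<^sup>2" using \<open>\<nu> \<noteq> \<nu>'\<close> by (simp add: h_def)
  have hh: "2 * (- \<nu> \<bullet> h) = (norm h)\<^sup>2" "2 * (\<nu>' \<bullet> h) = (norm h)\<^sup>2"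
    unfolding power2_norm_eq_inner h_def using d1 by (simp_all add: inner_diff inner_commute)
  define t where "t = min r r' / 2"
  have t: "0 < t" "t < r" "t < r'" using n n' by (auto simp: t_def)
  let ?z = "p + of_real t * h"
  have nz: "(norm (?z - p))\<^sup>2 = t * (t * (norm h)\<^sup>2)" using t by (simp add: norm_mult power_mult_distrib power2_eq_square)
  have iz: "v \<bullet> (?z - p) = t * (v \<bullet> h)" for v by (simp add: scaleR_conv_of_real[symmetric])
  have lt: "t * (t * (norm h)\<^sup>2) < t * (c * (norm h)\<^sup>2)" if "t < c" for c
    using that t h by (intro mult_strict_left_mono mult_strict_right_mono) auto
  have "2 * r * (- \<nu> \<bullet> (?z - p)) = t * (r * (norm h)\<^sup>2)"
    unfolding iz hh(1)[symmetric] by (simp add: algebra_simps)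
  then have "?z \<in> ball (p - of_real r * \<nu>) r"
    unfolding mem_tangent_ball(2)[OF n1(1) n(2)] nz using lt[OF t(2)] by simp
  moreover have "?z \<in> ball (p + of_real r' * \<nu>') r'"
  proof -
    have "2 * r' * (\<nu>' \<bullet> (?z - p)) = t * (r' * (norm h)\<^sup>2)"
      unfolding iz hh(2)[symmetric] by (simp add: algebra_simps)
    then show ?thesis
      unfolding mem_tangent_ball(1)[OF n1(2) n'(2)] nz using lt[OF t(3)] by (simp only:)
  qed
  ultimately show False using n(1) n'(1) closure_subset[of \<Omega>] unfolding normal_at_def by blast
qed

lemma normal_at_translate:
  assumes n: "normal_at \<Omega> p \<nu> r" and \<Omega>: "(\<lambda>z. v + z) ` \<Omega> = \<Omega>"
  shows "normal_at \<Omega> (p + v) \<nu> r"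
proof -
  have cl: "(\<lambda>z. v + z) ` closure \<Omega> = closure \<Omega>" using closure_translation[of v \<Omega>] \<Omega> by simp
  have ball: "z - v \<in> ball c r \<longleftrightarrow> z \<in> ball (c + v) r" for z c by (simp add: dist_norm algebra_simps)
  have "z \<in> \<Omega>" if z: "z \<in> ball (p + v - of_real r * \<nu>) r" for z
  proof -
    have "z - v \<in> ball (p - of_real r * \<nu>) r" unfolding ball using z by (simp add: algebra_simps)
    then have "z - v \<in> \<Omega>" using n by (auto simp: normal_at_def)
    then have "v + (z - v) \<in> \<Omega>" using \<Omega> by blast
    then show ?thesis by simp
  qed
  moreover have "z \<notin> closure \<Omega>" if z: "z \<in> ball (p + v + of_real r * \<nu>) r" for z
  proof
    assume "z \<in> closure \<Omega>"
    then obtain w where w: "w \<in> closure \<Omega>" "z = v + w" using cl by blast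
    have "z - v \<in> ball (p + of_real r * \<nu>) r" unfolding ball using z by (simp add: algebra_simps)
    then have "z - v \<notin> closure \<Omega>" using n by (auto simp: normal_at_def)
    then show False using w by simp
  qed
  ultimately show ?thesis using n unfolding normal_at_def by blast
qed

text \<open>In a tangent disc \<open>(norm (z - p))^2\<close> is below
  \<open>2 * r * \<bar>\<nu> \<bullet> (z - p)\<bar>\<close>, so for small r the quadratic Taylor
  error of \<phi> is dominated by its linear term and \<phi> has the sign of that term. The
  constants depend only on a neighbourhood of \<open>p\<^sub>0\<close>, so r is uniform
  there.\<close>

lemma normal_at_locally:
  assumes loc: "local_defining_function \<Omega> p\<^sub>0 U \<phi>" and op: "open \<Omega>"
  shows "\<exists>\<epsilon>>0. \<exists>r>0. \<forall>p\<in>frontier \<Omega> \<inter> ball p\<^sub>0 \<epsilon>. normal_at \<Omega> p (sgn (grad \<phi> p)) r"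
proof -
  have U: "open U" "p\<^sub>0 \<in> U" and c2: "C_diff_on 2 \<phi> U" and nd: "\<exists>h. frechet_derivative \<phi> (at p\<^sub>0) h \<noteq> 0"
    and \<Omega>: "\<Omega> \<inter> U = {z\<in>U. \<phi> z < 0}"
    using loc unfolding local_defining_function_def smooth_on_def by auto
  have d: "(\<phi> has_derivative (\<lambda>h. grad \<phi> z \<bullet> h)) (at z)" if "z \<in> U" for z
    using c2 that unfolding C_diff_on_2_iff by (auto intro: grad_has_derivative)
  have cont: "continuous_on U \<phi>"
    using d has_derivative_continuous continuous_at_imp_continuous_on by blast
  obtain \<epsilon>\<^sub>0 K where \<epsilon>\<^sub>0: "\<epsilon>\<^sub>0 > 0" "0 \<le> K" "cball p\<^sub>0 \<epsilon>\<^sub>0 \<subseteq> U"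
    "\<And>z w. z \<in> cball p\<^sub>0 \<epsilon>\<^sub>0 \<Longrightarrow> w \<in> cball p\<^sub>0 \<epsilon>\<^sub>0 \<Longrightarrow> norm (grad \<phi> z - grad \<phi> w) \<le> K * norm (z - w)"
    using gradient_Lipschitz[OF c2 U] by blast
  have "grad \<phi> p\<^sub>0 \<noteq> 0"
  proof
    assume 0: "grad \<phi> p\<^sub>0 = 0"
    have "frechet_derivative \<phi> (at p\<^sub>0) = (\<lambda>h. grad \<phi> p\<^sub>0 \<bullet> h)" using frechet_derivative_at[OF d[OF U(2)]] by simp
    then show False using nd 0 by simp
  qed
  \<comment> \<open>A lower bound for the gradient near \<open>p\<^sub>0\<close>; \<epsilon> and r
    are chosen so that K times the displacements stays below it. The denominators with
    \<open>K + 1\<close> admit K = 0.\<close>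
  define m where "m = norm (grad \<phi> p\<^sub>0) / 2"
  have m: "0 < m" using \<open>grad \<phi> p\<^sub>0 \<noteq> 0\<close> by (simp add: m_def)
  define \<epsilon> where "\<epsilon> = min (\<epsilon>\<^sub>0 / 2) (m / (K + 1))"
  have \<epsilon>: "0 < \<epsilon>" "2 * \<epsilon> \<le> \<epsilon>\<^sub>0" "(K + 1) * \<epsilon> \<le> m"
  proof -
    show "0 < \<epsilon>" "2 * \<epsilon> \<le> \<epsilon>\<^sub>0" using \<epsilon>\<^sub>0 m by (auto simp: \<epsilon>_def)
    have "(K + 1) * \<epsilon> \<le> (K + 1) * (m / (K + 1))" using \<epsilon>\<^sub>0 by (intro mult_left_mono) (auto simp: \<epsilon>_def)
    then show "(K + 1) * \<epsilon> \<le> m" using \<epsilon>\<^sub>0 by simp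
  qed
  define r where "r = min (\<epsilon> / 2) (m / (2 * (K + 1)))"
  have r: "0 < r" "2 * r \<le> \<epsilon>" "K * (2 * r) \<le> m"
  proof -
    show "0 < r" "2 * r \<le> \<epsilon>" using \<epsilon> m \<epsilon>\<^sub>0 by (auto simp: r_def)
    have "K * (2 * r) \<le> (K + 1) * (2 * (m / (2 * (K + 1))))" using \<epsilon>\<^sub>0 \<open>0 < r\<close> by (intro mult_mono) (auto simp: r_def)
    also have "\<dots> = m" using \<epsilon>\<^sub>0(2) by (simp add: field_simps)
    finally show "K * (2 * r) \<le> m" .
  qed
  have le0: "\<phi> z \<le> 0" if "z \<in> closure \<Omega>" "z \<in> U" for z
  proof (rule ccontr)
    assume "\<not> \<phi> z \<le> 0"
    have "open (U \<inter> \<phi> -` {0<..})" by (rule continuous_open_preimage[OF cont U(1)]) simp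
    moreover have "z \<in> U \<inter> \<phi> -` {0<..}" using \<open>\<not> \<phi> z \<le> 0\<close> that by simp
    ultimately have "\<Omega> \<inter> (U \<inter> \<phi> -` {0<..}) \<noteq> {}" using that(1) open_Int_closure_eq_empty by blast
    then show False using \<Omega> by force
  qed
  have "normal_at \<Omega> p (sgn (grad \<phi> p)) r" if p: "p \<in> frontier \<Omega>" "p \<in> ball p\<^sub>0 \<epsilon>" for p
  proof -
    have p\<epsilon>: "p \<in> cball p\<^sub>0 \<epsilon>\<^sub>0" and pU: "p \<in> U" using p \<epsilon> \<epsilon>\<^sub>0 by auto
    have "p \<notin> \<Omega>" "p \<in> closure \<Omega>" using p(1) op by (auto simp: frontier_def interior_open)
    then have \<phi>p: "\<phi> p = 0" using le0[of p] pU \<Omega> by force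
    have "norm (grad \<phi> p\<^sub>0 - grad \<phi> p) \<le> K * norm (p\<^sub>0 - p)" by (rule \<epsilon>\<^sub>0(4)) (use p\<epsilon> \<epsilon>\<^sub>0 in auto)
    also have "\<dots> \<le> (K + 1) * \<epsilon>" using p(2) \<epsilon>\<^sub>0 by (intro mult_mono) (auto simp: dist_norm)
    also have "\<dots> \<le> m" by (rule \<epsilon>(3))
    finally have gm: "m \<le> norm (grad \<phi> p)"
      using norm_triangle_ineq2[of "grad \<phi> p\<^sub>0" "grad \<phi> p"] by (simp add: m_def)
    define \<nu> where "\<nu> = sgn (grad \<phi> p)"
    define M where "M = norm (grad \<phi> p)"
    have M: "m \<le> M" "0 < M" using gm m by (auto simp: M_def)
    then have \<nu>: "norm \<nu> = 1" by (auto simp: \<nu>_def norm_sgn M_def)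
    have g\<nu>: "grad \<phi> p \<bullet> h = M * (\<nu> \<bullet> h)" for h
      using M by (simp add: \<nu>_def sgn_div_norm M_def)
    have tay: "\<bar>\<phi> z - M * (\<nu> \<bullet> (z - p))\<bar> \<le> K * (norm (z - p))\<^sup>2" "z \<in> U" if z: "norm (z - p) < 2 * r" for z
    proof -
      have "dist p\<^sub>0 z \<le> dist p\<^sub>0 p + dist p z" by (rule dist_triangle)
      then have z\<epsilon>: "z \<in> cball p\<^sub>0 \<epsilon>\<^sub>0" using z p(2) r \<epsilon> by (simp add: dist_norm norm_minus_commute)
      then show "z \<in> U" using \<epsilon>\<^sub>0 by auto
      show "\<bar>\<phi> z - M * (\<nu> \<bullet> (z - p))\<bar> \<le> K * (norm (z - p))\<^sup>2"
      proof -
        have "\<bar>\<phi> z - \<phi> p - grad \<phi> p \<bullet> (z - p)\<bar> \<le> K * (norm (z - p))\<^sup>2"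
          by (rule first_order_Taylor[OF d convex_cball p\<epsilon> z\<epsilon> \<epsilon>\<^sub>0(4,2)]) (use \<epsilon>\<^sub>0(3) in blast)+
        then show ?thesis by (simp only: \<phi>p g\<nu> diff_zero)
      qed
    qed
    have est: "norm (z - p) < 2 * r \<and> K * (norm (z - p))\<^sup>2 < M * x"
      if z: "(norm (z - p))\<^sup>2 < 2 * r * x" "\<bar>x\<bar> \<le> norm (z - p)" for z x
    proof -
      have x: "0 < x"
      proof -
        have "0 < 2 * r * x" using z(1) zero_le_power2[of "norm (z - p)"] by linarith
        then show ?thesis using r by (simp add: zero_less_mult_iff)
      qed
      have "norm (z - p) * norm (z - p) < 2 * r * norm (z - p)"
      proof -
        have "2 * r * x \<le> 2 * r * norm (z - p)" using z(2) r by (intro mult_left_mono) auto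
        then show ?thesis using z(1) unfolding power2_eq_square by linarith
      qed
      then have "norm (z - p) < 2 * r" by (simp add: mult_less_cancel_right_disj)
      moreover have "K * (norm (z - p))\<^sup>2 < M * x"
      proof (cases "K = 0")
        case True
        then show ?thesis using M x by simp
      next
        case False
        then have "K * (norm (z - p))\<^sup>2 < K * (2 * r * x)" using z(1) \<epsilon>\<^sub>0(2) by (intro mult_strict_left_mono) auto
        also have "\<dots> = K * (2 * r) * x" by simp
        also have "\<dots> \<le> M * x" using r(3) M x by (intro mult_right_mono) auto
        finally show ?thesis .
      qed
      ultimately show ?thesis by blast
    qed
    have CS: "\<bar>\<nu> \<bullet> (z - p)\<bar> \<le> norm (z - p)" "\<bar>- \<nu> \<bullet> (z - p)\<bar> \<le> norm (z - p)" for z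
      using Cauchy_Schwarz_ineq2[of \<nu> "z - p"] \<nu> by auto
    have "z \<in> \<Omega>" if "z \<in> ball (p - of_real r * \<nu>) r" for z
    proof -
      have "norm (z - p) < 2 * r \<and> K * (norm (z - p))\<^sup>2 < M * (- \<nu> \<bullet> (z - p))"
        using that unfolding mem_tangent_ball(2)[OF \<nu> r(1)] by (rule est) (rule CS)
      then have "\<phi> z < 0" "z \<in> U" using tay[of z] by (auto simp: abs_le_iff)
      then show ?thesis using \<Omega> by blast
    qed
    moreover have "z \<notin> closure \<Omega>" if "z \<in> ball (p + of_real r * \<nu>) r" for z
    proof -
      have "norm (z - p) < 2 * r \<and> K * (norm (z - p))\<^sup>2 < M * (\<nu> \<bullet> (z - p))"
        using that unfolding mem_tangent_ball(1)[OF \<nu> r(1)] by (rule est) (rule CS)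
      then have "\<phi> z > 0" "z \<in> U" using tay[of z] by (auto simp: abs_le_iff)
      then show ?thesis using le0[of z] by auto
    qed
    ultimately show ?thesis unfolding normal_at_def \<nu>_def[symmetric] using \<nu> by blast
  qed
  then show ?thesis using \<epsilon>(1) r(1) by blast
qed

lemma exterior_unit_normal_at:
  assumes ext: "exterior_unit_normal \<Omega> p \<nu>" and op: "open \<Omega>" and p: "p \<in> frontier \<Omega>"
  shows "\<exists>r>0. normal_at \<Omega> p \<nu> r"
proof -
  obtain U \<phi> c where \<nu>: "norm \<nu> = 1" and loc: "local_defining_function \<Omega> p U \<phi>" and c: "c > 0"
    "\<And>h. frechet_derivative \<phi> (at p) h = c * (\<nu> \<bullet> h)"
    using ext unfolding exterior_unit_normal_def by blast
  have "grad \<phi> p = of_real c * \<nu>"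
    by (simp add: grad_def partial_derivative_def c(2) inner_complex_def complex_eq_iff)
  then have "sgn (grad \<phi> p) = \<nu>" using c(1) \<nu> by (simp add: sgn_div_norm norm_mult scaleR_conv_of_real)
  then show ?thesis using normal_at_locally[OF loc op] p by (metis IntI centre_in_ball)
qed

lemma normal_at_compact:
  assumes sm: "smooth_domain \<Omega>" and K: "compact K" "K \<subseteq> frontier \<Omega>"
  shows "\<exists>r>0. \<forall>p\<in>K. \<exists>\<nu>. normal_at \<Omega> p \<nu> r"
proof -
  have op: "open \<Omega>" using sm by (simp add: smooth_domain_def)
  have "\<exists>\<epsilon> r. 0 < \<epsilon> \<and> 0 < r \<and> (\<forall>p\<in>frontier \<Omega> \<inter> ball q \<epsilon>. \<exists>\<nu>. normal_at \<Omega> p \<nu> r)" if "q \<in> K" for q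
  proof -
    have "\<forall>p\<in>frontier \<Omega>. \<exists>U \<phi>. local_defining_function \<Omega> p U \<phi>" using sm by (simp add: smooth_domain_def)
    moreover have "q \<in> frontier \<Omega>" using K that by blast
    ultimately obtain U \<phi> where loc: "local_defining_function \<Omega> q U \<phi>" by blast
    from normal_at_locally[OF loc op] show ?thesis by meson
  qed
  then obtain \<epsilon> r where er: "\<And>q. q \<in> K \<Longrightarrow> 0 < \<epsilon> q" "\<And>q. q \<in> K \<Longrightarrow> 0 < r q"
    "\<And>q p. q \<in> K \<Longrightarrow> p \<in> frontier \<Omega> \<Longrightarrow> p \<in> ball q (\<epsilon> q) \<Longrightarrow> \<exists>\<nu>. normal_at \<Omega> p \<nu> (r q)"
    by (metis IntI)
  have "K \<subseteq> (\<Union>q\<in>K. ball q (\<epsilon> q))" using er(1) by force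
  then obtain D where D: "D \<subseteq> K" "finite D" "K \<subseteq> (\<Union>q\<in>D. ball q (\<epsilon> q))"
    using compactE_image[OF K(1), of K "\<lambda>q. ball q (\<epsilon> q)"] by auto
  define \<rho> where "\<rho> = Min (insert 1 (r ` D))"
  have "0 < \<rho>" using D er(2) by (auto simp: \<rho>_def Min_gr_iff)
  moreover have "\<exists>\<nu>. normal_at \<Omega> p \<nu> \<rho>" if p: "p \<in> K" for p
  proof -
    obtain q where q: "q \<in> D" "p \<in> ball q (\<epsilon> q)" using D(3) p by blast
    then obtain \<nu> where "normal_at \<Omega> p \<nu> (r q)" using er(3)[of q p] D(1) K(2) p by blast
    moreover have "\<rho> \<le> r q" unfolding \<rho>_def using D(2) q(1) by (intro Min_le) auto
    ultimately show ?thesis using normal_at_mono \<open>0 < \<rho>\<close> by blast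
  qed
  ultimately show ?thesis by blast
qed

text \<open>The outer disc at a boundary point contains points arbitrarily close to it that are
  outside \<open>closure \<Omega>\<close>. As a consequence derivatives within the closure are
  two-sided ones at points of \<Omega>, and open images inside the closure lie in \<Omega>.\<close>

lemma interior_closure_smooth_domain:
  assumes sm: "smooth_domain \<Omega>"
  shows "interior (closure \<Omega>) = \<Omega>"
proof
  have op: "open \<Omega>" using sm by (simp add: smooth_domain_def)
  show "\<Omega> \<subseteq> interior (closure \<Omega>)" using op closure_subset by (rule interior_maximal[rotated])
  show "interior (closure \<Omega>) \<subseteq> \<Omega>"
  proof (rule subsetI, rule ccontr)
    fix p assume p: "p \<in> interior (closure \<Omega>)" "p \<notin> \<Omega>"
    then have "p \<in> frontier \<Omega>" using op interior_subset[of "closure \<Omega>"] by (auto simp: frontier_def interior_open)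
    then obtain r \<nu> where r: "r > 0" "normal_at \<Omega> p \<nu> r" using normal_at_compact[OF sm, of "{p}"] by auto
    then have \<nu>: "norm \<nu> = 1" by (simp add: normal_at_def)
    obtain e where e: "e > 0" "ball p e \<subseteq> closure \<Omega>" using p(1) by (meson mem_interior)
    define t where "t = min (e / 2) r"
    have t: "0 < t" "t < e" "t \<le> r" using e r by (auto simp: t_def)
    let ?z = "p + of_real t * \<nu>"
    have "?z \<in> ball p e" using t \<nu> by (simp add: dist_norm norm_mult)
    moreover have "\<nu> \<bullet> \<nu> = 1" using \<nu> by (simp add: dot_square_norm)
    then have "?z \<in> ball (p + of_real r * \<nu>) r"
      unfolding mem_tangent_ball(1)[OF \<nu> r(1)] using t \<nu> r(1)
      by (simp add: norm_mult scaleR_conv_of_real[symmetric] power2_eq_square)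
    ultimately show False using e(2) r(2) unfolding normal_at_def by blast
  qed
qed

text \<open>The derivative within \<open>closure \<Omega>\<close> is determined along the inner normal and along chords of \<open>S\<close>.\<close>

lemma boundary_gradient:
  assumes op: "open \<Omega>" and p: "p \<in> frontier \<Omega>" and n: "normal_at \<Omega> p \<nu> r" "0 < r"
    and G: "(u has_derivative (\<lambda>h. G \<bullet> h)) (at p within closure \<Omega>)"
    and nd: "has_normal_derivative \<Omega> u p b"
    and S: "S \<subseteq> frontier \<Omega>" "\<And>x. x \<in> S \<Longrightarrow> u x = a" "p \<in> S"
    and acc: "\<And>\<delta>. \<delta> > 0 \<Longrightarrow> \<exists>x\<in>S. x \<noteq> p \<and> dist x p < \<delta>"
  shows "G = of_real b * \<nu>"
proof -
  have \<nu>: "norm \<nu> = 1" using n by (simp add: normal_at_def)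
  then have \<nu>\<nu>: "\<nu> \<bullet> \<nu> = 1" by (simp add: dot_square_norm)
  obtain \<nu>' D where ext: "exterior_unit_normal \<Omega> p \<nu>'" and D: "(u has_derivative D) (at p within closure \<Omega>)" "D \<nu>' = b"
    using nd unfolding has_normal_derivative_def by blast
  have "\<nu>' = \<nu>" using exterior_unit_normal_at[OF ext op p] normal_at_unique n by blast
  interpret D: bounded_linear D by (rule has_derivative_bounded_linear[OF D(1)])
  have into: "p - t *\<^sub>R \<nu> \<in> closure \<Omega>" if "t \<in> {0..r}" for t
  proof (cases "t = 0")
    case True
    then show ?thesis using p by (simp add: frontier_def)
  next
    case False
    then have t: "0 < t" "t \<le> r" using that by auto
    then have "p - t *\<^sub>R \<nu> \<in> ball (p - of_real r * \<nu>) r"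
      unfolding mem_tangent_ball(2)[OF \<nu> n(2)] using \<nu> \<nu>\<nu> by (simp add: power2_eq_square)
    then show ?thesis using n closure_subset[of \<Omega>] by (auto simp: normal_at_def)
  qed
  have path: "((\<lambda>t. p - t *\<^sub>R \<nu>) has_derivative (\<lambda>h. - (h *\<^sub>R \<nu>))) (at 0 within cbox 0 r)"
    by (auto intro!: derivative_eq_intros)
  have chain: "((\<lambda>t. u (p - t *\<^sub>R \<nu>)) has_vector_derivative A (- \<nu>)) (at 0 within cbox 0 r)"
    if A: "(u has_derivative A) (at p within closure \<Omega>)" for A
  proof -
    interpret A: bounded_linear A by (rule has_derivative_bounded_linear[OF A])
    have "(u has_derivative A) (at (p - 0 *\<^sub>R \<nu>) within (\<lambda>t. p - t *\<^sub>R \<nu>) ` cbox 0 r)"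
      using A into by (auto intro: has_derivative_subset)
    from diff_chain_within[OF path this]
    have "((\<lambda>t. u (p - t *\<^sub>R \<nu>)) has_derivative (\<lambda>h. A (- (h *\<^sub>R \<nu>)))) (at 0 within cbox 0 r)" by (simp add: o_def)
    moreover have "(\<lambda>h. A (- (h *\<^sub>R \<nu>))) = (\<lambda>h. h *\<^sub>R A (- \<nu>))" by (simp add: fun_eq_iff A.neg A.scale)
    ultimately show ?thesis by (simp add: has_vector_derivative_def)
  qed
  have "G \<bullet> (- \<nu>) = D (- \<nu>)"
    by (rule vector_derivative_unique_within_closed_interval[OF n(2) _ chain[OF G] chain[OF D(1)]]) (use n(2) in simp)
  then have G\<nu>: "G \<bullet> \<nu> = b" using D(2) \<open>\<nu>' = \<nu>\<close> by (simp add: D.neg)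
  \<comment> \<open>Along boundary chords d the solution u is constant, so
    \<open>G \<bullet> d\<close> is of lower order, while d is nearly tangential; hence the
    tangential component of G vanishes.\<close>
  have perp: "\<bar>G \<bullet> (\<i> * \<nu>)\<bar> \<le> \<epsilon>" if \<epsilon>: "0 < \<epsilon>" for \<epsilon>
  proof -
    have "\<epsilon> / 4 > 0" using \<epsilon> by simp
    then obtain \<delta> where \<delta>: "\<delta> > 0" "\<And>x. x \<in> closure \<Omega> \<Longrightarrow> norm (x - p) < \<delta> \<Longrightarrow> norm (u x - u p - G \<bullet> (x - p)) \<le> \<epsilon> / 4 * norm (x - p)"
      using G unfolding has_derivative_within_alt by metis
    \<comment> \<open>\<open>k < r\<close> makes the normal part of the chord at most k/2, so its
      tangential part is at least k/2; the last bound makes the normal contribution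
      \<open>\<bar>\<nu> \<bullet> d\<bar> * \<bar>b\<bar>\<close> at most
      \<open>\<epsilon> / 4 * k\<close>.\<close>
    define \<delta>' where "\<delta>' = min \<delta> (min r (\<epsilon> * r / (2 * (\<bar>b\<bar> + 1))))"
    have "0 < \<epsilon> * r / (2 * (\<bar>b\<bar> + 1))" using \<epsilon> n(2) by (intro divide_pos_pos mult_pos_pos) auto
    then have "\<delta>' > 0" using \<delta> n(2) by (simp add: \<delta>'_def)
    then obtain x where x: "x \<in> S" "x \<noteq> p" "dist x p < \<delta>'" using acc by blast
    define d where "d = x - p"
    define k where "k = norm d"
    have k: "0 < k" "k < \<delta>" "k < r" "k < \<epsilon> * r / (2 * (\<bar>b\<bar> + 1))"
      using x by (auto simp: k_def d_def dist_norm \<delta>'_def)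
    have xf: "x \<in> frontier \<Omega>" using x S by auto
    then have xc: "x \<in> closure \<Omega>" "x \<notin> \<Omega>" using op by (auto simp: frontier_def interior_open)
    have 1: "\<bar>G \<bullet> d\<bar> \<le> \<epsilon> / 4 * k"
      using \<delta>(2)[OF xc(1)] k S(2)[OF x(1)] S(2)[OF S(3)] by (simp add: d_def k_def)
    have "x \<notin> ball (p + of_real r * \<nu>) r" "x \<notin> ball (p - of_real r * \<nu>) r"
      using n xc by (auto simp: normal_at_def)
    then have 2: "2 * r * \<bar>\<nu> \<bullet> d\<bar> \<le> k\<^sup>2"
      unfolding mem_tangent_ball[OF \<nu> n(2)] by (auto simp: d_def k_def abs_if)
    have dec: "d = (\<nu> \<bullet> d) *\<^sub>R \<nu> + ((\<i> * \<nu>) \<bullet> d) *\<^sub>R (\<i> * \<nu>)"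
    proof -
      have e: "Re \<nu> * Re \<nu> + Im \<nu> * Im \<nu> = 1" using \<nu>\<nu> by (simp add: inner_complex_def)
      have "Re d = (Re \<nu> * Re \<nu> + Im \<nu> * Im \<nu>) * Re d" "Im d = (Re \<nu> * Re \<nu> + Im \<nu> * Im \<nu>) * Im d" by (simp_all add: e)
      then show ?thesis by (simp add: complex_eq_iff inner_complex_def algebra_simps)
    qed
    have n\<nu>: "norm ((\<nu> \<bullet> d) *\<^sub>R \<nu>) = \<bar>\<nu> \<bullet> d\<bar>" "norm (((\<i> * \<nu>) \<bullet> d) *\<^sub>R (\<i> * \<nu>)) = \<bar>(\<i> * \<nu>) \<bullet> d\<bar>" using \<nu> by (simp_all add: norm_mult)
    have "k \<le> \<bar>\<nu> \<bullet> d\<bar> + \<bar>(\<i> * \<nu>) \<bullet> d\<bar>"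
      using norm_triangle_ineq[of "(\<nu> \<bullet> d) *\<^sub>R \<nu>" "((\<i> * \<nu>) \<bullet> d) *\<^sub>R (\<i> * \<nu>)"] unfolding dec[symmetric] n\<nu> k_def .
    moreover have "2 * \<bar>\<nu> \<bullet> d\<bar> \<le> k"
    proof -
      have "r * (2 * \<bar>\<nu> \<bullet> d\<bar>) \<le> r * k" using 2 k mult_right_mono[of k r k] unfolding power2_eq_square by linarith
      then show ?thesis using n(2) by simp
    qed
    ultimately have 3: "k / 2 \<le> \<bar>(\<i> * \<nu>) \<bullet> d\<bar>" by simp
    have "G \<bullet> d = (\<nu> \<bullet> d) * b + ((\<i> * \<nu>) \<bullet> d) * (G \<bullet> (\<i> * \<nu>))"
    proof -
      have "G \<bullet> d = G \<bullet> ((\<nu> \<bullet> d) *\<^sub>R \<nu> + ((\<i> * \<nu>) \<bullet> d) *\<^sub>R (\<i> * \<nu>))" by (rule arg_cong[OF dec])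
      then show ?thesis by (simp only: inner_add_right inner_scaleR_right G\<nu>)
    qed
    then have "\<bar>(\<i> * \<nu>) \<bullet> d\<bar> * \<bar>G \<bullet> (\<i> * \<nu>)\<bar> \<le> \<bar>G \<bullet> d\<bar> + \<bar>\<nu> \<bullet> d\<bar> * \<bar>b\<bar>"
      unfolding abs_mult[symmetric] by linarith
    moreover have "\<bar>\<nu> \<bullet> d\<bar> * \<bar>b\<bar> \<le> \<epsilon> / 4 * k"
    proof -
      have "k * (2 * (\<bar>b\<bar> + 1)) < \<epsilon> * r" using k(4) by (simp add: pos_less_divide_eq)
      then have "k * (k * (2 * (\<bar>b\<bar> + 1))) \<le> k * (\<epsilon> * r)" using k(1) by (intro mult_left_mono) auto
      then have kb: "k\<^sup>2 * (2 * \<bar>b\<bar>) \<le> \<epsilon> * r * k" 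
      proof -
        have "k * (k * (2 * (\<bar>b\<bar> + 1))) = k\<^sup>2 * (2 * \<bar>b\<bar>) + 2 * k\<^sup>2" by (simp add: power2_eq_square algebra_simps)
        moreover have "k * (\<epsilon> * r) = \<epsilon> * r * k" by simp
        ultimately show ?thesis using \<open>k * (k * (2 * (\<bar>b\<bar> + 1))) \<le> k * (\<epsilon> * r)\<close> zero_le_power2[of k] by linarith
      qed
      have "2 * r * \<bar>\<nu> \<bullet> d\<bar> * (2 * \<bar>b\<bar>) \<le> k\<^sup>2 * (2 * \<bar>b\<bar>)" using 2 by (intro mult_right_mono) auto
      then have "r * (4 * (\<bar>\<nu> \<bullet> d\<bar> * \<bar>b\<bar>)) \<le> r * (\<epsilon> * k)" using kb by (simp add: mult_ac)
      then show ?thesis using n(2) by simp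
    qed
    ultimately have "\<bar>(\<i> * \<nu>) \<bullet> d\<bar> * \<bar>G \<bullet> (\<i> * \<nu>)\<bar> \<le> \<epsilon> / 2 * k"
      using 1 by linarith
    moreover have "k / 2 * \<bar>G \<bullet> (\<i> * \<nu>)\<bar> \<le> \<bar>(\<i> * \<nu>) \<bullet> d\<bar> * \<bar>G \<bullet> (\<i> * \<nu>)\<bar>" using 3 by (intro mult_right_mono) auto
    ultimately have "k / 2 * \<bar>G \<bullet> (\<i> * \<nu>)\<bar> \<le> k / 2 * \<epsilon>" by (simp add: mult.commute)
    then show ?thesis using k(1) by simp
  qed
  have "\<bar>G \<bullet> (\<i> * \<nu>)\<bar> \<le> 0" by (rule field_le_epsilon) (use perp in auto)
  then have "G \<bullet> (\<i> * \<nu>) = 0" by simp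
  then have "Im (cnj \<nu> * G) = 0" "Re (cnj \<nu> * G) = b"
    using G\<nu> by (simp_all add: inner_complex_def algebra_simps)
  then have "cnj \<nu> * G = of_real b" by (simp add: complex_eq_iff)
  then have "\<nu> * cnj \<nu> * G = of_real b * \<nu>" by (simp add: mult_ac)
  moreover have "\<nu> * cnj \<nu> = 1" using \<nu> by (simp add: complex_norm_square[symmetric])
  ultimately show ?thesis by simp
qed

section \<open>The developing map\<close>

text \<open>With zero boundary values F extends across the line by reflection, and its zeros on the
  line then accumulate in the interior of the enlarged domain.\<close>

lemma holomorphic_zero_of_boundary_line:
  fixes F :: "complex \<Rightarrow> complex"
  assumes s: "s\<^sub>1 < s\<^sub>2" and hol: "F holomorphic_on open_band s\<^sub>1 s\<^sub>2" and cont: "continuous_on (closed_band s\<^sub>1 s\<^sub>2) F"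
    and line: "\<And>z. Re z = s\<^sub>2 \<Longrightarrow> F z = 0" and z: "z \<in> closed_band s\<^sub>1 s\<^sub>2"
  shows "F z = 0"
proof -
  define q where "q = of_real s\<^sub>2 + (0::complex)"
  define \<rho> where "\<rho> = s\<^sub>2 - s\<^sub>1"
  have \<rho>: "0 < \<rho>" and q: "Re q = s\<^sub>2" using s by (auto simp: \<rho>_def q_def)
  have near: "s\<^sub>1 < Re w" if "w \<in> ball q \<rho>" for w
    using that abs_Re_le_cmod[of "q - w"] q by (auto simp: dist_norm \<rho>_def)
  have half: "ball q \<rho> \<inter> {z. Re z < s\<^sub>2} \<subseteq> open_band s\<^sub>1 s\<^sub>2" "ball q \<rho> \<inter> {z. Re z \<le> s\<^sub>2} \<subseteq> closed_band s\<^sub>1 s\<^sub>2"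
    using near by (force simp: open_band_def closed_band_def)+
  have "\<exists>h. h holomorphic_on ball q \<rho> \<and> (\<forall>z\<in>ball q \<rho>. Re z \<le> s\<^sub>2 \<longrightarrow> h z = F z)"
    by (rule reflection_extension[OF q \<rho> holomorphic_on_subset[OF hol half(1)] continuous_on_subset[OF cont half(2)],
          where G = "\<lambda>_. 0"]) (auto simp: line)
  then obtain h where h: "h holomorphic_on ball q \<rho>" "\<And>z. z \<in> ball q \<rho> \<Longrightarrow> Re z \<le> s\<^sub>2 \<Longrightarrow> h z = F z" by blast
  have h0: "h w = 0" if w: "w \<in> ball q \<rho>" for w
  proof (rule analytic_continuation[OF h(1) open_ball connected_ball, of "ball q \<rho> \<inter> {z. Re z = s\<^sub>2}" q])
    show "q islimpt ball q \<rho> \<inter> {z. Re z = s\<^sub>2}"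
      unfolding islimpt_approachable
    proof (intro allI impI)
      fix e :: real assume e: "0 < e"
      define t where "t = min e \<rho> / 2"
      have t: "0 < t" "t < e" "t < \<rho>" using e \<rho> by (auto simp: t_def)
      have "dist (q + \<i> * of_real t) q = t" "dist q (q + \<i> * of_real t) = t" using t by (simp_all add: dist_norm norm_mult)
      moreover have "q + \<i> * of_real t \<noteq> q" using t by simp
      ultimately show "\<exists>x'\<in>ball q \<rho> \<inter> {z. Re z = s\<^sub>2}. x' \<noteq> q \<and> dist x' q < e"
        using t q by (intro bexI[of _ "q + \<i> * of_real t"]) auto
    qed
  qed (use h line \<rho> w in auto)
  define p where "p = q - of_real (\<rho> / 2)"
  have pB: "p \<in> open_band s\<^sub>1 s\<^sub>2" using s q by (simp add: p_def open_band_def \<rho>_def field_simps)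
  have pb: "p \<in> ball q \<rho>" using \<rho> by (simp add: p_def dist_norm norm_of_real del: of_real_divide)
  let ?W = "ball q \<rho> \<inter> open_band s\<^sub>1 s\<^sub>2"
  have W: "open ?W" "p \<in> ?W" using pB pb by (auto simp: open_open_band)
  have "F w = 0" if w: "w \<in> open_band s\<^sub>1 s\<^sub>2" for w
  proof (rule analytic_continuation[OF hol open_open_band convex_connected[OF convex_open_band], of ?W p])
    show "p islimpt ?W" by (rule interior_limit_point) (simp only: interior_open[OF W(1)] W(2))
    show "F z = 0" if "z \<in> ?W" for z using that h(2)[of z] h0[of z] by (auto simp: open_band_def)
  qed (use w pB in auto)
  then show ?thesis
    using continuous_constant_on_closure[of "open_band s\<^sub>1 s\<^sub>2" F 0 z] cont z by (simp add: closure_open_band[OF s])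
qed

text \<open>The ring and the band in one setting: injectivity modulo the period covers both, and
  \<tau> is 0 for a ring and the translation over one period for a band.\<close>

locale developing_map =
  fixes \<Omega> :: "complex set" and u :: "complex \<Rightarrow> real" and s\<^sub>1 s\<^sub>2 T :: real and g :: "complex \<Rightarrow> complex" and \<tau> :: complex
  assumes sm: "smooth_domain \<Omega>" and tor: "torsion_solution \<Omega> u" and np: "\<not> paraboloid_on \<Omega> u"
    and s: "s\<^sub>1 < s\<^sub>2" and T: "0 < T" and hol: "g holomorphic_on closed_band s\<^sub>1 s\<^sub>2"
    and im: "g ` closed_band s\<^sub>1 s\<^sub>2 = closure \<Omega>"
    and inj: "\<And>z w. z \<in> closed_band s\<^sub>1 s\<^sub>2 \<Longrightarrow> w \<in> closed_band s\<^sub>1 s\<^sub>2 \<Longrightarrow> g z = g w \<Longrightarrow> \<exists>n::int. w = z + of_int n * (\<i> * of_real T)"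
    and line: "\<And>s. s \<in> {s\<^sub>1, s\<^sub>2} \<Longrightarrow> g ` {z. Re z = s} \<subseteq> frontier \<Omega>"
    and od: "\<And>s. s \<in> {s\<^sub>1, s\<^sub>2} \<Longrightarrow> \<exists>a b. overdetermined_on \<Omega> u (g ` {z. Re z = s}) a b"
    and per: "\<And>z. z \<in> closed_band s\<^sub>1 s\<^sub>2 \<Longrightarrow> g (z + \<i> * of_real T) = g z + \<tau>"
begin

abbreviation "C \<equiv> closed_band s\<^sub>1 s\<^sub>2"
abbreviation "B \<equiv> open_band s\<^sub>1 s\<^sub>2"

lemma op: "open \<Omega>" and conn: "connected \<Omega>" using sm by (auto simp: smooth_domain_def)

lemma g_cont: "continuous_on C g" by (rule holomorphic_on_imp_continuous_on[OF hol])

lemma g_hol: "g holomorphic_on B" by (rule holomorphic_on_subset[OF hol open_band_subset_closed_band])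

lemma line_in_C: "Re z \<in> {s\<^sub>1, s\<^sub>2} \<Longrightarrow> z \<in> C"
  using s by (auto simp: closed_band_def)

lemma shift_in_B: "z + \<i> * of_real y \<in> B \<longleftrightarrow> z \<in> B"
  by (simp add: open_band_def)

lemma inj_close:
  assumes "z \<in> C" "w \<in> C" "g z = g w" "norm (w - z) < T"
  shows "w = z"
proof -
  obtain n :: int where n: "w = z + of_int n * (\<i> * of_real T)" using inj assms by blast
  have "norm (of_int n * (\<i> * of_real T) :: complex) = \<bar>of_int n\<bar> * T" using T by (simp add: norm_mult)
  then have "\<bar>of_int n\<bar> * T < 1 * T" using assms(4) n by simp
  then have "\<bar>of_int n :: real\<bar> < 1"
    using T by (simp only: mult_less_cancel_right)
  then have "n = 0" by linarith
  then show ?thesis using n by simp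
qed

lemma inj_on_ball: "inj_on g (ball z (T / 2) \<inter> B)"
proof (rule inj_onI)
  fix x y assume xy: "x \<in> ball z (T / 2) \<inter> B" "y \<in> ball z (T / 2) \<inter> B" "g x = g y"
  have "dist y x \<le> dist z y + dist z x" using dist_triangle3 by blast
  then have "norm (y - x) < T" using xy by (simp add: dist_norm)
  then show "x = y" using inj_close[of x y] xy open_band_subset_closed_band by blast
qed

lemma deriv_nonzero:
  assumes "z \<in> B"
  shows "deriv g z \<noteq> 0"
  by (rule holomorphic_injective_imp_regular[OF holomorphic_on_subset[OF g_hol] _ inj_on_ball[of z]])
     (use assms T in \<open>auto simp: open_open_band\<close>)

text \<open>The open mapping theorem puts the image of the open band into the interior of
  \<open>closure \<Omega>\<close>, which is \<Omega>; the converse inclusion holds because the lines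
  are mapped into the frontier.\<close>

lemma image_B: "g ` B = \<Omega>"
proof
  show "g ` B \<subseteq> \<Omega>"
  proof
    fix p assume "p \<in> g ` B"
    then obtain z where z: "z \<in> B" "p = g z" by blast
    let ?S = "ball z (T / 2) \<inter> B"
    have "open (g ` ?S)"
      by (rule open_mapping_thm3[OF holomorphic_on_subset[OF g_hol] _ inj_on_ball]) (auto simp: open_open_band)
    moreover have "g ` ?S \<subseteq> closure \<Omega>" using im open_band_subset_closed_band by blast
    ultimately have "g ` ?S \<subseteq> \<Omega>" using interior_maximal interior_closure_smooth_domain[OF sm] by metis
    then show "p \<in> \<Omega>" using z T by auto
  qed
  show "\<Omega> \<subseteq> g ` B"
  proof
    fix p assume p: "p \<in> \<Omega>"
    then obtain z where z: "z \<in> C" "p = g z" using im closure_subset by blast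
    have "z \<in> B"
    proof (rule ccontr)
      assume "z \<notin> B"
      then have "Re z \<in> {s\<^sub>1, s\<^sub>2}" using z by (auto simp: open_band_def closed_band_def)
      then have "p \<in> frontier \<Omega>" using line[of "Re z"] z by blast
      then show False using p op by (simp add: frontier_def interior_open)
    qed
    then show "p \<in> g ` B" using z by blast
  qed
qed

lemma translation: "(\<lambda>z. of_int n * \<tau> + z) ` \<Omega> = \<Omega>"
proof -
  have sub: "of_int n * \<tau> + p \<in> \<Omega>" if "p \<in> \<Omega>" for p n
  proof -
    obtain z where z: "z \<in> B" "p = g z" using \<open>p \<in> \<Omega>\<close> image_B by blast
    have "g (z + \<i> * of_real (of_int n * T)) = g z + of_int n * \<tau>"
      by (rule quasi_periodic_shift[where F = g and \<sigma> = \<tau>, OF per]) (use z open_band_subset_closed_band in auto)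
    moreover have "g (z + \<i> * of_real (of_int n * T)) \<in> \<Omega>"
      unfolding image_B[symmetric] by (rule imageI) (simp only: shift_in_B z)
    ultimately show ?thesis using z by (simp add: add.commute)
  qed
  show ?thesis
  proof (intro set_eqI iffI)
    fix p assume "p \<in> \<Omega>"
    then have "of_int (- n) * \<tau> + p \<in> \<Omega>" by (rule sub)
    then show "p \<in> (\<lambda>z. of_int n * \<tau> + z) ` \<Omega>" by (rule rev_image_eqI) simp
  qed (use sub in auto)
qed

text \<open>One period of the lines is compact; translations by multiples of \<tau> preserve
  \<Omega> and carry the radius found there along the rest.\<close>

lemma uniform_normals: "\<exists>r>0. \<exists>\<nu>. \<forall>z. Re z \<in> {s\<^sub>1, s\<^sub>2} \<longrightarrow> normal_at \<Omega> (g z) (\<nu> z) r"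
proof -
  let ?L = "cbox (Complex s\<^sub>1 0) (Complex s\<^sub>2 T) \<inter> {z. Re z \<in> {s\<^sub>1, s\<^sub>2}}"
  have "{z. Re z \<in> {s\<^sub>1, s\<^sub>2}} = {z. Re z = s\<^sub>1} \<union> {z. Re z = s\<^sub>2}" by auto
  then have "closed {z. Re z \<in> {s\<^sub>1, s\<^sub>2}}"
    by (simp add: closed_Un closed_Collect_eq continuous_intros)
  then have "compact ?L" by (intro compact_Int_closed compact_cbox)
  then have "compact (g ` ?L)"
    by (intro compact_continuous_image continuous_on_subset[OF g_cont]) (use line_in_C in blast)
  moreover have "g ` ?L \<subseteq> frontier \<Omega>"
  proof
    fix p assume "p \<in> g ` ?L"
    then obtain z where "Re z \<in> {s\<^sub>1, s\<^sub>2}" "p = g z" by auto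
    then show "p \<in> frontier \<Omega>" using line[of "Re z"] by blast
  qed
  ultimately have "\<exists>r>0. \<forall>p\<in>g ` ?L. \<exists>\<nu>. normal_at \<Omega> p \<nu> r" by (rule normal_at_compact[OF sm])
  then obtain r where r: "r > 0" "\<And>p. p \<in> g ` ?L \<Longrightarrow> \<exists>\<nu>. normal_at \<Omega> p \<nu> r" by (elim exE conjE) blast
  have "\<exists>\<nu>. normal_at \<Omega> (g z) \<nu> r" if z: "Re z \<in> {s\<^sub>1, s\<^sub>2}" for z
  proof -
    obtain n where n: "0 \<le> Im z - of_int n * T" "Im z - of_int n * T \<le> T" by (rule reduce_to_period[OF T])
    define z' where "z' = z + \<i> * of_real (of_int (- n) * T)"
    have "g z' = g z + of_int (- n) * \<tau>"
      unfolding z'_def by (rule quasi_periodic_shift[where F = g and \<sigma> = \<tau>, OF per line_in_C[OF z]])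
    then have gz: "g z' + of_int n * \<tau> = g z" by simp
    have re: "Re z' = Re z" and "Im z' = Im z - of_int n * T" by (simp_all add: z'_def)
    then have "z' \<in> ?L" using z n s by (auto simp: in_cbox_complex_iff)
    then obtain \<nu> where "normal_at \<Omega> (g z') \<nu> r" using r(2) by blast
    from normal_at_translate[OF this translation[of n]] have "normal_at \<Omega> (g z) \<nu> r" by (simp only: gz)
    then show ?thesis by blast
  qed
  then show ?thesis using r(1) by metis
qed

lemma boundary_accumulates:
  assumes z: "Re z \<in> {s\<^sub>1, s\<^sub>2}" and \<delta>: "\<delta> > 0"
  shows "\<exists>x\<in>g ` {w. Re w = Re z}. x \<noteq> g z \<and> dist x (g z) < \<delta>"
proof -
  obtain d where d: "d > 0" "\<And>w. w \<in> C \<Longrightarrow> dist w z < d \<Longrightarrow> dist (g w) (g z) < \<delta>"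
    using g_cont line_in_C[OF z] \<delta> unfolding continuous_on_iff by blast
  define t where "t = min d T / 2"
  have t: "0 < t" "t < d" "t < T" using d T by (auto simp: t_def)
  define w where "w = z + \<i> * of_real t"
  have nw: "norm (w - z) = t" using t by (simp add: w_def norm_mult)
  have re: "Re w = Re z" by (simp add: w_def)
  then have wC: "w \<in> C" using z line_in_C by simp
  have "g w \<noteq> g z"
  proof
    assume "g w = g z"
    then have "w = z" by (intro inj_close[OF line_in_C[OF z] wC]) (simp_all add: nw t)
    then show False using nw t by simp
  qed
  moreover have "dist (g w) (g z) < \<delta>" using d(2)[OF wC] nw t by (simp add: dist_norm)
  ultimately show ?thesis using re by blast
qed

theorem real_algebro_geometric:
  "real_algebro_geometric_mkdv (\<lambda>z. deriv (deriv g) z / (2 * deriv g z)) B"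
proof -
  obtain r \<nu> where r: "r > 0" and \<nu>: "\<And>z. Re z \<in> {s\<^sub>1, s\<^sub>2} \<Longrightarrow> normal_at \<Omega> (g z) (\<nu> z) r"
    using uniform_normals by blast
  obtain G where G: "continuous_on (closure \<Omega>) G"
      "\<And>z. z \<in> closure \<Omega> \<Longrightarrow> (u has_derivative (\<lambda>h. G z \<bullet> h)) (at z within closure \<Omega>)"
    and c2: "C_diff_on 2 u \<Omega>" and lap: "\<And>z. z \<in> \<Omega> \<Longrightarrow> laplacian u z + 2 = 0"
    using tor unfolding torsion_solution_def by blast
  have dG: "(u has_derivative (\<lambda>h. G z \<bullet> h)) (at z)" if "z \<in> \<Omega>" for z
  proof -
    have "z \<in> interior (closure \<Omega>)" using that interior_closure_smooth_domain[OF sm] by simp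
    then have at: "at z within closure \<Omega> = at z" by (rule at_within_interior)
    have "z \<in> closure \<Omega>" using that closure_subset by blast
    from G(2)[OF this] show ?thesis unfolding at .
  qed
  have bd: "\<exists>b. \<forall>z. Re z = s \<longrightarrow> G (g z) = of_real b * \<nu> z" if s': "s \<in> {s\<^sub>1, s\<^sub>2}" for s
  proof -
    obtain a b where ab: "overdetermined_on \<Omega> u (g ` {z. Re z = s}) a b" using od[OF s'] by blast
    have "G (g z) = of_real b * \<nu> z" if z: "Re z = s" for z
    proof (rule boundary_gradient[OF op _ \<nu> r, where S = "g ` {z. Re z = s}" and a = a])
      show fr: "g z \<in> frontier \<Omega>" using line[OF s'] z by blast
      show "(u has_derivative (\<bullet>) (G (g z))) (at (g z) within closure \<Omega>)"
        using G(2)[of "g z"] fr by (simp add: frontier_def)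
      show "has_normal_derivative \<Omega> u (g z) b" using ab z unfolding overdetermined_on_def by blast
      show "\<exists>x\<in>g ` {z. Re z = s}. x \<noteq> g z \<and> dist x (g z) < \<delta>" if "\<delta> > 0" for \<delta>
        using boundary_accumulates[of z \<delta>] z s' that by simp
    qed (use line[OF s'] z ab s' in \<open>auto simp: overdetermined_on_def\<close>)
    then show ?thesis by blast
  qed
  obtain b\<^sub>1 where b\<^sub>1: "\<And>z. Re z = s\<^sub>1 \<Longrightarrow> G (g z) = of_real b\<^sub>1 * \<nu> z" using bd[of s\<^sub>1] by auto
  obtain b\<^sub>2 where b\<^sub>2: "\<And>z. Re z = s\<^sub>2 \<Longrightarrow> G (g z) = of_real b\<^sub>2 * \<nu> z" using bd[of s\<^sub>2] by auto
  \<comment> \<open>Written with G and not with \<open>grad u\<close>, since G is continuous up to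
    the boundary; on \<Omega> the two agree.\<close>
  define f where "f z = (cnj (G (g z)) + cnj (g z)) / 2" for z
  have f_cont: "continuous_on C f"
    unfolding f_def[abs_def] using im
    by (intro continuous_intros continuous_on_compose2[OF G(1) g_cont] g_cont) auto
  have f_hol: "f holomorphic_on B"
  proof -
    have "(\<lambda>z. cnj (grad u (g z)) + cnj (g z)) holomorphic_on B"
      by (rule holomorphic_on_compose_gen[OF g_hol torsion_gradient_holomorphic[OF c2 op lap], unfolded o_def])
         (simp_all only: image_B order_refl)
    then have "(\<lambda>z. (cnj (grad u (g z)) + cnj (g z)) / 2) holomorphic_on B"
      by (rule holomorphic_on_divide[OF _ holomorphic_on_const]) simp
    then show ?thesis
    proof (rule holomorphic_transform)
      fix z assume "z \<in> B"
      then have "g z \<in> \<Omega>" using image_B by blast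
      from partial_eq_grad[OF dG[OF this]] show "(cnj (grad u (g z)) + cnj (g z)) / 2 = f z" by (simp add: f_def)
    qed
  qed
  have left: "2 * f z = of_real b\<^sub>1 * cnj (\<nu> z) + cnj (g z)" if "Re z = s\<^sub>1" for z
    using b\<^sub>1[OF that] by (simp add: f_def)
  have right: "2 * f z = of_real b\<^sub>2 * cnj (\<nu> z) + cnj (g z)" if "Re z = s\<^sub>2" for z
    using b\<^sub>2[OF that] by (simp add: f_def)
  \<comment> \<open>Nothing is assumed about the periodicity of u. The domain is invariant under
    \<tau>, so the normals are, and the boundary equation makes f additively periodic on one line;
    the defect then vanishes on the whole band because it has zero boundary values there.\<close>
  have f_per: "f (z + \<i> * of_real T) = f z + cnj \<tau> / 2" if z: "z \<in> C" for z
  proof -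
    have shC: "z + \<i> * of_real T \<in> C" if "z \<in> C" for z using that by (simp add: closed_band_def)
    have "f (z + \<i> * of_real T) - f z - cnj \<tau> / 2 = 0"
    proof (rule holomorphic_zero_of_boundary_line[OF s _ _ _ z])
      have "(\<lambda>z. f (z + \<i> * of_real T)) holomorphic_on B"
        by (rule holomorphic_on_compose_gen[OF _ f_hol, unfolded o_def]) (auto intro!: holomorphic_intros simp: shift_in_B)
      then show "(\<lambda>z. f (z + \<i> * of_real T) - f z - cnj \<tau> / 2) holomorphic_on B" by (intro holomorphic_intros f_hol)
      show "continuous_on C (\<lambda>z. f (z + \<i> * of_real T) - f z - cnj \<tau> / 2)"
        by (intro continuous_intros continuous_on_compose2[OF f_cont] f_cont) (auto intro: shC)
      fix z assume z: "Re z = s\<^sub>2"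
      have tr: "(\<lambda>z. \<tau> + z) ` \<Omega> = \<Omega>" using translation[of 1] by simp
      have gz: "g (z + \<i> * of_real T) = g z + \<tau>" using z by (intro per line_in_C) simp
      have n1: "normal_at \<Omega> (g z + \<tau>) (\<nu> z) r" using z by (intro normal_at_translate[OF \<nu> tr]) simp
      have n2: "normal_at \<Omega> (g z + \<tau>) (\<nu> (z + \<i> * of_real T)) r" using \<nu>[of "z + \<i> * of_real T"] z gz by simp
      have "\<nu> (z + \<i> * of_real T) = \<nu> z" by (rule normal_at_unique[OF n2 r n1 r])
      then have "2 * f (z + \<i> * of_real T) = 2 * f z + cnj \<tau>"
        using right[of z] right[of "z + \<i> * of_real T"] z gz by simp
      then show "f (z + \<i> * of_real T) - f z - cnj \<tau> / 2 = 0" by (simp add: field_simps)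
    qed
    then show ?thesis by (simp add: algebra_simps)
  qed
  \<comment> \<open>If f were constant, the gradient of u would be \<open>v\<^sub>0 - p\<close>, and
    u a paraboloid on the connected set \<Omega>.\<close>
  have nonconst: "\<exists>z\<in>B. deriv f z \<noteq> 0"
  proof (rule ccontr)
    assume "\<not> ?thesis"
    have df: "(f has_field_derivative 0) (at z within B)" if "z \<in> B" for z
    proof -
      have "deriv f z = 0" using \<open>\<not> (\<exists>z\<in>B. deriv f z \<noteq> 0)\<close> that by blast
      then show ?thesis using holomorphic_derivI[OF f_hol open_open_band that, of B] by (simp only:)
    qed
    have "\<exists>c. \<forall>z\<in>B. f z = c" by (rule has_field_derivative_zero_constant[OF convex_open_band df])
    then obtain c where c: "\<And>z. z \<in> B \<Longrightarrow> f z = c" by blast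
    define v\<^sub>0 where "v\<^sub>0 = cnj (2 * c)"
    have Gp: "G p = v\<^sub>0 - p" if "p \<in> \<Omega>" for p
    proof -
      obtain z where z: "z \<in> B" "p = g z" using image_B \<open>p \<in> \<Omega>\<close> by blast
      have "cnj (G p + p) = 2 * c" using c[OF z(1)] z(2) by (simp add: f_def)
      then have "G p + p = v\<^sub>0" unfolding v\<^sub>0_def by (metis complex_cnj_cnj)
      then show ?thesis by (simp add: algebra_simps)
    qed
    define w where "w p = u p + 1 / 2 * ((p - v\<^sub>0) \<bullet> (p - v\<^sub>0))" for p
    have dw: "(w has_derivative (\<lambda>h. 0)) (at p)" if p: "p \<in> \<Omega>" for p
    proof -
      have id: "((\<lambda>p. p - v\<^sub>0) has_derivative (\<lambda>h. h)) (at p)" by (auto intro!: derivative_eq_intros)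
      have "(w has_derivative (\<lambda>h. G p \<bullet> h + 1 / 2 * ((p - v\<^sub>0) \<bullet> h + h \<bullet> (p - v\<^sub>0)))) (at p)"
        unfolding w_def[abs_def]
        by (rule has_derivative_add[OF dG[OF p] has_derivative_mult_right[OF has_derivative_inner[OF id id]]])
      moreover have "G p \<bullet> h + 1 / 2 * ((p - v\<^sub>0) \<bullet> h + h \<bullet> (p - v\<^sub>0)) = 0" for h
      proof -
        have e: "h \<bullet> (p - v\<^sub>0) = (p - v\<^sub>0) \<bullet> h" by (rule inner_commute)
        have e': "(v\<^sub>0 - p) \<bullet> h = - ((p - v\<^sub>0) \<bullet> h)" by (simp only: inner_diff_left minus_diff_eq)
        have "- a + 1 / 2 * (a + a) = 0" for a :: real by simp
        then show ?thesis unfolding Gp[OF p] e e' .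
      qed
      ultimately show ?thesis by (simp only:)
    qed
    have "w constant_on \<Omega>"
    proof (rule has_derivative_zero_connected_constant_on[OF conn op finite.emptyI])
      show "continuous_on \<Omega> w"
        by (rule continuous_at_imp_continuous_on) (use has_derivative_continuous[OF dw] in blast)
      show "\<forall>p\<in>\<Omega> - {}. (w has_derivative (\<lambda>h. 0)) (at p within \<Omega>)"
      proof
        fix p assume "p \<in> \<Omega> - {}"
        then have "p \<in> \<Omega>" by simp
        from has_derivative_at_withinI[OF dw[OF this]] show "(w has_derivative (\<lambda>h. 0)) (at p within \<Omega>)" .
      qed
    qed
    then obtain a where a: "\<And>p. p \<in> \<Omega> \<Longrightarrow> w p = a" unfolding constant_on_def by blast
    have "\<forall>p\<in>\<Omega>. u p = a - (norm (p - v\<^sub>0))\<^sup>2 / 2"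
    proof
      fix p assume "p \<in> \<Omega>"
      then have "u p + 1 / 2 * ((p - v\<^sub>0) \<bullet> (p - v\<^sub>0)) = a" unfolding w_def[symmetric] by (rule a)
      then show "u p = a - (norm (p - v\<^sub>0))\<^sup>2 / 2" unfolding power2_norm_eq_inner by linarith
    qed
    then show False using np unfolding paraboloid_on_def by blast
  qed
  have strip: "strip s\<^sub>1 s\<^sub>2 T g f \<nu> \<tau> (cnj \<tau> / 2) b\<^sub>1 b\<^sub>2 r"
  proof
    show "g field_differentiable (at z within C)" if "z \<in> C" for z
      using hol that unfolding holomorphic_on_def by blast
    show "norm (\<nu> z) = 1" "ball (g z - of_real r * \<nu> z) r \<subseteq> g ` B" "ball (g z + of_real r * \<nu> z) r \<inter> g ` C = {}"
      if "Re z \<in> {s\<^sub>1, s\<^sub>2}" for z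
      using \<nu>[OF that] unfolding normal_at_def image_B im by blast+
    show "g z \<notin> g ` B" if "Re z \<in> {s\<^sub>1, s\<^sub>2}" for z
    proof -
      have "g z \<in> frontier \<Omega>" using line[OF that] by blast
      then show ?thesis using op unfolding image_B by (simp add: frontier_def interior_open)
    qed
  qed (fact s T f_cont f_hol per f_per deriv_nonzero r left right nonconst)+
  let ?\<eta> = "\<lambda>z. deriv (deriv g) z / (2 * deriv g z)"
  obtain U H where U: "open U" "C \<subseteq> U" and H: "H holomorphic_on U" "\<forall>z\<in>C. H z = g z" "\<forall>z\<in>U. deriv H z \<noteq> 0"
    and bc: "\<forall>s\<in>{s\<^sub>1, s\<^sub>2}. let \<eta> = (\<lambda>z. deriv (deriv H) z / (2 * deriv H z)) in (\<forall>y. Im (\<eta> (Complex s y)) = 0) \<or>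
        (\<exists>c. \<forall>y. (c has_real_derivative - 4 * Re (\<eta> (Complex s y)) * Im (\<eta> (Complex s y))) (at y) \<and>
             Im (deriv \<eta> (Complex s y)) = c y * Im (\<eta> (Complex s y)))"
    using strip.boundary_conditions[OF strip] by (elim exE conjE) (rule that)
  define \<eta> where "\<eta> = (\<lambda>z. deriv (deriv H) z / (2 * deriv H z))"
  have \<eta>_hol: "\<eta> holomorphic_on U"
  proof -
    have hD: "deriv H holomorphic_on U" by (rule holomorphic_deriv[OF H(1) U(1)])
    show ?thesis
      unfolding \<eta>_def
      by (rule holomorphic_on_divide[OF holomorphic_deriv[OF hD U(1)] holomorphic_on_mult[OF holomorphic_on_const hD]])
         (use H(3) in simp)
  qed
  have BU: "B \<subseteq> U" using U open_band_subset_closed_band by blast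
  have dg: "deriv g holomorphic_on B" by (rule holomorphic_deriv[OF g_hol open_open_band])
  have HB: "H holomorphic_on B" by (rule holomorphic_on_subset[OF H(1) BU])
  have Hg: "H z = g z" if "z \<in> B" for z using that H(2) open_band_subset_closed_band by blast
  have dH: "(deriv ^^ k) H z = (deriv ^^ k) g z" if "z \<in> B" for z k
    by (rule higher_deriv_transform_within_open[OF HB g_hol open_open_band that Hg])
  have eq: "\<eta> z = ?\<eta> z" if "z \<in> B" for z
    using dH[OF that, of 1] dH[OF that, of 2] by (simp add: \<eta>_def numeral_2_eq_2)
  have sB: "z + \<i> * of_real T \<in> B" if "z \<in> B" for z using that by (simp add: open_band_def)
  have d1: "deriv g (z + \<i> * of_real T) = deriv g z" if "z \<in> B" for z
  proof (rule deriv_shift[OF open_open_band that, where d = \<tau>])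
    show "g (w + \<i> * of_real T) = g w + \<tau>" if "w \<in> B" for w
      by (rule per) (use that open_band_subset_closed_band in blast)
    show "g field_differentiable at (z + \<i> * of_real T)"
      by (rule holomorphic_on_imp_differentiable_at[OF g_hol open_open_band sB[OF that]])
  qed
  have d2: "deriv (deriv g) (z + \<i> * of_real T) = deriv (deriv g) z" if "z \<in> B" for z
  proof (rule deriv_shift[OF open_open_band that, where d = 0])
    show "deriv g (w + \<i> * of_real T) = deriv g w + 0" if "w \<in> B" for w using d1[OF that] by simp
    show "deriv g field_differentiable at (z + \<i> * of_real T)"
      by (rule holomorphic_on_imp_differentiable_at[OF dg open_open_band sB[OF that]])
  qed
  have ag: "real_algebro_geometric_mkdv \<eta> B"
  proof (rule real_algebro_geometric_mkdvI[OF s T U \<eta>_hol])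
    show "\<eta> (z + \<i> * of_real T) = \<eta> z" if "z \<in> B" for z
      unfolding eq[OF that] eq[OF sB[OF that]] d1[OF that] d2[OF that] ..
    show "(\<forall>y. Im (\<eta> (Complex s y)) = 0) \<or>
        (\<exists>c. \<forall>y. (c has_real_derivative - 4 * Re (\<eta> (Complex s y)) * Im (\<eta> (Complex s y))) (at y) \<and>
             Im (deriv \<eta> (Complex s y)) = c y * Im (\<eta> (Complex s y)))" if "s \<in> {s\<^sub>1, s\<^sub>2}" for s
      using bspec[OF bc that] unfolding Let_def \<eta>_def .
  qed
  \<comment> \<open>The two functions agree on the open band only; being equal on an open set they
    have the same derivatives there, and \<open>mkdv_Q\<close> depends on nothing else.\<close>
  have Q: "mkdv_Q n \<eta> z = mkdv_Q n ?\<eta> z" if z: "z \<in> B" for n z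
  proof -
    have "?\<eta> holomorphic_on B"
      by (rule holomorphic_on_divide[OF holomorphic_deriv[OF dg open_open_band] holomorphic_on_mult[OF holomorphic_on_const dg]])
         (simp add: deriv_nonzero)
    then have "(deriv ^^ k) \<eta> z = (deriv ^^ k) ?\<eta> z" for k
      by (rule higher_deriv_transform_within_open[OF holomorphic_on_subset[OF \<eta>_hol BU] _ open_open_band z eq])
    then show ?thesis by (simp only: mkdv_Q_def dp_eval_def)
  qed
  obtain m a\<^sub>0 c where M: "\<forall>z\<in>B. mkdv_Q m \<eta> z = of_real a\<^sub>0 + (\<Sum>j<m. of_real (c j) * mkdv_Q j \<eta> z)"
    using ag unfolding real_algebro_geometric_mkdv_def by (elim exE) (rule that)
  have "\<forall>z\<in>B. mkdv_Q m ?\<eta> z = of_real a\<^sub>0 + (\<Sum>j<m. of_real (c j) * mkdv_Q j ?\<eta> z)"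
  proof
    fix z assume z: "z \<in> B"
    show "mkdv_Q m ?\<eta> z = of_real a\<^sub>0 + (\<Sum>j<m. of_real (c j) * mkdv_Q j ?\<eta> z)"
      using bspec[OF M z] by (simp only: Q[OF z])
  qed
  then show ?thesis
    unfolding real_algebro_geometric_mkdv_def by (intro exI[of _ m] exI[of _ a\<^sub>0] exI[of _ c])
qed

end

section \<open>The two geometric cases\<close>

lemma ring_developing_mapI:
  assumes dom: "serrin_ring_domain \<Omega> u" and map: "ring_developing_map \<Omega> s\<^sub>1 s\<^sub>2 T g" and np: "\<not> paraboloid_on \<Omega> u"
  shows "developing_map \<Omega> u s\<^sub>1 s\<^sub>2 T g 0"
proof -
  obtain C\<^sub>1 C\<^sub>2 a\<^sub>1 a\<^sub>2 b\<^sub>1 b\<^sub>2 where comp: "components (frontier \<Omega>) = {C\<^sub>1, C\<^sub>2}"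
      and od: "overdetermined_on \<Omega> u C\<^sub>1 a\<^sub>1 b\<^sub>1" "overdetermined_on \<Omega> u C\<^sub>2 a\<^sub>2 b\<^sub>2"
      and sm: "smooth_domain \<Omega>" "torsion_solution \<Omega> u"
    using dom unfolding serrin_ring_domain_def by (elim conjE exE) (rule that)
  have g: "s\<^sub>1 < s\<^sub>2" "T > 0" "g holomorphic_on closed_band s\<^sub>1 s\<^sub>2" "g ` closed_band s\<^sub>1 s\<^sub>2 = closure \<Omega>"
      and inj\<^sub>0: "\<forall>z\<in>closed_band s\<^sub>1 s\<^sub>2. \<forall>w\<in>closed_band s\<^sub>1 s\<^sub>2.
        g z = g w \<longleftrightarrow> (\<exists>n::int. w = z + of_int n * (\<i> * of_real T))"
      and lines\<^sub>0: "\<forall>s\<in>{s\<^sub>1, s\<^sub>2}. g ` {z. Re z = s} \<in> components (frontier \<Omega>)"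
    using map unfolding ring_developing_map_def by - (elim conjE, assumption)+
  note inj = bspec[OF bspec[OF inj\<^sub>0]] and lines = bspec[OF lines\<^sub>0]
  show ?thesis
  proof
    show "\<exists>n::int. w = z + of_int n * (\<i> * of_real T)"
      if "z \<in> closed_band s\<^sub>1 s\<^sub>2" "w \<in> closed_band s\<^sub>1 s\<^sub>2" "g z = g w" for z w
      by (rule iffD1[OF inj[OF that(1,2)] that(3)])
    show "g ` {z. Re z = s} \<subseteq> frontier \<Omega>" if "s \<in> {s\<^sub>1, s\<^sub>2}" for s
      by (rule in_components_subset[OF lines[OF that]])
    show "\<exists>a b. overdetermined_on \<Omega> u (g ` {z. Re z = s}) a b" if "s \<in> {s\<^sub>1, s\<^sub>2}" for s
    proof -
      have "g ` {z. Re z = s} = C\<^sub>1 \<or> g ` {z. Re z = s} = C\<^sub>2" using lines[OF that] unfolding comp by simp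
      then show ?thesis using od by metis
    qed
    show "g (z + \<i> * of_real T) = g z + 0" if z: "z \<in> closed_band s\<^sub>1 s\<^sub>2" for z
    proof -
      have sh: "z + \<i> * of_real T \<in> closed_band s\<^sub>1 s\<^sub>2" using z by (simp add: closed_band_def)
      have "\<exists>n::int. z + \<i> * of_real T = z + of_int n * (\<i> * of_real T)" by (rule exI[of _ 1]) simp
      then have "g z = g (z + \<i> * of_real T)" by (rule iffD2[OF inj[OF z sh]])
      then show ?thesis by simp
    qed
  qed (fact sm np g)+
qed

text \<open>Periodicity of \<open>deriv g\<close> makes \<open>g (z + \<i> * T) - g z\<close>
  constant on the open band, and by continuity on the closed one; this constant is the period
  \<tau>.\<close>

lemma band_developing_mapI:
  assumes dom: "periodic_serrin_band \<Omega> u" and map: "band_developing_map \<Omega> s\<^sub>1 s\<^sub>2 T g" and np: "\<not> paraboloid_on \<Omega> u"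
  shows "\<exists>\<tau>. developing_map \<Omega> u s\<^sub>1 s\<^sub>2 T g \<tau>"
proof -
  obtain a b where od: "overdetermined_on \<Omega> u (frontier \<Omega>) a b" and sm: "smooth_domain \<Omega>" "torsion_solution \<Omega> u"
    using dom unfolding periodic_serrin_band_def serrin_band_def by (elim conjE exE) (rule that)
  have g: "s\<^sub>1 < s\<^sub>2" "T > 0" "g holomorphic_on closed_band s\<^sub>1 s\<^sub>2"
      and bij: "bij_betw g (closed_band s\<^sub>1 s\<^sub>2) (closure \<Omega>)"
      and lines\<^sub>0: "\<forall>s\<in>{s\<^sub>1, s\<^sub>2}. g ` {z. Re z = s} \<in> components (frontier \<Omega>)"
      and dper\<^sub>0: "\<forall>z\<in>open_band s\<^sub>1 s\<^sub>2. deriv g (z + \<i> * of_real T) = deriv g z"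
    using map unfolding band_developing_map_def by - (elim conjE, assumption)+
  note lines = bspec[OF lines\<^sub>0] and dper = bspec[OF dper\<^sub>0]
  let ?D = "\<lambda>z. g (z + \<i> * of_real T) - g z"
  have hol: "g holomorphic_on open_band s\<^sub>1 s\<^sub>2" by (rule holomorphic_on_subset[OF g(3) open_band_subset_closed_band])
  have dD: "(?D has_field_derivative 0) (at z within open_band s\<^sub>1 s\<^sub>2)" if z: "z \<in> open_band s\<^sub>1 s\<^sub>2" for z
  proof -
    have "z + \<i> * of_real T \<in> open_band s\<^sub>1 s\<^sub>2" using z by (simp add: open_band_def)
    then have "(g has_field_derivative deriv g z) (at (z + \<i> * of_real T))"
      using holomorphic_derivI[OF hol open_open_band, of "z + \<i> * of_real T" UNIV] unfolding dper[OF z] by blast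
    moreover have "((\<lambda>z. z + \<i> * of_real T) has_field_derivative 1) (at z)" by (auto intro!: derivative_eq_intros)
    ultimately have "((\<lambda>z. g (z + \<i> * of_real T)) has_field_derivative deriv g z * 1) (at z)" by (rule DERIV_chain2)
    from DERIV_diff[OF this holomorphic_derivI[OF hol open_open_band z, of UNIV]]
    have "(?D has_field_derivative 0) (at z)" by simp
    then show ?thesis by (rule has_field_derivative_at_within)
  qed
  have "\<exists>\<tau>. \<forall>z\<in>open_band s\<^sub>1 s\<^sub>2. ?D z = \<tau>" by (rule has_field_derivative_zero_constant[OF convex_open_band dD])
  then obtain \<tau> where \<tau>: "\<And>z. z \<in> open_band s\<^sub>1 s\<^sub>2 \<Longrightarrow> ?D z = \<tau>" by blast
  have "continuous_on (closed_band s\<^sub>1 s\<^sub>2) ?D"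
    by (intro continuous_intros continuous_on_compose2[OF holomorphic_on_imp_continuous_on[OF g(3)]]
        holomorphic_on_imp_continuous_on[OF g(3)]) (auto simp: closed_band_def)
  then have D: "?D z = \<tau>" if "z \<in> closed_band s\<^sub>1 s\<^sub>2" for z
    using continuous_constant_on_closure[of "open_band s\<^sub>1 s\<^sub>2" ?D \<tau> z] \<tau> that by (simp only: closure_open_band[OF g(1)])
  have "developing_map \<Omega> u s\<^sub>1 s\<^sub>2 T g \<tau>"
  proof
    show "g ` closed_band s\<^sub>1 s\<^sub>2 = closure \<Omega>" using bij by (simp add: bij_betw_def)
    show "\<exists>n::int. w = z + of_int n * (\<i> * of_real T)"
      if "z \<in> closed_band s\<^sub>1 s\<^sub>2" "w \<in> closed_band s\<^sub>1 s\<^sub>2" "g z = g w" for z w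
      using bij that by (intro exI[of _ 0]) (auto simp: bij_betw_def inj_on_def)
    show "g ` {z. Re z = s} \<subseteq> frontier \<Omega>" if "s \<in> {s\<^sub>1, s\<^sub>2}" for s
      by (rule in_components_subset[OF lines[OF that]])
    show "\<exists>a b. overdetermined_on \<Omega> u (g ` {z. Re z = s}) a b" if "s \<in> {s\<^sub>1, s\<^sub>2}" for s
      using od in_components_subset[OF lines[OF that]] unfolding overdetermined_on_def by blast
    show "g (z + \<i> * of_real T) = g z + \<tau>" if "z \<in> closed_band s\<^sub>1 s\<^sub>2" for z
      using D[OF that] by (simp add: algebra_simps)
  qed (fact sm np g)+
  then show ?thesis by blast
qed

theorem theorem1p5:
  fixes \<Omega> :: "complex set" and u :: "complex \<Rightarrow> real" and g :: "complex \<Rightarrow> complex"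
    and s\<^sub>1 s\<^sub>2 T :: real
  assumes "(serrin_ring_domain \<Omega> u \<and> ring_developing_map \<Omega> s\<^sub>1 s\<^sub>2 T g) \<or>
           (periodic_serrin_band \<Omega> u \<and> band_developing_map \<Omega> s\<^sub>1 s\<^sub>2 T g)"
    and "\<not> paraboloid_on \<Omega> u"
  shows "real_algebro_geometric_mkdv (\<lambda>z. deriv (deriv g) z / (2 * deriv g z)) (open_band s\<^sub>1 s\<^sub>2)"
proof -
  from assms(1) show ?thesis
  proof (elim disjE conjE)
    assume "serrin_ring_domain \<Omega> u" "ring_developing_map \<Omega> s\<^sub>1 s\<^sub>2 T g"
    from ring_developing_mapI[OF this assms(2)] show ?thesis by (rule developing_map.real_algebro_geometric)
  next
    assume "periodic_serrin_band \<Omega> u" "band_developing_map \<Omega> s\<^sub>1 s\<^sub>2 T g"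
    from band_developing_mapI[OF this assms(2)] obtain \<tau> where "developing_map \<Omega> u s\<^sub>1 s\<^sub>2 T g \<tau>" ..
    then show ?thesis by (rule developing_map.real_algebro_geometric)
  qed
qed

end
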